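(* Let $d \geq 1$ and let $n_1, \dots, n_d \geq 1$ be $d$ distinct positive integers such that $q-1$ does not divide $n_i$ for each $i$, and $n_i/n_j$ is not an integral power of $p$ for each $i \neq j$. Then the $1 + \frac{d(d+1)}{2}$ elements $$\tilde{\pi}, \qquad \zeta(n_\ell, n_{\ell+1}, \dots, n_k) \quad (1 \leq \ell \leq k \leq d)$$ (i.e. $\tilde\pi$, $\zeta(n_1),\dots,\zeta(n_d)$, $\zeta(n_1,n_2),\dots,\zeta(n_{d-1},n_d)$, $\dots$, $\zeta(n_1,\dots,n_d)$) are algebraically independent over $\overline{K}$.
   Context: Let $\mathbb{F}_q$ be the finite field with $q$ elements, $p$ its characteristic, $K = \mathbb{F}_q(\theta)$, $K_\infty = \mathbb{F}_q((\theta^{-1}))$ with its $\infty$-adic absolute value $|\cdot|_\infty$ ($|\theta|_\infty > 1$), $\mathbb{C}_\infty$ the completion of an algebraic closure of $K_\infty$, and $\overline{K}$ the algebraic closure of $K$ in $\mathbb{C}_\infty$. Fixing a $(q-1)$-st root of $-\theta$, the Carlitz period is $\tilde{\pi} = (-\theta)^{q/(q-1)} \prod_{i=1}^\infty (1-\theta^{1-q^i})^{-1}$. For positive integers $n_1,\dots,n_r$, Thakur's multizeta value is $\zeta(n_1,\dots,n_r) = \sum \frac{1}{a_1^{n_1}\cdots a_r^{n_r}} \in K_\infty$, the sum over all monic polynomials $a_i \in \mathbb{F}_q[\theta]$ with $\deg a_1 > \cdots > \deg a_r \geq 0$. *)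

theory Defs
  imports "HOL-Computational_Algebra.Computational_Algebra"
          "HOL-Computational_Algebra.Formal_Laurent_Series"
          "HOL-Algebra.Algebraic_Closure_Type"
          "HOL-Library.Poly_Mapping" "HOL-Library.Cardinality"
begin

text \<open>Setting. The finite field F_q is a type 'a of class {finite, field}; q = CARD('a),
  p = CHAR('a). K_infinity = F_q((1/theta)) is the type 'a fls of formal Laurent series in
  the variable X = 1/theta, so theta = fls_X_inv. Its library metric is the
  infinity-adic one (|theta| > 1). Limits below are taken in this metric.
  The ambient algebraically closed field is 'a fls alg_closure, an algebraic
  closure of K_infinity (embedding to_ac).\<close>

definition theta :: "'a::field fls" where
  "theta = fls_X_inv"

definition poly_to_Kinf :: "'a::field poly \<Rightarrow> 'a fls" where
  "poly_to_Kinf a = (\<Sum>i\<le>degree a. fls_const (coeff a i) * theta ^ i)"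

definition Kfield :: "'a::field fls set" where
  "Kfield = {poly_to_Kinf a / poly_to_Kinf b | a b. b \<noteq> 0}"

definition monic_tuples :: "nat \<Rightarrow> nat \<Rightarrow> 'a::field poly list set" where
  "monic_tuples N r = {as. length as = r \<and> (\<forall>a\<in>set as. lead_coeff a = 1)
      \<and> sorted_wrt (\<lambda>a b. degree b < degree a) as
      \<and> (\<forall>a\<in>set as. degree a < N)}"

definition mzeta_partial :: "nat \<Rightarrow> nat list \<Rightarrow> 'a::{finite,field} fls" where
  "mzeta_partial N ns = (\<Sum>as\<in>monic_tuples N (length ns).
       \<Prod>i<length ns. inverse (poly_to_Kinf (as ! i) ^ (ns ! i)))"

definition mzeta :: "nat list \<Rightarrow> 'a::{finite,field} fls" where
  "mzeta ns = lim (\<lambda>N. mzeta_partial N ns)"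

definition carlitz_prod :: "'a::{finite,field} fls" where
  "carlitz_prod = lim (\<lambda>N. \<Prod>i\<in>{1..N}.
       inverse (1 - inverse (theta ^ (CARD('a) ^ i - 1))))"

text \<open>Carlitz period for a chosen (q-1)-st root omega of -theta:
  pi~ = omega^q * prod_{i>=1} (1 - theta^(1-q^i))^(-1).\<close>
definition carlitz_period :: "'a::{finite,field} fls alg_closure \<Rightarrow> 'a fls alg_closure" where
  "carlitz_period \<omega> = \<omega> ^ CARD('a) * to_ac carlitz_prod"

definition Kbar :: "'a::field fls alg_closure set" where
  "Kbar = {y. \<exists>P. P \<noteq> 0 \<and> (\<forall>i. coeff P i \<in> to_ac ` Kfield) \<and> poly P y = 0}"

definition alg_indep_over :: "'b::field set \<Rightarrow> 'i set \<Rightarrow> ('i \<Rightarrow> 'b) \<Rightarrow> bool" where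
  "alg_indep_over F I x \<longleftrightarrow>
     (\<forall>(S :: ('i \<Rightarrow>\<^sub>0 nat) set) c. finite S \<and> (\<forall>m\<in>S. Poly_Mapping.keys m \<subseteq> I \<and> c m \<in> F)
        \<and> (\<Sum>m\<in>S. c m * (\<Prod>i\<in>Poly_Mapping.keys m. x i ^ Poly_Mapping.lookup m i)) = 0
        \<longrightarrow> (\<forall>m\<in>S. c m = 0))"

end

theory Submission
  imports Defs
begin

text \<open>
Let \<open>w\<close> be a \<open>(q - 1)\<close>-st root of \<open>-theta\<close> and \<open>v = 1 / w\<close>. The numbers in question are, up to algebraic
factors and powers of the period, values at \<open>t = theta\<close> of series in \<open>v\<close> with coefficients in \<open>F_q[t]\<close>
that are entire in \<open>t\<close>. With \<open>\<tau>\<close> the substitution of \<open>v ^ q\<close> for \<open>v\<close> that fixes \<open>t\<close>, these are a series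
\<open>Om\<close> with \<open>Om = (t - theta ^ q) \<tau>(Om)\<close> and value \<open>1 / pi~\<close>, and series \<open>f l k\<close> built from the
Anderson-Thakur polynomials with \<open>f l k = \<tau>(f l k) + h k * \<tau>(f l (k - 1))\<close> and value a multiple of
\<open>zeta(n l, ..., n k)\<close>.

The series are algebraically independent over \<open>F_q(t, w)\<close>: adjoining them column by column, a dependence leads
to an equation \<open>c - \<tau> c = \<kappa> * h k ^ (p ^ j)\<close> over \<open>F_q(t, w, Om)\<close> with a nonzero constant \<open>\<kappa>\<close>, hence to a
relation between \<open>Om\<close> and \<open>f k k\<close>. At \<open>t = theta ^ (q ^ r)\<close> the series \<open>Om\<close> vanishes and \<open>f k k\<close> becomes a
Frobenius twist of a multiple of \<open>zeta(n k)\<close>; comparing exponents of \<open>v\<close> modulo \<open>q - 1\<close> contradicts the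
assumption that \<open>q - 1\<close> does not divide \<open>n k\<close>.

Linear independence of the monomials in these series carries over to their values. A linear relation between the
values at \<open>theta\<close> is transported by \<open>\<tau>\<close> to the points \<open>theta ^ (q ^ i)\<close>. The pigeonhole principle yields
a combination of the monomials with small polynomial coefficients that vanishes at many of these points, and a
Schwarz lemma gives it a high order in \<open>v\<close>, which contradicts linear independence over \<open>F_q(t, w)\<close>.
\<close>

section \<open>Subfields and algebraic elements\<close>

text \<open>No analysis over an algebraically closed complete field is needed: functions are formal
  series in \<open>v\<close>, being entire is a growth condition on the support, and evaluation is
  the remainder on division by \<open>lam e\<close>. The functional equations are triangular: that
  of \<open>f l k\<close> involves, besides \<open>f l k\<close>, only \<open>Om\<close> and the
  preceding column. Each new series thus solves \<open>y - \<tau> y = b\<close> over a field already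
  built. In characteristic p such a \<open>y\<close> can be algebraic only if a nontrivial
  combination of the powers \<open>b ^ (p ^ j)\<close> with constant coefficients equals
  \<open>c - \<tau> c\<close>; hence the additive polynomials, and hence the exclusion of ratios
  that are powers of p: the terms then carry pairwise different powers \<open>n l * p ^ j\<close> of
  \<open>Om\<close> and can be separated. The linear criterion yields independence of the values
  over the Laurent polynomials in \<open>v\<close>. The passage to the numbers of the statement is
  an exchange in towers in which the period comes at the start, since the other values agree with
  the multizeta values only up to factors that contain it.\<close>

definition subfld :: "'l::field set \<Rightarrow> bool" where
  "subfld E \<longleftrightarrow> 0 \<in> E \<and> 1 \<in> E \<and> (\<forall>x\<in>E. \<forall>y\<in>E. x + y \<in> E \<and> x * y \<in> E)
     \<and> (\<forall>x\<in>E. - x \<in> E \<and> inverse x \<in> E)"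

definition polys_over :: "'l::field set \<Rightarrow> 'l poly set" where
  "polys_over E = {P. \<forall>i. coeff P i \<in> E}"

definition adj :: "'l::field set \<Rightarrow> 'l \<Rightarrow> 'l set" where
  "adj E y = {poly P y / poly Q y | P Q. P \<in> polys_over E \<and> Q \<in> polys_over E \<and> poly Q y \<noteq> 0}"

definition clo :: "'l::field set \<Rightarrow> 'l set" where
  "clo E = {y. \<exists>P \<in> polys_over E. P \<noteq> 0 \<and> poly P y = 0}"

lemma adjI:
  "c = poly P y / poly Q y \<Longrightarrow> P \<in> polys_over E \<Longrightarrow> Q \<in> polys_over E \<Longrightarrow> poly Q y \<noteq> 0 \<Longrightarrow> c \<in> adj E y"
  unfolding adj_def by blast

context
  fixes E :: "'l::field set"
  assumes E: "subfld E"
begin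

lemma subfld_0: "0 \<in> E" and subfld_1: "1 \<in> E" using E by (auto simp: subfld_def)
lemma subfld_add: "x \<in> E \<Longrightarrow> y \<in> E \<Longrightarrow> x + y \<in> E" using E by (auto simp: subfld_def)
lemma subfld_mult: "x \<in> E \<Longrightarrow> y \<in> E \<Longrightarrow> x * y \<in> E" using E by (auto simp: subfld_def)
lemma subfld_uminus: "x \<in> E \<Longrightarrow> - x \<in> E" using E by (auto simp: subfld_def)
lemma subfld_inverse: "x \<in> E \<Longrightarrow> inverse x \<in> E" using E by (auto simp: subfld_def)
lemma subfld_diff: "x \<in> E \<Longrightarrow> y \<in> E \<Longrightarrow> x - y \<in> E"
  using subfld_add[of x "- y"] subfld_uminus[of y] by simp
lemma subfld_divide: "x \<in> E \<Longrightarrow> y \<in> E \<Longrightarrow> x / y \<in> E"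
  by (simp add: divide_inverse subfld_mult subfld_inverse)
lemma subfld_power: "x \<in> E \<Longrightarrow> x ^ n \<in> E"
  by (induction n) (auto simp: subfld_1 subfld_mult)
lemma subfld_sum: "(\<And>i. i \<in> A \<Longrightarrow> f i \<in> E) \<Longrightarrow> sum f A \<in> E"
  by (induction A rule: infinite_finite_induct) (auto simp: subfld_0 subfld_add)
lemma subfld_prod: "(\<And>i. i \<in> A \<Longrightarrow> f i \<in> E) \<Longrightarrow> prod f A \<in> E"
  by (induction A rule: infinite_finite_induct) (auto simp: subfld_1 subfld_mult)
lemma subfld_of_nat: "of_nat n \<in> E"
  by (induction n) (auto simp: subfld_0 subfld_1 subfld_add)

lemmas subfld_closed = subfld_0 subfld_1 subfld_add subfld_mult subfld_uminus subfld_inverse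
  subfld_diff subfld_divide subfld_power subfld_sum subfld_prod subfld_of_nat

lemma polys_over_0: "0 \<in> polys_over E" by (auto simp: polys_over_def subfld_0)
lemma polys_over_1: "1 \<in> polys_over E"
  by (auto simp: polys_over_def coeff_1 subfld_0 subfld_1)
lemma polys_over_add: "P \<in> polys_over E \<Longrightarrow> Q \<in> polys_over E \<Longrightarrow> P + Q \<in> polys_over E"
  by (auto simp: polys_over_def subfld_add)
lemma polys_over_diff: "P \<in> polys_over E \<Longrightarrow> Q \<in> polys_over E \<Longrightarrow> P - Q \<in> polys_over E"
  by (auto simp: polys_over_def subfld_diff)
lemma polys_over_uminus: "P \<in> polys_over E \<Longrightarrow> - P \<in> polys_over E"
  by (auto simp: polys_over_def subfld_uminus)
lemma polys_over_mult: "P \<in> polys_over E \<Longrightarrow> Q \<in> polys_over E \<Longrightarrow> P * Q \<in> polys_over E"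
  by (auto simp: polys_over_def coeff_mult subfld_closed)
lemma polys_over_smult: "c \<in> E \<Longrightarrow> Q \<in> polys_over E \<Longrightarrow> smult c Q \<in> polys_over E"
  by (auto simp: polys_over_def subfld_closed)
lemma polys_over_pCons: "pCons c Q \<in> polys_over E \<longleftrightarrow> c \<in> E \<and> Q \<in> polys_over E"
  by (auto simp: polys_over_def coeff_pCons split: nat.splits)
lemma polys_over_monom: "c \<in> E \<Longrightarrow> monom c n \<in> polys_over E"
  by (auto simp: polys_over_def subfld_closed)
lemma polys_over_sum: "(\<And>i. i \<in> A \<Longrightarrow> f i \<in> polys_over E) \<Longrightarrow> sum f A \<in> polys_over E"
  by (induction A rule: infinite_finite_induct) (auto simp: polys_over_0 polys_over_add)
lemma polys_over_power: "P \<in> polys_over E \<Longrightarrow> P ^ n \<in> polys_over E"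
  by (induction n) (auto simp: polys_over_1 polys_over_mult)
lemma polys_over_pderiv: "P \<in> polys_over E \<Longrightarrow> pderiv P \<in> polys_over E"
  unfolding polys_over_def mem_Collect_eq coeff_pderiv
  by (intro allI subfld_mult subfld_of_nat) auto
lemma polys_over_pcompose:
  "P \<in> polys_over E \<Longrightarrow> Q \<in> polys_over E \<Longrightarrow> pcompose P Q \<in> polys_over E"
  by (induction P) (auto simp: polys_over_0 polys_over_pCons pcompose_pCons polys_over_add polys_over_mult)
lemma poly_in_subfld: "P \<in> polys_over E \<Longrightarrow> y \<in> E \<Longrightarrow> poly P y \<in> E"
  unfolding poly_altdef by (intro subfld_sum subfld_mult subfld_power) (auto simp: polys_over_def)

lemmas polys_over_closed = polys_over_0 polys_over_1 polys_over_add polys_over_diff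
  polys_over_uminus polys_over_mult polys_over_smult polys_over_monom polys_over_sum
  polys_over_power polys_over_pderiv polys_over_pcompose

lemma adj_incl: "c \<in> E \<Longrightarrow> c \<in> adj E y"
  unfolding adj_def
  by (rule CollectI, rule exI[of _ "[:c:]"], rule exI[of _ 1])
     (auto simp: polys_over_pCons polys_over_closed)

lemma adj_self: "y \<in> adj E y"
  unfolding adj_def
  by (rule CollectI, rule exI[of _ "[:0,1:]"], rule exI[of _ 1])
     (auto simp: polys_over_pCons polys_over_closed subfld_closed)

lemma subfld_adj: "subfld (adj E y)"
  unfolding subfld_def
proof (intro conjI ballI)
  show "0 \<in> adj E y" "1 \<in> adj E y" by (auto intro: adj_incl simp: subfld_closed)
next
  fix a b assume "a \<in> adj E y" "b \<in> adj E y"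
  then obtain P Q R S where *: "a = poly P y / poly Q y" "b = poly R y / poly S y"
    "P \<in> polys_over E" "Q \<in> polys_over E" "R \<in> polys_over E" "S \<in> polys_over E"
    "poly Q y \<noteq> 0" "poly S y \<noteq> 0"
    unfolding adj_def by auto
  have "a + b = poly (P * S + R * Q) y / poly (Q * S) y"
    using * by (simp add: add_frac_eq)
  moreover have "a * b = poly (P * R) y / poly (Q * S) y"
    using * by simp
  ultimately show "a + b \<in> adj E y" "a * b \<in> adj E y" using *
    by - (rule adjI[of _ "P * S + R * Q" _ "Q * S"] adjI[of _ "P * R" _ "Q * S"];
          (intro polys_over_closed; assumption | simp))+
next
  fix a assume "a \<in> adj E y"
  then obtain P Q where *: "a = poly P y / poly Q y"
    "P \<in> polys_over E" "Q \<in> polys_over E" "poly Q y \<noteq> 0"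
    unfolding adj_def by auto
  show "- a \<in> adj E y" using *
    by (auto intro!: adjI[of _ "- P" _ Q] polys_over_closed)
  show "inverse a \<in> adj E y"
  proof (cases "poly P y = 0")
    case True
    hence "inverse a = 0" using * by simp
    thus ?thesis using adj_incl subfld_0 by simp
  next
    case False
    thus ?thesis using * by (auto intro!: adjI[of _ Q _ P])
  qed
qed

lemma clo_incl: "c \<in> E \<Longrightarrow> c \<in> clo E"
  unfolding clo_def
  by (rule CollectI, rule bexI[of _ "[:-c,1:]"]) (auto simp: polys_over_pCons polys_over_closed subfld_closed)

end

lemma adj_least:
  assumes "subfld F" "E \<subseteq> F" "y \<in> F"
  shows "adj E y \<subseteq> F"
proof
  fix c assume "c \<in> adj E y"
  then obtain P Q where *: "c = poly P y / poly Q y" "P \<in> polys_over E" "Q \<in> polys_over E"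
    by (auto simp: adj_def)
  have "P \<in> polys_over F" "Q \<in> polys_over F" using * assms(2) by (auto simp: polys_over_def)
  thus "c \<in> F" using * assms by (auto intro!: subfld_divide poly_in_subfld)
qed

lemma clo_mono: "E \<subseteq> F \<Longrightarrow> clo E \<subseteq> clo F"
  unfolding clo_def polys_over_def by blast

text \<open>Gaussian elimination: if equation \<open>x\<close> is not trivial, a pivot
  \<open>k\<close> removes it together with one unknown, and \<open>w\<close> is the reduced system.
  That the coefficients lie in \<open>E\<close> is what the application to algebraic elements
  needs.\<close>

lemma linear_dependence:
  fixes v :: "'i \<Rightarrow> 'x \<Rightarrow> 'l::field"
  assumes E: "subfld E" and "finite Z" "finite I" "card Z < card I"
    "\<And>i x. i \<in> I \<Longrightarrow> x \<in> Z \<Longrightarrow> v i x \<in> E"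
  shows "\<exists>c. (\<forall>i\<in>I. c i \<in> E) \<and> (\<exists>i\<in>I. c i \<noteq> 0) \<and> (\<forall>x\<in>Z. (\<Sum>i\<in>I. c i * v i x) = 0)"
  using assms(2-5)
proof (induction Z arbitrary: I v rule: finite_induct)
  case empty
  then obtain i where "i \<in> I" by fastforce
  thus ?case by (intro exI[of _ "\<lambda>_. 1"]) (auto simp: subfld_1[OF E])
next
  case (insert x Z)
  show ?case
  proof (cases "\<forall>i\<in>I. v i x = 0")
    case True
    have "\<exists>c. (\<forall>i\<in>I. c i \<in> E) \<and> (\<exists>i\<in>I. c i \<noteq> 0) \<and> (\<forall>x\<in>Z. (\<Sum>i\<in>I. c i * v i x) = 0)"
      using insert.prems insert.hyps by (intro insert.IH) auto
    thus ?thesis using True by auto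
  next
    case False
    then obtain k where k: "k \<in> I" "v k x \<noteq> 0" by auto
    define w where "w i y = v i y - v i x / v k x * v k y" for i y
    have "\<exists>c. (\<forall>i\<in>I-{k}. c i \<in> E) \<and> (\<exists>i\<in>I-{k}. c i \<noteq> 0) \<and> (\<forall>y\<in>Z. (\<Sum>i\<in>I-{k}. c i * w i y) = 0)"
      using insert.prems insert.hyps k unfolding w_def
      by (intro insert.IH) (auto intro!: subfld_closed[OF E])
    then obtain c where c: "\<forall>i\<in>I-{k}. c i \<in> E" "\<exists>i\<in>I-{k}. c i \<noteq> 0"
      "\<forall>y\<in>Z. (\<Sum>i\<in>I-{k}. c i * w i y) = 0" by blast
    define c' where "c' i = (if i = k then - (\<Sum>i\<in>I-{k}. c i * (v i x / v k x)) else c i)" for i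
    have eq: "(\<Sum>i\<in>I. c' i * v i y) = (\<Sum>i\<in>I-{k}. c i * w i y)" for y
    proof -
      have "(\<Sum>i\<in>I. c' i * v i y) = c' k * v k y + (\<Sum>i\<in>I-{k}. c' i * v i y)"
        using k insert.prems by (subst sum.remove[of _ k]) auto
      also have "(\<Sum>i\<in>I-{k}. c' i * v i y) = (\<Sum>i\<in>I-{k}. c i * v i y)"
        by (intro sum.cong) (auto simp: c'_def)
      also have "c' k * v k y = - (\<Sum>i\<in>I-{k}. c i * (v i x / v k x * v k y))"
        by (simp add: c'_def sum_distrib_right mult.assoc)
      finally show ?thesis by (simp add: w_def right_diff_distrib sum_subtractf)
    qed
    have "(\<Sum>i\<in>I. c' i * v i y) = 0" if "y \<in> insert x Z" for y
    proof (cases "y = x")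
      case True
      have "(\<Sum>i\<in>I-{k}. c i * w i x) = 0" using k by (intro sum.neutral) (auto simp: w_def)
      thus ?thesis using eq[of x] True by simp
    qed (use that c eq in auto)
    moreover have "\<forall>i\<in>I. c' i \<in> E"
      using c insert.prems k unfolding c'_def by (auto intro!: subfld_closed[OF E])
    moreover have "\<exists>i\<in>I. c' i \<noteq> 0" using c(2) by (auto simp: c'_def)
    ultimately show ?thesis by (intro exI[of _ c']) blast
  qed
qed

text \<open>An element that stabilises a nonzero finite-dimensional \<open>E\<close>-subspace is algebraic over \<open>E\<close>, and all
  algebraic elements arise in this way; this gives closure under sums and products.\<close>

definition spn :: "'l::field set \<Rightarrow> 'l set \<Rightarrow> 'l set" where
  "spn E G = {\<Sum>g\<in>G. a g * g | a. \<forall>g. a g \<in> E}"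

definition stab :: "'l::field set \<Rightarrow> 'l set \<Rightarrow> 'l set" where
  "stab E G = {z. \<forall>g\<in>G. z * g \<in> spn E G}"

context
  fixes E G :: "'l::field set"
  assumes E: "subfld E" and G: "finite G"
begin

lemma spn_0: "0 \<in> spn E G"
  unfolding spn_def by (rule CollectI, rule exI[of _ "\<lambda>_. 0"]) (auto simp: subfld_0[OF E])

lemma spn_add: "u \<in> spn E G \<Longrightarrow> v \<in> spn E G \<Longrightarrow> u + v \<in> spn E G"
proof -
  assume "u \<in> spn E G" "v \<in> spn E G"
  then obtain a b where "u = (\<Sum>g\<in>G. a g * g)" "v = (\<Sum>g\<in>G. b g * g)" "\<forall>g. a g \<in> E" "\<forall>g. b g \<in> E"
    by (auto simp: spn_def)
  thus ?thesis unfolding spn_def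
    by (intro CollectI exI[of _ "\<lambda>g. a g + b g"])
       (auto simp: sum.distrib algebra_simps intro: subfld_add[OF E])
qed

lemma spn_smult: "c \<in> E \<Longrightarrow> u \<in> spn E G \<Longrightarrow> c * u \<in> spn E G"
proof -
  assume "c \<in> E" "u \<in> spn E G"
  then obtain a where "u = (\<Sum>g\<in>G. a g * g)" "\<forall>g. a g \<in> E" by (auto simp: spn_def)
  thus ?thesis unfolding spn_def using \<open>c \<in> E\<close>
    by (intro CollectI exI[of _ "\<lambda>g. c * a g"])
       (auto simp: sum_distrib_left algebra_simps intro: subfld_mult[OF E])
qed

lemma spn_sum: "(\<And>i. i \<in> A \<Longrightarrow> f i \<in> spn E G) \<Longrightarrow> sum f A \<in> spn E G"
  by (induction A rule: infinite_finite_induct) (auto simp: spn_0 spn_add)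

lemma spn_base: "g \<in> G \<Longrightarrow> g \<in> spn E G"
  unfolding spn_def using G
  by (intro CollectI exI[of _ "\<lambda>h. if h = g then 1 else 0"])
     (auto simp: subfld_closed[OF E] if_distrib[of "\<lambda>x. x * _"] sum.delta cong: if_cong)

lemma stab_spn: "z \<in> stab E G \<Longrightarrow> u \<in> spn E G \<Longrightarrow> z * u \<in> spn E G"
proof -
  assume z: "z \<in> stab E G" and "u \<in> spn E G"
  then obtain a where u: "u = (\<Sum>g\<in>G. a g * g)" "\<forall>g. a g \<in> E" by (auto simp: spn_def)
  have "z * u = (\<Sum>g\<in>G. a g * (z * g))" by (simp add: u sum_distrib_left mult_ac)
  also have "\<dots> \<in> spn E G" 
  proof (rule spn_sum)
    fix g assume "g \<in> G"
    thus "a g * (z * g) \<in> spn E G" using z u(2) by (intro spn_smult[of "a g"]) (auto simp: stab_def)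
  qed
  finally show ?thesis .
qed

lemma stab_subset: "E \<subseteq> stab E G"
  by (auto simp: stab_def intro: spn_smult spn_base)
lemma stab_add: "z \<in> stab E G \<Longrightarrow> w \<in> stab E G \<Longrightarrow> z + w \<in> stab E G"
  by (auto simp: stab_def algebra_simps intro: spn_add)
lemma stab_mult: "z \<in> stab E G \<Longrightarrow> w \<in> stab E G \<Longrightarrow> z * w \<in> stab E G"
  by (auto simp: stab_def mult.assoc intro: stab_spn[unfolded stab_def])
lemma stab_power: "z \<in> stab E G \<Longrightarrow> z ^ n \<in> stab E G"
  by (induction n) (use stab_subset subfld_1[OF E] stab_mult in auto)

text \<open>The \<open>card G + 1\<close> elements \<open>z ^ i * g\<close> have coordinates with
  respect to \<open>card G\<close> generators, so a nonzero polynomial in \<open>z\<close> kills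
  \<open>g\<close>. The generators need not be independent; coordinates are merely chosen for each
  power.\<close>

lemma stab_algebraic:
  assumes "g \<in> G" "g \<noteq> 0" "z \<in> stab E G"
  shows "z \<in> clo E"
proof -
  have "\<forall>i. \<exists>a. (\<forall>h. a h \<in> E) \<and> z ^ i * g = (\<Sum>h\<in>G. a h * h)"
    using stab_spn[OF stab_power[OF assms(3)] spn_base[OF assms(1)]] by (auto simp: spn_def)
  then obtain A where A: "\<And>i h. A i h \<in> E" "\<And>i. z ^ i * g = (\<Sum>h\<in>G. A i h * h)" by metis
  obtain c where c: "\<forall>i\<in>{..card G}. c i \<in> E" "\<exists>i\<in>{..card G}. c i \<noteq> 0"
    "\<forall>h\<in>G. (\<Sum>i\<in>{..card G}. c i * A i h) = 0"
    using linear_dependence[OF E G, of "{..card G}" A] A by auto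
  define P where "P = (\<Sum>i\<in>{..card G}. monom (c i) i)"
  have "P \<in> polys_over E" unfolding P_def using c by (auto intro!: polys_over_closed[OF E])
  moreover have "P \<noteq> 0"
  proof
    assume "P = 0"
    have "coeff P j = c j" if "j \<le> card G" for j
      using that by (auto simp: P_def coeff_sum)
    with \<open>P = 0\<close> c(2) show False by auto
  qed
  moreover have "poly P z * g = 0"
  proof -
    have "poly P z * g = (\<Sum>i\<le>card G. c i * (z ^ i * g))"
      by (simp add: P_def poly_sum poly_monom sum_distrib_right mult.assoc)
    also have "\<dots> = (\<Sum>h\<in>G. (\<Sum>i\<le>card G. c i * A i h) * h)"
      by (simp add: A(2) sum_distrib_left sum_distrib_right mult.assoc sum.swap[of _ G])
    also have "\<dots> = 0" using c(3) by simp
    finally show ?thesis .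
  qed
  ultimately show ?thesis using assms by (auto simp: clo_def)
qed

end

lemma monic_over:
  assumes E: "subfld E" and "P \<in> polys_over E" "P \<noteq> 0"
  obtains Q where "Q \<in> polys_over E" "lead_coeff Q = 1" "degree Q = degree P"
    "\<And>y. poly Q y = 0 \<longleftrightarrow> poly P y = 0"
proof
  let ?Q = "smult (inverse (lead_coeff P)) P"
  show "?Q \<in> polys_over E" using assms by (auto intro!: polys_over_closed[OF E] subfld_closed[OF E] simp: polys_over_def)
qed (use assms in auto)

text \<open>The products \<open>g * z ^ j\<close> with \<open>j\<close> below the degree of
  \<open>Q\<close> generate a span stable under \<open>z\<close>, since \<open>Q\<close> rewrites
  \<open>z ^ n\<close> by lower powers with coefficients that stabilise the old span. Coefficients
  in \<open>stab E G\<close> instead of \<open>E\<close> give transitivity of algebraicity as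
  well.\<close>

lemma stab_extend:
  assumes E: "subfld E" and G: "finite G" "g \<in> G" "g \<noteq> 0"
    and Q: "Q \<in> polys_over (stab E G)" "lead_coeff Q = 1" "poly Q z = 0" and C: "C \<subseteq> stab E G"
  shows "\<exists>G'. finite G' \<and> (\<exists>g\<in>G'. g \<noteq> 0) \<and> insert z C \<subseteq> stab E G'"
proof -
  define n where "n = degree Q"
  define G' where "G' = (\<lambda>(g,j). g * z ^ j) ` (G \<times> {..<n})"
  have n: "n > 0"
  proof (rule ccontr)
    assume "\<not> n > 0"
    hence "Q = 1" using Q(2) by (auto simp: n_def elim: degree_eq_zeroE)
    thus False using Q(3) by simp
  qed
  have fin: "finite G'" using G by (auto simp: G'_def)
  have sp: "u * z ^ j \<in> spn E G'" if "u \<in> spn E G" "j < n" for u j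
  proof -
    obtain a where u: "u = (\<Sum>g\<in>G. a g * g)" "\<forall>g. a g \<in> E" using \<open>u \<in> spn E G\<close> by (auto simp: spn_def)
    have "u * z ^ j = (\<Sum>g\<in>G. a g * (g * z ^ j))" by (simp add: u sum_distrib_right mult.assoc)
    also have "\<dots> \<in> spn E G'"
      using u that by (intro spn_sum[OF E fin] spn_smult[OF E fin] spn_base[OF E fin]) (auto simp: G'_def)
    finally show ?thesis .
  qed
  have 1: "c \<in> stab E G'" if "c \<in> stab E G" for c
    unfolding stab_def
  proof (rule CollectI, rule ballI)
    fix h assume "h \<in> G'"
    then obtain g j where h: "g \<in> G" "j < n" "h = g * z ^ j" by (auto simp: G'_def)
    have "(c * g) * z ^ j \<in> spn E G'" using that h by (intro sp) (auto simp: stab_def)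
    thus "c * h \<in> spn E G'" by (simp add: h mult.assoc)
  qed
  have zn: "z ^ n = - (\<Sum>j<n. coeff Q j * z ^ j)"
  proof -
    have "0 = (\<Sum>j\<le>n. coeff Q j * z ^ j)" using Q(3) by (simp add: poly_altdef n_def)
    also have "\<dots> = (\<Sum>j<n. coeff Q j * z ^ j) + z ^ n"
      using Q(2) by (simp add: n_def lessThan_Suc_atMost[symmetric])
    finally show ?thesis by (simp add: eq_neg_iff_add_eq_0 add.commute)
  qed
  have "z \<in> stab E G'"
    unfolding stab_def
  proof (rule CollectI, rule ballI)
    fix h assume "h \<in> G'"
    then obtain g j where h: "g \<in> G" "j < n" "h = g * z ^ j" by (auto simp: G'_def)
    show "z * h \<in> spn E G'"
    proof (cases "Suc j < n")
      case True
      have "g * z ^ Suc j \<in> spn E G'" using True h by (intro sp spn_base[OF E G(1)]) auto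
      thus ?thesis by (simp add: h mult_ac)
    next
      case False
      hence "n = Suc j" using h by auto
      have "z * h = g * z ^ n" by (simp add: h \<open>n = Suc j\<close>)
      also have "\<dots> = (\<Sum>j<n. (-1) * ((coeff Q j * g) * z ^ j))"
        by (simp add: zn sum_distrib_left sum_negf mult_ac)
      also have "\<dots> \<in> spn E G'"
        using Q h(1) by (intro spn_sum[OF E fin] spn_smult[OF E fin] sp)
          (auto simp: stab_def polys_over_def subfld_closed[OF E])
      finally show ?thesis .
    qed
  qed
  moreover have "\<exists>h\<in>G'. h \<noteq> 0" using G n by (auto simp: G'_def intro!: bexI[of _ "g"] image_eqI[of _ _ "(g,0)"])
  ultimately show ?thesis using fin 1 C by blast
qed

lemma stab_finite_subset_clo:
  assumes E: "subfld E" and "finite C" "C \<subseteq> clo E"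
  shows "\<exists>G. finite G \<and> (\<exists>g\<in>G. g \<noteq> 0) \<and> C \<subseteq> stab E G"
  using assms(2,3)
proof (induction C rule: finite_induct)
  case empty
  show ?case by (intro exI[of _ "{1}"]) auto
next
  case (insert z C)
  then obtain G g where G: "finite G" "g \<in> G" "g \<noteq> 0" "C \<subseteq> stab E G" by auto
  obtain P where P: "P \<in> polys_over E" "P \<noteq> 0" "poly P z = 0" using insert by (auto simp: clo_def)
  obtain Q where Q: "Q \<in> polys_over E" "lead_coeff Q = 1" "poly Q z = 0"
    using monic_over[OF E P(1,2)] P(3) by metis
  have "Q \<in> polys_over (stab E G)" using Q(1) stab_subset[OF E G(1)] by (auto simp: polys_over_def)
  from stab_extend[OF E G(1-3) this Q(2,3) G(4)] show ?case .
qed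

lemma subfld_clo:
  assumes E: "subfld E" shows "subfld (clo E)"
proof -
  have *: "x + y \<in> clo E \<and> x * y \<in> clo E \<and> - x \<in> clo E" if xy: "x \<in> clo E" "y \<in> clo E" for x y
  proof -
    obtain G g where G: "finite G" "g \<in> G" "g \<noteq> 0" "{x,y} \<subseteq> stab E G"
      using stab_finite_subset_clo[OF E, of "{x,y}"] xy by auto
    have "-1 \<in> stab E G" using stab_subset[OF E G(1)] subfld_closed[OF E] by auto
    hence "- 1 * x \<in> clo E"
      using G by (intro stab_algebraic[OF E G(1-3)] stab_mult[OF E G(1)]) auto
    moreover have "x + y \<in> clo E" "x * y \<in> clo E"
      using G by (auto intro!: stab_algebraic[OF E G(1-3)] stab_add[OF E G(1)] stab_mult[OF E G(1)])
    ultimately show ?thesis by simp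
  qed
  have inv: "inverse x \<in> clo E" if x: "x \<in> clo E" for x
  proof (cases "x = 0")
    case False
    obtain P where P: "P \<in> polys_over E" "P \<noteq> 0" "poly P x = 0" using x by (auto simp: clo_def)
    have "reflect_poly P \<in> polys_over E" using P(1)
      by (auto simp: polys_over_def coeff_reflect_poly subfld_0[OF E])
    moreover have "poly (reflect_poly P) (inverse x) = 0"
      using P False by (simp add: poly_reflect_poly_nz)
    moreover have "reflect_poly P \<noteq> 0" using P by auto
    ultimately show ?thesis unfolding clo_def by blast
  qed (use clo_incl[OF E] subfld_0[OF E] in auto)
  show ?thesis unfolding subfld_def
    using * inv clo_incl[OF E] subfld_0[OF E] subfld_1[OF E] by blast
qed

lemma clo_clo:
  assumes E: "subfld E" shows "clo (clo E) = clo E"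
proof
  show "clo E \<subseteq> clo (clo E)" using clo_incl[OF subfld_clo[OF E]] by auto
  show "clo (clo E) \<subseteq> clo E"
  proof
    fix z assume "z \<in> clo (clo E)"
    then obtain P where P: "P \<in> polys_over (clo E)" "P \<noteq> 0" "poly P z = 0" by (auto simp: clo_def)
    obtain Q where Q: "Q \<in> polys_over (clo E)" "lead_coeff Q = 1" "poly Q z = 0"
      using monic_over[OF subfld_clo[OF E] P(1,2)] P(3) by metis
    obtain G g where G: "finite G" "g \<in> G" "g \<noteq> 0" "coeff Q ` {..degree Q} \<subseteq> stab E G"
      using stab_finite_subset_clo[OF E, of "coeff Q ` {..degree Q}"] Q(1)
      by (auto simp: polys_over_def image_subset_iff)
    have "coeff Q i \<in> stab E G" for i
    proof (cases "i \<le> degree Q")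
      case True
      thus ?thesis using G(4) by auto
    next
      case False
      thus ?thesis using stab_subset[OF E G(1)] subfld_0[OF E] by (auto simp: coeff_eq_0)
    qed
    hence "Q \<in> polys_over (stab E G)" by (auto simp: polys_over_def)
    from stab_extend[OF E G(1-3) this Q(2,3), of "{}"] obtain G' g'
      where "finite G'" "g' \<in> G'" "g' \<noteq> 0" "z \<in> stab E G'" by auto
    thus "z \<in> clo E" using stab_algebraic[OF E] by blast
  qed
qed

section \<open>Rings of fractions and common denominators\<close>

definition subrng :: "'l::field set \<Rightarrow> bool" where
  "subrng R \<longleftrightarrow> 1 \<in> R \<and> (\<forall>x\<in>R. - x \<in> R \<and> (\<forall>y\<in>R. x + y \<in> R \<and> x * y \<in> R))"

definition fracs :: "'l::field set \<Rightarrow> 'l set" where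
  "fracs R = {a / b | a b. a \<in> R \<and> b \<in> R \<and> b \<noteq> 0}"

lemma fracsI: "x = a / b \<Longrightarrow> a \<in> R \<Longrightarrow> b \<in> R \<Longrightarrow> b \<noteq> 0 \<Longrightarrow> x \<in> fracs R"
  unfolding fracs_def by blast

context
  fixes R :: "'l::field set"
  assumes R: "subrng R"
begin

lemma subrng_closed: "1 \<in> R" "x \<in> R \<Longrightarrow> y \<in> R \<Longrightarrow> x + y \<in> R" "x \<in> R \<Longrightarrow> y \<in> R \<Longrightarrow> x * y \<in> R"
  "x \<in> R \<Longrightarrow> - x \<in> R" "0 \<in> R"
proof -
  show *: "1 \<in> R" "x \<in> R \<Longrightarrow> y \<in> R \<Longrightarrow> x + y \<in> R" "x \<in> R \<Longrightarrow> y \<in> R \<Longrightarrow> x * y \<in> R" "x \<in> R \<Longrightarrow> - x \<in> R" for x y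
    using R by (auto simp: subrng_def)
  show "0 \<in> R" using *(2)[OF *(1) *(4)[OF *(1)]] by simp
qed

lemma fracs_incl: "x \<in> R \<Longrightarrow> x \<in> fracs R"
  by (rule fracsI[of _ x 1]) (use subrng_closed in auto)

lemma subfld_fracs: "subfld (fracs R)"
  unfolding subfld_def
proof (intro conjI ballI)
  show "0 \<in> fracs R" "1 \<in> fracs R" using fracs_incl subrng_closed by auto
  fix x y assume "x \<in> fracs R" "y \<in> fracs R"
  then obtain a b u v where *: "x = a / b" "y = u / v" "a \<in> R" "b \<in> R" "u \<in> R" "v \<in> R" "b \<noteq> 0" "v \<noteq> 0"
    by (auto simp: fracs_def)
  show "x + y \<in> fracs R"
    by (rule fracsI[of _ "a * v + u * b" "b * v"]) (use * subrng_closed in \<open>auto simp: add_frac_eq\<close>)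
  show "x * y \<in> fracs R"
    by (rule fracsI[of _ "a * u" "b * v"]) (use * subrng_closed in auto)
next
  fix x assume "x \<in> fracs R"
  then obtain a b where *: "x = a / b" "a \<in> R" "b \<in> R" "b \<noteq> 0" by (auto simp: fracs_def)
  show "- x \<in> fracs R" by (rule fracsI[of _ "- a" b]) (use * subrng_closed in auto)
  show "inverse x \<in> fracs R"
    by (cases "a = 0") (use * fracs_incl[OF subrng_closed(5)] in \<open>auto intro!: fracsI[of _ b a]\<close>)
qed

lemma common_denominator:
  assumes "finite J" "\<And>j. j \<in> J \<Longrightarrow> a j \<in> fracs R"
  shows "\<exists>V\<in>R. V \<noteq> 0 \<and> (\<forall>j\<in>J. V * a j \<in> R)"
  using assms
proof (induction J rule: finite_induct)
  case empty
  show ?case by (rule bexI[of _ 1]) (auto intro: subrng_closed)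
next
  case (insert j J)
  then obtain V where V: "V \<in> R" "V \<noteq> 0" "\<forall>j\<in>J. V * a j \<in> R" by auto
  obtain u v where *: "a j = u / v" "u \<in> R" "v \<in> R" "v \<noteq> 0"
    using insert.prems[of j] by (auto simp: fracs_def)
  have "(V * v) * a k \<in> R" if "k \<in> insert j J" for k
  proof (cases "k = j")
    case True
    thus ?thesis using * V by (auto intro: subrng_closed)
  next
    case False
    hence "V * a k \<in> R" using that V by auto
    hence "v * (V * a k) \<in> R" by (rule subrng_closed(3)[OF *(3)])
    thus ?thesis by (simp add: mult_ac)
  qed
  thus ?case using V * by (intro bexI[of _ "V * v"]) (auto intro: subrng_closed)
qed

end

section \<open>Algebraic independence\<close>

definition powprod :: "('i \<Rightarrow> 'b::comm_monoid_mult) \<Rightarrow> ('i \<Rightarrow>\<^sub>0 nat) \<Rightarrow> 'b" where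
  "powprod x m = (\<Prod>i\<in>Poly_Mapping.keys m. x i ^ Poly_Mapping.lookup m i)"

lemma powprod_superset:
  assumes "finite A" "Poly_Mapping.keys m \<subseteq> A"
  shows "powprod x m = (\<Prod>i\<in>A. x i ^ Poly_Mapping.lookup m i)"
  unfolding powprod_def using assms
  by (intro prod.mono_neutral_left) (auto simp: in_keys_iff)

lemma powprod_0 [simp]: "powprod x 0 = 1" by (simp add: powprod_def)

lemma powprod_add: "powprod x (m + m') = powprod x m * powprod x m'"
proof -
  let ?A = "Poly_Mapping.keys m \<union> Poly_Mapping.keys m'"
  have "Poly_Mapping.keys (m + m') \<subseteq> ?A" by (rule Poly_Mapping.keys_add)
  thus ?thesis
    by (simp add: powprod_superset[of ?A] lookup_add power_add prod.distrib)
qed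

lemma powprod_single [simp]: "powprod x (Poly_Mapping.single i e) = x i ^ e"
  by (simp add: powprod_def)

lemma alg_indep_over_powprod:
  "alg_indep_over F I x \<longleftrightarrow>
     (\<forall>S c. finite S \<and> (\<forall>m\<in>S. Poly_Mapping.keys m \<subseteq> I \<and> c m \<in> F) \<and> (\<Sum>m\<in>S. c m * powprod x m) = 0
        \<longrightarrow> (\<forall>m\<in>S. c m = 0))"
  by (simp add: alg_indep_over_def powprod_def)

lemma alg_indep_overI:
  assumes "\<And>S c m. finite S \<Longrightarrow> (\<And>m. m \<in> S \<Longrightarrow> Poly_Mapping.keys m \<subseteq> I) \<Longrightarrow> (\<And>m. m \<in> S \<Longrightarrow> c m \<in> F)
     \<Longrightarrow> (\<Sum>m\<in>S. c m * powprod x m) = 0 \<Longrightarrow> m \<in> S \<Longrightarrow> c m = 0"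
  shows "alg_indep_over F I x"
  using assms unfolding alg_indep_over_powprod by blast

lemma alg_indep_overD:
  assumes "alg_indep_over F I x" "finite S" "\<And>m. m \<in> S \<Longrightarrow> Poly_Mapping.keys m \<subseteq> I" "\<And>m. m \<in> S \<Longrightarrow> c m \<in> F"
    "(\<Sum>m\<in>S. c m * powprod x m) = 0" "m \<in> S"
  shows "c m = 0"
  using assms unfolding alg_indep_over_powprod by blast

lemma alg_indep_over_subset:
  assumes "alg_indep_over F I x" "J \<subseteq> I" "F' \<subseteq> F"
  shows "alg_indep_over F' J x"
proof (rule alg_indep_overI)
  fix S c m
  assume S: "finite S" "\<And>m. m \<in> S \<Longrightarrow> Poly_Mapping.keys m \<subseteq> J" "\<And>m. m \<in> S \<Longrightarrow> c m \<in> F'"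
    "(\<Sum>m\<in>S. c m * powprod x m) = 0" "m \<in> S"
  show "c m = 0"
    by (rule alg_indep_overD[OF assms(1) S(1) _ _ S(4,5)]) (use S assms in blast)+
qed

lemma alg_indep_over_empty:
  fixes x :: "'i \<Rightarrow> 'l::field"
  shows "alg_indep_over F {} x"
proof (rule alg_indep_overI)
  fix S :: "('i \<Rightarrow>\<^sub>0 nat) set" and c m
  assume S: "finite S" "\<And>m. m \<in> S \<Longrightarrow> Poly_Mapping.keys m \<subseteq> {}" "(\<Sum>m\<in>S. c m * powprod x m) = 0" "m \<in> S"
  have "\<And>m. m \<in> S \<Longrightarrow> m = 0" using S(2) by fastforce
  hence "S = {0}" using S(4) by auto
  thus "c m = 0" using S by simp
qed

definition rmv :: "'i \<Rightarrow> ('i \<Rightarrow>\<^sub>0 nat) \<Rightarrow> ('i \<Rightarrow>\<^sub>0 nat)" where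
  "rmv i m = m - Poly_Mapping.single i (Poly_Mapping.lookup m i)"

lemma rmv_split: "m = rmv i m + Poly_Mapping.single i (Poly_Mapping.lookup m i)"
  by (rule poly_mapping_eqI) (auto simp: rmv_def lookup_add lookup_minus lookup_single when_def)

lemma keys_rmv: "Poly_Mapping.keys (rmv i m) = Poly_Mapping.keys m - {i}"
  by (auto simp: rmv_def in_keys_iff lookup_minus lookup_single when_def split: if_splits)

text \<open>A relation is read as a polynomial in \<open>x i\<close> over \<open>E\<close>, which
  vanishes because \<open>x i\<close> is transcendental. Each coefficient is a relation in the other
  variables; stripping the variable \<open>i\<close> by \<open>rmv\<close> is injective on monomials
  with a given exponent of \<open>i\<close>, so no terms merge.\<close>

lemma alg_indep_over_insert:
  fixes x :: "'i \<Rightarrow> 'l::field"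
  assumes E: "subfld E" and sub: "F \<subseteq> E" "x ` I \<subseteq> E" and ind: "alg_indep_over F I x" and t: "x i \<notin> clo E"
  shows "alg_indep_over F (insert i I) x"
proof (rule alg_indep_overI)
  fix S :: "('i \<Rightarrow>\<^sub>0 nat) set" and c m
  assume S: "finite S" "\<And>m. m \<in> S \<Longrightarrow> Poly_Mapping.keys m \<subseteq> insert i I" "\<And>m. m \<in> S \<Longrightarrow> c m \<in> F"
    "(\<Sum>m\<in>S. c m * powprod x m) = 0" "m \<in> S"
  have iI: "i \<notin> I" using t sub(2) clo_incl[OF E] by auto
  have keys: "Poly_Mapping.keys (rmv i m) \<subseteq> I" if "m \<in> S" for m
    using S(2)[OF that] by (auto simp: keys_rmv)
  have mE: "powprod x (rmv i m) \<in> E" if "m \<in> S" for m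
    unfolding powprod_def using keys[OF that] sub(2)
    by (intro subfld_prod[OF E] subfld_power[OF E]) auto
  define P where "P = (\<Sum>m\<in>S. monom (c m * powprod x (rmv i m)) (Poly_Mapping.lookup m i))"
  have "P \<in> polys_over E"
    unfolding P_def using mE S(3) sub(1) by (intro polys_over_sum[OF E] polys_over_monom[OF E] subfld_mult[OF E]) auto
  moreover have "poly P (x i) = 0"
  proof -
    have "poly P (x i) = (\<Sum>m\<in>S. c m * powprod x m)"
      unfolding P_def poly_sum poly_monom
    proof (rule sum.cong[OF refl])
      fix m assume "m \<in> S"
      have "powprod x m = powprod x (rmv i m) * x i ^ Poly_Mapping.lookup m i"
        by (subst rmv_split[of m i]) (simp add: powprod_add)
      thus "c m * powprod x (rmv i m) * x i ^ Poly_Mapping.lookup m i = c m * powprod x m" by simp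
    qed
    thus ?thesis using S(4) by simp
  qed
  ultimately have P0: "P = 0" using t by (auto simp: clo_def)
  define e where "e = Poly_Mapping.lookup m i"
  define S' where "S' = {m\<in>S. Poly_Mapping.lookup m i = e}"
  have inj: "inj_on (rmv i) S'"
    by (rule inj_onI) (metis (mono_tags, lifting) S'_def mem_Collect_eq rmv_split)
  have "0 = coeff P e" using P0 by simp
  also have "\<dots> = (\<Sum>m\<in>S. if Poly_Mapping.lookup m i = e then c m * powprod x (rmv i m) else 0)"
    by (simp add: P_def coeff_sum)
  also have "\<dots> = (\<Sum>m\<in>S'. c m * powprod x (rmv i m))"
    unfolding S'_def using S(1) by (simp add: sum.inter_filter)
  also have "\<dots> = (\<Sum>m\<in>rmv i ` S'. c (the_inv_into S' (rmv i) m) * powprod x m)"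
    by (subst sum.reindex[OF inj]) (auto simp: the_inv_into_f_f[OF inj])
  finally have "(\<Sum>m\<in>rmv i ` S'. c (the_inv_into S' (rmv i) m) * powprod x m) = 0" by simp
  hence "c (the_inv_into S' (rmv i) (rmv i m)) = 0"
  proof (rule alg_indep_overD[OF ind, rotated 3])
    show "finite (rmv i ` S')" using S(1) by (auto simp: S'_def)
    show "rmv i m \<in> rmv i ` S'" using S(5) by (auto simp: S'_def e_def)
    fix m' assume "m' \<in> rmv i ` S'"
    then obtain m2 where m2: "m2 \<in> S'" "m' = rmv i m2" by auto
    show "Poly_Mapping.keys m' \<subseteq> I" using m2 keys by (auto simp: S'_def)
    show "c (the_inv_into S' (rmv i) m') \<in> F" 
      using m2 S(3) by (simp add: the_inv_into_f_f[OF inj]) (simp add: S'_def)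
  qed
  thus "c m = 0" using S(5) by (subst (asm) the_inv_into_f_f[OF inj]) (auto simp: S'_def e_def)
qed

text \<open>Coefficients and monomials are restricted separately, and \<open>C\<close> need only
  contain \<open>0\<close> and be closed under sums and products: it is a field in
  \<open>palg\<close> and the set of Laurent polynomials in the weighted spans.\<close>

definition combs :: "'b::comm_semiring_1 set \<Rightarrow> ('i \<Rightarrow>\<^sub>0 nat) set \<Rightarrow> ('i \<Rightarrow> 'b) \<Rightarrow> 'b set" where
  "combs C M x = {\<Sum>m\<in>S. c m * powprod x m | S c. finite S \<and> (\<forall>m\<in>S. m \<in> M \<and> c m \<in> C)}"

context
  fixes C :: "'b::comm_semiring_1 set"
  assumes C: "0 \<in> C" "\<And>a b. a \<in> C \<Longrightarrow> b \<in> C \<Longrightarrow> a + b \<in> C" "\<And>a b. a \<in> C \<Longrightarrow> b \<in> C \<Longrightarrow> a * b \<in> C"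
begin

text \<open>Sums and products produce families in which monomials repeat; collecting equal monomials
  brings them back to the form required by \<open>combs\<close>.\<close>

lemma combs_family:
  assumes "finite A" "\<And>j. j \<in> A \<Longrightarrow> f j \<in> M" "\<And>j. j \<in> A \<Longrightarrow> c j \<in> C"
  shows "(\<Sum>j\<in>A. c j * powprod x (f j)) \<in> combs C M x"
proof -
  have "(\<Sum>j\<in>A. c j * powprod x (f j)) = (\<Sum>m\<in>f ` A. \<Sum>j\<in>{j\<in>A. f j = m}. c j * powprod x (f j))"
    using assms(1) by (rule sum.image_gen)
  also have "\<dots> = (\<Sum>m\<in>f ` A. (\<Sum>j\<in>{j\<in>A. f j = m}. c j) * powprod x m)"
    by (intro sum.cong refl) (simp add: sum_distrib_right)
  finally have *: "(\<Sum>j\<in>A. c j * powprod x (f j)) = (\<Sum>m\<in>f ` A. (\<Sum>j\<in>{j\<in>A. f j = m}. c j) * powprod x m)" .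
  have "(\<Sum>j\<in>B. c j) \<in> C" if "B \<subseteq> A" for B
    using that by (induction B rule: infinite_finite_induct) (auto intro: C assms(3))
  thus ?thesis unfolding combs_def * using assms
    by (intro CollectI exI[of _ "f ` A"] exI[of _ "\<lambda>m. (\<Sum>j\<in>{j\<in>A. f j = m}. c j)"]) auto
qed

lemma combs_mult:
  assumes "u \<in> combs C M x" "v \<in> combs C M' x" "\<And>m m'. m \<in> M \<Longrightarrow> m' \<in> M' \<Longrightarrow> m + m' \<in> M''"
  shows "u * v \<in> combs C M'' x"
proof -
  obtain S c where u: "u = (\<Sum>m\<in>S. c m * powprod x m)" "finite S" "\<forall>m\<in>S. m \<in> M \<and> c m \<in> C"
    using assms(1) by (auto simp: combs_def)
  obtain T d where v: "v = (\<Sum>m\<in>T. d m * powprod x m)" "finite T" "\<forall>m\<in>T. m \<in> M' \<and> d m \<in> C"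
    using assms(2) by (auto simp: combs_def)
  have "u * v = (\<Sum>j\<in>S\<times>T. (c (fst j) * d (snd j)) * powprod x (fst j + snd j))"
    by (simp add: u(1) v(1) sum_product sum.cartesian_product powprod_add mult_ac case_prod_unfold)
  also have "\<dots> \<in> combs C M'' x"
    by (rule combs_family) (use u v assms(3) C(3) in auto)
  finally show ?thesis .
qed

lemma combs_add:
  assumes "u \<in> combs C M x" "v \<in> combs C M x" shows "u + v \<in> combs C M x"
proof -
  obtain S c where u: "u = (\<Sum>m\<in>S. c m * powprod x m)" "finite S" "\<forall>m\<in>S. m \<in> M \<and> c m \<in> C"
    using assms(1) by (auto simp: combs_def)
  obtain T d where v: "v = (\<Sum>m\<in>T. d m * powprod x m)" "finite T" "\<forall>m\<in>T. m \<in> M \<and> d m \<in> C"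
    using assms(2) by (auto simp: combs_def)
  have "u + v = (\<Sum>j\<in>S<+>T. (case j of Inl m \<Rightarrow> c m | Inr m \<Rightarrow> d m) * powprod x (case j of Inl m \<Rightarrow> m | Inr m \<Rightarrow> m))"
    using u v by (simp add: sum.Plus)
  also have "\<dots> \<in> combs C M x"
    by (rule combs_family) (use u v in auto)
  finally show ?thesis .
qed

lemma combs_const: "a \<in> C \<Longrightarrow> 0 \<in> M \<Longrightarrow> a \<in> combs C M x"
  using combs_family[of "{()}" "\<lambda>_. 0" M "\<lambda>_. a" x] by simp

lemma combs_var: "1 \<in> C \<Longrightarrow> Poly_Mapping.single i 1 \<in> M \<Longrightarrow> x i \<in> combs C M x"
  using combs_family[of "{()}" "\<lambda>_. Poly_Mapping.single i 1" M "\<lambda>_. 1" x] by simp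

end

definition palg :: "'l::field set \<Rightarrow> 'i set \<Rightarrow> ('i \<Rightarrow> 'l) \<Rightarrow> 'l set" where
  "palg F I x = combs F {m. Poly_Mapping.keys m \<subseteq> I} x"

definition fra :: "'l::field set \<Rightarrow> 'i set \<Rightarrow> ('i \<Rightarrow> 'l) \<Rightarrow> 'l set" where
  "fra F I x = fracs (palg F I x)"

context
  fixes F :: "'l::field set" and I :: "'i set" and x :: "'i \<Rightarrow> 'l"
  assumes F: "subfld F"
begin

lemma palg_const: "a \<in> F \<Longrightarrow> a \<in> palg F I x"
  unfolding palg_def by (rule combs_const) (auto intro: subfld_closed[OF F])

lemma palg_var: "i \<in> I \<Longrightarrow> x i \<in> palg F I x"
  unfolding palg_def by (rule combs_var) (auto intro: subfld_closed[OF F])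

lemma subrng_palg: "subrng (palg F I x)"
proof -
  have add: "u + v \<in> palg F I x" if "u \<in> palg F I x" "v \<in> palg F I x" for u v
    using that unfolding palg_def by (intro combs_add) (auto intro: subfld_closed[OF F])
  have mult: "u * v \<in> palg F I x" if "u \<in> palg F I x" "v \<in> palg F I x" for u v
  proof -
    have "Poly_Mapping.keys (m + m') \<subseteq> I" if "Poly_Mapping.keys m \<subseteq> I" "Poly_Mapping.keys m' \<subseteq> I" for m m'
      using Poly_Mapping.keys_add[of m m'] that by blast
    with that show ?thesis unfolding palg_def
      by (intro combs_mult[of F]) (auto intro: subfld_closed[OF F])
  qed
  have "- u \<in> palg F I x" if "u \<in> palg F I x" for u
    using mult[OF palg_const that, of "-1"] subfld_closed[OF F] by auto
  thus ?thesis unfolding subrng_def using add mult palg_const subfld_1[OF F] by blast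
qed

lemmas fra_incl = fracs_incl[OF subrng_palg, folded fra_def]
lemmas subfld_fra = subfld_fracs[OF subrng_palg, folded fra_def]

text \<open>Converse of \<open>alg_indep_over_insert\<close>: after clearing denominators, an
  algebraic equation for \<open>x i\<close> is a polynomial relation, and its monomials stay
  distinct because \<open>i\<close> does not occur in the coefficients.\<close>

lemma alg_indep_over_transcendental:
  assumes ind: "alg_indep_over F (insert i I) x" and i: "i \<notin> I"
  shows "x i \<notin> clo (fra F I x)"
proof
  assume "x i \<in> clo (fra F I x)"
  then obtain P where P: "P \<in> polys_over (fra F I x)" "P \<noteq> 0" "poly P (x i) = 0" by (auto simp: clo_def)
  define n where "n = degree P"
  obtain V where V: "V \<noteq> 0" "\<forall>j\<in>{..n}. V * coeff P j \<in> palg F I x"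
    using common_denominator[OF subrng_palg, of "{..n}" "coeff P"] P(1) by (auto simp: polys_over_def fra_def)
  have "\<forall>j\<in>{..n}. \<exists>S c. V * coeff P j = (\<Sum>m\<in>S. c m * powprod x m) \<and> finite S \<and>
     (\<forall>m\<in>S. Poly_Mapping.keys m \<subseteq> I \<and> c m \<in> F)"
    using V(2) unfolding palg_def combs_def by blast
  then obtain S c where S: "\<And>j. j \<le> n \<Longrightarrow> V * coeff P j = (\<Sum>m\<in>S j. c j m * powprod x m)"
    "\<And>j. j \<le> n \<Longrightarrow> finite (S j)"
    "\<And>j m. j \<le> n \<Longrightarrow> m \<in> S j \<Longrightarrow> Poly_Mapping.keys m \<subseteq> I \<and> c j m \<in> F"
    by (simp only: bchoice_iff) (metis atMost_iff)
  define J where "J = Sigma {..n} S"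
  define f :: "nat \<times> ('i \<Rightarrow>\<^sub>0 nat) \<Rightarrow> ('i \<Rightarrow>\<^sub>0 nat)"
    where "f = (\<lambda>(j, m). m + Poly_Mapping.single i j)"
  have l0: "Poly_Mapping.lookup m i = 0" if "j \<le> n" "m \<in> S j" for j m
    using S(3)[OF that] i by (auto simp: in_keys_iff)
  have inj: "inj_on f J"
  proof (rule inj_onI, clarsimp simp: f_def J_def)
    fix j m j' m' assume *: "m + Poly_Mapping.single i j = m' + Poly_Mapping.single i j'"
      "j \<le> n" "m \<in> S j" "j' \<le> n" "m' \<in> S j'"
    from arg_cong[OF *(1), of "\<lambda>m. Poly_Mapping.lookup m i"] have "j = j'"
      using l0[OF *(2,3)] l0[OF *(4,5)] by (simp add: lookup_add)
    thus "j = j' \<and> m = m'" using * by simp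
  qed
  define C where "C m = (case the_inv_into J f m of (j, m') \<Rightarrow> c j m')" for m
  have C: "C (f (j, m)) = c j m" if "j \<le> n" "m \<in> S j" for j m
    using the_inv_into_f_f[OF inj, of "(j, m)"] that by (simp add: C_def J_def)
  have "0 = V * poly P (x i)" using P by simp
  also have "\<dots> = (\<Sum>j\<le>n. (V * coeff P j) * x i ^ j)"
    by (simp add: poly_altdef n_def sum_distrib_left mult.assoc)
  also have "\<dots> = (\<Sum>j\<le>n. \<Sum>m\<in>S j. c j m * powprod x (f (j, m)))"
    by (intro sum.cong refl) (simp add: S f_def powprod_add sum_distrib_right mult.assoc)
  also have "\<dots> = (\<Sum>p\<in>J. c (fst p) (snd p) * powprod x (f p))"
    unfolding J_def using S(2) by (subst sum.Sigma) (auto simp: case_prod_unfold)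
  also have "\<dots> = (\<Sum>p\<in>J. C (f p) * powprod x (f p))"
    by (intro sum.cong refl) (auto simp: J_def C)
  also have "\<dots> = (\<Sum>m\<in>f ` J. C m * powprod x m)"
    by (simp add: sum.reindex[OF inj])
  finally have sum0: "(\<Sum>m\<in>f ` J. C m * powprod x m) = 0" by simp
  have z: "C m = 0" if "m \<in> f ` J" for m
  proof (rule alg_indep_overD[OF ind _ _ _ sum0 that])
    show "finite (f ` J)" using S(2) by (auto simp: J_def)
    fix m assume "m \<in> f ` J"
    then obtain j m' where *: "m = f (j, m')" "j \<le> n" "m' \<in> S j" by (auto simp: J_def)
    show "C m \<in> F" using * S(3) C by auto
    show "Poly_Mapping.keys m \<subseteq> insert i I"
      using Poly_Mapping.keys_add[of m' "Poly_Mapping.single i j"] S(3)[OF *(2,3)]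
      by (auto simp: *(1) f_def split: if_splits)
  qed
  have "V * coeff P n = (\<Sum>m\<in>S n. c n m * powprod x m)" using S by simp
  also have "\<dots> = 0"
  proof (intro sum.neutral ballI)
    fix m assume "m \<in> S n"
    hence "f (n, m) \<in> f ` J" by (auto simp: J_def)
    from z[OF this] C \<open>m \<in> S n\<close> show "c n m * powprod x m = 0" by simp
  qed
  finally show False using V P by (simp add: n_def)
qed

end

lemma fra_mono:
  assumes "I \<subseteq> J" shows "fra F I x \<subseteq> fra F J x"
proof -
  have "palg F I x \<subseteq> palg F J x" unfolding palg_def combs_def using assms by blast
  thus ?thesis unfolding fra_def fracs_def by blast
qed

text \<open>Exchange along the list: over the closure of the field generated by the earlier
  \<open>x\<close>, which contains the earlier \<open>x'\<close>, transcendence of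
  \<open>x (zs ! j)\<close> passes on to \<open>x' (zs ! j)\<close>. As these fields are
  algebraically closed in the ambient field, the coefficients may be enlarged from \<open>F\<close>
  to \<open>clo F\<close>.\<close>

lemma alg_indep_over_transfer:
  fixes x x' :: "'i \<Rightarrow> 'l::field"
  assumes F: "subfld F" and "distinct zs" and ind: "alg_indep_over F (set zs) x"
    and mem: "\<And>j. j < length zs \<Longrightarrow> x' (zs ! j) \<in> clo (fra F (set (take (Suc j) zs)) x)"
    and tr: "\<And>j. j < length zs \<Longrightarrow> x' (zs ! j) \<in> clo (fra F (set (take j zs)) x)
        \<Longrightarrow> x (zs ! j) \<in> clo (fra F (set (take j zs)) x)"
  shows "alg_indep_over (clo F) (set zs) x'"
proof -
  have "alg_indep_over (clo F) (set (take j zs)) x'" if "j \<le> length zs" for j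
    using that
  proof (induction j)
    case 0
    show ?case by (simp add: alg_indep_over_empty)
  next
    case (Suc j)
    let ?G = "fra F (set (take j zs)) x"
    let ?E = "clo ?G"
    have G: "subfld ?G" by (rule subfld_fra[OF F])
    have E: "subfld ?E" by (rule subfld_clo[OF G])
    have "alg_indep_over (clo F) (insert (zs ! j) (set (take j zs))) x'"
    proof (rule alg_indep_over_insert[OF E])
      have "F \<subseteq> ?G" by (auto intro!: fra_incl[OF F] palg_const[OF F])
      thus "clo F \<subseteq> ?E" by (rule clo_mono)
      show "x' ` set (take j zs) \<subseteq> ?E"
      proof
        fix y assume "y \<in> x' ` set (take j zs)"
        then obtain i where i: "i < j" "y = x' (zs ! i)" using Suc.prems by (auto simp: in_set_conv_nth)
        have "y \<in> clo (fra F (set (take (Suc i) zs)) x)" using mem[of i] i Suc.prems by auto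
        also have "\<dots> \<subseteq> ?E" using i by (intro clo_mono fra_mono set_take_subset_set_take) auto
        finally show "y \<in> ?E" .
      qed
      show "alg_indep_over (clo F) (set (take j zs)) x'" using Suc by simp
      have "alg_indep_over F (insert (zs ! j) (set (take j zs))) x"
        by (rule alg_indep_over_subset[OF ind]) (use Suc.prems set_take_subset[of j zs] in auto)
      moreover have "zs ! j \<notin> set (take j zs)"
        using \<open>distinct zs\<close> Suc.prems by (auto simp: in_set_conv_nth nth_eq_iff_index_eq)
      ultimately have "x (zs ! j) \<notin> ?E" by (rule alg_indep_over_transcendental[OF F])
      hence "x' (zs ! j) \<notin> ?E" using tr[of j] Suc.prems by auto
      thus "x' (zs ! j) \<notin> clo ?E" by (simp add: clo_clo[OF G])
    qed
    thus ?case using Suc.prems by (simp add: take_Suc_conv_app_nth)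
  qed
  from this[of "length zs"] show ?thesis by simp
qed

section \<open>Difference fields of positive characteristic\<close>

lemma poly_eq_of_transcendental:
  assumes E: "subfld E" and "y \<notin> clo E" "P \<in> polys_over E" "Q \<in> polys_over E" "poly P y = poly Q y"
  shows "P = Q"
proof (rule ccontr)
  assume "P \<noteq> Q"
  moreover have "P - Q \<in> polys_over E" using assms by (intro polys_over_closed[OF E])
  moreover have "poly (P - Q) y = 0" using assms by simp
  ultimately have "y \<in> clo E" unfolding clo_def by (metis (mono_tags, lifting) mem_Collect_eq right_minus_eq)
  thus False using assms by simp
qed

text \<open>The value at \<open>b\<close> of the additive polynomial whose \<open>p ^ j\<close>-th coefficient is the
  \<open>j\<close>-th coefficient of \<open>P\<close>.\<close>

definition ad :: "'l::field poly \<Rightarrow> 'l \<Rightarrow> 'l" where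
  "ad P b = (\<Sum>j\<le>degree P. coeff P j * b ^ (CHAR('l) ^ j))"

lemma ad_altdef:
  fixes P :: "'l::field poly"
  assumes "degree P \<le> n"
  shows "ad P b = (\<Sum>j\<le>n. coeff P j * b ^ (CHAR('l) ^ j))"
  unfolding ad_def using assms by (intro sum.mono_neutral_left) (auto simp: coeff_eq_0)

lemma ad_0 [simp]: "ad 0 b = 0" by (simp add: ad_def)

lemma ad_pCons: "ad (pCons c P) (b::'l::field) = c * b + ad P (b ^ CHAR('l))"
proof -
  have "ad (pCons c P) b = (\<Sum>j\<le>Suc (degree P). coeff (pCons c P) j * b ^ (CHAR('l) ^ j))"
    by (rule ad_altdef) (auto simp: degree_pCons_le)
  also have "\<dots> = c * b + (\<Sum>j\<le>degree P. coeff P j * b ^ (CHAR('l) ^ Suc j))"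
    by (subst sum.atMost_Suc_shift) simp
  finally show ?thesis by (simp add: ad_def power_mult)
qed

lemma ad_add: "ad (P + Q) b = ad P b + ad Q b"
proof -
  let ?n = "max (degree P) (degree Q)"
  have "degree (P + Q) \<le> ?n" by (rule degree_add_le_max)
  thus ?thesis by (simp add: ad_altdef[of _ ?n] sum.distrib algebra_simps)
qed

lemma ad_smult: "ad (smult c P) b = c * ad P b"
proof -
  have "ad (smult c P) b = (\<Sum>j\<le>degree P. coeff (smult c P) j * b ^ (CHAR('a) ^ j))"
    by (rule ad_altdef) (rule degree_smult_le)
  thus ?thesis by (simp add: ad_def sum_distrib_left mult.assoc)
qed

lemma ad_uminus: "ad (- P) b = - ad P b"
  by (simp add: ad_def sum_negf)

lemma ad_diff: "ad (P - Q) b = ad P b - ad Q b"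
  using ad_add[of P "- Q" b] by (simp add: ad_uminus)

lemma ad_monom: "ad (monom c j) (b::'l::field) = c * b ^ (CHAR('l) ^ j)"
proof -
  have "ad (monom c j) b = (\<Sum>i\<le>j. coeff (monom c j) i * b ^ (CHAR('l) ^ i))"
    by (rule ad_altdef) (rule degree_monom_le)
  also have "\<dots> = (\<Sum>i\<in>{j}. coeff (monom c j) i * b ^ (CHAR('l) ^ i))"
    by (rule sum.mono_neutral_right) auto
  finally show ?thesis by simp
qed

lemma ad_in:
  assumes E: "subfld E" and "P \<in> polys_over E" "b \<in> E" shows "ad P b \<in> E"
  unfolding ad_def using assms by (intro subfld_sum[OF E] subfld_mult[OF E] subfld_power[OF E]) (auto simp: polys_over_def)

lemma ad_0_right: "CHAR('l) > 0 \<Longrightarrow> ad P (0::'l::field) = 0"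
  by (simp add: ad_def power_0_left)

definition adpoly :: "'l::field poly \<Rightarrow> 'l \<Rightarrow> 'l poly" where
  "adpoly K h = (\<Sum>j\<le>degree K. monom (coeff K j * h ^ (CHAR('l) ^ j)) (CHAR('l) ^ j))"

lemma poly_adpoly: "poly (adpoly K h) z = ad K (h * z)"
  by (simp add: adpoly_def ad_def poly_sum poly_monom power_mult_distrib mult.assoc)

lemma adpoly_over:
  assumes E: "subfld E" and "K \<in> polys_over E" "h \<in> E"
  shows "adpoly K h \<in> polys_over E"
  unfolding adpoly_def using assms(2,3)
  by (intro polys_over_sum[OF E] polys_over_monom[OF E] subfld_mult[OF E] subfld_power[OF E]) (auto simp: polys_over_def)

lemma pderiv_sum: "pderiv (sum f A) = (\<Sum>i\<in>A. pderiv (f i))"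
  by (induction A rule: infinite_finite_induct) (auto simp: pderiv_add)

lemma pderiv_adpoly: "pderiv (adpoly K (h::'l::field)) = [:coeff K 0 * h:]"
proof -
  have "pderiv (adpoly K h) = (\<Sum>j\<le>degree K. pderiv (monom (coeff K j * h ^ (CHAR('l) ^ j)) (CHAR('l) ^ j)))"
    by (simp add: adpoly_def pderiv_sum)
  also have "\<dots> = (\<Sum>j\<in>{0}. pderiv (monom (coeff K j * h ^ (CHAR('l) ^ j)) (CHAR('l) ^ j)))"
  proof (rule sum.mono_neutral_right)
    show "\<forall>i\<in>{..degree K} - {0}. pderiv (monom (coeff K i * h ^ (CHAR('l) ^ i)) (CHAR('l) ^ i)) = 0"
      by (auto simp: pderiv_monom of_nat_eq_0_iff_char_dvd power_0_left)
  qed auto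
  also have "\<dots> = [:coeff K 0 * h:]" by (simp add: pderiv_monom monom_0)
  finally show ?thesis .
qed

text \<open>Only exponents divisible by p survive. The result is a polynomial in
  \<open>y ^ p\<close> over the same \<open>E\<close>, not a p-th power, so \<open>E\<close> need
  not be perfect.\<close>

lemma pderiv_0_char:
  fixes P :: "'l::field poly"
  assumes "pderiv P = 0" "P \<in> polys_over E" "0 \<in> E" "CHAR('l) > 0"
  shows "\<exists>R\<in>polys_over E. degree R \<le> degree P div CHAR('l) \<and> (\<forall>y. poly P y = poly R (y ^ CHAR('l)))"
proof -
  let ?p = "CHAR('l)"
  define n where "n = degree P div ?p"
  define R where "R = (\<Sum>i\<le>n. monom (coeff P (?p * i)) i)"
  have cR: "coeff R i = (if i \<le> n then coeff P (?p * i) else 0)" for i by (simp add: R_def coeff_sum)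
  have z: "coeff P k = 0" if "\<not> ?p dvd k" for k
  proof -
    have "k \<noteq> 0" using that by (intro notI) simp
    then obtain j where j: "k = Suc j" using not0_implies_Suc by blast
    have "coeff (pderiv P) j = 0" using assms by simp
    hence "of_nat (Suc j) * coeff P (Suc j) = 0" by (simp add: coeff_pderiv)
    moreover have "of_nat (Suc j) \<noteq> (0 :: 'l)" unfolding of_nat_eq_0_iff_char_dvd using that j by simp
    ultimately show ?thesis using j by simp
  qed
  have "poly P y = poly R (y ^ ?p)" for y
  proof -
    have "poly P y = (\<Sum>k\<le>degree P. coeff P k * y ^ k)" by (simp add: poly_altdef)
    also have "\<dots> = (\<Sum>k\<in>(\<lambda>i. ?p * i) ` {..n}. coeff P k * y ^ k)"
    proof (rule sum.mono_neutral_right)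
      show "(\<lambda>i. ?p * i) ` {..n} \<subseteq> {..degree P}"
        using assms(4) by (auto simp: n_def less_eq_div_iff_mult_less_eq mult.commute)
      show "\<forall>i\<in>{..degree P} - (\<lambda>i. ?p * i) ` {..n}. coeff P i * y ^ i = 0"
      proof
        fix k assume k: "k \<in> {..degree P} - (\<lambda>i. ?p * i) ` {..n}"
        have "\<not> ?p dvd k"
        proof
          assume "?p dvd k"
          then obtain i where "k = ?p * i" by auto
          moreover from this have "i \<le> n" using k assms(4) by (auto simp: n_def less_eq_div_iff_mult_less_eq mult.commute)
          ultimately show False using k by auto
        qed
        thus "coeff P k * y ^ k = 0" using z by simp
      qed
    qed auto
    also have "\<dots> = (\<Sum>i\<le>n. coeff P (?p * i) * y ^ (?p * i))"
      using assms(4) by (subst sum.reindex) (auto intro: inj_onI)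
    also have "\<dots> = poly R (y ^ ?p)" by (simp add: R_def poly_sum poly_monom power_mult)
    finally show ?thesis .
  qed
  moreover have "R \<in> polys_over E" using assms by (auto simp: polys_over_def cR)
  moreover have "degree R \<le> n" by (rule degree_le) (auto simp: cR)
  ultimately show ?thesis unfolding n_def by blast
qed

text \<open>\<open>\<tau>\<close> is a field endomorphism, hence injective, but it is not assumed
  surjective, since the substitution of \<open>v ^ q\<close> for \<open>v\<close> is not.\<close>

locale difference_field =
  fixes \<tau> :: "'l::field \<Rightarrow> 'l"
  assumes char: "prime CHAR('l)"
    and tau_add: "\<tau> (x + y) = \<tau> x + \<tau> y"
    and tau_mult: "\<tau> (x * y) = \<tau> x * \<tau> y"
    and tau_1 [simp]: "\<tau> 1 = 1"
begin

lemma tau_0 [simp]: "\<tau> 0 = 0"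
proof -
  have "\<tau> (0 + 0) = \<tau> 0 + \<tau> 0" by (rule tau_add)
  thus ?thesis by (metis add_0 add_cancel_right_right)
qed
lemma tau_uminus: "\<tau> (- x) = - \<tau> x" using tau_add[of x "- x"] by (simp add: eq_neg_iff_add_eq_0 add.commute)
lemma tau_diff: "\<tau> (x - y) = \<tau> x - \<tau> y" using tau_add[of x "- y"] by (simp add: tau_uminus)
lemma tau_power: "\<tau> (x ^ n) = \<tau> x ^ n" by (induction n) (auto simp: tau_mult)
lemma tau_sum: "\<tau> (sum f A) = (\<Sum>i\<in>A. \<tau> (f i))"
  by (induction A rule: infinite_finite_induct) (auto simp: tau_add)
lemma tau_eq_0_iff [simp]: "\<tau> x = 0 \<longleftrightarrow> x = 0"
proof
  assume "\<tau> x = 0"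
  show "x = 0"
  proof (rule ccontr)
    assume "x \<noteq> 0"
    hence "\<tau> x * \<tau> (inverse x) = 1" by (simp flip: tau_mult)
    thus False using \<open>\<tau> x = 0\<close> by simp
  qed
qed auto
lemma tau_inverse: "\<tau> (inverse x) = inverse (\<tau> x)"
proof (cases "x = 0")
  case False
  hence "\<tau> x * \<tau> (inverse x) = 1" by (simp flip: tau_mult)
  thus ?thesis by (metis inverse_unique)
qed auto
lemma tau_divide: "\<tau> (x / y) = \<tau> x / \<tau> y" by (simp add: divide_inverse tau_mult tau_inverse)

lemma map_poly_tau_coeff [simp]: "coeff (map_poly \<tau> P) i = \<tau> (coeff P i)" by (simp add: coeff_map_poly)

lemma degree_map_poly_tau [simp]: "degree (map_poly \<tau> P) = degree P"
  by (rule degree_map_poly) auto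

lemma tau_poly: "\<tau> (poly P x) = poly (map_poly \<tau> P) (\<tau> x)"
  by (simp add: poly_altdef tau_sum tau_mult tau_power)

definition Fix :: "'l set" where "Fix = {x. \<tau> x = x}"

lemma subfld_Fix: "subfld Fix"
  by (auto simp: subfld_def Fix_def tau_add tau_mult tau_uminus tau_inverse)

lemma ad_add_right: "ad P (b + c) = ad P b + ad P (c::'l)"
  by (simp add: ad_def freshmans_dream'[OF char refl] algebra_simps sum.distrib)

lemma power_p_diff: "(b - c) ^ CHAR('l) = b ^ CHAR('l) - (c::'l) ^ CHAR('l)"
  using freshmans_dream[OF char refl, of "b - c" c] by simp

lemma ad_0_right' [simp]: "ad P (0::'l) = 0" by (rule ad_0_right) (use char prime_gt_0_nat in blast)

lemma ad_diff_right: "ad P (b - c) = ad P b - ad P (c::'l)"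
  using ad_add_right[of P "b - c" c] by simp

lemma ad_tau: "\<tau> (ad P b) = ad (map_poly \<tau> P) (\<tau> b)"
  by (simp add: ad_def tau_sum tau_mult tau_power)

lemma map_poly_tau_Fix: "P \<in> polys_over Fix \<Longrightarrow> map_poly \<tau> P = P"
  by (rule poly_eqI) (auto simp: polys_over_def Fix_def)

lemma ad_tau_Fix: "P \<in> polys_over Fix \<Longrightarrow> \<tau> (ad P b) = ad P (\<tau> b)"
  by (simp add: ad_tau map_poly_tau_Fix)

text \<open>Containing all constants lets additive polynomials with coefficients in
  \<open>Fix\<close> act inside \<open>E\<close>, and places every \<open>\<tau>\<close>-fixed
  element of the ambient field in \<open>E\<close>.\<close>

definition good :: "'l set \<Rightarrow> bool" where
  "good E \<longleftrightarrow> subfld E \<and> \<tau> ` E \<subseteq> E \<and> Fix \<subseteq> E"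

lemma goodD: "good E \<Longrightarrow> subfld E" "good E \<Longrightarrow> x \<in> E \<Longrightarrow> \<tau> x \<in> E" "good E \<Longrightarrow> x \<in> Fix \<Longrightarrow> x \<in> E"
  by (auto simp: good_def)

lemma map_poly_tau_over: "good E \<Longrightarrow> P \<in> polys_over E \<Longrightarrow> map_poly \<tau> P \<in> polys_over E"
  by (auto simp: polys_over_def goodD)

lemma good_adj:
  assumes "good E" "\<tau> y \<in> adj E y"
  shows "good (adj E y)"
proof -
  note E = goodD(1)[OF assms(1)]
  have S: "subfld (adj E y)" by (rule subfld_adj[OF E])
  have "\<tau> c \<in> adj E y" if c: "c \<in> adj E y" for c
  proof -
    from c obtain P Q where *: "c = poly P y / poly Q y" "P \<in> polys_over E" "Q \<in> polys_over E"
      by (auto simp: adj_def)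
    have "R \<in> polys_over (adj E y)" if "R \<in> polys_over E" for R
      using that adj_incl[OF E] by (auto simp: polys_over_def)
    thus ?thesis using * map_poly_tau_over[OF assms(1)] assms(2)
      by (auto simp: tau_divide tau_poly intro!: subfld_divide[OF S] poly_in_subfld[OF S])
  qed
  thus ?thesis using S adj_incl[OF E] goodD(3)[OF assms(1)] by (auto simp: good_def)
qed

text \<open>If \<open>y\<close> is algebraic, its powers \<open>y ^ (p ^ j)\<close> are linearly dependent over \<open>E\<close>. A monic relation of minimal
  degree modulo \<open>E\<close> is fixed by \<open>\<tau>\<close>, so its coefficients are constants.\<close>

lemma transcendental_if_unsolvable:
  assumes gE: "good E" and y: "y = \<tau> y + b" "b \<in> E"
    and nosol: "\<And>K c. K \<in> polys_over Fix \<Longrightarrow> c \<in> E \<Longrightarrow> c - \<tau> c = ad K b \<Longrightarrow> K = 0"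
  shows "y \<notin> clo E"
proof
  note E = goodD(1)[OF gE]
  assume "y \<in> clo E"
  then obtain G g where G: "finite G" "g \<in> G" "g \<noteq> 0" "y \<in> stab E G"
    using stab_finite_subset_clo[OF E, of "{y}"] by auto
  have "\<forall>j. \<exists>a. (\<forall>u. a u \<in> E) \<and> y ^ (CHAR('l) ^ j) * g = (\<Sum>u\<in>G. a u * u)"
    using stab_spn[OF E G(1) stab_power[OF E G(1) G(4)] spn_base[OF E G(1,2)]] by (auto simp: spn_def)
  then obtain A where A: "\<And>i h. A i h \<in> E" "\<And>j. y ^ (CHAR('l) ^ j) * g = (\<Sum>h\<in>G. A j h * h)" by metis
  obtain c where c: "\<forall>i\<in>{..card G}. c i \<in> E" "\<exists>i\<in>{..card G}. c i \<noteq> 0"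
    "\<forall>h\<in>G. (\<Sum>i\<in>{..card G}. c i * A i h) = 0"
    using linear_dependence[OF E G(1), of "{..card G}" A] A by auto
  define P0 where "P0 = (\<Sum>i\<in>{..card G}. monom (c i) i)"
  have cP0: "coeff P0 j = (if j \<le> card G then c j else 0)" for j
    by (auto simp: P0_def coeff_sum)
  have P0: "P0 \<in> polys_over E" "P0 \<noteq> 0"
    using c subfld_0[OF E] by (auto simp: polys_over_def cP0 poly_eq_iff)
  have "degree P0 \<le> card G" by (rule degree_le) (auto simp: cP0)
  hence "ad P0 y = (\<Sum>j\<le>card G. c j * y ^ (CHAR('l) ^ j))" by (simp add: ad_altdef cP0)
  hence "ad P0 y * g = (\<Sum>j\<le>card G. c j * (y ^ (CHAR('l) ^ j) * g))" by (simp add: sum_distrib_right mult.assoc)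
  also have "\<dots> = (\<Sum>h\<in>G. (\<Sum>i\<le>card G. c i * A i h) * h)"
    by (simp add: A(2) sum_distrib_left sum_distrib_right mult.assoc sum.swap[of _ G])
  also have "\<dots> = 0" using c(3) by simp
  finally have "ad P0 y = 0" using G by simp
  \<comment> \<open>The dependence has value \<open>0\<close>, but minimality is taken among
    relations with value in \<open>E\<close>: this larger class is stable under the operation
    below.\<close>
  hence "\<exists>n. \<exists>P\<in>polys_over E. P \<noteq> 0 \<and> ad P y \<in> E \<and> degree P = n"
    using P0 subfld_0[OF E] by (intro exI[of _ "degree P0"] bexI[of _ P0]) auto
  then obtain n where n: "\<exists>P\<in>polys_over E. P \<noteq> 0 \<and> ad P y \<in> E \<and> degree P = n"
    and min: "\<And>m. m < n \<Longrightarrow> \<not> (\<exists>P\<in>polys_over E. P \<noteq> 0 \<and> ad P y \<in> E \<and> degree P = m)"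
    using exists_least_iff[of "\<lambda>n. \<exists>P\<in>polys_over E. P \<noteq> 0 \<and> ad P y \<in> E \<and> degree P = n"] by auto
  from n obtain P1 where P1: "P1 \<in> polys_over E" "P1 \<noteq> 0" "ad P1 y \<in> E" "degree P1 = n" by auto
  define P where "P = smult (inverse (lead_coeff P1)) P1"
  have linv: "inverse (lead_coeff P1) \<in> E" using P1 by (auto simp: polys_over_def intro: subfld_inverse[OF E])
  have P: "P \<in> polys_over E" "lead_coeff P = 1" "ad P y \<in> E" "degree P = n"
    using P1 linv by (auto simp: P_def ad_smult intro: polys_over_smult[OF E] subfld_mult[OF E])
  let ?P' = "map_poly \<tau> P"
  have P': "?P' \<in> polys_over E" by (rule map_poly_tau_over[OF gE P(1)])
  have b: "b = y - \<tau> y" using y(1) by (simp add: algebra_simps)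
  \<comment> \<open>Applying \<open>\<tau>\<close> to the relation and inserting
    \<open>\<tau> y = y - b\<close> gives a second relation with the same leading coefficient
    \<open>1\<close>; the difference has smaller degree and again a value in
    \<open>E\<close>.\<close>
  have eq: "ad (P - ?P') y = ad P y - \<tau> (ad P y) - ad ?P' b"
    by (simp add: ad_diff ad_tau b ad_diff_right)
  hence in_E: "ad (P - ?P') y \<in> E"
    using P P' y(2) goodD(2)[OF gE] by (auto intro!: subfld_diff[OF E] ad_in[OF E])
  have "P = ?P'"
  proof (rule ccontr)
    assume ne: "P \<noteq> ?P'"
    have "degree (P - ?P') < n"
    proof (rule ccontr)
      assume "\<not> degree (P - ?P') < n"
      moreover have "degree (P - ?P') \<le> n" using degree_diff_le_max[of P ?P'] P by simp
      ultimately have "degree (P - ?P') = n" by simp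
      moreover have "coeff (P - ?P') n = 0" using P by simp
      ultimately show False using ne by (metis leading_coeff_0_iff right_minus_eq)
    qed
    moreover have "P - ?P' \<in> polys_over E" by (intro polys_over_diff[OF E] P P')
    ultimately show False using min[of "degree (P - ?P')"] in_E ne by (metis right_minus_eq)
  qed
  hence "P \<in> polys_over Fix" by (auto simp: polys_over_def Fix_def poly_eq_iff)
  moreover have "ad P y - \<tau> (ad P y) = ad P b" using eq \<open>P = ?P'\<close> by simp
  ultimately have "P = 0" using nosol P by blast
  thus False using P by simp
qed

text \<open>The monic denominator of \<open>c\<close> of minimal degree is fixed by the action of \<open>\<tau>\<close> on polynomials in \<open>y\<close>.\<close>

lemma denominator_trivial:
  assumes gE: "good E" and y: "y = \<tau> y + b" "b \<in> E" "y \<notin> clo E"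
    and c: "c \<in> adj E y" "c - \<tau> c = poly B y" and B: "B \<in> polys_over E"
  shows "\<exists>P\<in>polys_over E. c = poly P y"
proof -
  note E = goodD(1)[OF gE]
  let ?den = "\<lambda>n. \<exists>P\<in>polys_over E. \<exists>Q\<in>polys_over E. Q \<noteq> 0 \<and> poly Q y * c = poly P y \<and> degree Q = n"
  from c obtain P Q where "c = poly P y / poly Q y" "P \<in> polys_over E" "Q \<in> polys_over E" "poly Q y \<noteq> 0"
    by (auto simp: adj_def)
  hence "?den (degree Q)" by (intro bexI[of _ P] bexI[of _ Q]) auto
  then obtain n where n: "?den n" and min: "\<And>m. m < n \<Longrightarrow> \<not> ?den m"
    using exists_least_iff[of ?den] by blast
  from n obtain P Q1 where Q1: "P \<in> polys_over E" "Q1 \<in> polys_over E" "Q1 \<noteq> 0" "poly Q1 y * c = poly P y" "degree Q1 = n"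
    by blast
  define u where "u = inverse (lead_coeff Q1)"
  define Q where "Q = smult u Q1"
  define P' where "P' = smult u P"
  have u: "u \<in> E" "u \<noteq> 0" using Q1 by (auto simp: u_def polys_over_def intro: subfld_inverse[OF E])
  have Q: "Q \<in> polys_over E" "P' \<in> polys_over E" "lead_coeff Q = 1" "poly Q y * c = poly P' y" "degree Q = n"
    using Q1 u by (auto simp: Q_def P'_def u_def intro: polys_over_smult[OF E])
  define s where "s = (\<lambda>R. pcompose (map_poly \<tau> R) [:- b, 1:])"
  have s: "s R \<in> polys_over E" if "R \<in> polys_over E" for R
    unfolding s_def using that y subfld_closed[OF E]
    by (intro polys_over_pcompose[OF E] map_poly_tau_over[OF gE]) (auto simp: polys_over_pCons[OF E] polys_over_0[OF E])
  have sp: "poly (s R) y = \<tau> (poly R y)" for R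
  proof -
    have "\<tau> y = y - b" using y(1) by (simp add: algebra_simps)
    thus ?thesis by (simp add: s_def poly_pcompose tau_poly)
  qed
  have lc: "degree (s Q) = n"
    using Q by (simp add: s_def degree_pcompose)
  have lc': "lead_coeff (s Q) = 1"
    unfolding s_def by (subst lead_coeff_comp) (use Q in auto)
  have den: "poly (s Q) y * c = poly (s P' + s Q * B) y"
  proof -
    have "poly (s Q) y * c = \<tau> (poly Q y) * (\<tau> c + poly B y)" using c(2) by (simp add: sp algebra_simps)
    also have "\<dots> = \<tau> (poly Q y * c) + \<tau> (poly Q y) * poly B y" by (simp add: tau_mult algebra_simps)
    also have "\<dots> = poly (s P' + s Q * B) y" by (simp add: Q sp)
    finally show ?thesis .
  qed
  have "s Q = Q"
  proof (rule ccontr)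
    assume ne: "s Q \<noteq> Q"
    have "degree (s Q - Q) < n"
    proof (rule ccontr)
      assume "\<not> degree (s Q - Q) < n"
      moreover have "degree (s Q - Q) \<le> n" using degree_diff_le_max[of "s Q" Q] Q lc by simp
      ultimately have "degree (s Q - Q) = n" by simp
      moreover have "coeff (s Q - Q) n = 0" using Q lc lc' by simp
      ultimately show False using ne by (metis leading_coeff_0_iff right_minus_eq)
    qed
    moreover have "?den (degree (s Q - Q))"
      using ne s[OF Q(1)] Q s[OF Q(2)] den B
      by (intro bexI[of _ "(s P' + s Q * B) - P'"] bexI[of _ "s Q - Q"] conjI refl)
         (auto simp: algebra_simps intro!: polys_over_diff[OF E] polys_over_add[OF E] polys_over_mult[OF E])
    ultimately show False using min by blast
  qed
  \<comment> \<open>A fixed value lies in \<open>E\<close>, and transcendence of \<open>y\<close>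
    then makes \<open>Q\<close> a constant.\<close>
  hence "\<tau> (poly Q y) = poly Q y" using sp[of Q] by simp
  hence "poly Q y \<in> E" using goodD(3)[OF gE] by (auto simp: Fix_def)
  hence "Q = [:poly Q y:]"
    using poly_eq_of_transcendental[OF E y(3) Q(1), of "[:poly Q y:]"] by (auto simp: polys_over_pCons[OF E] polys_over_0[OF E])
  hence "degree Q = 0" by (metis degree_pCons_0)
  hence "Q = 1" using Q(3) by (auto elim: degree_eq_zeroE)
  thus ?thesis using Q by auto
qed

text \<open>By transcendence of \<open>y\<close> the equation is an identity of polynomials. Its
  derivative keeps only the linear term of the additive polynomial and reads
  \<open>P' - \<tau> P' = k * h\<close> at \<open>y\<close>, with \<open>k\<close> the lowest
  coefficient of \<open>K\<close>. The side condition gives \<open>k = 0\<close>, so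
  \<open>P'\<close> is a constant \<open>x\<close>, and \<open>P - x * y\<close> is a polynomial in
  \<open>y ^ p\<close>. The induction continues with \<open>y\<close>, \<open>b\<close>,
  \<open>h\<close> replaced by their p-th powers and with the tail of \<open>K\<close>, which is why
  all of these vary in it. The alternative \<open>K = 0\<close> in the condition permits a use
  without any assumption on \<open>h\<close>.\<close>

lemma additive_solution_poly:
  assumes gE: "good E"
  shows "y = \<tau> y + b \<Longrightarrow> b \<in> E \<Longrightarrow> y \<notin> clo E \<Longrightarrow> P \<in> polys_over E \<Longrightarrow> K \<in> polys_over Fix \<Longrightarrow> h \<in> E \<Longrightarrow> b' \<in> E
    \<Longrightarrow> poly P y - \<tau> (poly P y) = ad K (h * \<tau> y) + b'
    \<Longrightarrow> K = 0 \<or> (\<forall>k\<in>Fix. \<forall>j. (\<exists>g\<in>adj E y. g - \<tau> g = k * h ^ (CHAR('l) ^ j)) \<longrightarrow> k = 0)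
    \<Longrightarrow> K = 0 \<and> (\<exists>K'\<in>polys_over Fix. \<exists>c'\<in>E. poly P y = ad K' y + c')"
proof (induction "degree P + (if K = 0 then 0 else Suc (degree K))" arbitrary: P K y b h b' rule: less_induct)
  case less
  note E = goodD(1)[OF gE]
  note y = \<open>y = \<tau> y + b\<close> \<open>b \<in> E\<close> \<open>y \<notin> clo E\<close>
  note PK = \<open>P \<in> polys_over E\<close> \<open>K \<in> polys_over Fix\<close> \<open>h \<in> E\<close> \<open>b' \<in> E\<close>
  note eq = \<open>poly P y - \<tau> (poly P y) = ad K (h * \<tau> y) + b'\<close>
  note cond = \<open>K = 0 \<or> (\<forall>k\<in>Fix. \<forall>j. (\<exists>g\<in>adj E y. g - \<tau> g = k * h ^ (CHAR('l) ^ j)) \<longrightarrow> k = 0)\<close>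
  have p0: "CHAR('l) > 1" using char prime_gt_1_nat by blast
  have KE: "K \<in> polys_over E" using PK goodD(3)[OF gE] by (auto simp: polys_over_def)
  show ?case
  proof (cases "degree P = 0 \<and> K = 0")
    case True
    then obtain a where "P = [:a:]" by (auto elim: degree_eq_zeroE)
    thus ?thesis using True PK
      by (intro conjI bexI[of _ 0] bexI[of _ a]) (auto simp: polys_over_0[OF subfld_Fix] polys_over_pCons[OF E])
  next
    case False
    obtain k K1 where K: "K = pCons k K1" by (cases K)
    have K1: "k \<in> Fix" "K1 \<in> polys_over Fix" using PK K by (auto simp: polys_over_pCons[OF subfld_Fix])
    have ty: "\<tau> y = y - b" using y(1) by (simp add: algebra_simps)
    define s where "s = (\<lambda>R. pcompose R [:- b, 1:])"
    have s: "s R \<in> polys_over E" if "R \<in> polys_over E" for R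
      unfolding s_def using that y subfld_closed[OF E]
      by (intro polys_over_pcompose[OF E]) (auto simp: polys_over_pCons[OF E] polys_over_0[OF E])
    have sp: "poly (s R) y = poly R (\<tau> y)" for R by (simp add: s_def poly_pcompose ty)
    have spd: "pderiv (s R) = s (pderiv R)" for R by (simp add: s_def pderiv_pcompose pderiv_pCons)
    have id: "P - s (map_poly \<tau> P) = s (adpoly K h) + [:b':]"
    proof (rule poly_eq_of_transcendental[OF E y(3)])
      show "P - s (map_poly \<tau> P) \<in> polys_over E"
        by (intro polys_over_diff[OF E] PK s map_poly_tau_over[OF gE])
      show "s (adpoly K h) + [:b':] \<in> polys_over E"
        using PK by (intro polys_over_add[OF E] s adpoly_over[OF E KE]) (auto simp: polys_over_pCons[OF E] polys_over_0[OF E])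
      show "poly (P - s (map_poly \<tau> P)) y = poly (s (adpoly K h) + [:b':]) y"
        using eq by (simp add: sp tau_poly poly_adpoly)
    qed
    have pm: "pderiv (map_poly \<tau> P) = map_poly \<tau> (pderiv P)"
    proof (rule poly_eqI)
      fix n
      have "\<tau> (of_nat m) = of_nat m" for m by (induction m) (auto simp: tau_add)
      from this[of "Suc n"] show "coeff (pderiv (map_poly \<tau> P)) n = coeff (map_poly \<tau> (pderiv P)) n"
        by (simp add: coeff_pderiv tau_mult)
    qed
    have "pderiv P - s (map_poly \<tau> (pderiv P)) = s [:k * h:]"
      using arg_cong[OF id, of pderiv] by (simp add: pderiv_diff pderiv_add spd pderiv_adpoly pm pderiv_pCons K)
    from arg_cong[OF this, of "\<lambda>P. poly P y"]
    have eq': "poly (pderiv P) y - \<tau> (poly (pderiv P) y) = k * h ^ (CHAR('l) ^ 0)" by (simp add: sp tau_poly)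
    have pd: "pderiv P \<in> polys_over E" by (rule polys_over_pderiv[OF E PK(1)])
    have "poly (pderiv P) y \<in> adj E y"
      by (rule adjI[of _ "pderiv P" _ 1]) (use pd polys_over_1[OF E] in auto)
    hence k0: "k = 0" using cond K K1 eq' by (metis pCons_eq_0_iff)
    define x where "x = poly (pderiv P) y"
    have x: "x \<in> Fix" using eq' k0 by (simp add: x_def Fix_def)
    hence xE: "x \<in> E" using goodD(3)[OF gE] by blast
    have Px: "pderiv P = [:x:]"
      by (rule poly_eq_of_transcendental[OF E y(3) pd])
         (use xE in \<open>auto simp: polys_over_pCons[OF E] polys_over_0[OF E] x_def\<close>)
    define P1 where "P1 = P - [:0, x:]"
    have P1: "P1 \<in> polys_over E" unfolding P1_def
      by (intro polys_over_diff[OF E] PK) (auto simp: polys_over_pCons[OF E] polys_over_0[OF E] xE subfld_0[OF E])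
    have "pderiv P1 = 0" by (simp add: P1_def pderiv_diff Px pderiv_pCons)
    then obtain R where R: "R \<in> polys_over E" "degree R \<le> degree P1 div CHAR('l)" "\<And>y. poly P1 y = poly R (y ^ CHAR('l))"
      using pderiv_0_char[OF _ P1 subfld_0[OF E]] p0 by auto
    have dP1: "degree P1 \<le> degree P"
    proof (cases "degree P = 0")
      case True
      hence "pderiv P = 0" using pderiv_eq_0_iff by (auto elim: degree_eq_zeroE simp: pderiv_pCons)
      hence "x = 0" using Px by simp
      thus ?thesis by (simp add: P1_def)
    next
      case False
      have "degree P1 \<le> max (degree P) (degree [:0, x:])" unfolding P1_def by (rule degree_diff_le_max)
      also have "\<dots> \<le> degree P" using False by auto
      finally show ?thesis .
    qed
    have dR: "degree R \<le> degree P div CHAR('l)" using R(2) div_le_mono[OF dP1, of "CHAR('l)"] by linarith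
    \<comment> \<open>Either \<open>P\<close> is not constant and the division of its degree by p
      lowers it, or \<open>K\<close> is nonzero and loses its lowest coefficient.\<close>
    have less': "degree R + (if K1 = 0 then 0 else Suc (degree K1)) < degree P + (if K = 0 then 0 else Suc (degree K))"
    proof (cases "degree P = 0")
      case True
      thus ?thesis using dR False K k0 by auto
    next
      case False
      hence "degree P div CHAR('l) < degree P" using p0 by simp
      thus ?thesis using dR K k0 by auto
    qed
    let ?y = "y ^ CHAR('l)"
    have yp: "?y = \<tau> ?y + b ^ CHAR('l)"
      
    proof -
      have "(\<tau> y + b) ^ CHAR('l) = \<tau> ?y + b ^ CHAR('l)"
        by (simp add: tau_power freshmans_dream[OF char refl])
      thus ?thesis unfolding y(1)[symmetric] .
    qed
    have "K1 = 0 \<and> (\<exists>K'\<in>polys_over Fix. \<exists>c'\<in>E. poly R ?y = ad K' ?y + c')"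
    proof (rule less.hyps[OF less' yp])
      show "b ^ CHAR('l) \<in> E" "h ^ CHAR('l) \<in> E" using y PK by (auto intro: subfld_power[OF E])
      show "?y \<notin> clo E"
      proof
        assume "?y \<in> clo E"
        then obtain Q where Q: "Q \<in> polys_over E" "Q \<noteq> 0" "poly Q ?y = 0" by (auto simp: clo_def)
        let ?m = "monom (1::'l) CHAR('l)"
        have dm: "degree ?m > 0" using p0 by (simp add: degree_monom_eq)
        have "pcompose Q ?m \<noteq> 0" using Q(2) dm by (simp add: pcompose_eq_0_iff)
        moreover have "pcompose Q ?m \<in> polys_over E"
          by (intro polys_over_pcompose[OF E] Q polys_over_monom[OF E] subfld_1[OF E])
        moreover have "poly (pcompose Q ?m) y = 0" using Q by (simp add: poly_pcompose poly_monom)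
        ultimately show False using y(3) unfolding clo_def by blast
      qed
      show "R \<in> polys_over E" "K1 \<in> polys_over Fix" by fact+
      show "b' - x * b \<in> E" using PK xE y by (auto intro!: subfld_diff[OF E] subfld_mult[OF E])
      have "poly R ?y - \<tau> (poly R ?y) = (poly P y - \<tau> (poly P y)) - x * (y - \<tau> y)"
        using x by (simp add: R(3)[symmetric] P1_def tau_diff tau_mult Fix_def algebra_simps)
      also have "\<dots> = ad K1 (h ^ CHAR('l) * \<tau> ?y) + (b' - x * b)"
        using eq k0 ty by (simp add: K ad_pCons tau_power power_mult_distrib)
      finally show "poly R ?y - \<tau> (poly R ?y) = ad K1 (h ^ CHAR('l) * \<tau> ?y) + (b' - x * b)" .
      have sub: "adj E ?y \<subseteq> adj E y"
        by (rule adj_least[OF subfld_adj[OF E]]) (auto intro: adj_incl[OF E] subfld_power[OF subfld_adj[OF E]] adj_self[OF E])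
      show "K1 = 0 \<or> (\<forall>k\<in>Fix. \<forall>j. (\<exists>g\<in>adj E ?y. g - \<tau> g = k * (h ^ CHAR('l)) ^ (CHAR('l) ^ j)) \<longrightarrow> k = 0)"
      proof (cases "K1 = 0")
        case False
        hence "K \<noteq> 0" using K by simp
        hence *: "k = 0" if "k \<in> Fix" "g \<in> adj E y" "g - \<tau> g = k * h ^ (CHAR('l) ^ j)" for k g j
          using cond that by blast
        have "k = 0" if "k \<in> Fix" "g \<in> adj E ?y" "g - \<tau> g = k * (h ^ CHAR('l)) ^ (CHAR('l) ^ j)" for k g j
          using *[of k g "Suc j"] that sub by (auto simp flip: power_mult)
        thus ?thesis by blast
      qed auto
    qed
    then obtain K' c' where K': "K1 = 0" "K' \<in> polys_over Fix" "c' \<in> E" "poly R ?y = ad K' ?y + c'" by auto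
    \<comment> \<open>The constant derivative \<open>x\<close> becomes the lowest coefficient of the
      additive polynomial.\<close>
    have "poly P y = ad (pCons x K') y + c'"
      using K'(4) by (simp add: R(3)[symmetric] P1_def ad_pCons algebra_simps)
    moreover have "pCons x K' \<in> polys_over Fix" using x K' by (simp add: polys_over_pCons[OF subfld_Fix])
    ultimately show ?thesis using K' K k0 by auto
  qed
qed

lemma additive_solution:
  assumes gE: "good E" and y: "y = \<tau> y + b" "b \<in> E" "y \<notin> clo E"
    and c: "c \<in> adj E y" "c - \<tau> c = ad K (h * \<tau> y) + b'"
    and K: "K \<in> polys_over Fix" and "h \<in> E" "b' \<in> E"
    and cond: "K = 0 \<or> (\<forall>k\<in>Fix. \<forall>j. (\<exists>g\<in>adj E y. g - \<tau> g = k * h ^ (CHAR('l) ^ j)) \<longrightarrow> k = 0)"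
  shows "K = 0 \<and> (\<exists>K'\<in>polys_over Fix. \<exists>c'\<in>E. c = ad K' y + c')"
proof -
  note E = goodD(1)[OF gE]
  let ?B = "pcompose (adpoly K h) [:- b, 1:] + [:b':]"
  have KE: "K \<in> polys_over E" using K goodD(3)[OF gE] by (auto simp: polys_over_def)
  have "\<tau> y = y - b" using y(1) by (simp add: algebra_simps)
  hence "c - \<tau> c = poly ?B y" using c by (simp add: poly_pcompose poly_adpoly)
  moreover have "?B \<in> polys_over E"
    using y assms by (intro polys_over_add[OF E] polys_over_pcompose[OF E] adpoly_over[OF E KE])
      (auto simp: polys_over_pCons[OF E] polys_over_0[OF E] subfld_closed[OF E])
  ultimately obtain P where P: "P \<in> polys_over E" "c = poly P y"
    using denominator_trivial[OF gE y c(1)] by blast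
  show ?thesis using additive_solution_poly[OF gE y P(1) K \<open>h \<in> E\<close> \<open>b' \<in> E\<close> _ cond] c P by simp
qed

end

section \<open>The multiplicative equation \<open>\<tau> y = y / a\<close>\<close>

context difference_field
begin

text \<open>The factors \<open>a ^ (degree Q - i)\<close> of the twisted map are chosen so that a
  leading coefficient \<open>1\<close> stays \<open>1\<close>. A monic element of least degree in
  \<open>D\<close> is therefore invariant, its lower coefficients solve
  \<open>c = a ^ e * \<tau> c\<close>, and only a power of the variable remains. \<open>D\<close>
  will be the set of polynomials vanishing at \<open>y\<close>, and the set of denominators of a
  solution.\<close>

lemma twisted_invariant_denominator:
  assumes gE: "good E" and a: "a \<in> E" "a \<noteq> 0"
    and nosol: "\<And>e c. e > 0 \<Longrightarrow> c \<in> E \<Longrightarrow> c = a ^ e * \<tau> c \<Longrightarrow> c = 0"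
    and D: "D \<subseteq> polys_over E" "\<And>u Q. u \<in> E \<Longrightarrow> Q \<in> D \<Longrightarrow> smult u Q \<in> D"
      "\<And>Q R. Q \<in> D \<Longrightarrow> R \<in> D \<Longrightarrow> Q - R \<in> D"
      "\<And>Q. Q \<in> D \<Longrightarrow> (\<Sum>i\<le>degree Q. monom (a ^ (degree Q - i) * \<tau> (coeff Q i)) i) \<in> D"
    and ex: "Q0 \<in> D" "Q0 \<noteq> 0"
  shows "\<exists>n. monom 1 n \<in> D"
proof -
  note E = goodD(1)[OF gE]
  let ?P = "\<lambda>n. \<exists>Q\<in>D. Q \<noteq> 0 \<and> degree Q = n"
  have "?P (degree Q0)" using ex by auto
  then obtain n where n: "?P n" and min: "\<And>m. m < n \<Longrightarrow> \<not> ?P m" using exists_least_iff[of ?P] by blast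
  then obtain Q1 where Q1: "Q1 \<in> D" "Q1 \<noteq> 0" "degree Q1 = n" by auto
  define u where "u = inverse (lead_coeff Q1)"
  define Q where "Q = smult u Q1"
  have "u \<in> E" using Q1 D(1) by (auto simp: u_def polys_over_def intro: subfld_inverse[OF E])
  hence Q: "Q \<in> D" "lead_coeff Q = 1" "degree Q = n" "Q \<in> polys_over E"
    using Q1 D(1,2) by (auto simp: Q_def u_def)
  define R where "R = (\<Sum>i\<le>n. monom (a ^ (n - i) * \<tau> (coeff Q i)) i)"
  have R: "R \<in> D" using D(4)[OF Q(1)] by (simp add: R_def Q)
  have cR: "coeff R i = (if i \<le> n then a ^ (n - i) * \<tau> (coeff Q i) else 0)" for i
    by (simp add: R_def coeff_sum)
  have "Q = R"
  proof (rule ccontr)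
    assume ne: "Q \<noteq> R"
    have "degree (Q - R) < n"
    proof (rule ccontr)
      assume "\<not> degree (Q - R) < n"
      moreover have "degree (Q - R) \<le> n" by (rule degree_le) (use Q cR in \<open>auto simp: coeff_eq_0\<close>)
      ultimately have "degree (Q - R) = n" by simp
      moreover have "coeff (Q - R) n = 0" using Q by (simp add: cR)
      ultimately show False using ne by (metis leading_coeff_0_iff right_minus_eq)
    qed
    moreover have "?P (degree (Q - R))" using D(3)[OF Q(1) R] ne by (intro bexI[of _ "Q - R"]) auto
    ultimately show False using min by blast
  qed
  have "coeff Q i = 0" if "i < n" for i
  proof (rule nosol[of "n - i"])
    show "coeff Q i \<in> E" using Q by (auto simp: polys_over_def)
    show "coeff Q i = a ^ (n - i) * \<tau> (coeff Q i)" using cR[of i] \<open>Q = R\<close> that by simp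
  qed (use that in auto)
  hence "Q = monom 1 n" using Q by (intro poly_eqI) (metis coeff_eq_0 coeff_monom linorder_neqE_nat)
  thus ?thesis using Q(1) by auto
qed

context
  fixes E a y
  assumes gE: "good E" and a: "a \<in> E" "a \<noteq> 0" and y: "y \<noteq> 0" "\<tau> y = y / a"
    and nosol: "\<And>e c. e > 0 \<Longrightarrow> c \<in> E \<Longrightarrow> c = a ^ e * \<tau> c \<Longrightarrow> c = 0"
begin

lemma twisted_poly:
  "poly (\<Sum>i\<le>degree Q. monom (a ^ (degree Q - i) * \<tau> (coeff Q i)) i) y = a ^ degree Q * \<tau> (poly Q y)"
proof -
  have "a ^ (degree Q - i) * \<tau> (coeff Q i) * y ^ i = a ^ degree Q * (\<tau> (coeff Q i) * (y / a) ^ i)"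
    if "i \<le> degree Q" for i
    using a that by (simp add: power_divide power_diff field_simps)
  hence "(\<Sum>i\<le>degree Q. a ^ (degree Q - i) * \<tau> (coeff Q i) * y ^ i)
      = (\<Sum>i\<le>degree Q. a ^ degree Q * (\<tau> (coeff Q i) * (y / a) ^ i))"
    by (intro sum.cong) auto
  thus ?thesis by (simp only: poly_sum poly_monom poly_altdef[of Q] tau_sum tau_mult tau_power y(2) sum_distrib_left)
qed

lemma twisted_poly_over:
  "Q \<in> polys_over E \<Longrightarrow> (\<Sum>i\<le>degree Q. monom (a ^ (degree Q - i) * \<tau> (coeff Q i)) i) \<in> polys_over E"
  using goodD(1,2)[OF gE] a
  by (intro polys_over_sum[OF goodD(1)[OF gE]] polys_over_monom[OF goodD(1)[OF gE]] subfld_mult subfld_power)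
     (auto simp: polys_over_def)

lemma torus_transcendental: "y \<notin> clo E"
proof
  assume "y \<in> clo E"
  then obtain Q0 where Q0: "Q0 \<in> polys_over E" "Q0 \<noteq> 0" "poly Q0 y = 0" by (auto simp: clo_def)
  let ?D = "{Q \<in> polys_over E. poly Q y = 0}"
  have "\<exists>n. monom 1 n \<in> ?D"
  proof (rule twisted_invariant_denominator[OF gE a nosol])
    fix Q assume "Q \<in> ?D"
    thus "(\<Sum>i\<le>degree Q. monom (a ^ (degree Q - i) * \<tau> (coeff Q i)) i) \<in> ?D"
      using twisted_poly_over[of Q] by (simp add: twisted_poly)
  qed (use Q0 in \<open>auto intro: polys_over_closed[OF goodD(1)[OF gE]]\<close>)
  thus False using y by (auto simp: poly_monom)
qed

text \<open>The only possible denominator of \<open>c\<close> is a power of \<open>y\<close>, so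
  \<open>c\<close> is a Laurent polynomial in \<open>y\<close> and the equation can be compared
  coefficientwise: \<open>\<tau>\<close> multiplies \<open>y ^ m\<close> by
  \<open>1 / a ^ m\<close>.\<close>

lemma torus_solution:
  assumes c: "c \<in> adj E y" "c - \<tau> c = poly B y" and B: "B \<in> polys_over E"
  shows "\<exists>p\<in>E. p - \<tau> p / a ^ m = coeff B m"
proof -
  note E = goodD(1)[OF gE]
  from c(1) obtain P0 Q0 where PQ: "c = poly P0 y / poly Q0 y" "P0 \<in> polys_over E" "Q0 \<in> polys_over E" "poly Q0 y \<noteq> 0"
    by (auto simp: adj_def)
  let ?D = "{Q \<in> polys_over E. \<exists>P\<in>polys_over E. poly Q y * c = poly P y}"
  have "\<exists>n. monom 1 n \<in> ?D"
  proof (rule twisted_invariant_denominator[OF gE a nosol])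
    show "Q0 \<in> ?D" "Q0 \<noteq> 0" using PQ by auto
  next
    fix u Q assume u: "u \<in> E" and "Q \<in> ?D"
    then obtain P where "Q \<in> polys_over E" "P \<in> polys_over E" "poly Q y * c = poly P y" by auto
    thus "smult u Q \<in> ?D" using u
      by (auto intro!: bexI[of _ "smult u P"] polys_over_smult[OF E])
  next
    fix Q R assume "Q \<in> ?D" "R \<in> ?D"
    then obtain P P' where "Q \<in> polys_over E" "P \<in> polys_over E" "poly Q y * c = poly P y"
      "R \<in> polys_over E" "P' \<in> polys_over E" "poly R y * c = poly P' y" by auto
    thus "Q - R \<in> ?D"
      by (auto intro!: bexI[of _ "P - P'"] polys_over_diff[OF E] simp: algebra_simps)
  next
    fix Q assume "Q \<in> ?D"
    then obtain P where P: "Q \<in> polys_over E" "P \<in> polys_over E" "poly Q y * c = poly P y" by auto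
    let ?s = "\<lambda>Q. \<Sum>i\<le>degree Q. monom (a ^ (degree Q - i) * \<tau> (coeff Q i)) i"
    let ?P' = "smult (a ^ degree Q / a ^ degree P) (?s P) + ?s Q * B"
    have "poly (?s Q) y * c = a ^ degree Q * \<tau> (poly Q y) * (\<tau> c + poly B y)"
      unfolding twisted_poly using c(2) by (simp add: algebra_simps)
    also have "\<dots> = a ^ degree Q * \<tau> (poly Q y * c) + poly (?s Q) y * poly B y"
      unfolding twisted_poly by (simp add: tau_mult distrib_left mult.assoc)
    also have "\<dots> = poly ?P' y" using a by (simp add: P(3) twisted_poly)
    finally have "poly (?s Q) y * c = poly ?P' y" .
    moreover have "?P' \<in> polys_over E"
      using P a B by (intro polys_over_add[OF E] polys_over_smult[OF E] polys_over_mult[OF E] twisted_poly_over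
         subfld_divide[OF E] subfld_power[OF E])
    ultimately show "?s Q \<in> ?D" using twisted_poly_over[OF P(1)] by blast
  qed auto
  then obtain n P where P: "P \<in> polys_over E" "y ^ n * c = poly P y" by (auto simp: poly_monom)
  define P2 where "P2 = smult (a ^ n / a ^ degree P) (\<Sum>i\<le>degree P. monom (a ^ (degree P - i) * \<tau> (coeff P i)) i)"
  have cP2: "coeff P2 i = a ^ n * \<tau> (coeff P i) / a ^ i" for i
    using a by (cases "i \<le> degree P") (auto simp: P2_def coeff_sum power_diff field_simps coeff_eq_0)
  have P2: "P2 \<in> polys_over E" unfolding P2_def using P a
    by (intro polys_over_smult[OF E] twisted_poly_over subfld_divide[OF E] subfld_power[OF E])
  have "P - P2 = monom 1 n * B"
  proof (rule poly_eq_of_transcendental[OF E torus_transcendental])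
    show "P - P2 \<in> polys_over E" "monom 1 n * B \<in> polys_over E"
      using P P2 B by (auto intro!: polys_over_diff[OF E] polys_over_mult[OF E] polys_over_monom[OF E] subfld_1[OF E])
    have "poly P2 y = a ^ n * \<tau> (y ^ n * c)" using a by (simp add: P2_def twisted_poly P(2))
    also have "\<dots> = y ^ n * \<tau> c" using a by (simp add: tau_mult tau_power y(2) power_divide)
    finally show "poly (P - P2) y = poly (monom 1 n * B) y"
      using c(2) by (simp add: P(2)[symmetric] poly_monom flip: right_diff_distrib)
  qed
  \<comment> \<open>The index is \<open>n + m\<close> because everything has been multiplied by
    \<open>y ^ n\<close>.\<close>
  from arg_cong[OF this, of "\<lambda>P. coeff P (n + m)"]
  have "coeff P (n + m) - a ^ n * \<tau> (coeff P (n + m)) / a ^ (n + m) = coeff B m"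
    by (simp add: cP2 coeff_monom_mult)
  hence "coeff P (n + m) - \<tau> (coeff P (n + m)) / a ^ m = coeff B m" using a by (simp add: power_add)
  thus ?thesis using P by (auto simp: polys_over_def)
qed

end

section \<open>Towers of additive equations\<close>

primrec tower :: "'l set \<Rightarrow> (nat \<Rightarrow> 'l) \<Rightarrow> nat \<Rightarrow> 'l set" where
  "tower E y 0 = E"
| "tower E y (Suc i) = adj (tower E y i) (y (Suc i))"

text \<open>Linear independence of the p-power powers of the \<open>b l\<close> over the constants,
  modulo the elements \<open>c - \<tau> c\<close> with \<open>c\<close> in \<open>E\<close>; it
  makes the solutions \<open>y l\<close> independent over \<open>E\<close>.\<close>

definition additively_free :: "'l set \<Rightarrow> (nat \<Rightarrow> 'l) \<Rightarrow> nat \<Rightarrow> bool" where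
  "additively_free E b n \<longleftrightarrow> (\<forall>K. (\<forall>l. K l \<in> polys_over Fix) \<longrightarrow>
     (\<exists>c\<in>E. c - \<tau> c = (\<Sum>l=1..n. ad (K l) (b l))) \<longrightarrow> (\<forall>l\<in>{1..n}. K l = 0))"

lemma good_tower_Suc:
  assumes "good (tower E y i)" "y (Suc i) = \<tau> (y (Suc i)) + b" "b \<in> tower E y i"
  shows "good (tower E y (Suc i))"
proof -
  note E = goodD(1)[OF assms(1)]
  have eq: "\<tau> (y (Suc i)) = y (Suc i) - b" using assms(2) by (simp add: algebra_simps)
  have "\<tau> (y (Suc i)) \<in> adj (tower E y i) (y (Suc i))"
    unfolding eq by (rule subfld_diff[OF subfld_adj[OF E]]) (use assms(3) adj_self[OF E] adj_incl[OF E] in auto)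
  thus ?thesis using good_adj[OF assms(1)] by simp
qed

lemma tower_incl: "good (tower E y i) \<Longrightarrow> tower E y i \<subseteq> tower E y (Suc i)"
  by (auto intro: adj_incl goodD)

text \<open>The clause on solutions carries the induction: an element \<open>c\<close> of the tower
  with \<open>c - \<tau> c \<in> E\<close> is an additive combination of the \<open>y l\<close> plus
  an element of \<open>E\<close>. Hence an equation that would make the next \<open>y\<close>
  algebraic descends to a relation among the \<open>b l\<close> in \<open>E\<close>, which is
  excluded.\<close>

lemma additive_tower:
  assumes gE: "good E" and b: "\<And>l. l \<in> {1..n} \<Longrightarrow> b l \<in> E" and y: "\<And>l. l \<in> {1..n} \<Longrightarrow> y l = \<tau> (y l) + b l"
    and free: "additively_free E b n"
  shows "i \<le> n \<Longrightarrow> good (tower E y i) \<and> E \<subseteq> tower E y i \<and> (\<forall>l\<in>{1..i}. y l \<in> tower E y i) \<and>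
     (\<forall>c\<in>tower E y i. c - \<tau> c \<in> E \<longrightarrow> (\<exists>K. (\<forall>l. K l \<in> polys_over Fix) \<and> (\<exists>c'\<in>E. c = (\<Sum>l=1..i. ad (K l) (y l)) + c'))) \<and>
     (i < n \<longrightarrow> y (Suc i) \<notin> clo (tower E y i))"
proof (induction i)
  have step: "y (Suc i) \<notin> clo (tower E y i)" if i: "i < n" and gT: "good (tower E y i)" and ET: "E \<subseteq> tower E y i" and
    sol: "\<And>c. c\<in>tower E y i \<Longrightarrow> c - \<tau> c \<in> E \<Longrightarrow> (\<exists>K. (\<forall>l. K l \<in> polys_over Fix) \<and> (\<exists>c'\<in>E. c = (\<Sum>l=1..i. ad (K l) (y l)) + c'))" for i
  proof (rule transcendental_if_unsolvable[OF gT, of _ "b (Suc i)"])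
    show "y (Suc i) = \<tau> (y (Suc i)) + b (Suc i)" using i y[of "Suc i"] by simp
    show "b (Suc i) \<in> tower E y i" using i b ET by auto
    fix K c assume K: "K \<in> polys_over Fix" and c: "c \<in> tower E y i" "c - \<tau> c = ad K (b (Suc i))"
    have "K \<in> polys_over E" using K goodD(3)[OF gE] by (auto simp: polys_over_def)
    hence "c - \<tau> c \<in> E" using c i b[of "Suc i"] by (auto intro: ad_in[OF goodD(1)[OF gE]])
    from sol[OF c(1) this] obtain K' c' where K': "\<forall>l. K' l \<in> polys_over Fix" "c' \<in> E" "c = (\<Sum>l=1..i. ad (K' l) (y l)) + c'"
      by blast
    define K2 where "K2 l = (if l = Suc i then K else if l \<le> i then - K' l else 0)" for l
    have K2: "\<forall>l. K2 l \<in> polys_over Fix" using K K' polys_over_closed[OF subfld_Fix] by (auto simp: K2_def)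
    have "c' - \<tau> c' = (c - \<tau> c) - (\<Sum>l=1..i. ad (K' l) (y l) - ad (K' l) (\<tau> (y l)))"
      using K' by (simp add: tau_add tau_sum ad_tau_Fix sum_subtractf)
    also have "(\<Sum>l=1..i. ad (K' l) (y l) - ad (K' l) (\<tau> (y l))) = (\<Sum>l=1..i. ad (K' l) (b l))"
    proof (rule sum.cong[OF refl])
      fix l assume "l \<in> {1..i}"
      hence "b l = y l - \<tau> (y l)" using y[of l] i by (simp add: algebra_simps)
      thus "ad (K' l) (y l) - ad (K' l) (\<tau> (y l)) = ad (K' l) (b l)" by (simp add: ad_diff_right)
    qed
    also have "(c - \<tau> c) - (\<Sum>l=1..i. ad (K' l) (b l)) = (\<Sum>l=1..Suc i. ad (K2 l) (b l))"
    proof -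
      have "(\<Sum>l=1..i. ad (K2 l) (b l)) = - (\<Sum>l=1..i. ad (K' l) (b l))"
        unfolding sum_negf[symmetric] by (rule sum.cong[OF refl]) (simp add: K2_def ad_uminus)
      thus ?thesis using c by (simp add: K2_def)
    qed
    also have "\<dots> = (\<Sum>l=1..n. ad (K2 l) (b l))"
      using i by (intro sum.mono_neutral_left) (auto simp: K2_def)
    finally have "\<forall>l\<in>{1..n}. K2 l = 0" using free K2 K'(2) unfolding additively_free_def by blast
    from this[rule_format, of "Suc i"] show "K = 0" using i by (simp add: K2_def)
  qed
  {
    case 0
    show ?case using gE step[of 0] by (auto intro!: exI[of _ "\<lambda>_. 0"] polys_over_0[OF subfld_Fix])
  next
    case (Suc i)
    let ?T = "tower E y i"
    have IH: "good ?T" "E \<subseteq> ?T" "\<forall>l\<in>{1..i}. y l \<in> tower E y i"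
      "\<And>c. c\<in>?T \<Longrightarrow> c - \<tau> c \<in> E \<Longrightarrow> (\<exists>K. (\<forall>l. K l \<in> polys_over Fix) \<and> (\<exists>c'\<in>E. c = (\<Sum>l=1..i. ad (K l) (y l)) + c'))"
      "y (Suc i) \<notin> clo ?T"
      using Suc by auto
    have yS: "y (Suc i) = \<tau> (y (Suc i)) + b (Suc i)" "b (Suc i) \<in> E" "b (Suc i) \<in> ?T"
      using Suc.prems y[of "Suc i"] b[of "Suc i"] IH by auto
    have gS: "good (tower E y (Suc i))" by (rule good_tower_Suc[OF IH(1) yS(1,3)])
    have inc: "?T \<subseteq> tower E y (Suc i)" by (rule tower_incl[OF IH(1)])
    have sol: "\<exists>K. (\<forall>l. K l \<in> polys_over Fix) \<and> (\<exists>c'\<in>E. c = (\<Sum>l=1..Suc i. ad (K l) (y l)) + c')"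
      if c: "c \<in> tower E y (Suc i)" "c - \<tau> c \<in> E" for c
    proof -
      have "0 = (0::'l poly) \<and> (\<exists>K'\<in>polys_over Fix. \<exists>c'\<in>?T. c = ad K' (y (Suc i)) + c')"
      proof (rule additive_solution[OF IH(1) yS(1,3) IH(5)])
        show "c - \<tau> c = ad 0 (0 * \<tau> (y (Suc i))) + (c - \<tau> c)" by simp
        show "c - \<tau> c \<in> ?T" using c IH by auto
      qed (use c polys_over_0[OF subfld_Fix] subfld_0[OF goodD(1)[OF IH(1)]] in auto)
      then obtain K1 c1 where K1: "K1 \<in> polys_over Fix" "c1 \<in> ?T" "c = ad K1 (y (Suc i)) + c1" by auto
      have bS: "b (Suc i) = y (Suc i) - \<tau> (y (Suc i))" using yS(1) by (simp add: algebra_simps)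
      have "K1 \<in> polys_over E" using K1 goodD(3)[OF gE] by (auto simp: polys_over_def)
      hence adE: "ad K1 (b (Suc i)) \<in> E" using yS by (auto intro: ad_in[OF goodD(1)[OF gE]])
      have "c1 - \<tau> c1 = (c - \<tau> c) - ad K1 (b (Suc i))"
        using K1 by (simp add: tau_add ad_tau_Fix bS ad_diff_right)
      also have "\<dots> \<in> E" by (rule subfld_diff[OF goodD(1)[OF gE] c(2) adE])
      finally obtain K c' where K: "\<forall>l. K l \<in> polys_over Fix" "c' \<in> E" "c1 = (\<Sum>l=1..i. ad (K l) (y l)) + c'"
        using IH(4)[OF K1(2)] by blast
      define K2 where "K2 = K(Suc i := K1)"
      have "(\<Sum>l=1..i. ad (K2 l) (y l)) = (\<Sum>l=1..i. ad (K l) (y l))"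
        by (rule sum.cong) (auto simp: K2_def)
      hence "c = (\<Sum>l=1..Suc i. ad (K2 l) (y l)) + c'" using K1(3) K(3) by (simp add: K2_def)
      moreover have "\<forall>l. K2 l \<in> polys_over Fix" using K K1 by (simp add: K2_def)
      ultimately show ?thesis using K(2) by blast
    qed
    have "y l \<in> tower E y (Suc i)" if "l \<in> {1..Suc i}" for l
      using that IH(3) inc adj_self[OF goodD(1)[OF IH(1)], of "y (Suc i)"] by (cases "l = Suc i") auto
    thus ?case using gS inc IH(2) sol step[of "Suc i"] Suc.prems by blast
  }
qed

end

text \<open>\<open>f l k\<close> belongs to the segment from \<open>l\<close> to \<open>k\<close>;
  the convention \<open>f (Suc k) k = 1\<close> for the empty segment makes the diagonal equation,
  with right-hand side \<open>h (Suc k)\<close>, a case of \<open>f_rec\<close>.\<close>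

locale difference_tower = difference_field \<tau> for \<tau> :: "'l::field \<Rightarrow> 'l" +
  fixes E0 :: "'l set" and h :: "nat \<Rightarrow> 'l" and f :: "nat \<Rightarrow> nat \<Rightarrow> 'l" and d :: nat
  assumes good_E0: "good E0" and h_E0: "\<And>k. h k \<in> E0"
    and f_diag: "\<And>k. f (Suc k) k = 1"
    and f_rec: "\<And>l k. 1 \<le> l \<Longrightarrow> l \<le> Suc k \<Longrightarrow> Suc k \<le> d \<Longrightarrow> f l (Suc k) = \<tau> (f l (Suc k)) + h (Suc k) * \<tau> (f l k)"
    and free_h: "additively_free E0 h d"
begin

primrec T :: "nat \<Rightarrow> 'l set" where
  "T 0 = E0"
| "T (Suc k) = tower (T k) (\<lambda>l. f l (Suc k)) (Suc k)"

definition new_free :: "nat \<Rightarrow> bool" where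
  "new_free k \<longleftrightarrow> (\<forall>K. (\<forall>i. K i \<in> polys_over Fix) \<longrightarrow> (\<forall>c\<in>T k. c - \<tau> c = (\<Sum>i=1..d. ad (K i) (h i))
      \<longrightarrow> (\<forall>i\<in>{k<..d}. K i = 0)))"

text \<open>Concerns the right-hand sides of column \<open>k + 1\<close> except the diagonal one.
  Arbitrary combinations of the \<open>h i\<close> are tolerated, since the diagonal term and the
  combinations in \<open>new_free\<close> have to be absorbed.\<close>

definition column_free :: "nat \<Rightarrow> bool" where
  "column_free k \<longleftrightarrow> (\<forall>K K'. (\<forall>i. K i \<in> polys_over Fix) \<longrightarrow> (\<forall>i. K' i \<in> polys_over Fix) \<longrightarrow>
     (\<forall>c\<in>T k. c - \<tau> c = (\<Sum>i=1..d. ad (K i) (h i)) + (\<Sum>l=1..k. ad (K' l) (h (Suc k) * \<tau> (f l k)))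
      \<longrightarrow> (\<forall>l\<in>{1..k}. K' l = 0)))"

lemma new_freeD:
  assumes "new_free k" "\<forall>i. K i \<in> polys_over Fix" "c \<in> T k" "c - \<tau> c = (\<Sum>i=1..d. ad (K i) (h i))"
  shows "\<forall>i\<in>{k<..d}. K i = 0"
  using assms(1)[unfolded new_free_def, rule_format, OF assms(2)[rule_format] assms(3,4)] by blast

lemma column_freeD:
  assumes "column_free k" "\<forall>i. K i \<in> polys_over Fix" "\<forall>i. K' i \<in> polys_over Fix" "c \<in> T k"
    "c - \<tau> c = (\<Sum>i=1..d. ad (K i) (h i)) + (\<Sum>l=1..k. ad (K' l) (h (Suc k) * \<tau> (f l k)))"
  shows "\<forall>l\<in>{1..k}. K' l = 0"
  using assms(1)[unfolded column_free_def, rule_format, OF assms(2)[rule_format] assms(3)[rule_format] assms(4,5)] by blast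

lemma ad_h_E0: "K \<in> polys_over Fix \<Longrightarrow> ad K (h i) \<in> E0"
  using h_E0 goodD[OF good_E0] by (auto simp: polys_over_def intro!: ad_in)

text \<open>\<open>column_free\<close> removes the terms with \<open>l \<le> k\<close>; what remains
  is the diagonal term \<open>h (Suc k)\<close>, removed by \<open>new_free\<close>.\<close>

lemma additively_free_column:
  assumes "new_free k" "column_free k" "k < d"
  shows "additively_free (T k) (\<lambda>l. h (Suc k) * \<tau> (f l k)) (Suc k)"
  unfolding additively_free_def
proof (intro allI impI)
  fix K :: "nat \<Rightarrow> 'l poly" assume K: "\<forall>l. K l \<in> polys_over Fix"
  assume "\<exists>c\<in>T k. c - \<tau> c = (\<Sum>l=1..Suc k. ad (K l) (h (Suc k) * \<tau> (f l k)))"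
  then obtain c where c: "c \<in> T k" "c - \<tau> c = (\<Sum>l=1..k. ad (K l) (h (Suc k) * \<tau> (f l k))) + ad (K (Suc k)) (h (Suc k))"
    by (auto simp: f_diag)
  define K1 where "K1 = (\<lambda>_. 0)(Suc k := K (Suc k))"
  have K1: "\<forall>i. K1 i \<in> polys_over Fix" using K polys_over_0[OF subfld_Fix] by (auto simp: K1_def)
  have "(\<Sum>i=1..d. ad (K1 i) (h i)) = (\<Sum>i\<in>{Suc k}. ad (K1 i) (h i))"
    using assms by (intro sum.mono_neutral_right) (auto simp: K1_def)
  hence s1: "(\<Sum>i=1..d. ad (K1 i) (h i)) = ad (K (Suc k)) (h (Suc k))" by (simp add: K1_def)
  have z: "\<forall>l\<in>{1..k}. K l = 0"
    by (rule column_freeD[OF assms(2) K1 K c(1)]) (use c(2) s1 in simp)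
  hence "(\<Sum>l=1..k. ad (K l) (h (Suc k) * \<tau> (f l k))) = 0" by (intro sum.neutral) auto
  hence "c - \<tau> c = (\<Sum>i=1..d. ad (K1 i) (h i))" using c s1 by simp
  hence "\<forall>i\<in>{k<..d}. K1 i = 0" by (rule new_freeD[OF assms(1) K1 c(1)])
  from bspec[OF this, of "Suc k"] have "K (Suc k) = 0" using assms(3) by (simp add: K1_def)
  thus "\<forall>l\<in>{1..Suc k}. K l = 0" using z by (auto simp: le_Suc_eq)
qed

text \<open>For \<open>new_free\<close>, a solution in \<open>T (Suc k)\<close> differs from an
  element of \<open>T k\<close> by an additive combination of column \<open>k + 1\<close>, whose
  right-hand sides are handled by \<open>column_free\<close> at \<open>k\<close>. For
  \<open>column_free\<close>, the column is taken down from the top; the side condition of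
  \<open>additive_solution\<close> asks that \<open>\<kappa> * h ^ (p ^ j)\<close> be unsolvable for
  nonzero \<open>\<kappa>\<close>, and this is \<open>new_free\<close> at \<open>Suc k\<close>,
  already proved, for the index \<open>k + 2\<close>.\<close>

lemma tower_invariant:
  assumes "k \<le> d"
  shows "good (T k) \<and> E0 \<subseteq> T k \<and> (\<forall>l\<in>{1..k}. f l k \<in> T k) \<and> new_free k \<and> (k < d \<longrightarrow> column_free k)"
  using assms
proof (induction k)
  case 0
  have "new_free 0" using free_h unfolding new_free_def additively_free_def by auto
  moreover have "column_free 0" by (simp add: column_free_def)
  ultimately show ?case using good_E0 by simp
next
  case (Suc k)
  let ?y = "\<lambda>l. f l (Suc k)"
  let ?b = "\<lambda>l. h (Suc k) * \<tau> (f l k)"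
  have IH: "good (T k)" "E0 \<subseteq> T k" "\<forall>l\<in>{1..k}. f l k \<in> T k" "new_free k" "column_free k" and kd: "k < d"
    using Suc by auto
  note S = goodD(1)[OF IH(1)]
  have free: "additively_free (T k) ?b (Suc k)" by (rule additively_free_column[OF IH(4,5) kd])
  have hT: "h i \<in> T k" for i using h_E0 IH(2) by auto
  have b: "?b l \<in> T k" if "l \<in> {1..Suc k}" for l
  proof -
    have "f l k \<in> T k" using that IH(3) f_diag[of k] subfld_1[OF S] by (cases "l = Suc k") auto
    thus ?thesis using hT goodD(2)[OF IH(1)] by (intro subfld_mult[OF S]) auto
  qed
  have y: "?y l = \<tau> (?y l) + ?b l" if "l \<in> {1..Suc k}" for l
    using f_rec[of l k] that kd by auto
  note tow = additive_tower[OF IH(1) b y free]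
  have inc: "tower (T k) ?y i \<subseteq> T (Suc k)" if "i \<le> Suc k" for i
    unfolding T.simps(2) using that
  proof (induction i rule: inc_induct)
    case (step i)
    have "tower (T k) ?y i \<subseteq> tower (T k) ?y (Suc i)"
      using tow[of i] step by (intro tower_incl) auto
    thus ?case using step by simp
  qed simp
  have gS: "good (T (Suc k))" and TS: "T k \<subseteq> T (Suc k)" and fS: "\<forall>l\<in>{1..Suc k}. f l (Suc k) \<in> T (Suc k)"
    and sol: "\<And>c. c\<in>T (Suc k) \<Longrightarrow> c - \<tau> c \<in> T k \<Longrightarrow> (\<exists>K. (\<forall>l. K l \<in> polys_over Fix) \<and> (\<exists>c'\<in>T k. c = (\<Sum>l=1..Suc k. ad (K l) (?y l)) + c'))"
    using tow[of "Suc k"] unfolding T.simps(2) by blast+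
  have new: "new_free (Suc k)"
    unfolding new_free_def
  proof (intro allI ballI impI)
    fix K :: "nat \<Rightarrow> 'l poly" and c i
    assume K: "\<forall>i. K i \<in> polys_over Fix" and c: "c \<in> T (Suc k)" "c - \<tau> c = (\<Sum>i=1..d. ad (K i) (h i))"
      and i: "i \<in> {Suc k<..d}"
    have "(\<Sum>i=1..d. ad (K i) (h i)) \<in> T k"
      using K ad_h_E0 IH(2) by (intro subfld_sum[OF S]) auto
    then obtain K' c' where K': "\<forall>l. K' l \<in> polys_over Fix" "c' \<in> T k" "c = (\<Sum>l=1..Suc k. ad (K' l) (?y l)) + c'"
      using sol[OF c(1)] c(2) by metis
    have "c' - \<tau> c' = (c - \<tau> c) - (\<Sum>l=1..Suc k. ad (K' l) (?y l) - ad (K' l) (\<tau> (?y l)))"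
      using K' by (simp add: tau_add tau_sum ad_tau_Fix sum_subtractf del: sum.cl_ivl_Suc)
    also have "(\<Sum>l=1..Suc k. ad (K' l) (?y l) - ad (K' l) (\<tau> (?y l))) = (\<Sum>l=1..Suc k. ad (K' l) (?b l))"
    proof (rule sum.cong[OF refl])
      fix l assume l: "l \<in> {1..Suc k}"
      hence "?b l = ?y l - \<tau> (?y l)" using y[OF l] by (simp add: algebra_simps)
      thus "ad (K' l) (?y l) - ad (K' l) (\<tau> (?y l)) = ad (K' l) (?b l)" by (simp add: ad_diff_right)
    qed
    finally have e1: "c' - \<tau> c' = (\<Sum>i=1..d. ad (K i) (h i)) - ad (K' (Suc k)) (h (Suc k)) - (\<Sum>l=1..k. ad (K' l) (?b l))"
      using c(2) by (simp add: f_diag)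
    \<comment> \<open>The diagonal term of column \<open>k + 1\<close> is \<open>h (Suc k)\<close>
      itself and is merged into the combination of the \<open>h i\<close>.\<close>
    define K2 where "K2 = K(Suc k := K (Suc k) - K' (Suc k))"
    have K2: "\<forall>i. K2 i \<in> polys_over Fix" using K K' by (auto simp: K2_def intro!: polys_over_diff[OF subfld_Fix])
    have "(\<Sum>i=1..d. ad (K2 i) (h i)) = (\<Sum>i=1..d. ad (K i) (h i) - (if i = Suc k then ad (K' (Suc k)) (h (Suc k)) else 0))"
      by (rule sum.cong) (auto simp: K2_def ad_diff)
    also have "\<dots> = (\<Sum>i=1..d. ad (K i) (h i)) - ad (K' (Suc k)) (h (Suc k))"
      using kd by (simp add: sum_subtractf)
    finally have e2: "c' - \<tau> c' = (\<Sum>i=1..d. ad (K2 i) (h i)) - (\<Sum>l=1..k. ad (K' l) (?b l))" using e1 by simp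
    hence "c' - \<tau> c' = (\<Sum>i=1..d. ad (K2 i) (h i)) + (\<Sum>l=1..k. ad (- K' l) (?b l))"
      by (simp add: ad_uminus sum_negf)
    moreover have "\<forall>i. - K' i \<in> polys_over Fix" using K' by (auto intro: polys_over_uminus[OF subfld_Fix])
    ultimately have "\<forall>l\<in>{1..k}. - K' l = 0"
      by (intro column_freeD[OF IH(5) K2 _ K'(2), of "\<lambda>l. - K' l"])
    hence "(\<Sum>l=1..k. ad (K' l) (?b l)) = 0" by (intro sum.neutral) auto
    with e2 have "\<forall>i\<in>{k<..d}. K2 i = 0" by (intro new_freeD[OF IH(4) K2 K'(2)]) simp
    from bspec[OF this, of i] show "K i = 0" using i by (simp add: K2_def)
  qed
  have "column_free (Suc k)" if kd': "Suc k < d"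
    unfolding column_free_def
  proof (intro allI impI ballI)
    fix K K' :: "nat \<Rightarrow> 'l poly" and c l0
    assume K: "\<forall>i. K i \<in> polys_over Fix" "\<forall>i. K' i \<in> polys_over Fix" and c: "c \<in> T (Suc k)"
      "c - \<tau> c = (\<Sum>i=1..d. ad (K i) (h i)) + (\<Sum>l=1..Suc k. ad (K' l) (h (Suc (Suc k)) * \<tau> (?y l)))"
      and l0: "l0 \<in> {1..Suc k}"
    let ?h = "h (Suc (Suc k))"
    \<comment> \<open>The term \<open>b'\<close> ranges over all of \<open>T k\<close>, because each
      step down the column changes it by
      \<open>ad L (h (Suc k) * \<tau> (f (Suc i) k))\<close>.\<close>
    have main: "\<forall>l\<in>{1..i}. K' l = 0"
      if "i \<le> Suc k" "c \<in> tower (T k) ?y i" "b' \<in> T k"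
        "c - \<tau> c = b' + (\<Sum>l=1..i. ad (K' l) (?h * \<tau> (?y l)))" for i c b'
      using that
    proof (induction i arbitrary: c b')
      case (Suc i)
      let ?E = "tower (T k) ?y i"
      have gE: "good ?E" and TE: "T k \<subseteq> ?E" and yE: "\<forall>l\<in>{1..i}. ?y l \<in> ?E" and tr: "?y (Suc i) \<notin> clo ?E"
        using tow[of i] Suc.prems(1) by auto
      note sE = goodD(1)[OF gE]
      let ?b' = "b' + (\<Sum>l=1..i. ad (K' l) (?h * \<tau> (?y l)))"
      have KE: "K' l \<in> polys_over ?E" for l using K(2) goodD(3)[OF gE] by (auto simp: polys_over_def)
      have hE: "?h \<in> ?E" using hT TE by auto
      have "K' (Suc i) = 0 \<and> (\<exists>L\<in>polys_over Fix. \<exists>c'\<in>?E. c = ad L (?y (Suc i)) + c')"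
      proof (rule additive_solution[OF gE y _ tr])
        show "Suc i \<in> {1..Suc k}" using Suc.prems by simp
        show "?b (Suc i) \<in> ?E" using b[of "Suc i"] Suc.prems TE by auto
        show "c \<in> adj ?E (?y (Suc i))" using Suc.prems by simp
        show "c - \<tau> c = ad (K' (Suc i)) (?h * \<tau> (?y (Suc i))) + ?b'"
          using Suc.prems by (simp add: algebra_simps)
        show "?b' \<in> ?E"
        proof (intro subfld_add[OF sE] subfld_sum[OF sE])
          show "b' \<in> ?E" using Suc.prems TE by auto
          fix l assume l: "l \<in> {1..i}"
          show "ad (K' l) (?h * \<tau> (?y l)) \<in> ?E"
            using l yE hE goodD(2)[OF gE] by (intro ad_in[OF sE KE] subfld_mult[OF sE]) auto
        qed
        show "K' (Suc i) \<in> polys_over Fix" "?h \<in> ?E" using K hE by auto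
        have "\<kappa> = 0" if \<kappa>: "\<kappa> \<in> Fix" "g \<in> adj ?E (?y (Suc i))" "g - \<tau> g = \<kappa> * ?h ^ (CHAR('l) ^ j)" for \<kappa> g j
        proof -
          define L where "L = (\<lambda>_. 0)(Suc (Suc k) := monom \<kappa> j)"
          have L: "\<forall>i. L i \<in> polys_over Fix" using \<kappa> polys_over_closed[OF subfld_Fix] by (auto simp: L_def)
          have "(\<Sum>i=1..d. ad (L i) (h i)) = (\<Sum>i\<in>{Suc (Suc k)}. ad (L i) (h i))"
            using kd' by (intro sum.mono_neutral_right) (auto simp: L_def)
          hence "g - \<tau> g = (\<Sum>i=1..d. ad (L i) (h i))" using \<kappa> by (simp add: L_def ad_monom)
          moreover have "g \<in> T (Suc k)" using \<kappa>(2) inc[of "Suc i"] Suc.prems by auto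
          ultimately have "\<forall>i\<in>{Suc k<..d}. L i = 0" by (intro new_freeD[OF new L])
          from bspec[OF this, of "Suc (Suc k)"] have "monom \<kappa> j = 0" using kd' by (simp add: L_def)
          thus ?thesis by simp
        qed
        thus "K' (Suc i) = 0 \<or> (\<forall>\<kappa>\<in>Fix. \<forall>j. (\<exists>g\<in>adj ?E (?y (Suc i)). g - \<tau> g = \<kappa> * ?h ^ (CHAR('l) ^ j)) \<longrightarrow> \<kappa> = 0)"
          by blast
      qed
      then obtain L c' where L: "K' (Suc i) = 0" "L \<in> polys_over Fix" "c' \<in> ?E" "c = ad L (?y (Suc i)) + c'" by auto
      have bS: "?b (Suc i) = ?y (Suc i) - \<tau> (?y (Suc i))"
        using y[of "Suc i"] Suc.prems by (simp add: algebra_simps)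
      have "\<forall>l\<in>{1..i}. K' l = 0"
      proof (rule Suc.IH[OF _ L(3)])
        show "b' - ad L (?b (Suc i)) \<in> T k"
          using L(2) goodD(3)[OF IH(1)] Suc.prems b[of "Suc i"]
          by (intro subfld_diff[OF S] ad_in[OF S]) (auto simp: polys_over_def)
        have "c' - \<tau> c' = (c - \<tau> c) - ad L (?b (Suc i))"
          by (simp add: L(4) bS tau_add ad_tau_Fix[OF L(2)] ad_diff_right)
        also have "c - \<tau> c = b' + (\<Sum>l=1..i. ad (K' l) (?h * \<tau> (?y l)))" using Suc.prems L(1) by simp
        finally show "c' - \<tau> c' = (b' - ad L (?b (Suc i))) + (\<Sum>l=1..i. ad (K' l) (?h * \<tau> (?y l)))" by simp
      qed (use Suc.prems in simp)
      thus ?case using L(1) by (auto simp: le_Suc_eq)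
    qed simp
    have "\<forall>l\<in>{1..Suc k}. K' l = 0"
    proof (rule main[OF le_refl _ _ c(2)])
      show "c \<in> tower (T k) ?y (Suc k)" using c by simp
      show "(\<Sum>i=1..d. ad (K i) (h i)) \<in> T k"
        using K ad_h_E0 IH(2) by (intro subfld_sum[OF S]) auto
    qed
    thus "K' l0 = 0" using l0 by blast
  qed
  thus ?case using gS TS fS new IH(2) by blast
qed

theorem tower_transcendental:
  assumes "k < d" "i \<le> Suc k"
  shows "good (tower (T k) (\<lambda>l. f l (Suc k)) i)" "T k \<subseteq> tower (T k) (\<lambda>l. f l (Suc k)) i"
    and "l \<in> {1..i} \<Longrightarrow> f l (Suc k) \<in> tower (T k) (\<lambda>l. f l (Suc k)) i"
    and "i < Suc k \<Longrightarrow> f (Suc i) (Suc k) \<notin> clo (tower (T k) (\<lambda>l. f l (Suc k)) i)"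
proof -
  have inv: "good (T k)" "E0 \<subseteq> T k" "\<forall>l\<in>{1..k}. f l k \<in> T k" "new_free k" "column_free k"
    using tower_invariant[of k] assms by auto
  note S = goodD(1)[OF inv(1)]
  let ?b = "\<lambda>l. h (Suc k) * \<tau> (f l k)"
  have b: "?b l \<in> T k" if "l \<in> {1..Suc k}" for l
  proof -
    have "f l k \<in> T k" using that inv(3) f_diag[of k] subfld_1[OF S] by (cases "l = Suc k") auto
    thus ?thesis using h_E0 inv(2) goodD(2)[OF inv(1)] by (intro subfld_mult[OF S]) auto
  qed
  have "additively_free (T k) ?b (Suc k)" using additively_free_column inv assms by blast
  from additive_tower[OF inv(1) b _ this, of "\<lambda>l. f l (Suc k)" i]
  have *: "good (tower (T k) (\<lambda>l. f l (Suc k)) i) \<and> T k \<subseteq> tower (T k) (\<lambda>l. f l (Suc k)) i \<and>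
    (\<forall>l\<in>{1..i}. f l (Suc k) \<in> tower (T k) (\<lambda>l. f l (Suc k)) i) \<and>
    (i < Suc k \<longrightarrow> f (Suc i) (Suc k) \<notin> clo (tower (T k) (\<lambda>l. f l (Suc k)) i))"
    using f_rec[of _ k] assms by auto
  show "good (tower (T k) (\<lambda>l. f l (Suc k)) i)" "T k \<subseteq> tower (T k) (\<lambda>l. f l (Suc k)) i"
    "l \<in> {1..i} \<Longrightarrow> f l (Suc k) \<in> tower (T k) (\<lambda>l. f l (Suc k)) i"
    "i < Suc k \<Longrightarrow> f (Suc i) (Suc k) \<notin> clo (tower (T k) (\<lambda>l. f l (Suc k)) i)"
    using * by blast+
qed

end

unbundle fps_syntax

section \<open>Laurent series over a polynomial ring and their evaluation\<close>

text \<open>A series in \<open>'a poly fls\<close> has the outer variable \<open>v\<close> and coefficients in \<open>F_q[t]\<close>; \<open>bc E j k\<close> is the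
  coefficient of \<open>v ^ j * t ^ k\<close>. The predicate \<open>ent\<close> says that \<open>E\<close> is entire as a function of \<open>t\<close>, and
  \<open>ev e E\<close> is the value of \<open>E\<close> at \<open>t = - v ^ (- e)\<close>, the zero of \<open>lam e\<close>. With \<open>w = 1 / v\<close> and
  \<open>theta = - w ^ (q - 1)\<close> the point of evaluation is \<open>theta\<close> for \<open>e = q - 1\<close> and \<open>theta ^ (q ^ i)\<close> for
  \<open>e = (q - 1) * q ^ i\<close>.\<close>

lemma fls_times_nth_supp:
  fixes f g :: "'r::comm_ring_1 fls"
  assumes "finite S" "\<And>i. f $$ i \<noteq> 0 \<Longrightarrow> g $$ (n - i) \<noteq> 0 \<Longrightarrow> i \<in> S"
  shows "(f * g) $$ n = (\<Sum>i\<in>S. f $$ i * g $$ (n - i))"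
proof -
  let ?I = "{fls_subdegree f..n - fls_subdegree g}"
  have "(f * g) $$ n = (\<Sum>i\<in>?I. f $$ i * g $$ (n - i))" by (rule fls_times_nth(2))
  also have "\<dots> = (\<Sum>i\<in>?I \<inter> S. f $$ i * g $$ (n - i))"
    using assms(2) by (intro sum.mono_neutral_right) (auto dest!: mult_not_zero)
  also have "\<dots> = (\<Sum>i\<in>S. f $$ i * g $$ (n - i))"
  proof (rule sum.mono_neutral_left)
    show "\<forall>i\<in>S - ?I \<inter> S. f $$ i * g $$ (n - i) = 0"
    proof
      fix i assume "i \<in> S - ?I \<inter> S"
      hence "i < fls_subdegree f \<or> n - i < fls_subdegree g" by auto
      thus "f $$ i * g $$ (n - i) = 0" by auto
    qed
  qed (use assms in auto)
  finally show ?thesis .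
qed

lemma fls_times_nonzero_nth:
  fixes f g :: "'r::comm_ring_1 fls"
  assumes "(f * g) $$ n \<noteq> 0"
  obtains i where "f $$ i \<noteq> 0" "g $$ (n - i) \<noteq> 0"
proof (rule ccontr)
  assume "\<not> thesis"
  hence "\<And>i. f $$ i \<noteq> 0 \<Longrightarrow> g $$ (n - i) \<noteq> 0 \<Longrightarrow> i \<in> {}" using that by blast
  hence "(f * g) $$ n = (\<Sum>i\<in>{}. f $$ i * g $$ (n - i))" by (intro fls_times_nth_supp) auto
  thus False using assms by simp
qed

text \<open>The test \<open>g 0 = 0\<close> makes the definition total: otherwise the image need not
  vanish below some exponent.\<close>

lift_definition map_fls :: "('r::zero \<Rightarrow> 's::zero) \<Rightarrow> 'r fls \<Rightarrow> 's fls" is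
  "\<lambda>g f n. if g 0 = 0 then g (f n) else 0"
  by (auto elim: eventually_mono)

lemma map_fls_nth: "g 0 = 0 \<Longrightarrow> map_fls g f $$ n = g (f $$ n)"
  by transfer auto

lemma map_fls_mult:
  fixes f1 f2 :: "'r::comm_ring_1 fls" and g :: "'r \<Rightarrow> 's::comm_ring_1"
  assumes g: "\<And>x y. g (x + y) = g x + g y" "\<And>x y. g (x * y) = g x * g y"
  shows "map_fls g (f1 * f2) = map_fls g f1 * map_fls g f2"
proof (rule fls_eqI)
  fix n
  have g0: "g 0 = 0" using g(1)[of 0 0] by (metis add_cancel_right_right add_0)
  have gs: "g (sum h A) = (\<Sum>i\<in>A. g (h i))" for h :: "int \<Rightarrow> 'r" and A
    by (induction A rule: infinite_finite_induct) (auto simp: g0 g)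
  let ?I = "{fls_subdegree f1..n - fls_subdegree f2}"
  have "map_fls g (f1 * f2) $$ n = (\<Sum>i\<in>?I. g (f1 $$ i) * g (f2 $$ (n - i)))"
    by (simp add: map_fls_nth[where g = g, OF g0] fls_times_nth(2) gs g)
  also have "\<dots> = (map_fls g f1 * map_fls g f2) $$ n"
  proof (subst fls_times_nth_supp[of ?I])
    fix i assume "map_fls g f1 $$ i \<noteq> 0" "map_fls g f2 $$ (n - i) \<noteq> 0"
    hence "f1 $$ i \<noteq> 0" "f2 $$ (n - i) \<noteq> 0" by (auto simp: map_fls_nth[where g = g, OF g0] g0)
    thus "i \<in> ?I" using fls_subdegree_leI[of f1 i] fls_subdegree_leI[of f2 "n - i"] by auto
  qed (auto simp: map_fls_nth[where g = g, OF g0])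
  finally show "map_fls g (f1 * f2) $$ n = (map_fls g f1 * map_fls g f2) $$ n" .
qed

abbreviation bc :: "'a::zero poly fls \<Rightarrow> int \<Rightarrow> nat \<Rightarrow> 'a" where
  "bc E j k \<equiv> coeff (E $$ j) k"

lemma bc_eqI: "(\<And>j k. bc E j k = bc F j k) \<Longrightarrow> E = F"
  by (intro fls_eqI poly_eqI) auto

lemma bc_build:
  fixes c :: "int \<Rightarrow> nat \<Rightarrow> 'a::zero"
  assumes "\<And>j k. c j k \<noteq> 0 \<Longrightarrow> N \<le> j" "\<And>j. \<exists>K. \<forall>k>K. c j k = 0"
  shows "\<exists>E. \<forall>j k. bc E j k = c j k"
proof -
  have 1: "coeff (Abs_poly (c j)) k = c j k" for j k
    using Abs_poly_inverse[of "c j"] assms(2)[of j] by (simp add: MOST_nat)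
  have 2: "Abs_fls (\<lambda>j. Abs_poly (c j)) $$ j = Abs_poly (c j)" for j
  proof (rule nth_Abs_fls_lower_bound[of N])
    show "\<forall>n<N. Abs_poly (c n) = 0"
      using assms(1) by (auto intro!: poly_eqI simp: 1) (metis not_le)
  qed
  show ?thesis by (rule exI[of _ "Abs_fls (\<lambda>j. Abs_poly (c j))"]) (simp add: 1 2)
qed

definition cc :: "'a::comm_ring_1 fls \<Rightarrow> 'a poly fls" where "cc = map_fls (\<lambda>c. [:c:])"

lemma cc_nth [simp]: "cc L $$ j = [:L $$ j:]" by (simp add: cc_def map_fls_nth)
lemma cc_0 [simp]: "cc 0 = 0" by (rule fls_eqI) simp
lemma cc_1 [simp]: "cc 1 = 1" by (rule fls_eqI) (simp add: one_pCons)
lemma cc_add: "cc (L + M) = cc L + cc M" by (rule fls_eqI) simp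
lemma cc_diff: "cc (L - M) = cc L - cc M" by (rule fls_eqI) simp
lemma cc_uminus: "cc (- L) = - cc L" by (rule fls_eqI) simp
lemma cc_mult: "cc (L * M) = cc L * cc M" unfolding cc_def by (rule map_fls_mult) auto
lemma cc_intpow [simp]: "cc (fls_shift j 1) = fls_shift j 1"
  by (rule fls_eqI) (auto simp: one_pCons)
lemma cc_eq_iff: "cc L = cc M \<longleftrightarrow> L = M"
  by (auto simp: fls_eq_iff)
lemma cc_compose: "r > 0 \<Longrightarrow> fls_compose_power (cc L) r = cc (fls_compose_power L r)"
  by (rule fls_eqI) (auto simp: fls_nth_compose_power)

definition tt :: "'a::comm_ring_1 poly fls" where "tt = fls_const [:0, 1:]"
definition lam :: "nat \<Rightarrow> 'a::comm_ring_1 poly fls" where "lam e = 1 + tt * fls_X_intpow (int e)"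

lemma tt_compose [simp]: "r > 0 \<Longrightarrow> fls_compose_power tt r = tt" by (simp add: tt_def)

lemma bc_tt_mult: "bc (tt * (fls_X_intpow i * G)) j k = (if k = 0 then 0 else bc G (j - i) (k - 1))"
  by (cases k) (auto simp: tt_def fls_shifted_times_simps coeff_pCons)

lemma bc_lam_mult: "bc (lam e * G) j k = bc G j k + (if k = 0 then 0 else bc G (j - int e) (k - 1))"
  by (simp add: lam_def distrib_right mult.assoc bc_tt_mult)

lemma lam_compose:
  "r > 0 \<Longrightarrow> fls_compose_power (lam e :: 'a::field poly fls) r = lam (e * r)"
  by (simp add: lam_def mult.commute)

text \<open>The coefficient of \<open>t ^ k\<close> has order at least \<open>A * k - C\<close> in
  \<open>v\<close>. A bound for every slope \<open>A\<close> means infinite radius of convergence in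
  \<open>t\<close>, which is \<open>ent\<close>. The constants \<open>C\<close> are tracked because
  their decrease measures both convergence and order of vanishing.\<close>

definition gr :: "nat \<Rightarrow> int \<Rightarrow> 'a::comm_ring_1 poly fls \<Rightarrow> bool" where
  "gr A C E \<longleftrightarrow> (\<forall>j k. bc E j k \<noteq> 0 \<longrightarrow> int (A * k) \<le> j + C)"

definition ent :: "'a::comm_ring_1 poly fls \<Rightarrow> bool" where
  "ent E \<longleftrightarrow> (\<forall>A. \<exists>C. gr A C E)"

lemma grD: "gr A C E \<Longrightarrow> bc E j k \<noteq> 0 \<Longrightarrow> int (A * k) \<le> j + C" by (auto simp: gr_def)
lemma gr_0 [simp]: "gr A C 0" by (auto simp: gr_def)
lemma gr_mono: "gr A C E \<Longrightarrow> C \<le> C' \<Longrightarrow> gr A C' E" unfolding gr_def by force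
lemma gr_slope_mono: "gr A C E \<Longrightarrow> A' \<le> A \<Longrightarrow> gr A' C E"
  unfolding gr_def by (metis (no_types, opaque_lifting) mult_le_mono1 of_nat_le_iff order.trans)
lemma gr_add: "gr A C E \<Longrightarrow> gr A C F \<Longrightarrow> gr A C (E + F)"
  unfolding gr_def by (metis add.left_neutral coeff_add fls_plus_nth)
lemma gr_uminus: "gr A C E \<Longrightarrow> gr A C (- E)" by (auto simp: gr_def)
lemma gr_diff: "gr A C E \<Longrightarrow> gr A C F \<Longrightarrow> gr A C (E - F)"
  using gr_add[of A C E "- F"] gr_uminus[of A C F] by simp
lemma gr_sum: "(\<And>i. i \<in> S \<Longrightarrow> gr A C (f i)) \<Longrightarrow> gr A C (sum f S)"
  by (induction S rule: infinite_finite_induct) (auto intro: gr_add)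

lemma bc_mult_nonzero:
  assumes "bc (E * F) j k \<noteq> 0"
  obtains i l where "l \<le> k" "bc E i l \<noteq> 0" "bc F (j - i) (k - l) \<noteq> (0::'a::comm_ring_1)"
proof -
  have "\<exists>i l. l \<le> k \<and> bc E i l \<noteq> 0 \<and> bc F (j - i) (k - l) \<noteq> 0"
  proof (rule ccontr)
    assume "\<not> ?thesis"
    hence *: "l \<le> k \<Longrightarrow> bc E i l * bc F (j - i) (k - l) = 0" for i l
      by (metis mult_zero_left mult_zero_right)
    have "bc (E * F) j k = 0"
      unfolding fls_times_nth(2) coeff_sum coeff_mult by (intro sum.neutral ballI *) simp
    thus False using assms by simp
  qed
  thus ?thesis using that by blast
qed

lemma gr_mult: "gr A C E \<Longrightarrow> gr A C' F \<Longrightarrow> gr A (C + C') (E * F)"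
  unfolding gr_def[of A "C + C'"]
proof (intro allI impI)
  fix j k assume g: "gr A C E" "gr A C' F" and "bc (E * F) j k \<noteq> 0"
  then obtain i l where *: "l \<le> k" "bc E i l \<noteq> 0" "bc F (j - i) (k - l) \<noteq> 0" by (elim bc_mult_nonzero)
  have "int (A * k) = int (A * l) + int (A * (k - l))" using *(1) by (simp add: diff_mult_distrib2 of_nat_diff)
  thus "int (A * k) \<le> j + (C + C')" using grD[OF g(1) *(2)] grD[OF g(2) *(3)] by linarith
qed

lemma gr_below: "gr A C E \<Longrightarrow> j < - C \<Longrightarrow> E $$ j = 0"
proof (rule poly_eqI)
  fix k assume g: "gr A C E" "j < - C"
  show "coeff (E $$ j) k = coeff 0 k"
    using grD[OF g(1), of j k] g(2) by (cases "bc E j k = 0") (auto simp del: of_nat_mult)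
qed

lemma gr_all_0: "(\<And>N::nat. gr A (C - int N) E) \<Longrightarrow> E = 0"
proof (rule fls_zero_eqI)
  fix j assume *: "\<And>N::nat. gr A (C - int N) E"
  show "E $$ j = 0" by (rule gr_below[OF *[of "nat (j + C + 1)"]]) simp
qed

text \<open>The slope grows by the factor \<open>r\<close>; this is how functional equations under
  \<open>\<tau>\<close> improve convergence.\<close>

lemma gr_compose:
  assumes "r > 0" "gr A C E" shows "gr (A * r) (C * int r) (fls_compose_power E r)"
  unfolding gr_def
proof (intro allI impI)
  fix j k assume "bc (fls_compose_power E r) j k \<noteq> 0"
  hence *: "int r dvd j" "bc E (j div int r) k \<noteq> 0" using assms(1) by (auto simp: fls_nth_compose_power split: if_splits)
  then obtain i where i: "j = int r * i" by auto
  have "int (A * k) \<le> i + C" using grD[OF assms(2) *(2)] assms(1) i by simp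
  hence "int (A * k) * int r \<le> (i + C) * int r" by (rule mult_right_mono) simp
  thus "int (A * r * k) \<le> j + C * int r" by (simp add: i algebra_simps)
qed

lemma gr_cc: "\<exists>C. gr A C (cc L)"
proof -
  obtain N where N: "\<forall>n<N. L $$ n = 0" by (rule fls_nth_vanishes_belowE)
  have "gr A (- N) (cc L)" unfolding gr_def
    using N by (auto simp: coeff_pCons split: nat.splits) (metis not_le)
  thus ?thesis by blast
qed

lemma entE: assumes "ent E" obtains C where "gr A C E" using assms by (auto simp: ent_def)
lemma ent_0 [simp]: "ent 0" by (auto simp: ent_def)
lemma ent_cc [simp]: "ent (cc L)" using gr_cc by (auto simp: ent_def)
lemma ent_1 [simp]: "ent 1" using ent_cc[of 1] by simp
lemma ent_intpow [simp]: "ent (fls_shift j 1)" using ent_cc[of "fls_shift j 1"] by (simp del: ent_cc)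
lemma ent_add: assumes "ent E" "ent F" shows "ent (E + F)"
  unfolding ent_def
proof
  fix A
  obtain C C' where "gr A C E" "gr A C' F" using assms by (meson entE)
  hence "gr A (max C C') (E + F)" by (intro gr_add) (auto elim: gr_mono)
  thus "\<exists>C. gr A C (E + F)" by blast
qed
lemma ent_uminus: "ent E \<Longrightarrow> ent (- E)" by (auto simp: ent_def intro: gr_uminus)
lemma ent_diff: "ent E \<Longrightarrow> ent F \<Longrightarrow> ent (E - F)" using ent_add[of E "- F"] ent_uminus[of F] by simp
lemma ent_mult: assumes "ent E" "ent F" shows "ent (E * F)"
  unfolding ent_def using assms by (meson entE gr_mult)
lemma ent_power: "ent E \<Longrightarrow> ent (E ^ n)" by (induction n) (auto intro: ent_mult)
lemma ent_sum: "(\<And>i. i \<in> S \<Longrightarrow> ent (f i)) \<Longrightarrow> ent (sum f S)"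
  by (induction S rule: infinite_finite_induct) (auto intro: ent_add)
lemma ent_prod: "(\<And>i. i \<in> S \<Longrightarrow> ent (f i)) \<Longrightarrow> ent (prod f S)"
  by (induction S rule: infinite_finite_induct) (auto intro: ent_mult)
lemma ent_const [simp]: "ent (fls_const p)"
  unfolding ent_def
proof
  fix A
  have "gr A (int (A * degree p)) (fls_const p)"
    unfolding gr_def by (auto simp: coeff_pCons) (metis le_degree mult_le_mono2 of_nat_mono of_nat_mult)
  thus "\<exists>C. gr A C (fls_const p)" by blast
qed
lemma ent_tt [simp]: "ent tt" by (simp add: tt_def)
lemma ent_lam [simp]: "ent (lam e)" unfolding lam_def by (intro ent_add ent_mult) auto
lemma ent_compose: assumes "r > 0" "ent E" shows "ent (fls_compose_power E r)"
  unfolding ent_def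
proof
  fix A
  obtain C where "gr A C E" using assms(2) by (rule entE)
  from gr_compose[OF assms(1) this] have "gr A (C * int r) (fls_compose_power E r)"
    by (rule gr_slope_mono) (use assms(1) in simp)
  thus "\<exists>C. gr A C (fls_compose_power E r)" by blast
qed

lemmas ent_closed = ent_0 ent_1 ent_cc ent_intpow ent_add ent_uminus ent_diff ent_mult ent_power
  ent_sum ent_prod ent_const ent_tt ent_lam ent_compose

text \<open>The tail sums \<open>S j k\<close> below give both the value at \<open>t = - v ^ (- e)\<close> (from \<open>k = 0\<close>)
  and the quotient by \<open>lam e\<close>.\<close>

lemma division_by_lam:
  fixes E :: "'a::comm_ring_1 poly fls"
  assumes "ent E"
  shows "\<exists>L G. E = cc L + lam e * G \<and> (\<forall>A C. e \<le> A \<longrightarrow> gr A C E \<longrightarrow> gr A (C - int A + int e) G)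
     \<and> (\<forall>l. \<exists>n0. \<forall>n\<ge>n0. L $$ l = (\<Sum>i<n. (-1) ^ i * bc E (l + int (e * i)) i))"
proof -
  \<comment> \<open>Slope \<open>e + 1\<close> rather than \<open>e\<close>: along the diagonal
    \<open>(j + e * i, k + i)\<close> it leaves only finitely many nonzero coefficients, all with
    \<open>i < N j\<close>.\<close>
  obtain C0 where C0: "gr (e + 1) C0 E" using assms by (rule entE)
  define N where "N j = nat (j + C0 + 1)" for j
  define S where "S j k = (\<Sum>i<N j. (-1) ^ i * bc E (j + int (e * i)) (k + i))" for j k
  have Nbound: "i < N j" if "bc E (j + int (e * i)) (k + i) \<noteq> 0" for i j k
  proof -
    have "int ((e + 1) * (k + i)) \<le> j + int (e * i) + C0" using grD[OF C0 that] .
    hence "int (e * i) + int i + int ((e + 1) * k) \<le> j + int (e * i) + C0" by (simp add: algebra_simps)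
    thus ?thesis by (simp add: N_def del: of_nat_mult)
  qed
  have S_eq: "S j k = (\<Sum>i<n. (-1) ^ i * bc E (j + int (e * i)) (k + i))" if "n \<ge> N j" for j k n
    unfolding S_def
  proof (rule sum.mono_neutral_left)
    show "\<forall>i\<in>{..<n} - {..<N j}. (-1) ^ i * bc E (j + int (e * i)) (k + i) = 0"
      using Nbound[of j _ k] by (metis DiffE lessThan_iff mult_zero_right)
  qed (use that in auto)
  \<comment> \<open>This recursion is the coefficient form of
    \<open>E = cc L + lam e * G\<close>.\<close>
  have S_rec: "S j k = bc E j k - S (j + int e) (Suc k)" for j k
  proof -
    let ?n = "N (j + int e)"
    have "S j k = (\<Sum>i<Suc ?n. (-1) ^ i * bc E (j + int (e * i)) (k + i))"
      by (rule S_eq) (simp add: N_def)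
    also have "\<dots> = bc E j k + (\<Sum>i<?n. (-1) ^ Suc i * bc E (j + int (e * Suc i)) (k + Suc i))"
      by (subst sum.lessThan_Suc_shift) simp
    also have "(\<Sum>i<?n. (-1) ^ Suc i * bc E (j + int (e * Suc i)) (k + Suc i)) = - S (j + int e) (Suc k)"
      unfolding S_def by (simp add: sum_negf[symmetric] algebra_simps)
    finally show ?thesis by simp
  qed
  have S_nz: "\<exists>i. bc E (j + int (e * i)) (k + i) \<noteq> 0" if "S j k \<noteq> 0" for j k
    using that unfolding S_def by (metis (mono_tags, lifting) mult_zero_right sum.neutral)
  have S_bound: "int ((e + 1) * k) \<le> j + C0" if "S j k \<noteq> 0" for j k
  proof -
    from S_nz[OF that] obtain i where "bc E (j + int (e * i)) (k + i) \<noteq> 0" by blast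
    from grD[OF C0 this] have "int (e * i) + int i + int ((e + 1) * k) \<le> j + int (e * i) + C0" by (simp add: algebra_simps)
    thus ?thesis by linarith
  qed
  define L where "L = Abs_fls (\<lambda>j. S j 0)"
  have L: "L $$ j = S j 0" for j
    unfolding L_def
  proof (rule nth_Abs_fls_lower_bound[of "- C0"])
    show "\<forall>n. n < - C0 \<longrightarrow> S n 0 = 0"
    proof (intro allI impI)
      fix n assume "n < - C0"
      thus "S n 0 = 0" using S_bound[of n 0] by (cases "S n 0 = 0") auto
    qed
  qed
  have "\<exists>G. \<forall>j k. bc G j k = S (j + int e) (Suc k)"
  proof (rule bc_build[of _ "- C0 - int e"])
    fix j k assume "S (j + int e) (Suc k) \<noteq> 0"
    from S_bound[OF this] have "0 \<le> j + int e + C0" by (smt (verit) of_nat_0_le_iff)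
    thus "- C0 - int e \<le> j" by simp
  next
    fix j
    have "S (j + int e) (Suc k) = 0" if "k > nat (j + int e + C0)" for k
    proof (rule ccontr)
      assume "S (j + int e) (Suc k) \<noteq> 0"
      from S_bound[OF this] have "int (e * Suc k) + int (Suc k) \<le> j + int e + C0" by (simp add: algebra_simps)
      hence "int k \<le> j + int e + C0" by linarith
      thus False using that by linarith
    qed
    thus "\<exists>K. \<forall>k>K. S (j + int e) (Suc k) = 0" by blast
  qed
  then obtain G where G: "\<And>j k. bc G j k = S (j + int e) (Suc k)" by blast
  have "E = cc L + lam e * G"
  proof (rule bc_eqI)
    fix j k
    show "bc E j k = bc (cc L + lam e * G) j k"
    proof (cases k)
      case 0
      thus ?thesis using S_rec[of j 0] by (simp add: bc_lam_mult L G)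
    next
      case (Suc k')
      have "bc (cc L + lam e * G) j k = S (j + int e) (Suc k) + S j k"
        using Suc by (simp add: bc_lam_mult G)
      thus ?thesis using S_rec[of j k] by simp
    qed
  qed
  \<comment> \<open>Division gains \<open>A - e\<close> in the bound; these gains add up to the
    order of vanishing in the Schwarz lemma.\<close>
  moreover have "gr A (C - int A + int e) G" if A: "e \<le> A" "gr A C E" for A C
    unfolding gr_def
  proof (intro allI impI)
    fix j k assume "bc G j k \<noteq> 0"
    then obtain i where i: "bc E (j + int e + int (e * i)) (Suc k + i) \<noteq> 0" using S_nz G by metis
    have "int (A * (Suc k + i)) \<le> j + int e + int (e * i) + C" using grD[OF A(2) i] .
    moreover have "int (e * i) \<le> int (A * i)" using A(1) by (intro of_nat_mono mult_le_mono1)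
    moreover have "int (A * (Suc k + i)) = int A + int (A * k) + int (A * i)" by (simp add: algebra_simps)
    ultimately show "int (A * k) \<le> j + (C - int A + int e)" by linarith
  qed
  moreover have "\<exists>n0. \<forall>n\<ge>n0. L $$ l = (\<Sum>i<n. (-1) ^ i * bc E (l + int (e * i)) i)" for l
    using S_eq[of l _ 0] by (intro exI[of _ "N l"]) (simp add: L)
  ultimately show ?thesis by blast
qed

text \<open>Uniqueness of the remainder: if \<open>lam e * G\<close> is free of \<open>t\<close>,
  the coefficients of \<open>G\<close> only change sign along diagonals of direction
  \<open>(e, 1)\<close>, so a nonzero one never dies out, which a bound of slope
  \<open>e + 1\<close> forbids.\<close>

lemma lam_multiple_constant:
  assumes "cc L = lam e * G" "ent G"
  shows "L = 0"
proof -
  have step: "bc G (j + int e) (Suc k) = - bc G j k" for j k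
  proof -
    have "bc (cc L) (j + int e) (Suc k) = 0" by simp
    thus ?thesis unfolding assms(1) bc_lam_mult by (simp add: eq_neg_iff_add_eq_0)
  qed
  have iter: "bc G (j + int (e * i)) (k + i) = (-1) ^ i * bc G j k" for i j k
  proof (induction i)
    case (Suc i)
    have "bc G (j + int (e * Suc i)) (k + Suc i) = bc G ((j + int (e * i)) + int e) (Suc (k + i))"
      by (simp add: algebra_simps)
    also have "\<dots> = (-1) ^ Suc i * bc G j k" unfolding step Suc by simp
    finally show ?case .
  qed simp
  obtain C where C: "gr (e + 1) C G" using assms(2) by (rule entE)
  have "bc G j k = 0" for j k
  proof (rule ccontr)
    assume nz: "bc G j k \<noteq> 0"
    define i where "i = nat (j + C + 1)"
    have "bc G (j + int (e * i)) (k + i) \<noteq> 0" unfolding iter using nz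
      by (cases "even i") auto
    from grD[OF C this] have "int (e * i) + int i + int ((e + 1) * k) \<le> j + int (e * i) + C" by (simp add: algebra_simps)
    hence "int i \<le> j + C" by linarith
    thus False unfolding i_def by linarith
  qed
  hence "G = 0" by (intro bc_eqI) auto
  thus ?thesis using assms(1) by (metis cc_0 cc_eq_iff mult_zero_right)
qed

definition ev :: "nat \<Rightarrow> 'a::comm_ring_1 poly fls \<Rightarrow> 'a fls" where
  "ev e E = (THE L. \<exists>G. ent G \<and> E = cc L + lam e * G)"

lemma ev_eqI:
  assumes "E = cc L + lam e * G" "ent G"
  shows "ev e E = L"
  unfolding ev_def
proof (rule the_equality)
  show "\<exists>G. ent G \<and> E = cc L + lam e * G" using assms by blast
  fix L' assume "\<exists>G. ent G \<and> E = cc L' + lam e * G"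
  then obtain G' where G': "ent G'" "E = cc L' + lam e * G'" by blast
  have "cc (L' - L) = lam e * (G - G')" using assms(1) G'(2) by (simp add: cc_diff algebra_simps)
  from lam_multiple_constant[OF this] show "L' = L" using assms G' by (auto intro: ent_diff)
qed

lemma ev_division:
  assumes "ent E"
  shows "\<exists>G. ent G \<and> E = cc (ev e E) + lam e * G \<and> (\<forall>A C. e \<le> A \<longrightarrow> gr A C E \<longrightarrow> gr A (C - int A + int e) G)"
    and "\<exists>n0. \<forall>n\<ge>n0. ev e E $$ l = (\<Sum>i<n. (-1) ^ i * bc E (l + int (e * i)) i)"
proof -
  obtain L G where LG: "E = cc L + lam e * G" "\<forall>A C. e \<le> A \<longrightarrow> gr A C E \<longrightarrow> gr A (C - int A + int e) G"
    "\<forall>l. \<exists>n0. \<forall>n\<ge>n0. L $$ l = (\<Sum>i<n. (-1) ^ i * bc E (l + int (e * i)) i)"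
    using division_by_lam[OF assms, of e] by blast
  have "ent G" unfolding ent_def
  proof
    fix A
    obtain C where "gr (max A e) C E" using assms by (rule entE)
    hence "gr (max A e) (C - int (max A e) + int e) G" using LG(2) by simp
    thus "\<exists>C. gr A C G" by (blast intro: gr_slope_mono[OF _ max.cobounded1])
  qed
  hence "ev e E = L" using LG(1) by (rule ev_eqI[rotated])
  thus "\<exists>G. ent G \<and> E = cc (ev e E) + lam e * G \<and> (\<forall>A C. e \<le> A \<longrightarrow> gr A C E \<longrightarrow> gr A (C - int A + int e) G)"
    and "\<exists>n0. \<forall>n\<ge>n0. ev e E $$ l = (\<Sum>i<n. (-1) ^ i * bc E (l + int (e * i)) i)"
    using LG \<open>ent G\<close> by blast+
qed

lemma ev_nth_nonzero:
  assumes "ent E" "ev e E $$ l \<noteq> 0"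
  shows "\<exists>i. bc E (l + int (e * i)) i \<noteq> 0"
  using ev_division(2)[OF assms(1), of e l] assms(2)
  by (metis (mono_tags, lifting) mult_zero_right order_refl sum.neutral)

lemma ev_add: assumes "ent E" "ent F" shows "ev e (E + F) = ev e E + ev e F"
proof -
  obtain G where G: "ent G" "E = cc (ev e E) + lam e * G" using ev_division(1)[OF assms(1)] by blast
  obtain H where H: "ent H" "F = cc (ev e F) + lam e * H" using ev_division(1)[OF assms(2)] by blast
  have "E + F = cc (ev e E + ev e F) + lam e * (G + H)"
    by (subst G(2), subst H(2)) (simp add: cc_add algebra_simps)
  thus ?thesis using G H by (intro ev_eqI[of _ _ _ "G + H"] ent_add)
qed

lemma ev_mult: assumes "ent E" "ent F" shows "ev e (E * F) = ev e E * ev e F"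
proof -
  obtain G where G: "ent G" "E = cc (ev e E) + lam e * G" using ev_division(1)[OF assms(1)] by blast
  obtain H where H: "ent H" "F = cc (ev e F) + lam e * H" using ev_division(1)[OF assms(2)] by blast
  have "E * F = cc (ev e E * ev e F) + lam e * (cc (ev e F) * G + E * H)"
  proof -
    have "E * F = E * cc (ev e F) + lam e * (E * H)" by (subst H(2)) (simp add: algebra_simps)
    also have "E * cc (ev e F) = cc (ev e E * ev e F) + lam e * (cc (ev e F) * G)"
      by (subst G(2)) (simp add: cc_mult algebra_simps)
    finally show ?thesis by (simp add: algebra_simps)
  qed
  thus ?thesis using G H assms by (intro ev_eqI[of _ _ _ "cc (ev e F) * G + E * H"]) (auto intro!: ent_add ent_mult)
qed

lemma ev_cc [simp]: "ev e (cc L) = L" by (rule ev_eqI[of _ _ _ 0]) auto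
lemma ev_0 [simp]: "ev e 0 = 0" using ev_cc[of e 0] by simp
lemma ev_1 [simp]: "ev e 1 = 1" using ev_cc[of e 1] by simp
lemma ev_intpow [simp]: "ev e (fls_shift j 1) = fls_shift j 1" using ev_cc[of e "fls_shift j 1"] by (simp del: ev_cc)
lemma ev_uminus: "ent E \<Longrightarrow> ev e (- E) = - ev e E"
  using ev_add[of E "- E" e] by (simp add: ent_uminus eq_neg_iff_add_eq_0 add.commute)
lemma ev_diff: "ent E \<Longrightarrow> ent F \<Longrightarrow> ev e (E - F) = ev e E - ev e F"
  using ev_add[of E "- F" e] by (simp add: ent_uminus ev_uminus)
lemma ev_power: "ent E \<Longrightarrow> ev e (E ^ n) = ev e E ^ n" by (induction n) (auto simp: ev_mult ent_power)
lemma ev_sum: "(\<And>i. i \<in> S \<Longrightarrow> ent (f i)) \<Longrightarrow> ev e (sum f S) = (\<Sum>i\<in>S. ev e (f i))"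
  by (induction S rule: infinite_finite_induct) (auto simp: ev_add ent_sum)
lemma ev_prod: "(\<And>i. i \<in> S \<Longrightarrow> ent (f i)) \<Longrightarrow> ev e (prod f S) = (\<Prod>i\<in>S. ev e (f i))"
  by (induction S rule: infinite_finite_induct) (auto simp: ev_mult ent_prod)

lemma ev_tt: "ev e tt = - fls_X_intpow (- int e)"
proof (rule ev_eqI[of _ _ _ "fls_X_intpow (- int e)"])
  show "tt = cc (- fls_X_intpow (- int e)) + lam e * fls_X_intpow (- int e)"
    by (simp add: lam_def cc_uminus algebra_simps fls_shifted_times_simps)
qed simp

lemma ev_lam [simp]: "ev e (lam e) = 0"
  by (rule ev_eqI[of _ _ _ 1]) auto

lemma ev_compose:
  fixes E :: "'a::field poly fls"
  assumes "r > 0" "ent E"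
  shows "ev (e * r) (fls_compose_power E r) = fls_compose_power (ev e E) r"
proof -
  obtain G where G: "ent G" "E = cc (ev e E) + lam e * G" using ev_division(1)[OF assms(2)] by blast
  have "fls_compose_power E r = cc (fls_compose_power (ev e E) r) + lam (e * r) * fls_compose_power G r"
    by (subst G(2)) (simp add: cc_compose assms lam_compose)
  thus ?thesis by (rule ev_eqI) (use G assms in \<open>auto intro: ent_compose\<close>)
qed

text \<open>The Schwarz lemma. Each zero splits off a factor \<open>lam e\<close> and improves the
  bound by \<open>A - e\<close>; the quotient still vanishes at the other points, because
  \<open>lam e\<close> takes there the value \<open>1 - v ^ (e - e')\<close>, nonzero for distinct
  exponents.\<close>

lemma vanishing_order:
  fixes E :: "'a::field poly fls"
  assumes "finite S" "ent E" "gr A C E" "\<And>e. e \<in> S \<Longrightarrow> ev e E = 0" "\<And>e. e \<in> S \<Longrightarrow> e \<le> A"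
    and "j < (\<Sum>e\<in>S. int A - int e) - C"
  shows "E $$ j = 0"
  using assms
proof (induction S arbitrary: E C j rule: finite_induct)
  case empty
  thus ?case using gr_below by auto
next
  case (insert e S)
  obtain G where G: "ent G" "E = lam e * G" "gr A (C - int A + int e) G"
    using ev_division(1)[OF insert.prems(1), of e] insert.prems by auto
  have "G $$ j = 0" if "j < (\<Sum>e\<in>insert e S. int A - int e) - C" for j
  proof (rule insert.IH[OF G(1,3)])
    fix e' assume e': "e' \<in> S"
    show "e' \<le> A" using e' insert.prems by auto
    have "0 = ev e' E" using e' insert.prems by simp
    also have "\<dots> = ev e' (lam e) * ev e' G" unfolding G(2) using G(1) by (intro ev_mult) auto
    also have "ev e' (lam e) = 1 - fls_X_intpow (int e - int e')"
    proof -
      have "ev e' (lam e) = ev e' 1 + ev e' tt * ev e' (fls_shift (- int e) 1)"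
        unfolding lam_def by (subst ev_add) (auto intro: ent_mult simp del: fls_shifted_times_simps ev_1 ev_intpow simp: ev_mult)
      thus ?thesis by (simp add: ev_tt fls_shifted_times_simps)
    qed
    finally have "1 - fls_X_intpow (int e - int e') = (0 :: 'a fls) \<or> ev e' G = 0" by simp
    moreover have "1 - fls_X_intpow (int e - int e') \<noteq> (0 :: 'a fls)"
    proof
      assume "1 - fls_X_intpow (int e - int e') = (0 :: 'a fls)"
      hence "(1 - fls_X_intpow (int e - int e') :: 'a fls) $$ 0 = 0" by simp
      thus False using e' insert.hyps by (auto split: if_splits)
    qed
    ultimately show "ev e' G = 0" by blast
  qed (use insert.hyps that in auto)
  hence *: "G $$ j = 0" "G $$ (j - int e) = 0" using insert.prems(5) by auto
  show ?case unfolding G(2) by (rule poly_eqI) (simp add: bc_lam_mult *)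
qed

section \<open>A linear independence criterion for values\<close>

text \<open>Size is measured by exponents: \<open>lp B\<close> describes Laurent polynomials in
  \<open>v\<close>, and \<open>blp D B\<close> those whose coefficients are polynomials in
  \<open>t\<close> of degree at most \<open>D\<close>. The symmetric bound in \<open>v\<close>
  includes the powers of \<open>w = 1 / v\<close>.\<close>

definition lp :: "nat \<Rightarrow> 'a::zero fls \<Rightarrow> bool" where
  "lp B f \<longleftrightarrow> (\<forall>j. f $$ j \<noteq> 0 \<longrightarrow> \<bar>j\<bar> \<le> int B)"

definition blp :: "nat \<Rightarrow> nat \<Rightarrow> 'a::comm_ring_1 poly fls \<Rightarrow> bool" where
  "blp D B E \<longleftrightarrow> (\<forall>j k. bc E j k \<noteq> 0 \<longrightarrow> k \<le> D \<and> \<bar>j\<bar> \<le> int B)"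

definition lpoly :: "'a::comm_ring_1 poly fls \<Rightarrow> bool" where
  "lpoly E \<longleftrightarrow> (\<exists>D B. blp D B E)"

lemma lp_mono: "lp B f \<Longrightarrow> B \<le> B' \<Longrightarrow> lp B' f" unfolding lp_def by force
lemma lp_0 [simp]: "lp B 0" by (simp add: lp_def)
lemma lp_add: "lp B f \<Longrightarrow> lp B g \<Longrightarrow> lp B (f + (g::'a::comm_ring_1 fls))"
  unfolding lp_def by (metis add.left_neutral fls_plus_nth)
lemma lp_sum: "(\<And>i. i \<in> S \<Longrightarrow> lp B (f i)) \<Longrightarrow> lp B (\<Sum>i\<in>S. (f i::'a::comm_ring_1 fls))"
  by (induction S rule: infinite_finite_induct) (auto intro: lp_add)
lemma lp_mult: "lp B f \<Longrightarrow> lp B' g \<Longrightarrow> lp (B + B') (f * (g::'a::comm_ring_1 fls))"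
  unfolding lp_def[of "B + B'"]
proof (intro allI impI)
  fix j assume *: "lp B f" "lp B' g" "(f * g) $$ j \<noteq> 0"
  from *(3) obtain i where "f $$ i \<noteq> 0" "g $$ (j - i) \<noteq> 0" by (rule fls_times_nonzero_nth)
  hence "\<bar>i\<bar> \<le> int B" "\<bar>j - i\<bar> \<le> int B'" using *(1,2) by (auto simp: lp_def)
  thus "\<bar>j\<bar> \<le> int (B + B')" by linarith
qed

lemma blp_mono: "blp D B E \<Longrightarrow> D \<le> D' \<Longrightarrow> B \<le> B' \<Longrightarrow> blp D' B' E" unfolding blp_def by force
lemma blp_add: "blp D B E \<Longrightarrow> blp D B F \<Longrightarrow> blp D B (E + F)"
  unfolding blp_def by (metis add.left_neutral coeff_add fls_plus_nth)
lemma blp_mult: "blp D B E \<Longrightarrow> blp D' B' F \<Longrightarrow> blp (D + D') (B + B') (E * F)"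
  unfolding blp_def[of "D + D'"]
proof (intro allI impI)
  fix j k assume *: "blp D B E" "blp D' B' F" and "bc (E * F) j k \<noteq> 0"
  then obtain i l where "l \<le> k" "bc E i l \<noteq> 0" "bc F (j - i) (k - l) \<noteq> 0" by (elim bc_mult_nonzero)
  hence "l \<le> k" "l \<le> D \<and> \<bar>i\<bar> \<le> int B" "k - l \<le> D' \<and> \<bar>j - i\<bar> \<le> int B'" using * by (auto simp: blp_def)
  thus "k \<le> D + D' \<and> \<bar>j\<bar> \<le> int (B + B')" by linarith
qed
lemma blp_compose: "r > 0 \<Longrightarrow> blp D B E \<Longrightarrow> blp D (B * r) (fls_compose_power E r)"
  unfolding blp_def
proof (intro allI impI)
  fix j k assume *: "r > 0" "\<forall>j k. bc E j k \<noteq> 0 \<longrightarrow> k \<le> D \<and> \<bar>j\<bar> \<le> int B" "bc (fls_compose_power E r) j k \<noteq> 0"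
  hence "int r dvd j" "bc E (j div int r) k \<noteq> 0" by (auto simp: fls_nth_compose_power split: if_splits)
  then obtain i where i: "j = int r * i" "bc E i k \<noteq> 0" using *(1) by auto
  hence "k \<le> D" "\<bar>i\<bar> \<le> int B" using *(2) by auto
  moreover have "\<bar>j\<bar> = \<bar>i\<bar> * int r" by (simp add: i abs_mult)
  ultimately show "k \<le> D \<and> \<bar>j\<bar> \<le> int (B * r)" by (simp add: mult_right_mono)
qed
lemma blp_gr: assumes "blp D B E" shows "gr A (int (A * D) + int B) E"
  unfolding gr_def
proof (intro allI impI)
  fix j k assume "bc E j k \<noteq> 0"
  hence *: "k \<le> D" "\<bar>j\<bar> \<le> int B" using assms by (auto simp: blp_def)
  have "int (A * k) \<le> int (A * D)" using *(1) by (intro of_nat_mono mult_le_mono2)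
  thus "int (A * k) \<le> j + (int (A * D) + int B)" using *(2) by linarith
qed

lemma lpoly_ent: "lpoly E \<Longrightarrow> ent E" unfolding lpoly_def ent_def using blp_gr by blast
lemma blp_ent: "blp D B E \<Longrightarrow> ent E" using lpoly_ent unfolding lpoly_def by blast
lemma lpoly_add: "lpoly E \<Longrightarrow> lpoly F \<Longrightarrow> lpoly (E + F)"
  unfolding lpoly_def by (meson blp_add blp_mono max.cobounded1 max.cobounded2)
lemma lpoly_mult: "lpoly E \<Longrightarrow> lpoly F \<Longrightarrow> lpoly (E * F)"
  unfolding lpoly_def using blp_mult by blast
lemma lpoly_0 [simp]: "lpoly 0" by (auto simp: lpoly_def blp_def)
lemma lpoly_const [simp]: "lpoly (fls_const p)"
  unfolding lpoly_def by (rule exI[of _ "degree p"], rule exI[of _ 0]) (auto simp: blp_def le_degree split: if_splits)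
lemma lpoly_1 [simp]: "lpoly 1" using lpoly_const[of 1] by simp
lemma lpoly_tt [simp]: "lpoly tt" by (simp add: tt_def)
lemma lpoly_intpow [simp]: "lpoly (fls_shift j 1)"
  unfolding lpoly_def by (rule exI[of _ 0], rule exI[of _ "nat \<bar>j\<bar>"]) (auto simp: blp_def split: if_splits)
lemma lpoly_uminus: "lpoly E \<Longrightarrow> lpoly (- E)" by (auto simp: lpoly_def blp_def)
lemma lpoly_diff: "lpoly E \<Longrightarrow> lpoly F \<Longrightarrow> lpoly (E - F)" using lpoly_add[of E "- F"] lpoly_uminus[of F] by simp
lemma lpoly_power: "lpoly E \<Longrightarrow> lpoly (E ^ n)" by (induction n) (auto intro: lpoly_mult)
lemma lpoly_sum: "(\<And>i. i \<in> S \<Longrightarrow> lpoly (f i)) \<Longrightarrow> lpoly (sum f S)"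
  by (induction S rule: infinite_finite_induct) (auto intro: lpoly_add)
lemma lpoly_compose: "r > 0 \<Longrightarrow> lpoly E \<Longrightarrow> lpoly (fls_compose_power E r)"
  unfolding lpoly_def using blp_compose by blast
lemma ev_blp: assumes "blp D B E" shows "lp (B + e * D) (ev e E)"
  unfolding lp_def
proof (intro allI impI)
  fix j assume "ev e E $$ j \<noteq> 0"
  moreover have "ent E" using assms by (rule blp_ent)
  ultimately obtain i where "bc E (j + int (e * i)) i \<noteq> 0" using ev_nth_nonzero by blast
  hence *: "i \<le> D" "\<bar>j + int (e * i)\<bar> \<le> int B" using assms by (auto simp: blp_def simp del: of_nat_mult)
  have "int (e * i) \<le> int (e * D)" using *(1) by (intro of_nat_mono mult_le_mono2)
  moreover have "int (e * i) \<ge> 0" by simp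
  ultimately show "\<bar>j\<bar> \<le> int (B + e * D)" unfolding of_nat_add using *(2) by linarith
qed

text \<open>For \<open>e > 2 * B\<close> the contributions of different powers of \<open>t\<close>
  occupy disjoint ranges of exponents of \<open>v\<close>, so nothing cancels.\<close>

lemma ev_nonzero_large:
  assumes "blp D B E" "E \<noteq> 0" "e > 2 * B" shows "ev e E \<noteq> 0"
proof -
  have "ent E" using assms(1) by (rule blp_ent)
  obtain j k where jk: "bc E j k \<noteq> 0" using assms(2) bc_eqI[of E 0] by auto
  obtain n0 where n0: "\<And>n. n \<ge> n0 \<Longrightarrow> ev e E $$ (j - int (e * k)) = (\<Sum>i<n. (-1) ^ i * bc E ((j - int (e * k)) + int (e * i)) i)"
    using ev_division(2)[OF \<open>ent E\<close>] by blast
  have "ev e E $$ (j - int (e * k)) = (\<Sum>i<max n0 (Suc k). (-1) ^ i * bc E ((j - int (e * k)) + int (e * i)) i)"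
    by (rule n0) simp
  also have "\<dots> = (\<Sum>i\<in>{k}. (-1) ^ i * bc E ((j - int (e * k)) + int (e * i)) i)"
  proof (rule sum.mono_neutral_right)
    show "\<forall>i\<in>{..<max n0 (Suc k)} - {k}. (-1) ^ i * bc E ((j - int (e * k)) + int (e * i)) i = 0"
    proof
      fix i assume "i \<in> {..<max n0 (Suc k)} - {k}"
      hence "i \<noteq> k" by simp
      have "bc E ((j - int (e * k)) + int (e * i)) i = 0"
      proof (rule ccontr)
        assume "bc E ((j - int (e * k)) + int (e * i)) i \<noteq> 0"
        hence "\<bar>(j - int (e * k)) + int (e * i)\<bar> \<le> int B" "\<bar>j\<bar> \<le> int B"
          using assms(1) jk unfolding blp_def by blast+
        hence "\<bar>int (e * i) - int (e * k)\<bar> \<le> 2 * int B" by linarith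
        moreover have "\<bar>int (e * i) - int (e * k)\<bar> = int e * \<bar>int i - int k\<bar>"
          by (simp add: abs_mult flip: right_diff_distrib)
        moreover have "int e * \<bar>int i - int k\<bar> \<ge> int e * 1" using \<open>i \<noteq> k\<close> by (intro mult_left_mono) auto
        ultimately show False using assms(3) by linarith
      qed
      thus "(-1) ^ i * bc E ((j - int (e * k)) + int (e * i)) i = 0" by simp
    qed
  qed auto
  also have "\<dots> \<noteq> 0" using jk by (cases "even k") auto
  finally show ?thesis by auto
qed

text \<open>Nontrivial relations up to every order yield an exact one. The elimination works by
  cross multiplication, since the scalars form only a domain, later \<open>F_q[t]\<close>.\<close>

lemma bounded_relations:
  fixes v :: "'x \<Rightarrow> int \<Rightarrow> 'r::idom"
  assumes "finite Z" "\<And>B. \<exists>c. (\<exists>x\<in>Z. c x \<noteq> 0) \<and> (\<forall>j<B. (\<Sum>x\<in>Z. c x * v x j) = 0)"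
  shows "\<exists>c. (\<exists>x\<in>Z. c x \<noteq> 0) \<and> (\<forall>j. (\<Sum>x\<in>Z. c x * v x j) = 0)"
  using assms
proof (induction Z arbitrary: v rule: finite_psubset_induct)
  case (psubset Z)
  show ?case
  proof (cases "\<forall>x\<in>Z. \<forall>j. v x j = 0")
    case True
    from psubset.prems[of 0] obtain c :: "'x \<Rightarrow> 'r" where "\<exists>x\<in>Z. c x \<noteq> 0" by blast
    thus ?thesis using True by (intro exI[of _ c]) auto
  next
    case False
    then obtain y p where y: "y \<in> Z" "v y p \<noteq> 0" by auto
    define w where "w x j = v y p * v x j - v x p * v y j" for x j
    have split: "(\<Sum>x\<in>Z. c x * v x j) = c y * v y j + (\<Sum>x\<in>Z-{y}. c x * v x j)" for c j
      using y psubset.hyps by (subst sum.remove[of _ y]) auto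
    have wsum: "(\<Sum>x\<in>Z-{y}. c x * w x j) = v y p * (\<Sum>x\<in>Z-{y}. c x * v x j) - (\<Sum>x\<in>Z-{y}. c x * v x p) * v y j" for c j
      by (simp add: w_def right_diff_distrib sum_subtractf sum_distrib_left sum_distrib_right mult_ac)
    have "\<exists>c. (\<exists>x\<in>Z-{y}. c x \<noteq> 0) \<and> (\<forall>j. (\<Sum>x\<in>Z-{y}. c x * w x j) = 0)"
    proof (rule psubset.IH)
      show "Z - {y} \<subset> Z" using y by auto
      fix B
      \<comment> \<open>The bound is raised past the pivot position \<open>p\<close>, so that the
        relation there determines \<open>c y\<close>.\<close>
      obtain c where c: "\<exists>x\<in>Z. c x \<noteq> 0" "\<And>j. j < max B (p + 1) \<Longrightarrow> (\<Sum>x\<in>Z. c x * v x j) = 0"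
        using psubset.prems by blast
      have p0: "(\<Sum>x\<in>Z-{y}. c x * v x p) = - (c y * v y p)" using c(2)[of p] split[of c p] by (simp add: eq_neg_iff_add_eq_0 add.commute)
      have "(\<Sum>x\<in>Z-{y}. c x * w x j) = 0" if "j < B" for j
      proof -
        have "(\<Sum>x\<in>Z-{y}. c x * v x j) = - (c y * v y j)" using c(2)[of j] split[of c j] that by (simp add: eq_neg_iff_add_eq_0 add.commute)
        thus ?thesis unfolding wsum p0 by simp
      qed
      moreover have "\<exists>x\<in>Z-{y}. c x \<noteq> 0"
      proof (rule ccontr)
        assume "\<not> ?thesis"
        hence *: "\<forall>x\<in>Z-{y}. c x = 0" by blast
        hence "c y * v y p = 0" using p0 by simp
        hence "c y = 0" using y by simp
        thus False using * c(1) by auto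
      qed
      ultimately show "\<exists>c. (\<exists>x\<in>Z-{y}. c x \<noteq> 0) \<and> (\<forall>j<B. (\<Sum>x\<in>Z-{y}. c x * w x j) = 0)" by blast
    qed
    then obtain c where c: "\<exists>x\<in>Z-{y}. c x \<noteq> 0" "\<And>j. (\<Sum>x\<in>Z-{y}. c x * w x j) = 0" by blast
    define c' where "c' x = (if x = y then - (\<Sum>x\<in>Z-{y}. c x * v x p) else v y p * c x)" for x
    have "(\<Sum>x\<in>Z. c' x * v x j) = 0" for j
    proof -
      have "(\<Sum>x\<in>Z-{y}. c' x * v x j) = v y p * (\<Sum>x\<in>Z-{y}. c x * v x j)"
        unfolding sum_distrib_left by (rule sum.cong) (auto simp: c'_def)
      thus ?thesis using wsum[of c j] c(2)[of j] by (simp add: split c'_def)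
    qed
    moreover have "\<exists>x\<in>Z. c' x \<noteq> 0" using c(1) y by (auto simp: c'_def)
    ultimately show ?thesis by blast
  qed
qed

lemma sum_powers_le:
  assumes "q \<ge> (2::nat)" shows "(\<Sum>\<nu>\<le>N. q ^ \<nu>) \<le> 2 * q ^ N"
proof (induction N)
  case (Suc N)
  have "2 * q ^ N \<le> q ^ Suc N" using assms by simp
  thus ?case using Suc unfolding sum.atMost_Suc by linarith
qed simp

text \<open>The left-hand side counts conditions, the right-hand side unknowns. There are only
  \<open>n - 1\<close> conditions per point, and
  \<open>(D + 1) / (N + 1) = (2 * n - 1) / (2 * n)\<close> lies strictly between
  \<open>(n - 1) / n\<close> and \<open>1\<close>: unknowns outnumber conditions although
  \<open>D < N\<close>. \<open>H\<close> is such that \<open>C\<close> and \<open>e0\<close>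
  contribute at most \<open>(n - 1) * s * M * H\<close> on the left, less than the surplus
  \<open>n * s * (H * M + 1)\<close>.\<close>

lemma pigeonhole_exponents:
  fixes n s C H M e0 D N :: nat
  assumes "n \<ge> 1" "s \<ge> 1" "N + 1 = 2 * n * s" "D + 1 = (2 * n - 1) * s" "H = 4 * n * C + 4 * n * e0"
    and P: "P \<le> 2 * M"
  shows "(n - 1) * ((N + 1) * ((2 * C + H) * M + 1) + e0 * D * P) < n * ((D + 1) * (H * M + 1))"
proof -
  obtain m where m: "n = Suc m" using assms(1) by (cases n) auto
  have D: "D + 1 = (2 * m + 1) * s" using assms(4) m by simp
  have "D \<le> 2 * n * s" using D m by simp
  have "e0 * D * P \<le> e0 * (2 * n * s) * (2 * M)" 
    by (intro mult_le_mono le_refl \<open>D \<le> 2 * n * s\<close> P)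
  hence "m * ((N + 1) * ((2 * C + H) * M + 1) + e0 * D * P)
      \<le> m * ((2 * n * s) * ((2 * C + H) * M + 1) + e0 * (2 * n * s) * (2 * M))"
    unfolding assms(3) by (intro mult_le_mono2 add_left_mono)
  also have "\<dots> = m * (2 * n * s * (H * M + 1)) + m * (s * M * H)"
    unfolding assms(5) by (simp add: algebra_simps)
  also have "\<dots> < n * ((2 * m + 1) * s * (H * M + 1))"
  proof -
    have "n * ((2 * m + 1) * s * (H * M + 1)) = m * (2 * n * s * (H * M + 1)) + n * (s * (H * M + 1))"
      by (simp add: algebra_simps)
    moreover have "m * (s * M * H) < n * (s * (H * M + 1))"
      using assms(2) by (simp add: m algebra_simps)
    ultimately show ?thesis by linarith
  qed
  finally show ?thesis using D m by simp
qed

lemma card_bounded_support: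
  fixes A B :: nat
  defines "Z \<equiv> {f :: 'a::{finite,zero} fls. \<forall>j. f $$ j \<noteq> 0 \<longrightarrow> - int A \<le> j \<and> j \<le> int B}"
  shows "finite Z" "card Z \<le> CARD('a) ^ (A + B + 1)"
proof -
  let ?J = "{- int A..int B}"
  let ?F = "PiE ?J (\<lambda>_. UNIV :: 'a set)"
  have inj: "inj_on (\<lambda>f. restrict (fls_nth f) ?J) Z"
  proof (rule inj_onI)
    fix f g assume fg: "f \<in> Z" "g \<in> Z" "restrict (fls_nth f) ?J = restrict (fls_nth g) ?J"
    show "f = g"
    proof (rule fls_eqI)
      fix j show "f $$ j = g $$ j"
      proof (cases "j \<in> ?J")
        case True
        thus ?thesis using fun_cong[OF fg(3), of j] by simp
      next
        case False
        hence "f $$ j = 0" "g $$ j = 0" using fg(1,2) unfolding Z_def by auto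
        thus ?thesis by simp
      qed
    qed
  qed
  have sub: "(\<lambda>f. restrict (fls_nth f) ?J) ` Z \<subseteq> ?F" by auto
  have fin: "finite ?F" by (intro finite_PiE) auto
  show "finite Z" using inj sub fin by (metis finite_imageD finite_subset)
  have "card Z \<le> card ?F" using inj sub fin by (rule card_inj_on_le)
  also have "card ?F = CARD('a) ^ card ?J" by (simp add: card_PiE)
  also have "card ?J = A + B + 1" by simp
  finally show "card Z \<le> CARD('a) ^ (A + B + 1)" .
qed

text \<open>Over a finite field the pigeonhole principle can count elements: two choices of
  coefficients give the same values, and their difference is the solution. Proportionality to
  \<open>r \<nu>\<close> is tested against one index \<open>k0 \<nu>\<close> with nonzero entry.
  Only nonpositive exponents of \<open>v\<close> occur, so the \<open>P i\<close> are polynomials in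
  \<open>t\<close> and \<open>w\<close>.\<close>

lemma auxiliary_polynomials:
  fixes r :: "nat \<Rightarrow> 'i \<Rightarrow> 'a::{finite,field} fls" and e :: "nat \<Rightarrow> nat"
  assumes I: "finite I" "I \<noteq> {}" and n: "n = card I"
    and r: "\<And>\<nu> i. \<nu> \<le> N \<Longrightarrow> i \<in> I \<Longrightarrow> lp (C * M) (r \<nu> i)" "\<And>\<nu>. \<nu> \<le> N \<Longrightarrow> \<exists>i\<in>I. r \<nu> i \<noteq> 0"
    and s: "s \<ge> 1" "N + 1 = 2 * n * s" "D + 1 = (2 * n - 1) * s" and H: "H = 4 * n * C + 4 * n * e0"
    and e: "(\<Sum>\<nu>\<le>N. e \<nu>) \<le> e0 * (2 * M)"
  shows "\<exists>P. (\<forall>i\<in>I. \<forall>j k. bc (P i) j k \<noteq> 0 \<longrightarrow> k \<le> D \<and> - int (H * M) \<le> j \<and> j \<le> 0) \<and> (\<exists>i\<in>I. P i \<noteq> 0)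
     \<and> (\<forall>\<nu>\<le>N. \<exists>k\<in>I. r \<nu> k \<noteq> 0 \<and> (\<forall>i\<in>I. r \<nu> k * ev (e \<nu>) (P i) = r \<nu> i * ev (e \<nu>) (P k)))"
proof -
  let ?B = "I \<times> {..D} \<times> {..H * M}"
  let ?Dom = "PiE ?B (\<lambda>_. UNIV :: 'a set)"
  define P0 :: "('i \<times> nat \<times> nat \<Rightarrow> 'a) \<Rightarrow> 'i \<Rightarrow> 'a poly fls" where
    "P0 c i = (SOME P. \<forall>j k. bc P j k = (if k \<le> D \<and> - int (H * M) \<le> j \<and> j \<le> 0 then c (i, k, nat (- j)) else 0))" for c i
  have ex: "\<exists>P. \<forall>j k. bc P j k = (if k \<le> D \<and> - int (H * M) \<le> j \<and> j \<le> 0 then c (i, k, nat (- j)) else (0::'a))" for c and i :: 'i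
    by (rule bc_build[of _ "- int (H * M)"]) (auto split: if_splits intro!: exI[of _ D])
  have P0: "bc (P0 c i) j k = (if k \<le> D \<and> - int (H * M) \<le> j \<and> j \<le> 0 then c (i, k, nat (- j)) else (0::'a))" for c i j k
    using someI_ex[OF ex[of c i]] unfolding P0_def by blast
  obtain k0 where k0: "\<And>\<nu>. \<nu> \<le> N \<Longrightarrow> k0 \<nu> \<in> I \<and> r \<nu> (k0 \<nu>) \<noteq> 0" using r(2) by metis
  have shape: "blp D (H * M) (P0 c i)" for c i unfolding blp_def P0 by auto
  have Pent: "ent (P0 c i)" for c i using shape lpoly_ent unfolding lpoly_def by blast
  define val where "val c \<nu> i = r \<nu> (k0 \<nu>) * ev (e \<nu>) (P0 c i) - r \<nu> i * ev (e \<nu>) (P0 c (k0 \<nu>))" for c \<nu> i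
  \<comment> \<open>Evaluation at \<open>t = - v ^ (- e \<nu>)\<close> lowers exponents by at most
    \<open>e \<nu> * D\<close>; a factor \<open>r \<nu> i\<close> moves them by at most
    \<open>C * M\<close> in either direction.\<close>
  let ?Z = "\<lambda>\<nu>. {f :: 'a fls. \<forall>j. f $$ j \<noteq> 0 \<longrightarrow> - int (C * M + H * M + e \<nu> * D) \<le> j \<and> j \<le> int (C * M)}"
  let ?J = "Sigma {..N} (\<lambda>\<nu>. I - {k0 \<nu>})"
  let ?Cod = "PiE ?J (\<lambda>(\<nu>, i). ?Z \<nu>)"
  have range: "val c \<nu> i \<in> ?Z \<nu>" if \<nu>: "\<nu> \<le> N" and i: "i \<in> I" for c \<nu> i
  proof -
    have evP: "- int (H * M + e \<nu> * D) \<le> j \<and> j \<le> 0" if nz: "ev (e \<nu>) (P0 c i) $$ j \<noteq> 0" for j i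
    proof -
      obtain l where "bc (P0 c i) (j + int (e \<nu> * l)) l \<noteq> 0" using ev_nth_nonzero[OF Pent nz] by blast
      hence *: "l \<le> D" "- int (H * M) \<le> j + int (e \<nu> * l)" "j + int (e \<nu> * l) \<le> 0" unfolding P0 by (auto split: if_splits simp del: of_nat_mult)
      have "int (e \<nu> * l) \<le> int (e \<nu> * D)" using *(1) by (intro of_nat_mono mult_le_mono2)
      thus ?thesis using *(2,3) by (smt (verit) of_nat_0_le_iff of_nat_add)
    qed
    have prod: "- int (C * M + H * M + e \<nu> * D) \<le> j \<and> j \<le> int (C * M)"
      if "i1 \<in> I" "(r \<nu> i1 * ev (e \<nu>) (P0 c i2)) $$ j \<noteq> 0" for i1 i2 j
    proof -
      from that(2) obtain l where l: "r \<nu> i1 $$ l \<noteq> 0" "ev (e \<nu>) (P0 c i2) $$ (j - l) \<noteq> 0"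
        by (rule fls_times_nonzero_nth)
      have "\<bar>l\<bar> \<le> int (C * M)" using r(1)[OF \<nu> that(1)] l(1) unfolding lp_def by blast
      with evP[OF l(2)] show ?thesis by (smt (verit) of_nat_add)
    qed
    show ?thesis
    proof (rule CollectI, intro allI impI)
      fix j assume "val c \<nu> i $$ j \<noteq> 0"
      hence "(r \<nu> (k0 \<nu>) * ev (e \<nu>) (P0 c i)) $$ j \<noteq> 0 \<or> (r \<nu> i * ev (e \<nu>) (P0 c (k0 \<nu>))) $$ j \<noteq> 0"
        by (auto simp: val_def)
      thus "- int (C * M + H * M + e \<nu> * D) \<le> j \<and> j \<le> int (C * M)" using prod i k0[OF \<nu>] by blast
    qed
  qed
  define F where "F c = restrict (\<lambda>(\<nu>, i). val c \<nu> i) ?J" for c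
  have FD: "F ` ?Dom \<subseteq> ?Cod"
  proof (rule image_subsetI)
    fix c
    have "(case x of (\<nu>, i) \<Rightarrow> val c \<nu> i) \<in> (case x of (\<nu>, i) \<Rightarrow> ?Z \<nu>)" if "x \<in> ?J" for x
      using range[of "fst x" "snd x" c] that by (cases x) simp
    thus "F c \<in> ?Cod" unfolding F_def restrict_PiE_iff by blast
  qed
  have finZ: "finite (?Z \<nu>)" for \<nu> by (rule card_bounded_support(1))
  have finC: "finite ?Cod" using I finZ by (intro finite_PiE) auto
  have cardJ: "card (I - {k0 \<nu>}) = n - 1" if "\<nu> \<le> N" for \<nu> using k0[OF that] I n by (subst card_Diff_singleton) auto
  have "card ?Cod = (\<Prod>x\<in>?J. card (case x of (\<nu>, i) \<Rightarrow> ?Z \<nu>))" using I by (subst card_PiE) auto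
  also have "\<dots> = (\<Prod>\<nu>\<le>N. \<Prod>i\<in>I - {k0 \<nu>}. card (?Z \<nu>))"
    by (subst prod.Sigma) (use I in \<open>auto intro!: prod.cong simp: case_prod_unfold\<close>)
  also have "\<dots> = (\<Prod>\<nu>\<le>N. card (?Z \<nu>) ^ (n - 1))" by (rule prod.cong) (auto simp: cardJ)
  also have "\<dots> \<le> (\<Prod>\<nu>\<le>N. (CARD('a) ^ ((C * M + H * M + e \<nu> * D) + C * M + 1)) ^ (n - 1))"
    by (intro prod_mono conjI power_mono card_bounded_support(2)) auto
  also have "\<dots> = CARD('a) ^ (\<Sum>\<nu>\<le>N. (n - 1) * ((2 * C + H) * M + 1 + e \<nu> * D))"
  proof -
    have "((C * M + H * M + x * D) + C * M + 1) * k = k * ((2 * C + H) * M + 1 + x * D)" for k x :: nat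
      by (simp add: algebra_simps)
    thus ?thesis by (simp only: power_sum power_mult[symmetric])
  qed
  also have "(\<Sum>\<nu>\<le>N. (n - 1) * ((2 * C + H) * M + 1 + e \<nu> * D)) = (n - 1) * ((N + 1) * ((2 * C + H) * M + 1) + D * (\<Sum>\<nu>\<le>N. e \<nu>))"
    by (simp only: sum_distrib_left[symmetric] sum.distrib sum_constant card_atMost Suc_eq_plus1 of_nat_id
          sum_distrib_right[symmetric] mult.commute[of D], simp only: distrib_left, simp only: mult_ac)
  also have "CARD('a) ^ \<dots> \<le> CARD('a) ^ ((n - 1) * ((N + 1) * ((2 * C + H) * M + 1) + e0 * D * (2 * M)))"
    using mult_le_mono2[OF e, of D] by (intro power_increasing mult_le_mono2 add_left_mono) (auto simp: mult_ac)
  also have "\<dots> < CARD('a) ^ (n * ((D + 1) * (H * M + 1)))"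
  proof (rule power_strict_increasing)
    have "n \<ge> 1" using I n by (simp add: Suc_leI card_gt_0_iff)
    from pigeonhole_exponents[OF this s H order_refl]
    show "(n - 1) * ((N + 1) * ((2 * C + H) * M + 1) + e0 * D * (2 * M)) < n * ((D + 1) * (H * M + 1))" .
    have "card {0, 1 :: 'a} \<le> CARD('a)" by (intro card_mono) auto
    thus "1 < CARD('a)" by simp
  qed
  also have "\<dots> = card ?Dom" using I by (simp add: card_PiE card_cartesian_product n)
  finally have "card ?Cod < card ?Dom" .
  moreover have "card (F ` ?Dom) \<le> card ?Cod" using FD finC by (rule card_mono[rotated])
  ultimately have "\<not> inj_on F ?Dom" by (intro pigeonhole) linarith
  then obtain c c' where c: "c \<in> ?Dom" "c' \<in> ?Dom" "c \<noteq> c'" "F c = F c'" by (auto simp: inj_on_def)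
  define P where "P i = P0 c i - P0 c' i" for i
  have Pbc: "k \<le> D \<and> - int (H * M) \<le> j \<and> j \<le> 0" if "bc (P i) j k \<noteq> 0" for i j k
    using that unfolding P_def by (auto simp: P0 split: if_splits)
  have "\<exists>i\<in>I. P i \<noteq> 0"
  proof -
    obtain x where x: "c x \<noteq> c' x" using c(3) unfolding fun_eq_iff by blast
    have "x \<in> ?B" using x c(1,2) by (metis PiE_arb)
    then obtain i k b where ikb: "x = (i, k, b)" "i \<in> I" "k \<le> D" "b \<le> H * M" by auto
    have "bc (P i) (- int b) k \<noteq> 0" using x ikb by (simp add: P_def P0 flip: of_nat_mult)
    hence "P i \<noteq> 0" by auto
    thus ?thesis using ikb by blast
  qed
  moreover have "\<exists>k\<in>I. r \<nu> k \<noteq> 0 \<and> (\<forall>i\<in>I. r \<nu> k * ev (e \<nu>) (P i) = r \<nu> i * ev (e \<nu>) (P k))" if \<nu>: "\<nu> \<le> N" for \<nu>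
  proof (intro bexI[of _ "k0 \<nu>"] conjI ballI)
    show "k0 \<nu> \<in> I" "r \<nu> (k0 \<nu>) \<noteq> 0" using k0[OF \<nu>] by auto
    fix i assume i: "i \<in> I"
    show "r \<nu> (k0 \<nu>) * ev (e \<nu>) (P i) = r \<nu> i * ev (e \<nu>) (P (k0 \<nu>))"
    proof (cases "i = k0 \<nu>")
      case False
      hence "val c \<nu> i = val c' \<nu> i" using fun_cong[OF c(4), of "(\<nu>, i)"] \<nu> i by (simp add: F_def)
      thus ?thesis by (simp add: val_def P_def ev_diff Pent algebra_simps)
    qed simp
  qed
  ultimately show ?thesis using Pbc by blast
qed

lemma fls_sum_nth: "(\<Sum>x\<in>S. f x) $$ j = (\<Sum>x\<in>S. (f x :: 'r::comm_ring_1 fls) $$ j)"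
  by (induction S rule: infinite_finite_induct) auto

text \<open>The relation between the values is transported to a relation \<open>r \<nu>\<close> between the values of the \<open>\<tau> ^ N\<close>-images of the
  \<open>\<psi> i\<close> at each point \<open>t = theta ^ (q ^ \<nu>)\<close> with \<open>\<nu> \<le> N\<close>. For \<open>E\<close>, the combination of these images with
  coefficients \<open>P i\<close>, to vanish there it suffices that the values of the \<open>P i\<close> are proportional to \<open>r \<nu>\<close>. These
  are only \<open>card I - 1\<close> linear conditions, which is why the number of unknowns suffices.\<close>

theorem values_linearly_independent:
  fixes \<psi> :: "'i \<Rightarrow> 'a::{finite,field} poly fls" and \<Phi> \<Phi>' :: "'i \<Rightarrow> 'i \<Rightarrow> 'a poly fls"
    and q e0 s0 :: nat
  defines "a0 \<equiv> tt + fls_shift (int (e0 * q)) (1 :: 'a poly fls)"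
  assumes q: "q \<ge> 2" "e0 \<ge> 1" and I: "finite I" and ent: "\<And>i. i \<in> I \<Longrightarrow> ent (\<psi> i)"
    and sys: "\<And>i. i \<in> I \<Longrightarrow> \<psi> i = (\<Sum>m\<in>I. \<Phi> i m * fls_compose_power (\<psi> m) q)"
    and inv: "\<And>i. i \<in> I \<Longrightarrow> a0 ^ s0 * fls_compose_power (\<psi> i) q = (\<Sum>m\<in>I. \<Phi>' i m * \<psi> m)"
    and \<Phi>: "\<And>i m. lpoly (\<Phi> i m)" "\<And>i m. lpoly (\<Phi>' i m)"
    and indep: "\<And>c. (\<And>i. i \<in> I \<Longrightarrow> lpoly (c i)) \<Longrightarrow> (\<Sum>i\<in>I. c i * \<psi> i) = 0 \<Longrightarrow> \<forall>i\<in>I. c i = 0"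
    and \<rho>: "\<And>i. i \<in> I \<Longrightarrow> lp B0 (\<rho> i)" "(\<Sum>i\<in>I. \<rho> i * ev e0 (\<psi> i)) = 0"
  shows "\<forall>i\<in>I. \<rho> i = 0"
proof (rule ccontr)
  assume nz: "\<not> (\<forall>i\<in>I. \<rho> i = 0)"
  define T where "T i E = fls_compose_power E (q ^ i)" for i and E :: "'a poly fls"
  have qp: "q ^ i > 0" "q > 0" for i using q by auto
  have T_add: "T i (E + F) = T i E + T i F" and T_mult: "T i (E * F) = T i E * T i F"
    and T_sum: "T i (sum f S) = (\<Sum>x\<in>S. T i (f x))" and T_0 [simp]: "T i 0 = 0" for i E F f and S :: "'i set"
    by (induction S rule: infinite_finite_induct) (auto simp: T_def)
  have T_Suc: "T i (fls_compose_power E q) = T (Suc i) E" for i E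
    using q unfolding T_def by (intro fls_eqI)
      (auto simp: fls_nth_compose_power zdvd_mult_cancel1 dvd_div_iff_mult mult.commute
            div_mult2_eq[symmetric] zdiv_zmult2_eq intro: dvd_mult_left)
  have T_ent: "ent E \<Longrightarrow> ent (T i E)" for i E unfolding T_def using qp by (intro ent_compose)
  have T_lpoly: "lpoly E \<Longrightarrow> lpoly (T i E)" for i E unfolding T_def using qp by (intro lpoly_compose)
  define e where "e \<nu> = e0 * q ^ \<nu>" for \<nu>
  \<comment> \<open>Linear independence of the \<open>\<psi>\<close> forces the matrix product of
    \<open>\<Phi>\<close> and \<open>\<Phi>'\<close> to be the scalar \<open>a0 ^ s0\<close>; this
    keeps transported relations nontrivial.\<close>
  have inverse: "(\<Sum>m\<in>I. \<Phi> i m * \<Phi>' m l) = (if i = l then a0 ^ s0 else 0)" if il: "i \<in> I" "l \<in> I" for i l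
  proof -
    have "(\<Sum>l\<in>I. ((\<Sum>m\<in>I. \<Phi> i m * \<Phi>' m l) - (if i = l then a0 ^ s0 else 0)) * \<psi> l)
        = (\<Sum>l\<in>I. \<Sum>m\<in>I. \<Phi> i m * \<Phi>' m l * \<psi> l) - (\<Sum>l\<in>I. (if i = l then a0 ^ s0 else 0) * \<psi> l)"
      by (simp add: left_diff_distrib sum_subtractf sum_distrib_right)
    also have "(\<Sum>l\<in>I. (if i = l then a0 ^ s0 else 0) * \<psi> l) = a0 ^ s0 * \<psi> i"
      using il(1) I by (simp add: if_distrib[of "\<lambda>x. x * _"] cong: if_cong)
    also have "(\<Sum>l\<in>I. \<Sum>m\<in>I. \<Phi> i m * \<Phi>' m l * \<psi> l) = (\<Sum>m\<in>I. \<Phi> i m * (\<Sum>l\<in>I. \<Phi>' m l * \<psi> l))"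
      by (subst sum.swap) (simp add: sum_distrib_left mult.assoc)
    also have "\<dots> = (\<Sum>m\<in>I. \<Phi> i m * (a0 ^ s0 * fls_compose_power (\<psi> m) q))"
      by (rule sum.cong) (auto simp: inv)
    also have "\<dots> = a0 ^ s0 * (\<Sum>m\<in>I. \<Phi> i m * fls_compose_power (\<psi> m) q)"
      by (simp add: sum_distrib_left mult_ac)
    also have "\<dots> = a0 ^ s0 * \<psi> i" using sys[OF il(1)] by simp
    finally have "(\<Sum>l\<in>I. ((\<Sum>m\<in>I. \<Phi> i m * \<Phi>' m l) - (if i = l then a0 ^ s0 else 0)) * \<psi> l) = 0" by simp
    hence "\<forall>l\<in>I. (\<Sum>m\<in>I. \<Phi> i m * \<Phi>' m l) - (if i = l then a0 ^ s0 else 0) = 0"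
      by (intro indep) (auto intro!: lpoly_diff lpoly_sum lpoly_mult \<Phi> lpoly_power lpoly_add simp: a0_def)
    thus ?thesis using il by simp
  qed
  obtain D1 B1 where \<Phi>b: "\<And>i m. i \<in> I \<Longrightarrow> m \<in> I \<Longrightarrow> blp D1 B1 (\<Phi> i m)"
  proof -
    obtain d b where db: "\<And>i m. blp (d i m) (b i m) (\<Phi> i m)" using \<Phi>(1) unfolding lpoly_def by metis
    have "blp (\<Sum>i\<in>I. \<Sum>m\<in>I. d i m) (\<Sum>i\<in>I. \<Sum>m\<in>I. b i m) (\<Phi> i m)" if "i \<in> I" "m \<in> I" for i m
    proof -
      have le: "f i m \<le> (\<Sum>i\<in>I. \<Sum>m\<in>I. f i m)" for f :: "'i \<Rightarrow> 'i \<Rightarrow> nat"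
        using member_le_sum[of m I "f i"] member_le_sum[of i I "\<lambda>i. \<Sum>m\<in>I. f i m"] that I by fastforce
      show ?thesis by (rule blp_mono[OF db le le])
    qed
    thus ?thesis using that by blast
  qed
  \<comment> \<open>With this \<open>C\<close> one step of the transport costs at most
    \<open>C * q ^ i\<close>, and \<open>2 \<le> q\<close> lets the bound \<open>C * q ^ i\<close>
    grow by that much.\<close>
  define C where "C = B0 + B1 + e0 * D1"
  have relation: "\<exists>r. (\<forall>m\<in>I. lp (C * q ^ i) (r m)) \<and> (\<exists>m\<in>I. r m \<noteq> 0) \<and> (\<Sum>m\<in>I. r m * ev (e \<nu>) (T i (\<psi> m))) = 0"
    if "\<nu> \<le> i" for \<nu> i
    using that
  proof (induction i rule: dec_induct)
    case base
    have Tcc: "fls_compose_power (ev e0 (\<psi> m)) (q ^ \<nu>) = ev (e \<nu>) (T \<nu> (\<psi> m))" if "m \<in> I" for m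
      unfolding e_def T_def by (rule ev_compose[symmetric]) (use qp ent that in auto)
    let ?r = "\<lambda>m. fls_compose_power (\<rho> m) (q ^ \<nu>)"
    have "lp (C * q ^ \<nu>) (?r m)" if m: "m \<in> I" for m
      unfolding lp_def
    proof (intro allI impI)
      fix j assume "?r m $$ j \<noteq> 0"
      hence *: "int (q ^ \<nu>) dvd j" "\<rho> m $$ (j div int (q ^ \<nu>)) \<noteq> 0"
        using qp by (auto simp: fls_nth_compose_power split: if_splits)
      then obtain l where l: "j = int (q ^ \<nu>) * l" by auto
      have "\<bar>l\<bar> \<le> int B0" using * \<rho>(1)[OF m] l q by (auto simp: lp_def)
      moreover have "B0 \<le> C" by (simp add: C_def)
      ultimately have "\<bar>l\<bar> \<le> int C" by linarith
      hence "\<bar>l\<bar> * int (q ^ \<nu>) \<le> int C * int (q ^ \<nu>)" by (rule mult_right_mono) simp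
      thus "\<bar>j\<bar> \<le> int (C * q ^ \<nu>)" unfolding l by (simp add: abs_mult mult.commute)
    qed
    moreover have "\<exists>m\<in>I. ?r m \<noteq> 0"
    proof -
      obtain m j where "m \<in> I" "\<rho> m $$ j \<noteq> 0" using nz by (meson fls_zero_eqI)
      hence "?r m $$ (int (q ^ \<nu>) * j) \<noteq> 0" using qp q by (simp add: fls_nth_compose_power)
      thus ?thesis using \<open>m \<in> I\<close> by force
    qed
    moreover have "(\<Sum>m\<in>I. ?r m * ev (e \<nu>) (T \<nu> (\<psi> m))) = 0"
    proof -
      have "(\<Sum>m\<in>I. ?r m * ev (e \<nu>) (T \<nu> (\<psi> m))) = (\<Sum>m\<in>I. fls_compose_power (\<rho> m * ev e0 (\<psi> m)) (q ^ \<nu>))"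
        by (rule sum.cong) (auto simp: Tcc)
      also have "\<dots> = fls_compose_power (\<Sum>m\<in>I. \<rho> m * ev e0 (\<psi> m)) (q ^ \<nu>)"
        using I by (induction I rule: finite_induct) auto
      finally show ?thesis by (simp add: \<rho>(2))
    qed
    ultimately show ?case by (intro exI[of _ ?r]) blast
  next
    case (step i)
    then obtain r where r: "\<And>m. m \<in> I \<Longrightarrow> lp (C * q ^ i) (r m)" "\<exists>m\<in>I. r m \<noteq> 0"
      "(\<Sum>m\<in>I. r m * ev (e \<nu>) (T i (\<psi> m))) = 0" by blast
    \<comment> \<open>The row vector \<open>r\<close> is multiplied by the twisted matrix
      \<open>\<Phi>\<close>, in accordance with \<open>sys\<close>.\<close>
    define r' where "r' l = (\<Sum>m\<in>I. r m * ev (e \<nu>) (T i (\<Phi> m l)))" for l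
    have ent\<Phi>: "ent (T i (\<Phi> m l))" "ent (T i (\<Phi>' m l))" for m l
      by (rule T_ent, rule lpoly_ent, rule \<Phi>)+
    have "lp (C * q ^ Suc i) (r' l)" if l: "l \<in> I" for l
      unfolding r'_def
    proof (rule lp_sum)
      fix m assume m: "m \<in> I"
      have "blp D1 (B1 * q ^ i) (T i (\<Phi> m l))" unfolding T_def by (rule blp_compose[OF qp(1) \<Phi>b[OF m l]])
      hence "lp (C * q ^ i + (B1 * q ^ i + e \<nu> * D1)) (r m * ev (e \<nu>) (T i (\<Phi> m l)))"
        by (intro lp_mult r(1)[OF m] ev_blp)
      moreover have "C * q ^ i + (B1 * q ^ i + e \<nu> * D1) \<le> C * q ^ Suc i"
      proof -
        have "q ^ \<nu> \<le> q ^ i" using step q by (intro power_increasing) auto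
        hence "e \<nu> * D1 \<le> e0 * q ^ i * D1" unfolding e_def by (intro mult_le_mono1 mult_le_mono2)
        moreover have "C * q ^ i = B0 * q ^ i + B1 * q ^ i + e0 * q ^ i * D1" by (simp add: C_def algebra_simps)
        ultimately have "B1 * q ^ i + e \<nu> * D1 \<le> C * q ^ i" by linarith
        moreover have "2 * (C * q ^ i) \<le> q * (C * q ^ i)" using q by (intro mult_le_mono1)
        moreover have "q * (C * q ^ i) = C * q ^ Suc i" by simp
        ultimately show ?thesis by linarith
      qed
      ultimately show "lp (C * q ^ Suc i) (r m * ev (e \<nu>) (T i (\<Phi> m l)))" by (rule lp_mono)
    qed
    moreover have "\<exists>l\<in>I. r' l \<noteq> 0"
    proof (rule ccontr)
      assume "\<not> ?thesis"
      hence z: "r' l = 0" if "l \<in> I" for l using that by blast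
      obtain k where k: "k \<in> I" "r k \<noteq> 0" using r(2) by blast
      have "0 = (\<Sum>l\<in>I. r' l * ev (e \<nu>) (T i (\<Phi>' l k)))" using z by (intro sum.neutral[symmetric]) simp
      also have "\<dots> = (\<Sum>l\<in>I. \<Sum>m\<in>I. r m * ev (e \<nu>) (T i (\<Phi> m l * \<Phi>' l k)))"
        unfolding r'_def sum_distrib_right by (intro sum.cong refl) (simp add: T_mult ev_mult ent\<Phi> mult.assoc)
      also have "\<dots> = (\<Sum>m\<in>I. \<Sum>l\<in>I. r m * ev (e \<nu>) (T i (\<Phi> m l * \<Phi>' l k)))" by (rule sum.swap)
      also have "\<dots> = (\<Sum>m\<in>I. r m * ev (e \<nu>) (T i (\<Sum>l\<in>I. \<Phi> m l * \<Phi>' l k)))"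
      proof (rule sum.cong[OF refl])
        fix m assume "m \<in> I"
        have "ev (e \<nu>) (T i (\<Sum>l\<in>I. \<Phi> m l * \<Phi>' l k)) = (\<Sum>l\<in>I. ev (e \<nu>) (T i (\<Phi> m l * \<Phi>' l k)))"
          unfolding T_sum by (rule ev_sum) (simp add: T_mult ent\<Phi> ent_mult)
        thus "(\<Sum>l\<in>I. r m * ev (e \<nu>) (T i (\<Phi> m l * \<Phi>' l k))) = r m * ev (e \<nu>) (T i (\<Sum>l\<in>I. \<Phi> m l * \<Phi>' l k))"
          by (simp add: sum_distrib_left)
      qed
      also have "\<dots> = (\<Sum>m\<in>I. if m = k then r k * ev (e \<nu>) (T i (a0 ^ s0)) else 0)"
        using k by (intro sum.cong refl) (simp add: inverse)
      also have "\<dots> = r k * ev (e \<nu>) (T i (a0 ^ s0))" using k I by simp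
      \<comment> \<open>The twisted factor \<open>T i a0\<close> is
        \<open>t + w ^ (e0 * q ^ Suc i)\<close>; it vanishes only at the point with
        \<open>\<nu> = Suc i\<close>, excluded by \<open>\<nu> \<le> i\<close>.\<close>
      finally have "ev (e \<nu>) (T i (a0 ^ s0)) = 0" using k by simp
      moreover have "T i (a0 ^ s0) = T i a0 ^ s0" unfolding T_def using qp by simp
      moreover have "ent (T i a0)" unfolding a0_def by (intro T_ent ent_add) auto
      ultimately have "ev (e \<nu>) (T i a0) = 0" by (simp add: ev_power)
      moreover have "T i a0 = tt + fls_shift (int (e0 * q ^ Suc i)) 1"
        unfolding a0_def T_def using qp by (simp add: mult_ac)
      ultimately have "fls_shift (int (e0 * q ^ Suc i)) 1 - fls_shift (int (e \<nu>)) (1 :: 'a fls) = 0"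
        by (simp add: ev_add ev_tt)
      hence "(fls_shift (int (e0 * q ^ Suc i)) 1 - fls_shift (int (e \<nu>)) (1 :: 'a fls)) $$ (- int (e \<nu>)) = 0" by simp
      hence "e0 * q ^ Suc i = e \<nu>" by (auto split: if_splits simp del: of_nat_mult of_nat_power power_Suc)
      hence "q ^ Suc i = q ^ \<nu>" using q by (simp add: e_def)
      hence "Suc i = \<nu>" using q by (metis One_nat_def Suc_1 Suc_le_lessD power_inject_exp)
      thus False using step by simp
    qed
    moreover have "(\<Sum>l\<in>I. r' l * ev (e \<nu>) (T (Suc i) (\<psi> l))) = 0"
    proof -
      have "ev (e \<nu>) (T i (\<psi> m)) = (\<Sum>l\<in>I. ev (e \<nu>) (T i (\<Phi> m l)) * ev (e \<nu>) (T (Suc i) (\<psi> l)))" if m: "m \<in> I" for m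
      proof -
        have "T i (\<psi> m) = (\<Sum>l\<in>I. T i (\<Phi> m l) * T (Suc i) (\<psi> l))"
          by (subst sys[OF m]) (simp add: T_sum T_mult T_Suc)
        thus ?thesis using ent\<Phi> ent by (simp add: ev_sum ev_mult T_ent ent_mult)
      qed
      hence "0 = (\<Sum>m\<in>I. r m * (\<Sum>l\<in>I. ev (e \<nu>) (T i (\<Phi> m l)) * ev (e \<nu>) (T (Suc i) (\<psi> l))))"
        using r(3) by simp
      also have "\<dots> = (\<Sum>m\<in>I. \<Sum>l\<in>I. r m * ev (e \<nu>) (T i (\<Phi> m l)) * ev (e \<nu>) (T (Suc i) (\<psi> l)))"
        by (simp add: sum_distrib_left mult.assoc)
      also have "\<dots> = (\<Sum>l\<in>I. r' l * ev (e \<nu>) (T (Suc i) (\<psi> l)))"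
        unfolding r'_def sum_distrib_right by (rule sum.swap)
      finally show ?thesis by simp
    qed
    ultimately show ?case by (intro exI[of _ r']) blast
  qed
  have I0: "I \<noteq> {}" using nz by auto
  define n where "n = card I"
  have n1: "n \<ge> 1" using I I0 by (simp add: n_def Suc_leI card_gt_0_iff)
  define H where "H = 4 * n * C + 4 * n * e0"
  let ?Z = "I \<times> {..H}"
  let ?v = "\<lambda>(i, b) j. \<psi> i $$ (j + int b)"
  \<comment> \<open>The shifts of the \<open>\<psi>\<close> by at most \<open>H\<close> are linearly
    independent over \<open>F_q[t]\<close>; by \<open>bounded_relations\<close> this already shows
    below some order \<open>B\<close>, the order that the auxiliary function has to reach.\<close>
  have "\<exists>B. \<not> (\<exists>c. (\<exists>x\<in>?Z. c x \<noteq> 0) \<and> (\<forall>j<B. (\<Sum>x\<in>?Z. c x * ?v x j) = 0))"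
  proof (rule ccontr)
    assume "\<not> ?thesis"
    hence "\<exists>c. (\<exists>x\<in>?Z. c x \<noteq> 0) \<and> (\<forall>j. (\<Sum>x\<in>?Z. c x * ?v x j) = 0)"
      using I by (intro bounded_relations) auto
    then obtain c where c: "\<exists>x\<in>?Z. c x \<noteq> 0" "\<And>j. (\<Sum>x\<in>?Z. c x * ?v x j) = 0" by blast
    define g where "g i = (\<Sum>b\<le>H. fls_const (c (i, b)) * fls_shift (int b) 1)" for i
    have "(\<Sum>i\<in>I. g i * \<psi> i) = 0"
    proof (rule fls_eqI)
      fix j
      have "(\<Sum>i\<in>I. g i * \<psi> i) $$ j = (\<Sum>i\<in>I. \<Sum>b\<le>H. c (i, b) * \<psi> i $$ (j + int b))"
        by (simp add: g_def sum_distrib_right fls_shifted_times_simps mult.assoc fls_sum_nth)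
      also have "\<dots> = (\<Sum>x\<in>?Z. c x * ?v x j)" by (simp add: sum.cartesian_product case_prod_unfold)
      finally show "(\<Sum>i\<in>I. g i * \<psi> i) $$ j = 0 $$ j" using c(2) by simp
    qed
    moreover have "lpoly (g i)" for i unfolding g_def by (intro lpoly_sum lpoly_mult) auto
    ultimately have "\<forall>i\<in>I. g i = 0" by (intro indep)
    moreover have "g i $$ (- int b) = c (i, b)" if "b \<le> H" for i b
    proof -
      have "g i $$ (- int b) = (\<Sum>b'\<le>H. if b' = b then c (i, b') else 0)"
        unfolding g_def fls_sum_nth by (rule sum.cong) auto
      thus ?thesis using that by simp
    qed
    ultimately have "c x = 0" if "x \<in> ?Z" for x using that by (metis SigmaE atMost_iff fls_zero_nth)
    thus False using c(1) by blast
  qed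
  then obtain B where B: "\<And>c x. (\<And>j. j < B \<Longrightarrow> (\<Sum>x\<in>?Z. c x * ?v x j) = 0) \<Longrightarrow> x \<in> ?Z \<Longrightarrow> c x = 0" by blast
  \<comment> \<open>The twist \<open>T N\<close> turns slope \<open>2 * e0\<close> into
    \<open>2 * e0 * M\<close>, so every zero, having \<open>e \<nu> \<le> e0 * M\<close>,
    contributes at least half of the slope to the order of vanishing.\<close>
  obtain C1 where C1: "\<And>i. i \<in> I \<Longrightarrow> gr (2 * e0) (int C1) (\<psi> i)"
  proof -
    have "\<exists>C. gr (2 * e0) (int C) (\<psi> i)" if i: "i \<in> I" for i
    proof -
      obtain C where "gr (2 * e0) C (\<psi> i)" using ent[OF i] by (rule entE)
      hence "gr (2 * e0) (int (nat C)) (\<psi> i)" by (rule gr_mono) simp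
      thus ?thesis by blast
    qed
    then obtain f where f: "\<And>i. i \<in> I \<Longrightarrow> gr (2 * e0) (int (f i)) (\<psi> i)" by metis
    have "gr (2 * e0) (int (\<Sum>i\<in>I. f i)) (\<psi> i)" if "i \<in> I" for i
      by (rule gr_mono[OF f[OF that]]) (use that I in \<open>simp only: of_nat_le_iff member_le_sum\<close>)
    thus ?thesis using that by blast
  qed
  \<comment> \<open>\<open>s\<close> is the free parameter: after the loss caused by the degree
    \<open>D\<close>, the order of vanishing is \<open>M * (2 * e0 * s - H - C1)\<close>, and it has
    to reach \<open>M * B\<close>.\<close>
  define s where "s = Suc (nat \<bar>B\<bar> + H + C1)"
  define N where "N = 2 * n * s - 1"
  define D where "D = (2 * n - 1) * s - 1"
  define M where "M = q ^ N"
  have s1: "s \<ge> 1" by (simp add: s_def)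
  have N1: "N + 1 = 2 * n * s" using n1 s1 by (simp add: N_def)
  have D1: "D + 1 = (2 * n - 1) * s" using n1 s1 by (simp add: D_def)
  have ND: "N = D + s" using N1 D1 n1 by (auto simp: diff_mult_distrib)
  have M0: "M > 0" using q by (simp add: M_def)
  have "\<forall>\<nu>. \<exists>r. \<nu> \<le> N \<longrightarrow> (\<forall>m\<in>I. lp (C * M) (r m)) \<and> (\<exists>m\<in>I. r m \<noteq> 0) \<and> (\<Sum>m\<in>I. r m * ev (e \<nu>) (T N (\<psi> m))) = 0"
    using relation[of _ N] unfolding M_def by blast
  from choice[OF this] obtain r where rr: "\<forall>\<nu>. \<nu> \<le> N \<longrightarrow> (\<forall>m\<in>I. lp (C * M) (r \<nu> m)) \<and> (\<exists>m\<in>I. r \<nu> m \<noteq> 0) \<and> (\<Sum>m\<in>I. r \<nu> m * ev (e \<nu>) (T N (\<psi> m))) = 0"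
    by blast
  have r: "lp (C * M) (r \<nu> m)" "\<exists>m\<in>I. r \<nu> m \<noteq> 0" "(\<Sum>m\<in>I. r \<nu> m * ev (e \<nu>) (T N (\<psi> m))) = 0"
    if "\<nu> \<le> N" "m \<in> I" for \<nu> m
    using rr that by blast+
  have esum: "(\<Sum>\<nu>\<le>N. e \<nu>) \<le> e0 * (2 * M)"
    unfolding e_def M_def sum_distrib_left[symmetric] using sum_powers_le[OF q(1)] by (rule mult_le_mono2)
  obtain k0 where k0: "k0 \<in> I" using I0 by blast
  obtain P where P': "(\<forall>i\<in>I. \<forall>j k. bc (P i) j k \<noteq> 0 \<longrightarrow> k \<le> D \<and> - int (H * M) \<le> j \<and> j \<le> 0) \<and> (\<exists>i\<in>I. P i \<noteq> 0)
     \<and> (\<forall>\<nu>\<le>N. \<exists>k\<in>I. r \<nu> k \<noteq> 0 \<and> (\<forall>i\<in>I. r \<nu> k * ev (e \<nu>) (P i) = r \<nu> i * ev (e \<nu>) (P k)))"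
    using auxiliary_polynomials[where r = r, OF I I0 n_def r(1) r(2)[OF _ k0] s1 N1 D1 H_def esum] by blast
  have P: "\<And>i j k. i \<in> I \<Longrightarrow> bc (P i) j k \<noteq> 0 \<Longrightarrow> k \<le> D \<and> - int (H * M) \<le> j \<and> j \<le> 0"
    "\<exists>i\<in>I. P i \<noteq> 0"
    "\<And>\<nu>. \<nu> \<le> N \<Longrightarrow> \<exists>k\<in>I. r \<nu> k \<noteq> 0 \<and> (\<forall>i\<in>I. r \<nu> k * ev (e \<nu>) (P i) = r \<nu> i * ev (e \<nu>) (P k))"
    using P' by blast+
  define E where "E = (\<Sum>i\<in>I. P i * T N (\<psi> i))"
  have Pent: "ent (P i)" if "i \<in> I" for i
    by (rule blp_ent[of D "H * M"]) (use P(1)[OF that] in \<open>force simp: blp_def\<close>)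
  have T\<psi>: "ent (T N (\<psi> i))" if "i \<in> I" for i using ent[OF that] by (rule T_ent)
  have Eent: "ent E" unfolding E_def using Pent T\<psi> by (intro ent_sum ent_mult)
  have evE: "ev (e \<nu>) E = 0" if \<nu>: "\<nu> \<le> N" for \<nu>
  proof -
    obtain k where k: "k \<in> I" "r \<nu> k \<noteq> 0" "\<And>i. i \<in> I \<Longrightarrow> r \<nu> k * ev (e \<nu>) (P i) = r \<nu> i * ev (e \<nu>) (P k)"
      using P(3)[OF \<nu>] by blast
    have "r \<nu> k * ev (e \<nu>) E = (\<Sum>i\<in>I. r \<nu> k * ev (e \<nu>) (P i) * ev (e \<nu>) (T N (\<psi> i)))"
      unfolding E_def using Pent T\<psi> by (simp add: ev_sum ev_mult ent_mult sum_distrib_left mult.assoc)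
    also have "\<dots> = (\<Sum>i\<in>I. ev (e \<nu>) (P k) * (r \<nu> i * ev (e \<nu>) (T N (\<psi> i))))"
      by (rule sum.cong) (auto simp: k(3))
    also have "\<dots> = 0" using r(3)[OF \<nu> k0] by (simp flip: sum_distrib_left)
    finally show ?thesis using k(2) by simp
  qed
  have grE: "gr (2 * e0 * M) (int M * (2 * int e0 * int D + int H + int C1)) E"
    unfolding E_def
  proof (rule gr_sum)
    fix i assume i: "i \<in> I"
    have "gr (2 * e0 * M) (int (2 * e0 * M * D) + int (H * M)) (P i)"
      unfolding gr_def
    proof (intro allI impI)
      fix j k assume "bc (P i) j k \<noteq> 0"
      from P(1)[OF i this] have *: "k \<le> D" "- int (H * M) \<le> j" by auto
      have "int (2 * e0 * M * k) \<le> int (2 * e0 * M * D)" using *(1) by (intro of_nat_mono mult_le_mono2)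
      thus "int (2 * e0 * M * k) \<le> j + (int (2 * e0 * M * D) + int (H * M))" using *(2) by linarith
    qed
    moreover have "gr (2 * e0 * M) (int C1 * int M) (T N (\<psi> i))"
      unfolding T_def M_def using qp C1[OF i] by (intro gr_compose) auto
    ultimately have "gr (2 * e0 * M) ((int (2 * e0 * M * D) + int (H * M)) + int C1 * int M) (P i * T N (\<psi> i))"
      by (rule gr_mult)
    thus "gr (2 * e0 * M) (int M * (2 * int e0 * int D + int H + int C1)) (P i * T N (\<psi> i))"
      by (rule gr_mono) (simp add: algebra_simps)
  qed
  have Ezero: "E $$ j = 0" if j: "j < int M * (2 * int e0 * int s - int H - int C1)" for j
  proof (rule vanishing_order[OF _ Eent grE])
    show "finite (e ` {..N})" by simp
    show "ev x E = 0" if "x \<in> e ` {..N}" for x using that evE by auto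
    show "x \<le> 2 * e0 * M" if x: "x \<in> e ` {..N}" for x
    proof -
      obtain \<nu> where "\<nu> \<le> N" "x = e0 * q ^ \<nu>" using x by (auto simp: e_def)
      moreover from this have "q ^ \<nu> \<le> M" unfolding M_def using q by (intro power_increasing) auto
      ultimately have "x \<le> e0 * M" by simp
      thus ?thesis by simp
    qed
    have "inj_on e {..N}"
      using q by (auto simp: inj_on_def e_def)
    hence "(\<Sum>x\<in>e ` {..N}. int (2 * e0 * M) - int x) = (\<Sum>\<nu>\<le>N. int (2 * e0 * M) - int (e \<nu>))" by (simp add: sum.reindex)
    also have "\<dots> = int (N + 1) * int (2 * e0 * M) - int (\<Sum>\<nu>\<le>N. e \<nu>)" by (simp add: sum_subtractf)
    also have "\<dots> \<ge> int (N + 1) * int (2 * e0 * M) - int (e0 * (2 * M))"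
      using esum by (simp only: diff_left_mono of_nat_mono)
    also have "int (N + 1) * int (2 * e0 * M) - int (e0 * (2 * M)) = int M * (2 * int e0 * int D + 2 * int e0 * int s)"
      unfolding ND by (simp add: algebra_simps)
    finally show "j < (\<Sum>x\<in>e ` {..N}. int (2 * e0 * M) - int x) - int M * (2 * int e0 * int D + int H + int C1)"
      using j by (simp add: algebra_simps)
  qed
  obtain i0 j0 where i0: "i0 \<in> I" "P i0 $$ j0 \<noteq> 0" using P(2) by (meson fls_zero_eqI)
  have Pj: "- int (H * M) \<le> j \<and> j \<le> 0" if a: "i \<in> I" "P i $$ j \<noteq> 0" for i j
  proof -
    obtain k where "bc (P i) j k \<noteq> 0" using a(2) by (metis leading_coeff_0_iff)
    thus ?thesis using P(1)[OF a(1)] by blast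
  qed
  \<comment> \<open>The twisted \<open>\<psi>\<close> only have exponents divisible by
    \<open>M\<close>. Hence the coefficients of the \<open>P i\<close> in one residue class of
    exponents modulo \<open>M\<close>, that of a nonzero coefficient, can be separated;
    \<open>c\<close> lists them and is a relation among the shifts by at most
    \<open>H\<close>.\<close>
  define b0 where "b0 = nat (- j0) div M"
  define t where "t = nat (- j0) mod M"
  have j0: "j0 = - int (M * b0 + t)" using Pj[OF i0] by (simp add: b0_def t_def)
  have tM: "t < M" using M0 by (simp add: t_def)
  have b0: "b0 \<le> H"
  proof -
    have "nat (- j0) \<le> H * M" using Pj[OF i0] by linarith
    hence "nat (- j0) div M \<le> H * M div M" by (rule div_le_mono)
    thus ?thesis using M0 by (simp add: b0_def)
  qed
  define c where "c = (\<lambda>(i, b). P i $$ (- int (M * b + t)))"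
  have "c (i0, b0) = 0"
  proof (rule B)
    show "(i0, b0) \<in> ?Z" using i0 b0 by simp
    fix j assume j: "j < B"
    have "E $$ (int M * j - int t) = (\<Sum>i\<in>I. \<Sum>b\<le>H. c (i, b) * \<psi> i $$ (j + int b))"
      unfolding E_def fls_sum_nth
    proof (rule sum.cong[OF refl])
      fix i assume i: "i \<in> I"
      let ?S = "(\<lambda>b. - int (M * b + t)) ` {..H}"
      have "(P i * T N (\<psi> i)) $$ (int M * j - int t) = (\<Sum>l\<in>?S. P i $$ l * T N (\<psi> i) $$ (int M * j - int t - l))"
      proof (rule fls_times_nth_supp)
        fix l assume l: "P i $$ l \<noteq> 0" "T N (\<psi> i) $$ (int M * j - int t - l) \<noteq> 0"
        from l(2) have "int M dvd int M * j - int t - l"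
          using qp by (auto simp: T_def M_def fls_nth_compose_power split: if_splits)
        hence "int M dvd (int M * j - int t - l) - int M * j" by (rule dvd_diff[OF _ dvd_triv_left])
        hence "int M dvd - l - int t" by (simp add: algebra_simps)
        then obtain b where b: "- l - int t = int M * b" by auto
        have lb: "- int (H * M) \<le> l" "l \<le> 0" using Pj[OF i l(1)] by auto
        have "b \<ge> 0"
        proof (rule ccontr)
          assume "\<not> b \<ge> 0"
          hence "int M * b \<le> int M * (-1)" by (intro mult_left_mono) auto
          thus False using b lb tM by linarith
        qed
        moreover have "b \<le> int H"
        proof (rule ccontr)
          assume "\<not> b \<le> int H"
          hence "int M * b \<ge> int M * (int H + 1)" by (intro mult_left_mono) auto
          hence "int M * b \<ge> int (H * M) + int M" by (simp add: algebra_simps)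
          thus False using b lb M0 by linarith
        qed
        moreover have "l = - int (M * nat b + t)" using b \<open>b \<ge> 0\<close> by simp
        ultimately show "l \<in> ?S" by (intro image_eqI[of _ _ "nat b"]) auto
      qed simp
      also have "\<dots> = (\<Sum>b\<le>H. P i $$ (- int (M * b + t)) * T N (\<psi> i) $$ (int M * j - int t + int (M * b + t)))"
        using M0 by (subst sum.reindex) (auto simp: inj_on_def)
      also have "\<dots> = (\<Sum>b\<le>H. c (i, b) * \<psi> i $$ (j + int b))"
      proof (rule sum.cong[OF refl])
        fix b
        have "int M * j - int t + int (M * b + t) = int M * (j + int b)" by (simp add: algebra_simps)
        moreover have "T N (\<psi> i) $$ (int M * (j + int b)) = \<psi> i $$ (j + int b)"
          using M0 unfolding T_def M_def[symmetric] by (simp add: fls_nth_compose_power)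
        ultimately show "P i $$ (- int (M * b + t)) * T N (\<psi> i) $$ (int M * j - int t + int (M * b + t)) = c (i, b) * \<psi> i $$ (j + int b)"
          by (simp add: c_def)
      qed
      finally show "(P i * T N (\<psi> i)) $$ (int M * j - int t) = (\<Sum>b\<le>H. c (i, b) * \<psi> i $$ (j + int b))" .
    qed
    also have "\<dots> = (\<Sum>x\<in>?Z. c x * ?v x j)" by (simp add: sum.cartesian_product case_prod_unfold)
    finally have "(\<Sum>x\<in>?Z. c x * ?v x j) = E $$ (int M * j - int t)" by simp
    also have "\<dots> = 0"
    proof (rule Ezero)
      have "2 * int e0 * int s \<ge> 2 * 1 * int s" using q by (intro mult_right_mono mult_left_mono) auto
      hence "B \<le> 2 * int e0 * int s - int H - int C1" by (simp add: s_def)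
      hence "int M * (j + 1) \<le> int M * (2 * int e0 * int s - int H - int C1)" using j by (intro mult_left_mono) auto
      thus "int M * j - int t < int M * (2 * int e0 * int s - int H - int C1)" using M0 by (simp add: algebra_simps)
    qed
    finally show "(\<Sum>x\<in>?Z. c x * ?v x j) = 0" .
  qed
  thus False using i0 j0 by (simp add: c_def)
qed

section \<open>Power sums of monic polynomials\<close>

lemma fls_const_sum: "fls_const (sum f A) = (\<Sum>x\<in>A. fls_const (f x :: 'r::comm_ring_1))"
  by (rule fls_eqI) (simp add: fls_sum_nth)

lemma poly_to_Kinf_nth: "poly_to_Kinf (a::'a::field poly) $$ n = (if n \<le> 0 then coeff a (nat (- n)) else 0)"
proof -
  have th: "theta ^ i = (fls_shift (int i) 1 :: 'a fls)" for i
    by (simp add: theta_def fls_X_inv_power_conv_shift_1)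
  have "poly_to_Kinf a $$ n = (\<Sum>i\<le>degree a. coeff a i * (if n = - int i then 1 else 0))"
    unfolding poly_to_Kinf_def by (auto simp: fls_sum_nth th intro!: sum.cong)
  also have "\<dots> = (if n \<le> 0 then coeff a (nat (- n)) else 0)"
  proof (cases "n \<le> 0")
    case True
    hence "(n = - int i) = (i = nat (- n))" for i by auto
    thus ?thesis using True by (auto simp: if_distrib[of "\<lambda>x. _ * x"] coeff_eq_0 cong: if_cong)
  next
    case False
    hence "n \<noteq> - int i" for i by auto
    thus ?thesis using False by simp
  qed
  finally show ?thesis .
qed

lemma poly_to_Kinf_conv: "poly_to_Kinf a = poly (map_poly fls_const a) (theta :: 'a::field fls)"
proof -
  have "degree (map_poly fls_const a) = degree a" by (rule degree_map_poly) simp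
  thus ?thesis by (simp add: poly_altdef poly_to_Kinf_def coeff_map_poly)
qed

lemma poly_to_Kinf_inj: "poly_to_Kinf a = poly_to_Kinf b \<longleftrightarrow> a = (b::'a::field poly)"
proof
  assume "poly_to_Kinf a = poly_to_Kinf b"
  hence "poly_to_Kinf a $$ (- int i) = poly_to_Kinf b $$ (- int i)" for i by simp
  thus "a = b" by (intro poly_eqI) (simp add: poly_to_Kinf_nth)
qed simp

lemma poly_to_Kinf_0 [simp]: "poly_to_Kinf 0 = 0" by (simp add: poly_to_Kinf_conv)
lemma poly_to_Kinf_1 [simp]: "poly_to_Kinf 1 = 1" by (simp add: poly_to_Kinf_conv one_pCons map_poly_pCons)
lemma poly_to_Kinf_eq_0_iff [simp]: "poly_to_Kinf a = 0 \<longleftrightarrow> a = (0::'a::field poly)"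
  using poly_to_Kinf_inj[of a 0] by simp
lemma poly_to_Kinf_add: "poly_to_Kinf (a + b) = poly_to_Kinf a + poly_to_Kinf (b::'a::field poly)"
  by (rule fls_eqI) (simp add: poly_to_Kinf_nth)
lemma poly_to_Kinf_diff: "poly_to_Kinf (a - b) = poly_to_Kinf a - poly_to_Kinf (b::'a::field poly)"
  by (rule fls_eqI) (simp add: poly_to_Kinf_nth)
lemma poly_to_Kinf_mult: "poly_to_Kinf (a * b) = poly_to_Kinf a * poly_to_Kinf (b::'a::field poly)"
proof -
  have "map_poly fls_const (a * b) = map_poly fls_const a * map_poly fls_const b"
    by (rule poly_eqI) (simp add: coeff_map_poly coeff_mult fls_const_sum)
  thus ?thesis by (simp add: poly_to_Kinf_conv)
qed
lemma poly_to_Kinf_power: "poly_to_Kinf (a ^ n) = poly_to_Kinf (a::'a::field poly) ^ n"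
  by (induction n) (auto simp: poly_to_Kinf_mult)
lemma poly_to_Kinf_prod: "poly_to_Kinf (prod f A) = (\<Prod>i\<in>A. poly_to_Kinf (f i :: 'a::field poly))"
  by (induction A rule: infinite_finite_induct) (auto simp: poly_to_Kinf_mult)
lemma poly_to_Kinf_X: "poly_to_Kinf [:0, 1:] = (theta :: 'a::field fls)"
  by (simp add: poly_to_Kinf_conv map_poly_pCons)

section \<open>Frobenius and the Carlitz polynomials\<close>

context
  fixes q :: nat
  assumes q_def: "q = CARD('a::{finite,field})"
begin

lemma q_gt_1: "q > 1"
proof -
  have "card {0, 1 :: 'a} \<le> CARD('a)" by (intro card_mono) auto
  thus ?thesis by (simp add: q_def)
qed

lemma char_prime: "prime CHAR('a)"
  by (rule prime_CHAR_semidom) (simp add: finite_imp_CHAR_pos)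

lemma fermat: "(x::'a) ^ q = x"
proof (cases "x = 0")
  case False
  have "x * (\<Prod>y\<in>UNIV-{0}. x * y) = x * x ^ (CARD('a) - 1) * \<Prod>(UNIV-{0})"
    by (simp add: prod.distrib card_Diff_singleton mult_ac)
  also have "x * x ^ (CARD('a) - 1) = x ^ q"
    using q_gt_1 unfolding q_def by (metis Suc_diff_1 less_trans power_Suc zero_less_one)
  also have "(\<Prod>y\<in>UNIV-{0}. x * y) = (\<Prod>y\<in>UNIV-{0}. y)"
    by (rule prod.reindex_bij_witness[of _ "\<lambda>y. y / x" "\<lambda>y. x * y"]) (use False in auto)
  finally show ?thesis by simp
qed (use q_gt_1 in \<open>auto simp: power_0_left\<close>)

text \<open>The polynomial \<open>(X + 1) ^ q - X ^ q - 1\<close> has degree below \<open>q\<close>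
  and vanishes at all \<open>q\<close> elements of the field. That \<open>q\<close> is a power of p
  does not enter.\<close>

lemma binomial_q_vanishes:
  assumes "0 < k" "k < q" shows "CHAR('a) dvd (q choose k)"
proof -
  let ?x = "[:0, 1 :: 'a:]"
  define P where "P = (?x + 1) ^ q - ?x ^ q - 1"
  have "(?x + 1) ^ q = (\<Sum>k\<le>q. of_nat (q choose k) * ?x ^ k * 1 ^ (q - k))" by (rule binomial_ring)
  also have "\<dots> = (\<Sum>k\<le>q. monom (of_nat (q choose k)) k)"
    by (intro sum.cong refl) (simp add: monom_altdef of_nat_poly)
  finally have c: "coeff ((?x + 1) ^ q) i = (if i \<le> q then of_nat (q choose i) else 0)" for i
    by (simp add: coeff_sum)
  have x: "?x ^ q = monom 1 q" by (simp add: monom_altdef)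
  have cP: "coeff P i = (if 0 < i \<and> i < q then of_nat (q choose i) else 0)" for i
    using q_gt_1 by (auto simp: P_def c x coeff_1)
  have "P = 0"
  proof (rule ccontr)
    assume P: "P \<noteq> 0"
    have "degree P \<le> q - 1" by (rule degree_le) (auto simp: cP)
    moreover have "poly P y = 0" for y by (simp add: P_def fermat)
    hence "card {y. poly P y = 0} = q" by (simp add: q_def)
    moreover have "card {y. poly P y = 0} \<le> degree P" by (rule card_poly_roots_bound[OF P])
    ultimately show False using q_gt_1 by simp
  qed
  hence "of_nat (q choose k) = (0 :: 'a)" using cP[of k] assms by simp
  thus ?thesis by (simp add: of_nat_eq_0_iff_char_dvd)
qed

lemma CHAR_dvd_q: "CHAR('a) dvd q"
  using binomial_q_vanishes[of 1] q_gt_1 by simp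

lemma frobenius_add:
  assumes "CHAR('r::comm_ring_1) = CHAR('a)"
  shows "(x + y :: 'r) ^ (q ^ i) = x ^ (q ^ i) + y ^ (q ^ i)"
proof (induction i)
  case (Suc i)
  have 1: "(x + y :: 'r) ^ q = x ^ q + y ^ q" for x y
  proof -
    have "(x + y) ^ q = (\<Sum>k\<le>q. of_nat (q choose k) * x ^ k * y ^ (q - k))" by (rule binomial_ring)
    also have "\<dots> = (\<Sum>k\<in>{0,q}. of_nat (q choose k) * x ^ k * y ^ (q - k))"
    proof (rule sum.mono_neutral_right)
      show "\<forall>k\<in>{..q} - {0, q}. of_nat (q choose k) * x ^ k * y ^ (q - k) = 0"
      proof
        fix k assume "k \<in> {..q} - {0, q}"
        hence "CHAR('a) dvd (q choose k)" by (intro binomial_q_vanishes) auto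
        hence "of_nat (q choose k) = (0 :: 'r)" by (simp only: assms of_nat_eq_0_iff_char_dvd)
        thus "of_nat (q choose k) * x ^ k * y ^ (q - k) = 0" by simp
      qed
    qed auto
    also have "\<dots> = x ^ q + y ^ q" using q_gt_1 by (simp add: add.commute)
    finally show ?thesis .
  qed
  have "(x + y) ^ (q ^ Suc i) = ((x + y) ^ (q ^ i)) ^ q" by (simp only: power_Suc2 power_mult)
  also have "\<dots> = (x ^ (q ^ i)) ^ q + (y ^ (q ^ i)) ^ q" by (simp add: Suc 1)
  finally show ?case by (simp only: power_Suc2 power_mult)
qed simp

lemma frobenius_uminus:
  assumes "CHAR('r::comm_ring_1) = CHAR('a)"
  shows "(- x :: 'r) ^ (q ^ i) = - (x ^ (q ^ i))"
proof -
  have "0 = (x + - x) ^ (q ^ i)" using q_gt_1 by (simp add: power_0_left)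
  also have "\<dots> = x ^ (q ^ i) + (- x) ^ (q ^ i)" by (rule frobenius_add[OF assms])
  finally show ?thesis by (simp add: eq_neg_iff_add_eq_0 add.commute)
qed

lemma frobenius_diff:
  assumes "CHAR('r::comm_ring_1) = CHAR('a)"
  shows "(x - y :: 'r) ^ (q ^ i) = x ^ (q ^ i) - y ^ (q ^ i)"
  using frobenius_add[OF assms, of x "- y" i] frobenius_uminus[OF assms, of y i] by simp

lemma frobenius_sum:
  assumes "CHAR('r::comm_ring_1) = CHAR('a)"
  shows "(sum f A :: 'r) ^ (q ^ i) = (\<Sum>x\<in>A. f x ^ (q ^ i))"
  using q_gt_1 by (induction A rule: infinite_finite_induct) (auto simp: frobenius_add[OF assms] power_0_left)

lemmas frob_fls = frobenius_add[where 'r = "'a fls", simplified] frobenius_diff[where 'r = "'a fls", simplified]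
  frobenius_sum[where 'r = "'a fls", simplified] frobenius_uminus[where 'r = "'a fls", simplified]

lemmas frob_fls1 = frob_fls[where i = 1, simplified]

lemma fls_const_power: "fls_const c ^ n = fls_const ((c::'b::comm_ring_1) ^ n)"
  by (induction n) auto

lemma fermat_power: "(c::'a) ^ (q ^ i) = c"
proof (induction i)
  case (Suc i)
  have "c ^ (q ^ Suc i) = (c ^ (q ^ i)) ^ q" by (simp only: power_Suc2 power_mult)
  thus ?case by (simp add: Suc fermat)
qed simp

abbreviation th :: "'a fls" where "th \<equiv> theta"

text \<open>\<open>Dd i\<close> and \<open>ll d\<close> are Carlitz's \<open>D_i\<close> and \<open>l_d\<close>; \<open>FF d\<close> is the \<open>F_q\<close>-linear polynomial with value
  \<open>1\<close> at all monic polynomials of degree \<open>d\<close>, and the logarithmic derivative of \<open>1 - FF d\<close> generates the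
  power sums.\<close>

definition Dd :: "nat \<Rightarrow> 'a fls" where "Dd i = (\<Prod>j<i. th ^ (q ^ i) - th ^ (q ^ j))"
definition ll :: "nat \<Rightarrow> 'a fls" where "ll d = (\<Prod>j=1..d. th - th ^ (q ^ j))"
definition cf :: "nat \<Rightarrow> nat \<Rightarrow> 'a fls" where "cf d i = 1 / (Dd i * ll (d - i) ^ (q ^ i))"
definition FF :: "nat \<Rightarrow> 'a fls \<Rightarrow> 'a fls" where "FF d z = (\<Sum>i\<le>d. cf d i * z ^ (q ^ i))"

lemma theta_power_nth: "(theta ^ n :: 'b::field fls) $$ l = (if l = - int n then 1 else 0)"
  by (simp add: theta_def fls_X_inv_power_conv_shift_1)

lemma theta_power_inj: "theta ^ m = (theta ^ n :: 'b::field fls) \<longleftrightarrow> m = n"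
proof
  assume "theta ^ m = (theta ^ n :: 'b fls)"
  hence "(theta ^ m :: 'b fls) $$ (- int m) = (theta ^ n :: 'b fls) $$ (- int m)" by simp
  thus "m = n" by (simp add: theta_power_nth split: if_splits)
qed simp

lemma theta_diff_nz: "i \<noteq> j \<Longrightarrow> th ^ (q ^ i) - th ^ (q ^ j) \<noteq> 0"
  using q_gt_1 by (simp add: theta_power_inj)

lemma Dd_nz: "Dd i \<noteq> 0" using theta_diff_nz by (auto simp: Dd_def simp del: right_minus_eq)
lemma ll_nz: "ll i \<noteq> 0" using theta_diff_nz[of 0] by (auto simp: ll_def simp del: right_minus_eq)

lemma Dd_Suc: "Dd (Suc i) = (th ^ (q ^ Suc i) - th) * Dd i ^ q"
proof -
  have "Dd (Suc i) = (th ^ (q ^ Suc i) - th) * (\<Prod>j<i. th ^ (q ^ Suc i) - th ^ (q ^ Suc j))"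
    unfolding Dd_def by (subst prod.lessThan_Suc_shift) simp
  also have "(\<Prod>j<i. th ^ (q ^ Suc i) - th ^ (q ^ Suc j)) = Dd i ^ q"
    unfolding Dd_def prod_power_distrib
    by (rule prod.cong) (simp_all add: frob_fls1 mult.commute flip: power_mult)
  finally show ?thesis .
qed

lemma ll_Suc: "ll (Suc m) = ll m * (th - th ^ (q ^ Suc m))"
  by (simp add: ll_def)

text \<open>Coefficient form of \<open>FF_theta\<close>. Together with \<open>cf_restrict\<close> it
  yields the values of \<open>FF d\<close> at powers of \<open>theta\<close> without prior knowledge
  of its zeros.\<close>

lemma cf_shift: "i \<le> d \<Longrightarrow> cf (Suc d) (Suc i) * (th ^ (q ^ Suc i) - th) = cf d i ^ q"
proof -
  have nz: "th ^ (q ^ Suc i) - th \<noteq> 0" using theta_diff_nz[of "Suc i" 0] by simp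
  show ?thesis using nz Dd_nz[of i] ll_nz[of "d - i"]
    by (simp add: cf_def Dd_Suc power_divide power_mult_distrib mult.commute[of q] flip: power_mult)
qed

lemma cf_restrict: "i \<le> d \<Longrightarrow> cf (Suc d) i * (th ^ (q ^ i) - th ^ (q ^ Suc d)) = cf d i"
proof -
  assume i: "i \<le> d"
  have nz: "th ^ (q ^ i) - th ^ (q ^ Suc d) \<noteq> 0" using theta_diff_nz[of i "Suc d"] i by simp
  have "Suc d - i = Suc (d - i)" using i by simp
  moreover have "(th - th ^ (q ^ Suc (d - i))) ^ (q ^ i) = th ^ (q ^ i) - th ^ (q ^ Suc d)"
    using i by (simp add: frob_fls flip: power_mult power_add) (simp add: mult.assoc flip: power_add)
  ultimately have "ll (Suc d - i) ^ (q ^ i) = ll (d - i) ^ (q ^ i) * (th ^ (q ^ i) - th ^ (q ^ Suc d))"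
    by (simp only: ll_Suc power_mult_distrib)
  thus ?thesis using nz by (simp add: cf_def)
qed

lemma FF_add: "FF d (x + y) = FF d x + FF d y"
  by (simp add: FF_def frob_fls distrib_left sum.distrib)

lemma FF_const: "FF d (fls_const c * x) = fls_const c * FF d x"
  by (simp add: FF_def power_mult_distrib fls_const_power fermat_power sum_distrib_left mult_ac)

lemma FF_0: "FF d 0 = 0" using q_gt_1 by (simp add: FF_def power_0_left)

lemma FF_sum: "FF d (sum f A) = (\<Sum>i\<in>A. FF d (f i))"
  by (induction A rule: infinite_finite_induct) (auto simp: FF_0 FF_add)

lemma FF_theta: "FF (Suc d) (th * z) = th * FF (Suc d) z + FF d z ^ q"
proof -
  have "FF (Suc d) (th * z) - th * FF (Suc d) z = (\<Sum>i\<le>Suc d. cf (Suc d) i * (th ^ (q ^ i) - th) * z ^ (q ^ i))"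
    by (simp only: FF_def sum_distrib_left sum_subtractf[symmetric] power_mult_distrib) (rule sum.cong, auto simp: algebra_simps)
  also have "\<dots> = (\<Sum>i\<le>d. cf (Suc d) (Suc i) * (th ^ (q ^ Suc i) - th) * z ^ (q ^ Suc i))"
    by (subst sum.atMost_Suc_shift) simp
  also have "\<dots> = (\<Sum>i\<le>d. (cf d i * z ^ (q ^ i)) ^ q)"
    by (rule sum.cong[OF refl], subst cf_shift) (simp, simp only: power_mult_distrib power_Suc2 power_mult)
  also have "\<dots> = FF d z ^ q" by (simp add: FF_def frob_fls1)
  finally show ?thesis by (simp add: algebra_simps)
qed

text \<open>Subtracting the two coefficient relations, summed over \<open>i\<close>, gives
  \<open>(theta ^ (q ^ Suc d) - theta) * FF (Suc d) 1 = FF d 1 ^ q - FF d 1\<close>, and the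
  right-hand side vanishes when \<open>FF d 1\<close> is \<open>0\<close> or
  \<open>1\<close>.\<close>

lemma FF_1: "FF d 1 = (if d = 0 then 1 else 0)"
proof -
  have rec: "(th ^ (q ^ Suc d) - th) * FF (Suc d) 1 = FF d 1 ^ q - FF d 1" for d
  proof -
    have "(\<Sum>i\<le>Suc d. cf (Suc d) i * (th ^ (q ^ i) - th)) = FF d 1 ^ q"
      using FF_theta[of d 1] by (simp add: FF_def algebra_simps sum_subtractf sum_distrib_left)
    moreover have "(\<Sum>i\<le>Suc d. cf (Suc d) i * (th ^ (q ^ i) - th ^ (q ^ Suc d))) = FF d 1"
      unfolding sum.atMost_Suc FF_def by (auto intro!: sum.cong simp: cf_restrict simp del: power_Suc)
    ultimately have "FF d 1 ^ q - FF d 1 = (\<Sum>i\<le>Suc d. cf (Suc d) i * (th ^ (q ^ i) - th) - cf (Suc d) i * (th ^ (q ^ i) - th ^ (q ^ Suc d)))"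
      by (simp only: sum_subtractf)
    also have "\<dots> = (\<Sum>i\<le>Suc d. (th ^ (q ^ Suc d) - th) * cf (Suc d) i)"
      by (rule sum.cong) (auto simp: algebra_simps)
    finally show ?thesis by (simp only: FF_def power_one mult_1_right sum_distrib_left)
  qed
  have nz: "th ^ (q ^ Suc d) - th \<noteq> 0" for d using theta_diff_nz[of "Suc d" 0] by simp
  show ?thesis
  proof (induction d)
    case 0
    show ?case by (simp add: FF_def cf_def Dd_def ll_def)
  next
    case (Suc d)
    have "FF d 1 ^ q - FF d 1 = 0" using Suc q_gt_1 by (auto simp: power_0_left)
    hence "FF (Suc d) 1 = 0" using rec[of d] nz[of d] by simp
    thus ?case by simp
  qed
qed

lemma FF_theta_power: "j \<le> d \<Longrightarrow> FF d (th ^ j) = (if j = d then 1 else 0)"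
proof (induction j arbitrary: d)
  case 0
  thus ?case by (simp add: FF_1)
next
  case (Suc j)
  then obtain d' where d: "d = Suc d'" by (cases d) auto
  show ?case using Suc q_gt_1 by (simp add: d FF_theta power_0_left)
qed

lemma FF_monic:
  assumes "degree a = d" "lead_coeff a = (1::'a)"
  shows "FF d (poly_to_Kinf a) = 1"
proof -
  have "FF d (poly_to_Kinf a) = (\<Sum>i\<le>d. fls_const (coeff a i) * FF d (th ^ i))"
    unfolding poly_to_Kinf_def using assms(1) by (simp add: FF_sum FF_const)
  also have "\<dots> = (\<Sum>i\<le>d. if i = d then fls_const (coeff a i) else 0)"
    by (rule sum.cong) (auto simp: FF_theta_power)
  finally show ?thesis using assms by simp
qed

definition monics :: "nat \<Rightarrow> 'a poly set" where
  "monics d = {a. degree a = d \<and> lead_coeff a = 1}"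

lemma card_monics: "finite (monics d)" "card (monics d) = q ^ d"
proof -
  let ?F = "PiE {..<d} (\<lambda>_. UNIV :: 'a set)"
  let ?f = "\<lambda>a. restrict (coeff a) {..<d}"
  have "bij_betw ?f (monics d) ?F"
  proof (rule bij_betw_imageI)
    show "inj_on ?f (monics d)"
    proof (rule inj_onI)
      fix a b assume ab: "a \<in> monics d" "b \<in> monics d" "?f a = ?f b"
      show "a = b"
      proof (rule poly_eqI)
        fix i show "coeff a i = coeff b i"
          using fun_cong[OF ab(3), of i] ab(1,2)
          by (cases i d rule: linorder_cases) (auto simp: monics_def coeff_eq_0)
      qed
    qed
    show "?f ` monics d = ?F"
    proof
      show "?F \<subseteq> ?f ` monics d"
      proof
        fix c assume c: "c \<in> ?F"
        define a where "a = monom 1 d + (\<Sum>i<d. monom (c i) i)"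
        have ca: "coeff a i = (if i = d then 1 else if i < d then c i else 0)" for i
          by (auto simp: a_def coeff_sum)
        have "degree a = d"
        proof (rule antisym)
          show "degree a \<le> d" by (rule degree_le) (simp add: ca)
          show "d \<le> degree a" by (rule le_degree) (simp add: ca)
        qed
        hence "a \<in> monics d" by (simp add: monics_def ca)
        moreover have "?f a = c"
        proof (rule ext)
          fix i show "?f a i = c i" using PiE_arb[OF c, of i] by (cases "i < d") (simp_all add: ca)
        qed
        ultimately show "c \<in> ?f ` monics d" by blast
      qed
      show "?f ` monics d \<subseteq> ?F" by (rule image_subsetI) (simp add: restrict_PiE_iff)
    qed
  qed
  moreover have "finite ?F" by (intro finite_PiE) auto
  moreover have "card ?F = q ^ d" by (simp add: card_PiE q_def)
  ultimately show "finite (monics d)" "card (monics d) = q ^ d"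
    using bij_betw_finite bij_betw_same_card by metis+
qed

section \<open>Generating function of the power sums\<close>

definition power_sum_monic :: "nat \<Rightarrow> nat \<Rightarrow> 'a fls" where
  "power_sum_monic d n = (\<Sum>a\<in>monics d. inverse (poly_to_Kinf a ^ n))"

definition FP :: "nat \<Rightarrow> 'a fls poly" where "FP d = 1 - (\<Sum>i\<le>d. monom (cf d i) (q ^ i))"

lemma poly_FP: "poly (FP d) z = 1 - FF d z"
  by (simp add: FP_def FF_def poly_sum poly_monom)

text \<open>Both sides have degree at most \<open>q ^ d\<close> and agree at
  \<open>q ^ d + 1\<close> points: they are \<open>1\<close> at \<open>0\<close> and vanish at all
  monic polynomials of degree \<open>d\<close>.\<close>

lemma FP_product: "FP d = (\<Prod>a\<in>monics d. [:1, - inverse (poly_to_Kinf a):])"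
proof -
  let ?R = "poly_to_Kinf ` monics d"
  let ?Q = "\<Prod>a\<in>monics d. [:1, - inverse (poly_to_Kinf a):]"
  have nz: "poly_to_Kinf a \<noteq> 0" if "a \<in> monics d" for a using that by (auto simp: monics_def)
  have "degree (FP d) \<le> q ^ d"
    unfolding FP_def
  proof (rule degree_diff_le)
    show "degree (\<Sum>i\<le>d. monom (cf d i) (q ^ i)) \<le> q ^ d"
    proof (rule degree_sum_le)
      fix i assume "i \<in> {..d}"
      hence "q ^ i \<le> q ^ d" using q_gt_1 by (intro power_increasing) auto
      thus "degree (monom (cf d i) (q ^ i)) \<le> q ^ d" using degree_monom_le order.trans by blast
    qed simp
  qed simp
  moreover have "degree ?Q \<le> (\<Sum>a\<in>monics d. 1)"
  proof (rule order.trans[OF degree_prod_sum_le[OF card_monics(1)]], rule sum_mono)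
    show "(degree \<circ> (\<lambda>a. [:1, - inverse (poly_to_Kinf a):])) a \<le> 1" for a :: "'a poly" by simp
  qed
  ultimately have deg: "degree (FP d - ?Q) \<le> q ^ d" by (intro degree_diff_le) (auto simp: card_monics)
  have root: "poly (FP d - ?Q) r = 0" if r: "r \<in> insert 0 ?R" for r
  proof (cases "r = 0")
    case True
    thus ?thesis by (simp add: poly_FP FF_0 poly_prod)
  next
    case False
    then obtain a where a: "a \<in> monics d" "r = poly_to_Kinf a" using r by auto
    have "FF d r = 1" using a by (auto simp: monics_def intro: FF_monic)
    hence "poly (FP d) r = 0" by (simp add: poly_FP)
    moreover have "poly ?Q r = 0"
      unfolding poly_prod using a nz[OF a(1)] card_monics by (intro prod_zero bexI[of _ a]) auto
    ultimately show ?thesis by simp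
  qed
  show ?thesis
  proof (rule ccontr)
    assume "FP d \<noteq> ?Q"
    hence n0: "FP d - ?Q \<noteq> 0" by simp
    have "card (insert 0 ?R) \<le> card {r. poly (FP d - ?Q) r = 0}"
      using root poly_roots_finite[OF n0] by (intro card_mono) auto
    also have "\<dots> \<le> q ^ d" using card_poly_roots_bound[OF n0] deg by linarith
    also have "card (insert 0 ?R) = Suc (card ?R)"
      using card_monics nz by (subst card_insert_disjoint) auto
    also have "card ?R = q ^ d" by (subst card_image) (auto simp: card_monics inj_on_def poly_to_Kinf_inj)
    finally show False by simp
  qed
qed

lemma of_nat_q_power: "i > 0 \<Longrightarrow> of_nat (q ^ i) = (0 :: 'a fls)"
proof -
  assume "i > 0"
  hence "CHAR('a) dvd q ^ i" using CHAR_dvd_q by (cases i) auto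
  hence "CHAR('a fls) dvd q ^ i" by simp
  thus ?thesis by (simp only: of_nat_eq_0_iff_char_dvd)
qed

lemma pderiv_FP: "pderiv (FP d) = [:- cf d 0:]"
proof -
  have "pderiv (FP d) = - (\<Sum>i\<le>d. pderiv (monom (cf d i) (q ^ i)))"
    by (simp add: FP_def pderiv_diff pderiv_sum)
  also have "(\<Sum>i\<le>d. pderiv (monom (cf d i) (q ^ i))) = (\<Sum>i\<in>{0}. pderiv (monom (cf d i) (q ^ i)))"
    by (rule sum.mono_neutral_right) (auto simp: pderiv_monom of_nat_q_power simp del: of_nat_power)
  finally show ?thesis by (simp add: pderiv_monom monom_0)
qed

text \<open>The logarithmic derivative of the product formula; the derivative of \<open>FP d\<close>
  is the constant \<open>- cf d 0\<close>, since \<open>q ^ i\<close> is zero in the field for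
  \<open>i > 0\<close>. Index \<open>m\<close> carries the power sum of exponent
  \<open>m + 1\<close>.\<close>

lemma power_sum_generating:
  "fps_of_poly (FP d) * Abs_fps (\<lambda>m. power_sum_monic d (Suc m)) = fps_const (cf d 0)"
proof -
  define g where "g a = Abs_fps (\<lambda>m. inverse (poly_to_Kinf a) ^ m)" for a :: "'a poly"
  define L where "L a = fps_of_poly [:1, - inverse (poly_to_Kinf a):]" for a :: "'a poly"
  have Lg: "L a * g a = 1" for a
  proof (rule fps_ext)
    fix m
    have "L a = 1 - fps_const (inverse (poly_to_Kinf a)) * fps_X"
      by (simp add: L_def fps_of_poly_pCons fps_const_neg[symmetric] del: fps_const_neg)
    thus "(L a * g a) $ m = 1 $ m"
      by (cases m) (auto simp: g_def left_diff_distrib mult.assoc)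
  qed
  have "fps_of_poly (pderiv (FP d)) = (\<Sum>a\<in>monics d. fps_const (- inverse (poly_to_Kinf a)) * (\<Prod>b\<in>monics d - {a}. L b))"
    unfolding FP_product pderiv_prod fps_of_poly_sum fps_of_poly_mult fps_of_poly_prod L_def
    by (rule sum.cong[OF refl]) (simp add: pderiv_pCons fps_of_poly_const mult.commute)
  also have "\<dots> = (\<Sum>a\<in>monics d. fps_const (- inverse (poly_to_Kinf a)) * (fps_of_poly (FP d) * g a))"
  proof (rule sum.cong[OF refl])
    fix a assume a: "a \<in> monics d"
    have "fps_of_poly (FP d) = L a * (\<Prod>b\<in>monics d - {a}. L b)"
      unfolding FP_product fps_of_poly_prod L_def[symmetric] using a card_monics by (subst prod.remove[of _ a]) auto
    hence "fps_of_poly (FP d) * g a = (L a * g a) * (\<Prod>b\<in>monics d - {a}. L b)" by (simp add: mult_ac)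
    thus "fps_const (- inverse (poly_to_Kinf a)) * (\<Prod>b\<in>monics d - {a}. L b)
       = fps_const (- inverse (poly_to_Kinf a)) * (fps_of_poly (FP d) * g a)" by (simp add: Lg)
  qed
  also have "\<dots> = - (fps_of_poly (FP d) * (\<Sum>a\<in>monics d. fps_const (inverse (poly_to_Kinf a)) * g a))"
    by (simp add: sum_distrib_left sum_negf mult_ac fps_const_neg[symmetric] del: fps_const_neg)
  also have "(\<Sum>a\<in>monics d. fps_const (inverse (poly_to_Kinf a)) * g a) = Abs_fps (\<lambda>m. power_sum_monic d (Suc m))"
    by (rule fps_ext) (simp add: fps_sum_nth g_def power_sum_monic_def power_inverse)
  finally have "fps_of_poly [:- cf d 0:] = - (fps_of_poly (FP d) * Abs_fps (\<lambda>m. power_sum_monic d (Suc m)))"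
    by (simp add: pderiv_FP)
  thus ?thesis by (simp add: fps_of_poly_const fps_const_neg[symmetric] del: fps_const_neg)
qed

text \<open>The normalisation by \<open>ll d ^ (m + 1)\<close> makes the power sum of exponent
  \<open>m + 1\<close> depend on \<open>d\<close> only through \<open>theta ^ (q ^ d)\<close>, as
  the recursion \<open>uu_rec\<close> shows.\<close>

definition uu :: "nat \<Rightarrow> nat \<Rightarrow> 'a fls" where
  "uu d m = ll d * power_sum_monic d (Suc m) * ll d ^ m"

definition PP :: "nat \<Rightarrow> 'a fls \<Rightarrow> 'a fls" where
  "PP i x = (\<Prod>j=1..i. th ^ (q ^ i) - x ^ (q ^ j))"

lemma coeff_FP: "coeff (FP d) j = (if j = 0 then 1 else 0) - (\<Sum>i\<le>d. if q ^ i = j then cf d i else 0)"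
  by (simp add: FP_def coeff_diff coeff_1 coeff_sum)

text \<open>\<open>PP i\<close> vanishes at \<open>theta ^ (q ^ d)\<close> for \<open>i > d\<close>,
  so one formula serves all \<open>i\<close> and the truncation at \<open>d\<close> disappears from
  the recursion.\<close>

lemma cf_ll: "(if i \<le> d then cf d i * ll d ^ (q ^ i) else 0) = PP i (th ^ (q ^ d)) / Dd i"
proof (cases "i \<le> d")
  case True
  have e: "(th ^ (q ^ j)) ^ (q ^ i) = th ^ (q ^ (i + j))" for j
    by (simp add: power_add mult.commute flip: power_mult)
  have p: "(\<Prod>j\<in>{a..b}. th - th ^ (q ^ j)) ^ (q ^ i) = (\<Prod>j\<in>{a..b}. th ^ (q ^ i) - th ^ (q ^ (i + j)))" for a b
    unfolding prod_power_distrib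
    by (rule prod.cong) (simp_all only: frob_fls e)
  have "{1..d} = {1..d - i} \<union> {d - i + 1..d}" using True by auto
  hence "ll d = ll (d - i) * (\<Prod>j\<in>{d - i + 1..d}. th - th ^ (q ^ j))"
    unfolding ll_def by (simp only:) (rule prod.union_disjoint, auto)
  hence "ll d ^ (q ^ i) = ll (d - i) ^ (q ^ i) * (\<Prod>j\<in>{d - i + 1..d}. th ^ (q ^ i) - th ^ (q ^ (i + j)))"
    by (simp only: power_mult_distrib p)
  also have "(\<Prod>j\<in>{d - i + 1..d}. th ^ (q ^ i) - th ^ (q ^ (i + j))) = PP i (th ^ (q ^ d))"
    unfolding PP_def
    by (rule prod.reindex_bij_witness[of _ "\<lambda>j. d - i + j" "\<lambda>j. j - (d - i)"])
       (use True in \<open>auto simp: add.commute[of _ i] simp flip: power_mult power_add\<close>)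
  finally show ?thesis using True Dd_nz[of i] ll_nz[of "d - i"] by (simp add: cf_def)
next
  case False
  have "PP i (th ^ (q ^ d)) = 0"
    unfolding PP_def
    by (rule prod_zero) (use False in \<open>auto intro!: bexI[of _ "i - d"] simp flip: power_mult power_add\<close>)
  thus ?thesis using False by simp
qed

lemma uu_rec: "uu d m = (if m = 0 then 1 else 0) + (\<Sum>i\<in>{i. q ^ i \<le> m}. PP i (th ^ (q ^ d)) / Dd i * uu d (m - q ^ i))"
proof -
  let ?S = "\<lambda>m. power_sum_monic d (Suc m)"
  have fin: "finite {i. q ^ i \<le> m}"
  proof (rule finite_subset)
    show "{i. q ^ i \<le> m} \<subseteq> {..m}"
      using q_gt_1 by (auto intro: order.trans[OF less_imp_le[OF less_exp]] dest: le_less_trans[OF less_imp_le[OF power_gt_expt]])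
         (metis le_trans less_imp_le_nat power_gt_expt)
  qed simp
  have "(fps_of_poly (FP d) * Abs_fps ?S) $ m = fps_const (cf d 0) $ m" by (simp only: power_sum_generating)
  hence "(\<Sum>j=0..m. coeff (FP d) j * ?S (m - j)) = (if m = 0 then cf d 0 else 0)"
    by (simp add: fps_mult_nth)
  also have "(\<Sum>j=0..m. coeff (FP d) j * ?S (m - j))
     = (\<Sum>j=0..m. (if j = 0 then ?S (m - j) else 0)) - (\<Sum>j=0..m. \<Sum>i\<le>d. if q ^ i = j then cf d i * ?S (m - j) else 0)"
    by (simp add: coeff_FP left_diff_distrib sum_subtractf sum_distrib_right if_distrib[of "\<lambda>x. x * _"] cong: if_cong)
  also have "(\<Sum>j=0..m. (if j = 0 then ?S (m - j) else 0)) = ?S m" by simp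
  also have "(\<Sum>j=0..m. \<Sum>i\<le>d. if q ^ i = j then cf d i * ?S (m - j) else 0)
     = (\<Sum>i\<le>d. if q ^ i \<le> m then cf d i * ?S (m - q ^ i) else 0)"
    by (subst sum.swap) (auto intro!: sum.cong)
  also have "\<dots> = (\<Sum>i\<in>{i. q ^ i \<le> m}. if i \<le> d then cf d i * ?S (m - q ^ i) else 0)"
    using fin by (simp add: sum.If_cases Int_def conj_commute)
  finally have "?S m = (if m = 0 then cf d 0 else 0) + (\<Sum>i\<in>{i. q ^ i \<le> m}. if i \<le> d then cf d i * ?S (m - q ^ i) else 0)"
    by (simp add: algebra_simps)
  hence "uu d m = ll d * ll d ^ m * (if m = 0 then cf d 0 else 0)
     + (\<Sum>i\<in>{i. q ^ i \<le> m}. ll d * ll d ^ m * (if i \<le> d then cf d i * ?S (m - q ^ i) else 0))"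
    by (simp add: uu_def sum_distrib_left algebra_simps)
  also have "ll d * ll d ^ m * (if m = 0 then cf d 0 else 0) = (if m = 0 then 1 else 0)"
    using ll_nz[of d] by (simp add: cf_def Dd_def)
  also have "(\<Sum>i\<in>{i. q ^ i \<le> m}. ll d * ll d ^ m * (if i \<le> d then cf d i * ?S (m - q ^ i) else 0))
     = (\<Sum>i\<in>{i. q ^ i \<le> m}. PP i (th ^ (q ^ d)) / Dd i * uu d (m - q ^ i))"
  proof (rule sum.cong[OF refl])
    fix i assume "i \<in> {i. q ^ i \<le> m}"
    hence "ll d ^ m = ll d ^ (q ^ i) * ll d ^ (m - q ^ i)" by (simp flip: power_add)
    thus "ll d * ll d ^ m * (if i \<le> d then cf d i * ?S (m - q ^ i) else 0) = PP i (th ^ (q ^ d)) / Dd i * uu d (m - q ^ i)"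
      unfolding cf_ll[symmetric] by (simp add: uu_def)
  qed
  finally show ?thesis .
qed

text \<open>The inner variable of \<open>H\<close> stands for \<open>theta\<close>; the outer one
  receives \<open>x\<close>, which will be \<open>theta ^ (q ^ d)\<close>.\<close>

definition bev :: "'a poly poly \<Rightarrow> 'a fls \<Rightarrow> 'a fls" where
  "bev H x = poly (map_poly poly_to_Kinf H) x"

lemma bev_mult: "bev (H * G) x = bev H x * bev G x"
proof -
  have s: "poly_to_Kinf (sum f A) = (\<Sum>i\<in>A. poly_to_Kinf (f i :: 'a poly))" for f and A :: "nat set"
    by (induction A rule: infinite_finite_induct) (auto simp: poly_to_Kinf_add)
  have "map_poly poly_to_Kinf (H * G) = map_poly poly_to_Kinf H * map_poly poly_to_Kinf G"
    by (rule poly_eqI) (simp add: coeff_map_poly coeff_mult s poly_to_Kinf_mult)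
  thus ?thesis by (simp add: bev_def)
qed

lemma bev_add: "bev (H + G) x = bev H x + bev G x"
proof -
  have "map_poly poly_to_Kinf (H + G) = map_poly poly_to_Kinf H + map_poly poly_to_Kinf G"
    by (rule poly_eqI) (simp add: coeff_map_poly poly_to_Kinf_add)
  thus ?thesis by (simp add: bev_def)
qed

lemma bev_const [simp]: "bev [:p:] x = poly_to_Kinf p" by (simp add: bev_def map_poly_pCons)
lemma bev_0 [simp]: "bev 0 x = 0" by (simp add: bev_def)
lemma bev_1 [simp]: "bev 1 x = 1" by (simp add: bev_def map_poly_1')
lemma bev_monom: "bev (monom 1 k) x = x ^ k"
proof -
  have "map_poly poly_to_Kinf (monom 1 k) = (monom 1 k :: 'a fls poly)"
    by (rule poly_eqI) (simp add: coeff_map_poly)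
  thus ?thesis by (simp add: bev_def poly_monom)
qed
lemma bev_diff: "bev (H - G) x = bev H x - bev G x"
  using bev_add[of "H - G" G x] by simp
lemma bev_sum: "bev (sum f A) x = (\<Sum>i\<in>A. bev (f i) x)"
  by (induction A rule: infinite_finite_induct) (auto simp: bev_add)
lemma bev_prod: "bev (prod f A) x = (\<Prod>i\<in>A. bev (f i) x)"
  by (induction A rule: infinite_finite_induct) (auto simp: bev_mult)

text \<open>\<open>uu_rec\<close> expresses \<open>uu d m\<close> through polynomials in
  \<open>theta ^ (q ^ d)\<close> with denominators \<open>Dd i\<close>, which
  \<open>\<Delta>\<close> clears. The degree of \<open>PP i\<close> is at most
  \<open>q + ... + q ^ i\<close>; its product with \<open>q - 1\<close> is at most
  \<open>q * q ^ i\<close>, which adds up with the inductive bound \<open>q * (m - q ^ i)\<close> to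
  \<open>q * m\<close>.\<close>

lemma uu_polynomial:
  "\<exists>\<Delta> H. \<Delta> \<noteq> 0 \<and> (q - 1) * degree H \<le> q * m \<and> (\<forall>d. bev H (th ^ (q ^ d)) = poly_to_Kinf \<Delta> * uu d m)"
proof (induction m rule: less_induct)
  case (less m)
  let ?X = "[:0, 1 :: 'a:]"
  let ?J = "{i. q ^ i \<le> m}"
  show ?case
  proof (cases "m = 0")
    case True
    have "uu d 0 = 1" for d using uu_rec[of d 0] q_gt_1 by simp
    thus ?thesis using True by (intro exI[of _ 1] exI[of _ 1]) auto
  next
    case False
    have fin: "finite ?J"
      by (rule finite_subset[of _ "{..m}"]) (use q_gt_1 in \<open>auto intro: order.trans[OF less_imp_le[OF power_gt_expt]]\<close>)
    have "\<forall>i\<in>?J. \<exists>DH. fst DH \<noteq> 0 \<and> (q - 1) * degree (snd DH) \<le> q * (m - q ^ i)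
       \<and> (\<forall>d. bev (snd DH) (th ^ (q ^ d)) = poly_to_Kinf (fst DH) * uu d (m - q ^ i))"
    proof
      fix i assume i: "i \<in> ?J"
      have "m - q ^ i < m" using False q_gt_1 by simp
      from less[OF this] show "\<exists>DH. fst DH \<noteq> 0 \<and> (q - 1) * degree (snd DH) \<le> q * (m - q ^ i)
       \<and> (\<forall>d. bev (snd DH) (th ^ (q ^ d)) = poly_to_Kinf (fst DH) * uu d (m - q ^ i))" by auto
    qed
    from bchoice[OF this] obtain DH where DH: "\<And>i. i \<in> ?J \<Longrightarrow> fst (DH i) \<noteq> 0"
      "\<And>i. i \<in> ?J \<Longrightarrow> (q - 1) * degree (snd (DH i)) \<le> q * (m - q ^ i)"
      "\<And>i d. i \<in> ?J \<Longrightarrow> bev (snd (DH i)) (th ^ (q ^ d)) = poly_to_Kinf (fst (DH i)) * uu d (m - q ^ i)" by blast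
    define DP where "DP i = (\<Prod>j<i. ?X ^ (q ^ i) - ?X ^ (q ^ j))" for i
    have DP: "poly_to_Kinf (DP i) = Dd i" for i
      by (simp add: DP_def Dd_def poly_to_Kinf_prod poly_to_Kinf_diff poly_to_Kinf_power poly_to_Kinf_X)
    have DPnz: "DP i \<noteq> 0" for i using DP[of i] Dd_nz[of i] by auto
    define PH where "PH i = (\<Prod>j=1..i. [:?X ^ (q ^ i):] - monom 1 (q ^ j))" for i
    have PH: "bev (PH i) x = PP i x" for i x
      by (simp add: PH_def PP_def bev_prod bev_diff bev_monom poly_to_Kinf_power poly_to_Kinf_X)
    have degPH: "(q - 1) * degree (PH i) \<le> q * q ^ i" for i
    proof -
      have "degree (PH i) \<le> (\<Sum>j=1..i. degree ([:?X ^ (q ^ i):] - monom 1 (q ^ j)))"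
        unfolding PH_def using degree_prod_sum_le[of "{1..i}" "\<lambda>j. [:?X ^ (q ^ i):] - monom 1 (q ^ j)"] by simp
      also have "\<dots> \<le> (\<Sum>j=1..i. q ^ j)"
        by (intro sum_mono degree_diff_le) (auto simp: degree_monom_le)
      finally have "(q - 1) * degree (PH i) \<le> (q - 1) * (\<Sum>j=1..i. q ^ j)" by (rule mult_le_mono2)
      also have "(q - 1) * (\<Sum>j=1..i. q ^ j) + q = q * q ^ i"
      proof (induction i)
        case (Suc i)
        have "(q - 1) * (\<Sum>j=1..Suc i. q ^ j) + q = ((q - 1) * (\<Sum>j=1..i. q ^ j) + q) + (q - 1) * q ^ Suc i"
          by (simp add: algebra_simps)
        also have "\<dots> = q ^ Suc i + (q - 1) * q ^ Suc i" by (simp only: Suc power_Suc)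
        also have "\<dots> = (1 + (q - 1)) * q ^ Suc i" by (simp only: add_mult_distrib mult_1)
        also have "1 + (q - 1) = q" using q_gt_1 by simp
        finally show ?case .
      qed simp
      hence "(q - 1) * (\<Sum>j=1..i. q ^ j) \<le> q * q ^ i" by linarith
      finally show ?thesis .
    qed
    define \<Delta> where "\<Delta> = (\<Prod>i\<in>?J. DP i * fst (DH i))"
    define co where "co i = (\<Prod>k\<in>?J - {i}. DP k * fst (DH k))" for i
    define H where "H = (\<Sum>i\<in>?J. PH i * snd (DH i) * [:co i:])"
    have "\<Delta> \<noteq> 0" unfolding \<Delta>_def using fin DPnz DH(1) by auto
    moreover have "(q - 1) * degree H \<le> q * m"
    proof -
      have "degree (PH i * snd (DH i) * [:co i:]) \<le> q * m div (q - 1)" if i: "i \<in> ?J" for i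
      proof -
        have "degree (PH i * snd (DH i) * [:co i:]) \<le> degree (PH i) + degree (snd (DH i)) + 0"
          by (rule order.trans[OF degree_mult_le add_mono]) (auto intro: degree_mult_le)
        moreover have "(degree (PH i) + degree (snd (DH i))) * (q - 1) \<le> q * m"
        proof -
          have "q * q ^ i + q * (m - q ^ i) = q * m" using i by (simp flip: distrib_left)
          thus ?thesis unfolding mult.commute[of _ "q - 1"] distrib_left using degPH[of i] DH(2)[OF i] by linarith
        qed
        hence "degree (PH i) + degree (snd (DH i)) \<le> q * m div (q - 1)"
          using q_gt_1 by (simp add: less_eq_div_iff_mult_less_eq)
        ultimately show ?thesis by simp
      qed
      hence "degree H \<le> q * m div (q - 1)" unfolding H_def by (intro degree_sum_le fin)
      thus ?thesis using q_gt_1 by (simp add: less_eq_div_iff_mult_less_eq mult.commute)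
    qed
    moreover have "bev H (th ^ (q ^ d)) = poly_to_Kinf \<Delta> * uu d m" for d
    proof -
      let ?x = "th ^ (q ^ d)"
      have "bev H ?x = (\<Sum>i\<in>?J. PP i ?x * (poly_to_Kinf (fst (DH i)) * uu d (m - q ^ i)) * poly_to_Kinf (co i))"
        unfolding H_def bev_sum bev_mult PH bev_const by (rule sum.cong[OF refl]) (simp add: DH(3))
      also have "\<dots> = (\<Sum>i\<in>?J. poly_to_Kinf \<Delta> * (PP i ?x / Dd i * uu d (m - q ^ i)))"
      proof (rule sum.cong[OF refl])
        fix i assume i: "i \<in> ?J"
        have "\<Delta> = DP i * fst (DH i) * co i" unfolding \<Delta>_def co_def using fin i by (rule prod.remove)
        hence "poly_to_Kinf \<Delta> = Dd i * poly_to_Kinf (fst (DH i)) * poly_to_Kinf (co i)"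
          by (simp add: poly_to_Kinf_mult DP)
        thus "PP i ?x * (poly_to_Kinf (fst (DH i)) * uu d (m - q ^ i)) * poly_to_Kinf (co i)
           = poly_to_Kinf \<Delta> * (PP i ?x / Dd i * uu d (m - q ^ i))"
          using Dd_nz[of i] by simp
      qed
      also have "\<dots> = poly_to_Kinf \<Delta> * uu d m"
        using False by (simp only: uu_rec[of d m] sum_distrib_left[symmetric]) simp
      finally show ?thesis .
    qed
    ultimately show ?thesis by blast
  qed
qed

theorem anderson_thakur:
  assumes "n \<ge> 1"
  shows "\<exists>\<Delta> H. \<Delta> \<noteq> 0 \<and> (q - 1) * degree H \<le> q * (n - 1) \<and>
     (\<forall>d. bev H (th ^ (q ^ d)) = poly_to_Kinf \<Delta> * (ll d ^ n * power_sum_monic d n))"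
proof -
  have "uu d (n - 1) = ll d ^ n * power_sum_monic d n" for d
    using assms by (cases n) (auto simp: uu_def)
  thus ?thesis using uu_polynomial[of "n - 1"] by simp
qed

end

section \<open>Limits\<close>

text \<open>The coefficients at \<open>v ^ j\<close> no longer change from index
  \<open>j + C + 1\<close> on, so the limit is read off there and inherits the bounds.\<close>

lemma gr_limit:
  assumes "gr A C (F 0)" "\<And>N. gr A (C - int N) (F (Suc N) - F N)"
  shows "\<exists>L. \<forall>N. gr A (C - int N) (L - F N)"
proof -
  have tail: "gr A (C - int N) (F (N + M) - F N)" for N M
  proof (induction M)
    case (Suc M)
    have "gr A (C - int N) (F (Suc (N + M)) - F (N + M))" by (rule gr_mono[OF assms(2)]) simp
    from gr_add[OF this Suc] show ?case by simp
  qed simp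
  have tail': "gr A (C - int N) (F M - F N)" if "N \<le> M" for N M
    using tail[of N "M - N"] that by simp
  have grF: "gr A C (F N)" for N using gr_add[OF tail[of 0 N, simplified] assms(1)] by simp
  define c where "c j k = bc (F (nat (j + C + 1))) j k" for j k
  have stable: "bc (F N) j k = c j k" if "j + C < int N" for N j k
  proof (rule ccontr)
    assume ne: "bc (F N) j k \<noteq> c j k"
    let ?M = "nat (j + C + 1)"
    have "bc (F N - F ?M) j k \<noteq> 0" using ne by (simp add: c_def)
    moreover have "?M \<le> N" using that by linarith
    ultimately have "int (A * k) \<le> j + (C - int ?M)" using grD[OF tail'] by blast
    moreover have "int (A * k) \<ge> 0" by simp
    ultimately show False by linarith
  qed
  have "\<exists>L. \<forall>j k. bc L j k = c j k"
  proof (rule bc_build[of c "- C"])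
    fix j k assume "c j k \<noteq> 0"
    hence "int (A * k) \<le> j + C" unfolding c_def by (rule grD[OF grF])
    moreover have "int (A * k) \<ge> 0" by simp
    ultimately show "- C \<le> j" by linarith
  next
    fix j show "\<exists>K. \<forall>k>K. c j k = 0"
      unfolding c_def by (rule exI[of _ "degree (F (nat (j + C + 1)) $$ j)"]) (auto simp: coeff_eq_0)
  qed
  then obtain L where L: "\<And>j k. bc L j k = c j k" by blast
  have "gr A (C - int N) (L - F N)" for N
    unfolding gr_def
  proof (intro allI impI)
    fix j k assume ne: "bc (L - F N) j k \<noteq> 0"
    define M where "M = max N (nat (j + C + 1))"
    have "bc (F M) j k = c j k" by (rule stable) (simp add: M_def)
    hence "bc (F M - F N) j k \<noteq> 0" using ne by (simp add: L)
    thus "int (A * k) \<le> j + (C - int N)" using grD[OF tail'[of N M]] by (simp add: M_def)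
  qed
  thus ?thesis by blast
qed

lemma gr_1: "C \<ge> 0 \<Longrightarrow> gr A C 1" by (auto simp: gr_def coeff_1 split: if_splits)

lemma gr_intpow: "gr A j (fls_shift j 1)"
  by (auto simp: gr_def coeff_1 split: if_splits)

lemma gr_prod:
  assumes "\<And>i. i \<in> S \<Longrightarrow> gr A 0 (f i)" shows "gr A 0 (prod f S)"
  using assms
proof (induction S rule: infinite_finite_induct)
  case (insert x S)
  have "gr A (0 + 0) (f x * prod f S)" by (rule gr_mult) (use insert in auto)
  thus ?case using insert by simp
qed (auto intro: gr_1)

definition val_ge :: "int \<Rightarrow> 'r::zero fls \<Rightarrow> bool" where
  "val_ge c f \<longleftrightarrow> (\<forall>l<c. f $$ l = 0)"

lemma val_ge_mono: "val_ge c f \<Longrightarrow> c' \<le> c \<Longrightarrow> val_ge c' f" by (auto simp: val_ge_def)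
lemma val_ge_0 [simp]: "val_ge c 0" by (simp add: val_ge_def)
lemma val_ge_add: "val_ge c f \<Longrightarrow> val_ge c g \<Longrightarrow> val_ge c (f + (g :: 'r::comm_ring_1 fls))" by (auto simp: val_ge_def)
lemma val_ge_diff: "val_ge c f \<Longrightarrow> val_ge c g \<Longrightarrow> val_ge c (f - (g :: 'r::comm_ring_1 fls))" by (auto simp: val_ge_def)
lemma val_ge_uminus: "val_ge c f \<Longrightarrow> val_ge c (- (f :: 'r::comm_ring_1 fls))" by (auto simp: val_ge_def)
lemma val_ge_sum: "(\<And>i. i \<in> S \<Longrightarrow> val_ge c (f i)) \<Longrightarrow> val_ge c (\<Sum>i\<in>S. (f i :: 'r::comm_ring_1 fls))"
  by (induction S rule: infinite_finite_induct) (auto intro: val_ge_add)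
lemma val_ge_mult: "val_ge c f \<Longrightarrow> val_ge c' g \<Longrightarrow> val_ge (c + c') (f * (g :: 'r::comm_ring_1 fls))"
  unfolding val_ge_def
proof (intro allI impI, rule ccontr)
  fix l assume *: "\<forall>l<c. f $$ l = 0" "\<forall>l<c'. g $$ l = 0" "l < c + c'" "(f * g) $$ l \<noteq> 0"
  from *(4) obtain i where "f $$ i \<noteq> 0" "g $$ (l - i) \<noteq> 0" by (rule fls_times_nonzero_nth)
  hence "i \<ge> c" "l - i \<ge> c'" using *(1,2) by (meson not_le)+
  thus False using *(3) by linarith
qed
lemma val_ge_exists: "\<exists>c. val_ge c f" unfolding val_ge_def by (meson fls_nth_vanishes_belowE)
lemma val_ge_all: "(\<And>N::nat. val_ge (int N - c) f) \<Longrightarrow> f = 0"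
proof (rule fls_zero_eqI)
  fix l assume *: "\<And>N::nat. val_ge (int N - c) f"
  show "f $$ l = 0" using *[of "nat (l + c + 1)"] by (simp add: val_ge_def)
qed
lemma val_ge_subdegree: "val_ge (fls_subdegree f) f" by (auto simp: val_ge_def)

text \<open>Bridge from the metric to valuations: the coefficientwise limit is the limit in the
  metric and comes with an error estimate.\<close>

lemma fls_limit:
  fixes Y :: "nat \<Rightarrow> 'r::comm_ring_1 fls"
  assumes "val_ge c (Y 0)" "\<And>N. val_ge (int N + c) (Y (Suc N) - Y N)"
  shows "\<forall>N. val_ge (int N + c) (lim Y - Y N)"
proof -
  have tail: "val_ge (int N + c) (Y (N + M) - Y N)" for N M
  proof (induction M)
    case (Suc M)
    have "val_ge (int N + c) (Y (Suc (N + M)) - Y (N + M))" by (rule val_ge_mono[OF assms(2)]) simp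
    from val_ge_add[OF this Suc] show ?case by simp
  qed simp
  have tail': "val_ge (int N + c) (Y M - Y N)" if "N \<le> M" for N M
    using tail[of N "M - N"] that by simp
  have Yc: "val_ge c (Y N)" for N using val_ge_add[OF tail[of 0 N, simplified] assms(1)] by simp
  define L where "L = Abs_fls (\<lambda>l. Y (nat (l - c + 1)) $$ l)"
  have Lnth: "L $$ l = Y (nat (l - c + 1)) $$ l" for l
    unfolding L_def by (rule nth_Abs_fls_lower_bound[of c]) (use Yc in \<open>auto simp: val_ge_def\<close>)
  have LN: "val_ge (int N + c) (L - Y N)" for N
    unfolding val_ge_def
  proof (intro allI impI)
    fix l assume l: "l < int N + c"
    have "nat (l - c + 1) \<le> N" using l by linarith
    show "(L - Y N) $$ l = 0"
    proof (cases "l < c")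
      case True
      thus ?thesis using Yc by (auto simp: val_ge_def Lnth)
    next
      case False
      have "val_ge (int (nat (l - c + 1)) + c) (Y N - Y (nat (l - c + 1)))" by (rule tail') fact
      hence "(Y N - Y (nat (l - c + 1))) $$ l = 0" using False by (simp add: val_ge_def)
      thus ?thesis by (simp add: Lnth)
    qed
  qed
  have "Y \<longlonglongrightarrow> L"
  proof (rule metric_LIMSEQ_I)
    fix r :: real assume "r > 0"
    then obtain m where m: "(1 / 2) ^ m < r" using real_arch_pow_inv[of r "1/2"] by auto
    have "dist (Y N) L < r" if N: "N \<ge> nat (int m - c) + m" for N
    proof (cases "Y N = L")
      case True
      thus ?thesis using \<open>r > 0\<close> by simp
    next
      case False
      have "val_ge (int N + c) (Y N - L)" using val_ge_uminus[OF LN[of N]] by simp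
      hence "fls_subdegree (Y N - L) \<ge> int N + c"
        using False by (intro fls_subdegree_geI) (auto simp: val_ge_def)
      hence sd: "fls_subdegree (Y N - L) \<ge> int m" using N by linarith
      hence "dist (Y N) L = inverse (2 ^ nat (fls_subdegree (Y N - L)))"
        using False by (simp add: dist_fls_def)
      also have "\<dots> = (1 / 2) ^ nat (fls_subdegree (Y N - L))" by (simp add: power_one_over inverse_eq_divide)
      also have "\<dots> \<le> (1 / 2) ^ m" using sd by (intro power_decreasing) auto
      finally show ?thesis using m by simp
    qed
    thus "\<exists>no. \<forall>n\<ge>no. dist (Y n) L < r" by blast
  qed
  hence "lim Y = L" by (rule limI)
  thus ?thesis using LN by simp
qed

section \<open>The substitution theta = - w ^ (q - 1)\<close>

text \<open>\<open>phi (q - 1)\<close> embeds \<open>F_q((1 / theta))\<close> into \<open>F_q((v))\<close> by \<open>theta = - w ^ (q - 1)\<close>, \<open>w = 1 / v\<close>.\<close>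

definition sign_twist :: "'r::comm_ring_1 fls \<Rightarrow> 'r fls" where
  "sign_twist f = Abs_fls (\<lambda>n. if even n then f $$ n else - f $$ n)"

lemma sign_twist_nth: "sign_twist f $$ n = (if even n then f $$ n else - f $$ n)"
proof -
  obtain N where "\<forall>n<N. f $$ n = 0" by (rule fls_nth_vanishes_belowE)
  thus ?thesis unfolding sign_twist_def by (intro nth_Abs_fls_lower_bound[of N]) auto
qed

lemma sign_twist_add: "sign_twist (f + g) = sign_twist f + sign_twist g" by (rule fls_eqI) (simp add: sign_twist_nth)
lemma sign_twist_mult: "sign_twist (f * g) = sign_twist f * sign_twist g"
proof (rule fls_eqI)
  fix n
  let ?I = "{fls_subdegree f..n - fls_subdegree g}"
  have "(sign_twist f * sign_twist g) $$ n = (\<Sum>i\<in>?I. sign_twist f $$ i * sign_twist g $$ (n - i))"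
  proof (rule fls_times_nth_supp)
    fix i assume "sign_twist f $$ i \<noteq> 0" "sign_twist g $$ (n - i) \<noteq> 0"
    hence "f $$ i \<noteq> 0" "g $$ (n - i) \<noteq> 0" by (auto simp: sign_twist_nth split: if_splits)
    thus "i \<in> ?I" using fls_subdegree_leI[of f i] fls_subdegree_leI[of g "n - i"] by auto
  qed simp
  also have "\<dots> = (\<Sum>i\<in>?I. (if even n then 1 else -1) * (f $$ i * g $$ (n - i)))"
    by (rule sum.cong) (auto simp: sign_twist_nth)
  also have "\<dots> = sign_twist (f * g) $$ n" by (simp add: sign_twist_nth fls_times_nth(2) sum_negf)
  finally show "sign_twist (f * g) $$ n = (sign_twist f * sign_twist g) $$ n" by simp
qed

definition phi :: "nat \<Rightarrow> 'r::field fls \<Rightarrow> 'r fls" where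
  "phi e f = fls_compose_power (sign_twist f) e"

context
  fixes e :: nat assumes e: "e > 0"
begin

lemma phi_add: "phi e (f + g) = phi e f + phi e g" by (simp add: phi_def sign_twist_add)
lemma phi_mult: "phi e (f * g) = phi e f * phi e g" by (simp add: phi_def sign_twist_mult)
lemma phi_const [simp]: "phi e (fls_const c) = fls_const c"
proof -
  have "sign_twist (fls_const c) = fls_const c" by (rule fls_eqI) (simp add: sign_twist_nth)
  thus ?thesis using e by (simp add: phi_def)
qed
lemma phi_0 [simp]: "phi e 0 = 0" using phi_const[of 0] by simp
lemma phi_1 [simp]: "phi e 1 = 1" using phi_const[of 1] by simp
lemma phi_uminus: "phi e (- f) = - phi e f" using phi_add[of f "- f"] by (simp add: eq_neg_iff_add_eq_0 add.commute)
lemma phi_diff: "phi e (f - g) = phi e f - phi e g" using phi_add[of f "- g"] by (simp add: phi_uminus)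
lemma phi_power: "phi e (f ^ n) = phi e f ^ n" by (induction n) (auto simp: phi_mult)
lemma phi_sum: "phi e (sum f S) = (\<Sum>i\<in>S. phi e (f i))"
  by (induction S rule: infinite_finite_induct) (auto simp: phi_add)
lemma phi_prod: "phi e (prod f S) = (\<Prod>i\<in>S. phi e (f i))"
  by (induction S rule: infinite_finite_induct) (auto simp: phi_mult)
lemma phi_nth: "phi e f $$ n = (if int e dvd n then sign_twist f $$ (n div int e) else 0)"
  using e by (simp add: phi_def fls_nth_compose_power)
lemma phi_eq_0_iff [simp]: "phi e f = 0 \<longleftrightarrow> f = 0"
proof
  assume *: "phi e f = 0"
  show "f = 0"
  proof (rule fls_zero_eqI)
    fix n
    have "phi e f $$ (int e * n) = 0" using * by simp
    thus "f $$ n = 0" using e by (simp add: phi_nth sign_twist_nth split: if_splits)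
  qed
qed simp
lemma phi_inverse: "phi e (inverse f) = inverse (phi e f)"
proof (cases "f = 0")
  case False
  hence "phi e f * phi e (inverse f) = 1" by (simp flip: phi_mult)
  thus ?thesis by (metis inverse_unique)
qed simp
lemma phi_divide: "phi e (f / g) = phi e f / phi e g" by (simp add: divide_inverse phi_mult phi_inverse)
lemma phi_theta: "phi e theta = - fls_shift (int e) 1"
proof (rule fls_eqI)
  fix n
  show "phi e theta $$ n = (- fls_shift (int e) 1) $$ n"
  proof (cases "int e dvd n")
    case True
    then obtain m where m: "n = int e * m" by auto
    have "n + int e = 0 \<longleftrightarrow> int e * (m + 1) = 0" by (simp add: m algebra_simps)
    hence "n + int e = 0 \<longleftrightarrow> m = -1" using e by (simp add: eq_neg_iff_add_eq_0)
    thus ?thesis using e by (simp add: phi_nth sign_twist_nth theta_def m)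
  next
    case False
    have "n + int e \<noteq> 0"
    proof
      assume "n + int e = 0"
      hence "n = int e * (-1)" by simp
      hence "int e dvd n" by (rule dvdI)
      thus False using False by contradiction
    qed
    thus ?thesis using False by (simp add: phi_nth)
  qed
qed
lemma phi_val_ge: assumes "val_ge c f" shows "val_ge (int e * c) (phi e f)"
  unfolding val_ge_def
proof (intro allI impI)
  fix l assume l: "l < int e * c"
  show "phi e f $$ l = 0"
  proof (cases "int e dvd l")
    case True
    then obtain m where m: "l = int e * m" by auto
    hence "m < c" using l e by simp
    thus ?thesis using assms e by (auto simp: phi_nth sign_twist_nth m val_ge_def)
  qed (simp add: phi_nth)
qed
lemma phi_nth_nonzero: "phi e f $$ n \<noteq> 0 \<Longrightarrow> int e dvd n" by (auto simp: phi_nth split: if_splits)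

end

lemma ev_gr: assumes "ent E" "gr A C E" "e \<le> A" shows "val_ge (- C) (ev e E)"
  unfolding val_ge_def
proof (intro allI impI, rule ccontr)
  fix l assume l: "l < - C" "ev e E $$ l \<noteq> 0"
  obtain i where "bc E (l + int (e * i)) i \<noteq> 0" using ev_nth_nonzero[OF assms(1) l(2)] by blast
  from grD[OF assms(2) this] have "int (A * i) \<le> l + int (e * i) + C" .
  moreover have "int (e * i) \<le> int (A * i)" using assms(3) by (intro of_nat_mono mult_le_mono1)
  ultimately show False using l by linarith
qed

text \<open>A bound of slope \<open>A\<close> for \<open>E\<close> gives slope \<open>A * q\<close>
  for its twist, hence by the functional equation for \<open>E\<close> itself; iteration reaches
  every slope.\<close>

lemma ent_bootstrap:
  fixes E :: "'a::field poly fls"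
  assumes E: "E = P * fls_compose_power E q + Q" and "ent P" "ent Q" and gr: "gr A C E" "A \<ge> 1" and q: "q \<ge> 2"
  shows "ent E"
proof -
  have "\<exists>C. gr (A * q ^ r) C E" for r
  proof (induction r)
    case (Suc r)
    then obtain C where C: "gr (A * q ^ r) C E" by blast
    have 1: "gr (A * q ^ Suc r) (C * int q) (fls_compose_power E q)"
      using gr_compose[OF _ C, of q] q by (simp add: mult_ac)
    obtain C1 C2 where "gr (A * q ^ Suc r) C1 P" "gr (A * q ^ Suc r) C2 Q" using assms(2,3) by (meson entE)
    hence 2: "gr (A * q ^ Suc r) C1 P" "gr (A * q ^ Suc r) C2 Q" by auto
    have "gr (A * q ^ Suc r) (max (C1 + C * int q) C2) (P * fls_compose_power E q + Q)"
      by (rule gr_add) (rule gr_mono[OF gr_mult[OF 2(1) 1]], simp, rule gr_mono[OF 2(2)], simp)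
    thus ?case using E by metis
  qed (use gr in auto)
  note * = this
  show ?thesis unfolding ent_def
  proof
    fix A'
    have "A' < 2 ^ A'" by (rule less_exp)
    also have "2 ^ A' \<le> q ^ A'" using q by (intro power_mono) auto
    also have "q ^ A' \<le> A * q ^ A'" using gr(2) by simp
    finally have "A' \<le> A * q ^ A'" by simp
    thus "\<exists>C. gr A' C E" using *[of A'] gr_slope_mono by blast
  qed
qed

section \<open>Thakur's power sums\<close>

lemmas power_sum_monic_conv = power_sum_monic_def[OF refl]
lemmas monics_conv = monics_def[OF refl]
lemmas bev_conv = bev_def[OF refl]

lemma val_ge_prod: "(\<And>i. i \<in> S \<Longrightarrow> val_ge 0 (f i)) \<Longrightarrow> val_ge 0 (\<Prod>i\<in>S. (f i :: 'r::comm_ring_1 fls))"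
proof (induction S rule: infinite_finite_induct)
  case (insert x S)
  thus ?case using val_ge_mult[of 0 "f x" 0 "prod f S"] by simp
qed (auto simp: val_ge_def)

lemma val_ge_power: "val_ge 0 f \<Longrightarrow> val_ge 0 ((f :: 'r::comm_ring_1 fls) ^ n)"
  using val_ge_prod[of "{..<n}" "\<lambda>_. f"] by simp

lemma val_ge_inverse_monic_power:
  assumes "lead_coeff a = (1::'a::field)" "n \<ge> 1"
  shows "val_ge (int (degree a)) (inverse (poly_to_Kinf a ^ n))"
proof -
  let ?x = "poly_to_Kinf a"
  have nz: "?x \<noteq> 0" using assms by auto
  have sd: "fls_subdegree ?x = - int (degree a)"
  proof (rule fls_subdegree_eqI)
    show "?x $$ (- int (degree a)) \<noteq> 0" using assms by (simp add: poly_to_Kinf_nth)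
    fix k assume "k < - int (degree a)"
    thus "?x $$ k = 0" by (simp add: poly_to_Kinf_nth coeff_eq_0)
  qed
  have i: "val_ge (int (degree a)) (inverse ?x)"
    using val_ge_subdegree[of "inverse ?x"] by (simp add: sd fls_inverse_subdegree)
  obtain m where n: "n = Suc m" using assms(2) by (cases n) auto
  have "val_ge 0 (inverse ?x)" by (rule val_ge_mono[OF i]) simp
  hence "val_ge (int (degree a) + 0) (inverse ?x * inverse ?x ^ m)" by (intro val_ge_mult[OF i] val_ge_power)
  thus ?thesis by (simp add: n power_inverse)
qed

lemma power_sum_val_ge: "n \<ge> 1 \<Longrightarrow> val_ge (int d) (power_sum_monic d n)"
  unfolding power_sum_monic_conv
proof (rule val_ge_sum)
  fix a :: "'a poly" assume "n \<ge> 1" "a \<in> monics d"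
  hence "lead_coeff a = 1" "degree a = d" by (auto simp: monics_conv)
  thus "val_ge (int d) (inverse (poly_to_Kinf a ^ n))" using val_ge_inverse_monic_power \<open>n \<ge> 1\<close> by blast
qed

lemma finite_monics: "finite (monics d :: 'a::{finite,field} poly set)"
  by (rule card_monics(1)[OF refl])

lemma monic_tuples_0: "monic_tuples N 0 = {[]}" "monic_tuples 0 (Suc r) = {}"
  by (auto simp: monic_tuples_def length_Suc_conv)

text \<open>Degrees decrease strictly, so degree \<open>N\<close> can occur only in the leading
  entry; splitting there gives the recursion on \<open>N\<close> that the deformed sums
  imitate.\<close>

lemma monic_tuples_Suc:
  "monic_tuples (Suc N) (Suc r) = monic_tuples N (Suc r) \<union> (\<lambda>(a, as). a # as) ` (monics N \<times> monic_tuples N r)"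
proof (intro equalityI subsetI)
  fix as :: "'a poly list" assume as: "as \<in> monic_tuples (Suc N) (Suc r)"
  then obtain b bs where bs: "as = b # bs" "length bs = r" by (auto simp: monic_tuples_def length_Suc_conv)
  show "as \<in> monic_tuples N (Suc r) \<union> (\<lambda>(a, as). a # as) ` (monics N \<times> monic_tuples N r)"
  proof (cases "degree b = N")
    case True
    hence "b \<in> monics N" "bs \<in> monic_tuples N r" using as bs by (auto simp: monic_tuples_def monics_conv)
    thus ?thesis unfolding bs(1) by blast
  next
    case False
    hence "degree b < N" using as by (auto simp: monic_tuples_def bs(1))
    moreover have "\<forall>a\<in>set bs. degree a < degree b" using as by (auto simp: monic_tuples_def bs(1))
    ultimately have "as \<in> monic_tuples N (Suc r)" using as by (force simp: monic_tuples_def bs(1))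
    thus ?thesis by blast
  qed
next
  fix as :: "'a poly list"
  assume "as \<in> monic_tuples N (Suc r) \<union> (\<lambda>(a, as). a # as) ` (monics N \<times> monic_tuples N r)"
  thus "as \<in> monic_tuples (Suc N) (Suc r)"
    by (auto simp: monic_tuples_def monics_conv less_Suc_eq)
qed

lemma finite_monic_tuples: "finite (monic_tuples N r :: 'a::{finite,field} poly list set)"
proof (induction N arbitrary: r)
  case 0
  show ?case by (cases r) (simp_all add: monic_tuples_0)
next
  case (Suc N)
  show ?case by (cases r) (simp_all add: monic_tuples_0 monic_tuples_Suc Suc finite_monics)
qed

lemma mzeta_partial_simps:
  "mzeta_partial N [] = 1" "mzeta_partial 0 (n # ns) = 0"
  "mzeta_partial (Suc N) (n # ns) = (mzeta_partial N (n # ns) + power_sum_monic N n * mzeta_partial N ns :: 'a::{finite,field} fls)"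
proof -
  let ?g = "\<lambda>ns as. \<Prod>i<length ns. inverse (poly_to_Kinf (as ! i) ^ (ns ! i)) :: 'a fls"
  let ?B = "(\<lambda>(a, as). a # as) ` (monics N \<times> monic_tuples N (length ns))"
  have g: "?g (n # ns) (a # as) = inverse (poly_to_Kinf a ^ n) * ?g ns as" for a as
    by (simp add: prod.lessThan_Suc_shift del: prod.lessThan_Suc)
  have "mzeta_partial (Suc N) (n # ns) = (\<Sum>as\<in>monic_tuples N (Suc (length ns)) \<union> ?B. ?g (n # ns) as)"
    by (simp add: mzeta_partial_def monic_tuples_Suc)
  also have "\<dots> = (\<Sum>as\<in>monic_tuples N (Suc (length ns)). ?g (n # ns) as) + (\<Sum>as\<in>?B. ?g (n # ns) as)"
  proof (rule sum.union_disjoint)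
    show "finite ?B" by (intro finite_imageI finite_cartesian_product finite_monics finite_monic_tuples)
    show "monic_tuples N (Suc (length ns)) \<inter> ?B = {}" by (auto simp: monic_tuples_def monics_conv)
  qed (rule finite_monic_tuples)
  also have "(\<Sum>as\<in>?B. ?g (n # ns) as) = (\<Sum>(a, as)\<in>monics N \<times> monic_tuples N (length ns). ?g (n # ns) (a # as))"
    by (subst sum.reindex) (auto simp: inj_on_def case_prod_unfold)
  also have "\<dots> = (\<Sum>(a, as)\<in>monics N \<times> monic_tuples N (length ns). inverse (poly_to_Kinf a ^ n) * ?g ns as)"
    by (rule sum.cong) (auto simp only: g split: prod.splits)
  also have "\<dots> = power_sum_monic N n * mzeta_partial N ns"
    by (simp add: power_sum_monic_conv mzeta_partial_def sum_product sum.cartesian_product)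
  finally show "mzeta_partial (Suc N) (n # ns) = (mzeta_partial N (n # ns) + power_sum_monic N n * mzeta_partial N ns :: 'a fls)"
    by (simp only: mzeta_partial_def length_Cons)
qed (simp_all add: mzeta_partial_def monic_tuples_0)

lemma mzeta_partial_val_ge: "val_ge 0 (mzeta_partial N ns :: 'a::{finite,field} fls)" if "\<forall>n\<in>set ns. n \<ge> 1"
  using that
proof (induction N arbitrary: ns)
  case 0
  show ?case by (cases ns) (auto simp: mzeta_partial_simps val_ge_def)
next
  case (Suc N)
  show ?case
  proof (cases ns)
    case Nil
    thus ?thesis by (auto simp: mzeta_partial_simps val_ge_def)
  next
    case (Cons n ms)
    have "val_ge 0 (power_sum_monic N n :: 'a fls)" by (rule val_ge_mono[OF power_sum_val_ge]) (use Suc.prems Cons in auto)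
    hence "val_ge (0 + 0) (power_sum_monic N n * mzeta_partial N ms :: 'a fls)"
      by (intro val_ge_mult Suc.IH) (use Suc.prems Cons in auto)
    thus ?thesis using Suc.IH[OF Suc.prems] by (simp add: Cons mzeta_partial_simps val_ge_add)
  qed
qed

lemma mzeta_limit:
  assumes "\<forall>n\<in>set ns. n \<ge> 1"
  shows "val_ge (int N) (mzeta ns - mzeta_partial N ns :: 'a::{finite,field} fls)"
proof -
  have "\<forall>N. val_ge (int N + 0) (lim (\<lambda>N. mzeta_partial N ns) - mzeta_partial N ns :: 'a fls)"
  proof (rule fls_limit)
    show "val_ge 0 (mzeta_partial 0 ns :: 'a fls)" by (rule mzeta_partial_val_ge[OF assms])
    fix N show "val_ge (int N + 0) (mzeta_partial (Suc N) ns - mzeta_partial N ns :: 'a fls)"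
    proof (cases ns)
      case (Cons n ms)
      have "val_ge (int N + 0) (power_sum_monic N n * mzeta_partial N ms :: 'a fls)"
        by (intro val_ge_mult power_sum_val_ge mzeta_partial_val_ge) (use assms Cons in auto)
      thus ?thesis by (simp add: Cons mzeta_partial_simps)
    qed (simp add: mzeta_partial_simps)
  qed
  thus ?thesis by (simp add: mzeta_def)
qed

text \<open>The only monic polynomial of degree \<open>0\<close> contributes \<open>1\<close>; the
  remaining terms have positive valuation.\<close>

lemma mzeta_single_nonzero:
  assumes "n \<ge> 1" shows "mzeta [n] \<noteq> (0 :: 'a::{finite,field} fls)"
proof
  assume z: "mzeta [n] = (0 :: 'a fls)"
  have m: "monics 0 = {1 :: 'a poly}" by (auto simp: monics_conv elim!: degree_eq_zeroE)
  have "mzeta_partial (Suc 0) [n] = (1 :: 'a fls)"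
    by (simp add: mzeta_partial_simps power_sum_monic_conv m)
  hence "val_ge 1 (- 1 :: 'a fls)" using mzeta_limit[of "[n]" "Suc 0", where 'a = 'a] z assms by simp
  thus False by (auto simp: val_ge_def dest: spec[of _ 0])
qed

lemma carlitz_prod_limit:
  fixes P :: "nat \<Rightarrow> 'a::{finite,field} fls"
  defines "P \<equiv> \<lambda>N. \<Prod>i\<in>{1..N}. inverse (1 - inverse (theta ^ (CARD('a) ^ i - 1)))"
  shows "val_ge (int N) (carlitz_prod - P N)" "val_ge 0 (P N)"
proof -
  have q: "CARD('a) > 1" by (rule q_gt_1[OF refl])
  have th: "inverse (theta ^ m) = (fls_X_intpow (int m) :: 'a fls)" for m
  proof -
    have "fls_X_intpow (int m) * theta ^ m = (1 :: 'a fls)"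
      by (simp add: theta_def fls_X_inv_power_conv_shift_1 fls_shifted_times_simps)
    thus ?thesis by (metis inverse_unique mult.commute)
  qed
  have sd: "val_ge 0 (inverse (1 - inverse (theta ^ m) :: 'a fls))" if "m > 0" for m
  proof -
    have "fls_subdegree (1 - inverse (theta ^ m) :: 'a fls) = 0"
      by (rule fls_subdegree_eqI) (use that in \<open>auto simp: th\<close>)
    thus ?thesis using val_ge_subdegree[of "inverse (1 - inverse (theta ^ m) :: 'a fls)"]
      by (simp add: fls_inverse_subdegree)
  qed
  have unit: "(1 - inverse (theta ^ m) :: 'a fls) \<noteq> 0" if "m > 0" for m
  proof -
    have "(1 - inverse (theta ^ m) :: 'a fls) $$ 0 \<noteq> 0" using that by (simp add: th)
    thus ?thesis by (metis fls_zero_nth)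
  qed
  have tv: "val_ge (int N) (inverse (theta ^ m) :: 'a fls)" if "m \<ge> Suc N" for m N
    unfolding th val_ge_def using that by auto
  have geo: "inverse (1 - z) - 1 = z * inverse (1 - z)" if "1 - z \<noteq> 0" for z :: "'a fls"
    using that by (simp add: field_simps)
  have pos: "CARD('a) ^ i - 1 \<ge> i" for i
  proof -
    have "i < CARD('a) ^ i" by (rule power_gt_expt) (use q in simp)
    thus ?thesis by simp
  qed
  show P0: "val_ge 0 (P N)" for N
    unfolding P_def
  proof (rule val_ge_prod)
    fix i assume "i \<in> {1..N}"
    hence "CARD('a) ^ i - 1 > 0" using pos[of i] by auto
    thus "val_ge 0 (inverse (1 - inverse (theta ^ (CARD('a) ^ i - 1))) :: 'a fls)" by (rule sd)
  qed
  have "\<forall>N. val_ge (int N + 0) (lim P - P N)"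
  proof (rule fls_limit[OF P0])
    fix N
    let ?m = "CARD('a) ^ Suc N - 1"
    let ?u = "1 - inverse (theta ^ ?m) :: 'a fls"
    have m: "?m \<ge> Suc N" by (rule pos)
    have u: "?u \<noteq> 0" by (rule unit) (use m in linarith)
    have "P (Suc N) - P N = P N * (inverse ?u - 1)" by (simp add: P_def algebra_simps)
    also have "inverse ?u - 1 = inverse (theta ^ ?m) * inverse ?u"
      by (rule geo[OF u])
    finally have e: "P (Suc N) - P N = P N * (inverse (theta ^ ?m) * inverse ?u)" .
    have t: "val_ge (int N) (inverse (theta ^ ?m) :: 'a fls)" by (rule tv[OF m])
    have "val_ge 0 (inverse ?u)" by (rule sd) (use m in linarith)
    hence "val_ge (0 + (int N + 0)) (P N * (inverse (theta ^ ?m) * inverse ?u))"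
      by (intro val_ge_mult P0 t)
    thus "val_ge (int N + 0) (P (Suc N) - P N)" by (simp add: e)
  qed
  thus "val_ge (int N) (carlitz_prod - P N)" by (simp add: carlitz_prod_def P_def)
qed

section \<open>The functions Omega, h and their iterated sums\<close>

lemma compose_compose:
  "r > 0 \<Longrightarrow> s > 0 \<Longrightarrow> fls_compose_power (fls_compose_power E r) s = fls_compose_power E (r * s)"
  by (rule fls_eqI) (auto simp: fls_nth_compose_power zdiv_zmult2_eq elim!: dvdE)

text \<open>Since \<open>h\<close> starts at exponent \<open>1\<close>, replacing \<open>v\<close>
  by \<open>v ^ (q ^ N)\<close> raises every exponent by at least \<open>q ^ N - 1 \<ge> N\<close>
  at the same power of \<open>t\<close>.\<close>

lemma gr_compose_decay:
  assumes "gr A C h" "val_ge 1 h" "q \<ge> 2"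
  shows "gr A (C - int N) (fls_compose_power h (q ^ N))"
  unfolding gr_def
proof (intro allI impI)
  fix j k assume ne: "bc (fls_compose_power h (q ^ N)) j k \<noteq> 0"
  have qN: "q ^ N > 0" using assms(3) by simp
  have "N < q ^ N" using assms(3) by (intro power_gt_expt) auto
  hence N: "int N \<le> int (q ^ N) - 1" by linarith
  obtain i where i: "j = int (q ^ N) * i" "bc h i k \<noteq> 0"
    using ne qN by (auto simp: fls_nth_compose_power split: if_splits elim!: dvdE)
  have "i \<ge> 1" using i(2) assms(2) by (auto simp: val_ge_def not_le[symmetric])
  hence "(int (q ^ N) - 1) * 1 \<le> (int (q ^ N) - 1) * i" using qN by (intro mult_left_mono) auto
  hence "int N \<le> j - i" using N by (simp add: i(1) algebra_simps)
  moreover have "int (A * k) \<le> i + C" by (rule grD[OF assms(1) i(2)])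
  ultimately show "int (A * k) \<le> j + (C - int N)" by linarith
qed

text \<open>For \<open>e = q - 1\<close> and \<open>m = q ^ j\<close> the element \<open>ap e m\<close> is \<open>t - theta ^ m\<close>, since \<open>(- 1) ^ m = - 1\<close> in \<open>F_q\<close>.\<close>

definition ap :: "nat \<Rightarrow> nat \<Rightarrow> 'a::field poly fls" where
  "ap e m = tt + fls_shift (int (e * m)) 1"

text \<open>Compared with \<open>bev\<close>, the coefficients become polynomials in
  \<open>t\<close> and the outer variable becomes \<open>theta = - w ^ e\<close>. Twisting by
  \<open>q ^ i\<close> turns the latter into \<open>theta ^ (q ^ i)\<close>, and evaluation at
  \<open>t = theta\<close> returns \<open>bev\<close>.\<close>

definition hx :: "nat \<Rightarrow> 'a::field poly poly \<Rightarrow> 'a poly fls" where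
  "hx e H = poly (map_poly fls_const H) (- fls_shift (int e) 1)"

lemma intpow_mult: "fls_shift i 1 * fls_shift j 1 = (fls_shift (i + j) 1 :: 'r::comm_ring_1 fls)"
  by (simp add: fls_shifted_times_simps)

lemma intpow_power: "fls_shift i 1 ^ n = (fls_shift (int n * i) 1 :: 'r::comm_ring_1 fls)"
  by (induction n) (simp_all add: intpow_mult algebra_simps)

lemma ap_lam: "ap e m = fls_shift (int (e * m)) 1 * lam (e * m)"
proof -
  have "fls_shift (int (e * m)) 1 * (tt * fls_X_intpow (int (e * m)))
      = tt * (fls_shift (int (e * m)) 1 * fls_shift (- int (e * m)) 1 :: 'a poly fls)" by (simp only: ac_simps)
  also have "\<dots> = tt" by (simp only: intpow_mult) simp
  finally show ?thesis by (simp add: ap_def lam_def distrib_left add.commute)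
qed

lemma ap_compose: "r > 0 \<Longrightarrow> fls_compose_power (ap e m) r = ap e (m * r)"
  by (simp add: ap_def mult_ac)

lemma lpoly_ap [simp]: "lpoly (ap e m)"
  unfolding ap_def by (intro lpoly_add lpoly_tt lpoly_intpow)

lemma ent_ap [simp]: "ent (ap e m)" by (rule lpoly_ent) simp

lemma ap_nonzero: "ap e m \<noteq> 0"
proof
  assume "ap e m = (0 :: 'a poly fls)"
  hence "bc (ap e m :: 'a poly fls) 0 1 = 0" by simp
  thus False by (auto simp: ap_def tt_def split: if_splits)
qed

lemma poly_map_fls_const:
  "poly (map_poly fls_const H) z = (\<Sum>k\<le>degree H. fls_const (coeff H k) * (z :: 'r::idom fls) ^ k)"
proof -
  have "degree (map_poly fls_const H) = degree H" by (rule degree_map_poly) simp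
  thus ?thesis by (simp add: poly_altdef coeff_map_poly)
qed

lemma lpoly_hx [simp]: "lpoly (hx e H)"
  unfolding hx_def poly_map_fls_const
  by (intro lpoly_sum lpoly_mult lpoly_power lpoly_const lpoly_uminus lpoly_intpow)

lemma hx_val_ge: "val_ge (- int (e * degree H)) (hx e H)"
  unfolding hx_def poly_map_fls_const
proof (rule val_ge_sum)
  fix k assume "k \<in> {..degree H}"
  hence k: "e * k \<le> e * degree H" by simp
  have "(- fls_shift (int e) 1) ^ k = (-1) ^ k * (fls_shift (int k * int e) 1 :: 'a poly fls)"
    by (subst power_minus) (simp add: intpow_power)
  moreover have "((-1) ^ k * (fls_shift (int k * int e) 1 :: 'a poly fls)) = (if even k then 1 else - 1) * fls_shift (int k * int e) 1"
    by simp
  ultimately have e: "(- fls_shift (int e) 1) ^ k = (if even k then fls_shift (int k * int e) 1 else - (fls_shift (int k * int e) 1 :: 'a poly fls))"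
    by auto
  have k': "int k * int e \<le> int (e * degree H)" using k by (metis mult.commute of_nat_mono of_nat_mult)
  show "val_ge (- int (e * degree H)) (fls_const (coeff H k) * (- fls_shift (int e) 1) ^ k)"
    unfolding e val_ge_def using k' by auto
qed

text \<open>\<open>H n / \<Delta> n\<close> is the Anderson-Thakur polynomial of index \<open>n\<close>.\<close>

locale carlitz =
  fixes q e0 :: nat and H :: "nat \<Rightarrow> 'a::{finite,field} poly poly" and \<Delta> :: "nat \<Rightarrow> 'a poly"
  assumes q_card: "q = CARD('a)" and q_Suc: "q = Suc e0"
    and \<Delta>_nz: "n \<ge> 1 \<Longrightarrow> \<Delta> n \<noteq> 0"
    and degree_H: "n \<ge> 1 \<Longrightarrow> e0 * degree (H n) \<le> q * (n - 1)"
    and bev_H: "n \<ge> 1 \<Longrightarrow> bev (H n) (theta ^ (q ^ d)) = poly_to_Kinf (\<Delta> n) * (ll q d ^ n * power_sum_monic d n)"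
begin

abbreviation \<tau> :: "'r::zero fls \<Rightarrow> 'r fls" where "\<tau> E \<equiv> fls_compose_power E q"

lemma q_ge_2: "q \<ge> 2" using q_gt_1[OF q_card] by simp
lemma e0_pos: "e0 \<ge> 1" "e0 > 0" using q_ge_2 q_Suc by simp_all
lemma q_pos [simp]: "q > 0" "q \<noteq> 0" using q_ge_2 by simp_all

text \<open>\<open>Om = v ^ q * (\<Prod>i\<ge>1. 1 - t / theta ^ (q ^ i))\<close>.\<close>

definition OmN :: "nat \<Rightarrow> 'a poly fls" where
  "OmN N = fls_X_intpow (int q) * (\<Prod>i\<in>{1..N}. lam (e0 * q ^ i))"

lemma gr_lam: "i \<ge> 1 \<Longrightarrow> gr e0 0 (lam (e0 * q ^ i) :: 'a poly fls)"
  unfolding gr_def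
proof (intro allI impI)
  fix j k assume i: "i \<ge> 1" and ne: "bc (lam (e0 * q ^ i) :: 'a poly fls) j k \<noteq> 0"
  hence "(j = 0 \<and> k = 0) \<or> (j = int (e0 * q ^ i) \<and> k = 1)"
    using bc_lam_mult[of "e0 * q ^ i" "1 :: 'a poly fls" j k] by (auto simp: coeff_1 split: if_splits)
  moreover have "e0 * 1 \<le> e0 * q ^ i" by (intro mult_le_mono2) (simp add: Suc_le_eq)
  hence "int (e0 * 1) \<le> int (e0 * q ^ i)" by (rule of_nat_mono)
  ultimately show "int (e0 * k) \<le> j + 0" by (auto simp del: of_nat_mult of_nat_power)
qed

lemma gr_OmN: "gr e0 0 (OmN N)"
proof -
  have "gr e0 (- int q + 0) (fls_X_intpow (int q) * (\<Prod>i\<in>{1..N}. lam (e0 * q ^ i)) :: 'a poly fls)"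
    by (rule gr_mult[OF gr_intpow gr_prod]) (rule gr_lam, simp)
  thus ?thesis unfolding OmN_def by (rule gr_mono) simp
qed

lemma OmN_Suc: "OmN (Suc N) = OmN N * lam (e0 * q ^ Suc N)"
  by (simp add: OmN_def)

lemma gr_OmN_diff: "gr e0 (- int N) (OmN (Suc N) - OmN N)"
proof -
  have "OmN (Suc N) - OmN N = OmN N * (tt * fls_X_intpow (int (e0 * q ^ Suc N)))"
    by (simp only: OmN_Suc lam_def) (simp add: algebra_simps)
  moreover have "gr e0 (- int N) (tt * fls_X_intpow (int (e0 * q ^ Suc N)) :: 'a poly fls)"
    unfolding gr_def
  proof (intro allI impI)
    fix j k assume "bc (tt * fls_X_intpow (int (e0 * q ^ Suc N)) :: 'a poly fls) j k \<noteq> 0"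
    hence jk: "k = 1" "j = int (e0 * q ^ Suc N)"
      using bc_tt_mult[of "int (e0 * q ^ Suc N)" "1 :: 'a poly fls" j k] by (auto simp: coeff_1 split: if_splits)
    have "Suc N < q ^ Suc N" using q_ge_2 by (intro power_gt_expt) auto
    hence "N + 2 \<le> q ^ Suc N" by linarith
    hence "e0 * (N + 2) \<le> e0 * q ^ Suc N" by (rule mult_le_mono2)
    hence "e0 * (N + 1) + e0 \<le> e0 * q ^ Suc N" by (simp add: algebra_simps)
    moreover have "e0 * (N + 1) \<ge> 1 * (N + 1)" using e0_pos(1) by (intro mult_le_mono1)
    ultimately have "e0 + N \<le> e0 * q ^ Suc N" by (simp del: power_Suc)
    hence "int (e0 + N) \<le> int (e0 * q ^ Suc N)" by (rule of_nat_mono)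
    thus "int (e0 * k) \<le> j + (- int N)" by (simp add: jk)
  qed
  ultimately show ?thesis using gr_mult[OF gr_OmN[of N]] by simp
qed

definition Om :: "'a poly fls" where
  "Om = (SOME L. \<forall>N. gr e0 (0 - int N) (L - OmN N))"

lemma Om_limit: "gr e0 (- int N) (Om - OmN N)"
proof -
  have "\<exists>L. \<forall>N. gr e0 (0 - int N) (L - OmN N)"
    by (rule gr_limit) (use gr_OmN gr_OmN_diff in auto)
  from someI_ex[OF this] show ?thesis by (simp add: Om_def)
qed

lemma gr_Om: "gr e0 0 Om" using gr_add[OF Om_limit[of 0, simplified] gr_OmN[of 0]] by simp

text \<open>\<open>\<tau>\<close> shifts the product to the indices \<open>2, ..., N + 1\<close>;
  \<open>ap e0 q\<close> supplies the missing factor \<open>lam (e0 * q)\<close> and lowers the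
  exponent of \<open>v\<close> by \<open>e0 * q\<close>, where
  \<open>q * q - e0 * q = q\<close>.\<close>

lemma OmN_step: "ap e0 q * \<tau> (OmN N) = OmN (Suc N)"
proof -
  have "\<tau> (OmN N) = fls_X_intpow (int (q * q)) * (\<Prod>i\<in>{1..N}. lam (e0 * q ^ Suc i))"
  proof -
    have "\<tau> (\<Prod>i\<in>S. lam (e0 * q ^ i)) = (\<Prod>i\<in>S. lam (e0 * q ^ Suc i) :: 'a poly fls)" if "finite S" for S
      using that by (induction S) (simp_all add: lam_compose mult_ac)
    thus ?thesis by (simp add: OmN_def)
  qed
  also have "(\<Prod>i\<in>{1..N}. lam (e0 * q ^ Suc i)) = (\<Prod>i\<in>{2..Suc N}. lam (e0 * q ^ i) :: 'a poly fls)"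
    using prod.shift_bounds_cl_Suc_ivl[of "\<lambda>i. lam (e0 * q ^ i) :: 'a poly fls" 1 N] by (simp add: numeral_2_eq_2)
  finally have 1: "\<tau> (OmN N) = fls_X_intpow (int (q * q)) * (\<Prod>i\<in>{2..Suc N}. lam (e0 * q ^ i))" .
  have 2: "(\<Prod>i\<in>{1..Suc N}. lam (e0 * q ^ i)) = lam (e0 * q) * (\<Prod>i\<in>{2..Suc N}. lam (e0 * q ^ i) :: 'a poly fls)"
    using prod.atLeast_Suc_atMost[of 1 "Suc N" "\<lambda>i. lam (e0 * q ^ i) :: 'a poly fls"] by (simp add: numeral_2_eq_2)
  have 3: "fls_shift (int (e0 * q)) 1 * fls_X_intpow (int (q * q)) = (fls_X_intpow (int q) :: 'a poly fls)"
    by (simp only: intpow_mult) (simp add: q_Suc algebra_simps)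
  show ?thesis unfolding 1 OmN_def[of "Suc N"] 2 ap_lam by (subst 3[symmetric]) (simp only: ac_simps)
qed

lemma Om_eq: "Om = ap e0 q * \<tau> Om"
proof -
  obtain C where C: "gr e0 C (ap e0 q :: 'a poly fls)" using ent_ap by (rule entE)
  have "gr e0 (\<bar>C\<bar> - int N) (Om - ap e0 q * \<tau> Om)" for N
  proof -
    have "Om - ap e0 q * \<tau> Om = (Om - OmN (Suc N)) - ap e0 q * \<tau> (Om - OmN N)"
      by (simp add: OmN_step[symmetric] algebra_simps)
    moreover have "gr e0 (\<bar>C\<bar> - int N) (Om - OmN (Suc N))" by (rule gr_mono[OF Om_limit]) simp
    moreover have "gr e0 (\<bar>C\<bar> - int N) (ap e0 q * \<tau> (Om - OmN N))"
    proof -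
      have "gr (e0 * q) ((- int N) * int q) (\<tau> (Om - OmN N))" by (rule gr_compose[OF _ Om_limit]) simp
      hence "gr e0 ((- int N) * int q) (\<tau> (Om - OmN N))" by (rule gr_slope_mono) (use q_ge_2 in simp)
      from gr_mult[OF C this] show ?thesis
      proof (rule gr_mono)
        have "int N * 1 \<le> int N * int q" using q_ge_2 by (intro mult_left_mono) auto
        thus "C + - int N * int q \<le> \<bar>C\<bar> - int N" by simp
      qed
    qed
    ultimately show ?thesis using gr_diff by metis
  qed
  hence "Om - ap e0 q * \<tau> Om = 0" by (rule gr_all_0)
  thus ?thesis by simp
qed

lemma ent_Om [simp]: "ent Om"
  by (rule ent_bootstrap[of Om "ap e0 q" q 0 e0 0]) (use Om_eq gr_Om e0_pos q_ge_2 in auto)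

lemma val_ge_Om: "val_ge (int q) Om"
proof -
  have OmN: "val_ge (int q) (OmN N)" for N
  proof -
    have "val_ge 0 (lam m :: 'a poly fls)" for m by (auto simp: lam_def val_ge_def tt_def)
    hence "val_ge (int q + 0) (OmN N)" unfolding OmN_def by (intro val_ge_mult val_ge_prod) (auto simp: val_ge_def)
    thus ?thesis by simp
  qed
  show ?thesis unfolding val_ge_def
  proof (intro allI impI)
    fix l assume l: "l < int q"
    have "(Om - OmN (nat (\<bar>l\<bar> + 1))) $$ l = 0"
      by (rule gr_below[OF Om_limit]) simp
    thus "Om $$ l = 0" using OmN l by (auto simp: val_ge_def)
  qed
qed

end

context carlitz
begin

lemma Om_val_ge_power: "val_ge (int (q * n)) (Om ^ n)"
proof (induction n)
  case (Suc n)
  have "val_ge (int q + int (q * n)) (Om * Om ^ n)" by (rule val_ge_mult[OF val_ge_Om Suc])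
  thus ?case by (simp add: algebra_simps)
qed (auto simp: val_ge_def)

section \<open>The iterated sums\<close>

definition zeta_term :: "nat \<Rightarrow> 'a poly fls" where "zeta_term n = hx e0 (H n) * Om ^ n"

lemma ent_zeta_term [simp]: "ent (zeta_term n)"
  unfolding zeta_term_def by (intro ent_mult ent_power ent_Om lpoly_ent lpoly_hx)

text \<open>\<open>Om ^ n\<close> has order at least \<open>q * n\<close>, while the pole of the
  Anderson-Thakur factor has order at most \<open>q * (n - 1)\<close> by \<open>degree_H\<close>.
  The positive order is what makes the iterated sums converge.\<close>

lemma val_ge_zeta_term: assumes "n \<ge> 1" shows "val_ge 1 (zeta_term n)"
proof -
  have "val_ge (- int (e0 * degree (H n)) + int (q * n)) (zeta_term n)"
    unfolding zeta_term_def by (intro val_ge_mult hx_val_ge Om_val_ge_power)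
  moreover have "1 \<le> - int (e0 * degree (H n)) + int (q * n)"
  proof -
    have "q * n = q * (n - 1) + q" using assms by (cases n) auto
    hence "e0 * degree (H n) + 1 \<le> q * n" using degree_H[OF assms] q_ge_2 by linarith
    thus ?thesis by linarith
  qed
  ultimately show ?thesis by (rule val_ge_mono)
qed

text \<open>Deformation of \<open>mzeta_partial\<close> with the same recursion: the twist of
  \<open>zeta_term n\<close> by \<open>q ^ N\<close> takes the place of the power sum of degree
  \<open>N\<close>.\<close>

fun zeta_sum :: "nat \<Rightarrow> nat list \<Rightarrow> 'a poly fls" where
  "zeta_sum N [] = 1"
| "zeta_sum 0 (n # ns) = 0"
| "zeta_sum (Suc N) (n # ns) = zeta_sum N (n # ns) + fls_compose_power (zeta_term n) (q ^ N) * zeta_sum N ns"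

lemma zeta_sum_convergent:
  assumes "\<forall>n\<in>set ns. n \<ge> 1"
  shows "\<exists>C. gr e0 C (zeta_sum 0 ns) \<and> (\<forall>N. gr e0 (C - int N) (zeta_sum (Suc N) ns - zeta_sum N ns))"
  using assms
proof (induction ns)
  case Nil
  show ?case by (rule exI[of _ 0]) (simp add: gr_1)
next
  case (Cons n ns)
  then obtain C where C: "gr e0 C (zeta_sum 0 ns)" "\<And>N. gr e0 (C - int N) (zeta_sum (Suc N) ns - zeta_sum N ns)" by auto
  obtain L where L: "\<And>N. gr e0 (C - int N) (L - zeta_sum N ns)" using gr_limit[of e0 C "\<lambda>N. zeta_sum N ns"] C by blast
  have "gr e0 C L" using gr_add[OF L[of 0, simplified] C(1)] by simp
  hence bound: "gr e0 C (zeta_sum N ns)" for N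
    using gr_diff[of e0 C L "L - zeta_sum N ns"] gr_mono[OF L[of N], of C] by simp
  obtain C' where C': "gr e0 C' (zeta_term n)" using ent_zeta_term by (rule entE)
  have "gr e0 (C' - int N) (fls_compose_power (zeta_term n) (q ^ N))" for N
    by (rule gr_compose_decay[OF C' val_ge_zeta_term q_ge_2]) (use Cons.prems in simp)
  from gr_mult[OF this bound] have "gr e0 (C' + C - int N) (fls_compose_power (zeta_term n) (q ^ N) * zeta_sum N ns)" for N
    by (simp add: algebra_simps)
  thus ?case by (intro exI[of _ "C' + C"]) simp
qed

text \<open>The limit of the sums \<open>zeta_sum N\<close> with respect to the order in \<open>v\<close>.\<close>

definition zeta_fun :: "nat list \<Rightarrow> 'a poly fls" where
  "zeta_fun ns = (SOME L. \<exists>C. \<forall>N. gr e0 (C - int N) (L - zeta_sum N ns))"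

lemma zeta_fun_limit:
  assumes "\<forall>n\<in>set ns. n \<ge> 1"
  shows "\<exists>C. \<forall>N. gr e0 (C - int N) (zeta_fun ns - zeta_sum N ns)"
proof -
  obtain C where "gr e0 C (zeta_sum 0 ns)" "\<And>N. gr e0 (C - int N) (zeta_sum (Suc N) ns - zeta_sum N ns)"
    using zeta_sum_convergent[OF assms] by auto
  hence "\<exists>L. \<exists>C. \<forall>N. gr e0 (C - int N) (L - zeta_sum N ns)" using gr_limit[of e0 C "\<lambda>N. zeta_sum N ns"] by blast
  from someI_ex[OF this] show ?thesis by (simp add: zeta_fun_def)
qed

lemma zeta_fun_Nil [simp]: "zeta_fun [] = 1"
proof -
  obtain C where "\<And>N. gr e0 (C - int N) (zeta_fun [] - 1)" using zeta_fun_limit[of "[]"] by auto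
  hence "zeta_fun [] - 1 = 0" by (rule gr_all_0)
  thus ?thesis by simp
qed

lemma gr_zeta_fun: assumes "\<forall>n\<in>set ns. n \<ge> 1" shows "\<exists>C. gr e0 C (zeta_fun ns)"
proof -
  obtain C where C: "\<And>N. gr e0 (C - int N) (zeta_fun ns - zeta_sum N ns)" using zeta_fun_limit[OF assms] by auto
  obtain C' where C': "gr e0 C' (zeta_sum 0 ns)" using zeta_sum_convergent[OF assms] by auto
  have "gr e0 (max C C') ((zeta_fun ns - zeta_sum 0 ns) + zeta_sum 0 ns)"
    by (rule gr_add; rule gr_mono[of e0]) (use C[of 0] C' in auto)
  thus ?thesis by auto
qed

text \<open>The defining recursion removes the largest index, this one the smallest: it is either
  positive, and all indices are lowered by one under a \<open>\<tau>\<close>, or \<open>0\<close>,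
  which leaves \<open>zeta_term n\<close> times the twisted sum over the others.\<close>

lemma zeta_sum_snoc: "zeta_sum (Suc N) (ns @ [n]) = \<tau> (zeta_sum N (ns @ [n])) + zeta_term n * \<tau> (zeta_sum N ns)"
proof (induction N arbitrary: ns)
  case 0
  show ?case by (cases ns; cases "tl ns") (auto simp: fls_eq_iff fls_nth_compose_power)
next
  case (Suc N)
  have t: "\<tau> (fls_compose_power E (q ^ N)) = fls_compose_power E (q ^ Suc N)" for E :: "'a poly fls"
    by (subst compose_compose) (simp_all add: mult_ac)
  show ?case
  proof (cases ns)
    case Nil
    have "zeta_sum (Suc (Suc N)) [n] = zeta_sum (Suc N) [n] + fls_compose_power (zeta_term n) (q ^ Suc N)" by simp
    also have "zeta_sum (Suc N) [n] = \<tau> (zeta_sum N [n]) + zeta_term n" using Suc[of "[]"] by simp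
    finally have A: "zeta_sum (Suc (Suc N)) [n] = \<tau> (zeta_sum N [n]) + zeta_term n + fls_compose_power (zeta_term n) (q ^ Suc N)" .
    have B: "\<tau> (zeta_sum (Suc N) [n]) = \<tau> (zeta_sum N [n]) + fls_compose_power (zeta_term n) (q ^ Suc N)"
      by (simp add: t del: power_Suc)
    show ?thesis unfolding Nil append_Nil A B by simp
  next
    case (Cons m ms)
    have "zeta_sum (Suc (Suc N)) (ns @ [n]) = zeta_sum (Suc N) (m # ms @ [n]) + fls_compose_power (zeta_term m) (q ^ Suc N) * zeta_sum (Suc N) (ms @ [n])"
      by (simp only: Cons append_Cons zeta_sum.simps)
    also have "zeta_sum (Suc N) (m # ms @ [n]) = \<tau> (zeta_sum N (m # ms @ [n])) + zeta_term n * \<tau> (zeta_sum N (m # ms))"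
      using Suc[of "m # ms"] by simp
    also have "zeta_sum (Suc N) (ms @ [n]) = \<tau> (zeta_sum N (ms @ [n])) + zeta_term n * \<tau> (zeta_sum N ms)" by (rule Suc)
    finally have A: "zeta_sum (Suc (Suc N)) (ns @ [n]) = \<tau> (zeta_sum N (m # ms @ [n])) + zeta_term n * \<tau> (zeta_sum N (m # ms)) +
      fls_compose_power (zeta_term m) (q ^ Suc N) * (\<tau> (zeta_sum N (ms @ [n])) + zeta_term n * \<tau> (zeta_sum N ms))" .
    have B: "\<tau> (zeta_sum (Suc N) (m # ks)) = \<tau> (zeta_sum N (m # ks)) + fls_compose_power (zeta_term m) (q ^ Suc N) * \<tau> (zeta_sum N ks)" for ks
      by (simp add: t del: power_Suc)
    show ?thesis unfolding A unfolding Cons append_Cons B by (simp only: distrib_left distrib_right ac_simps)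
  qed
qed

lemma zeta_fun_snoc:
  assumes "\<forall>m\<in>set (ns @ [n]). m \<ge> 1"
  shows "zeta_fun (ns @ [n]) = \<tau> (zeta_fun (ns @ [n])) + zeta_term n * \<tau> (zeta_fun ns)"
proof -
  obtain C1 where C1: "\<And>N. gr e0 (C1 - int N) (zeta_fun (ns @ [n]) - zeta_sum N (ns @ [n]))" using zeta_fun_limit[OF assms] by auto
  obtain C2 where C2: "\<And>N. gr e0 (C2 - int N) (zeta_fun ns - zeta_sum N ns)" using zeta_fun_limit[of ns] assms by auto
  obtain C3 where C3: "gr e0 C3 (zeta_term n)" using ent_zeta_term by (rule entE)
  have decay: "gr e0 (\<bar>C\<bar> * int q - int N) (\<tau> D)" if D: "gr e0 (C - int N) D" for C N and D :: "'a poly fls"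
  proof -
    have "gr (e0 * q) ((C - int N) * int q) (\<tau> D)" by (rule gr_compose[OF _ D]) simp
    hence "gr e0 ((C - int N) * int q) (\<tau> D)" by (rule gr_slope_mono) (use q_ge_2 in simp)
    thus ?thesis
    proof (rule gr_mono)
      have "int N * 1 \<le> int N * int q" using q_ge_2 by (intro mult_left_mono) auto
      moreover have "C * int q \<le> \<bar>C\<bar> * int q" by (rule mult_right_mono) auto
      ultimately show "(C - int N) * int q \<le> \<bar>C\<bar> * int q - int N" unfolding left_diff_distrib by linarith
    qed
  qed
  define K where "K = \<bar>C1\<bar> * int q + \<bar>C2\<bar> * int q + \<bar>C1\<bar> + \<bar>C3\<bar>"
  have K: "C1 \<le> K" "\<bar>C1\<bar> * int q \<le> K" "C3 + \<bar>C2\<bar> * int q \<le> K"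
  proof -
    have "0 \<le> \<bar>C1\<bar> * int q" "0 \<le> \<bar>C2\<bar> * int q" by simp_all
    thus "C1 \<le> K" "\<bar>C1\<bar> * int q \<le> K" "C3 + \<bar>C2\<bar> * int q \<le> K" unfolding K_def by linarith+
  qed
  have "gr e0 (K - int N) (zeta_fun (ns @ [n]) - (\<tau> (zeta_fun (ns @ [n])) + zeta_term n * \<tau> (zeta_fun ns)))" for N
  proof -
    have "zeta_fun (ns @ [n]) - (\<tau> (zeta_fun (ns @ [n])) + zeta_term n * \<tau> (zeta_fun ns))
      = (zeta_fun (ns @ [n]) - zeta_sum (Suc N) (ns @ [n])) - (\<tau> (zeta_fun (ns @ [n]) - zeta_sum N (ns @ [n])) + zeta_term n * \<tau> (zeta_fun ns - zeta_sum N ns))"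
      by (simp add: zeta_sum_snoc algebra_simps)
    moreover have "gr e0 (K - int N) (zeta_fun (ns @ [n]) - zeta_sum (Suc N) (ns @ [n]))"
      by (rule gr_mono[OF C1]) (use K in simp)
    moreover have "gr e0 (K - int N) (\<tau> (zeta_fun (ns @ [n]) - zeta_sum N (ns @ [n])))"
      by (rule gr_mono[OF decay[OF C1]]) (use K in simp)
    moreover have "gr e0 (K - int N) (zeta_term n * \<tau> (zeta_fun ns - zeta_sum N ns))"
      by (rule gr_mono[OF gr_mult[OF C3 decay[OF C2]]]) (use K in simp)
    ultimately show ?thesis by (metis gr_add gr_diff)
  qed
  hence "zeta_fun (ns @ [n]) - (\<tau> (zeta_fun (ns @ [n])) + zeta_term n * \<tau> (zeta_fun ns)) = 0" by (rule gr_all_0)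
  thus ?thesis by (simp only: right_minus_eq)
qed

lemma ent_zeta_fun: "\<forall>n\<in>set ns. n \<ge> 1 \<Longrightarrow> ent (zeta_fun ns)"
proof (induction ns rule: rev_induct)
  case (snoc n ns)
  obtain C where C: "gr e0 C (zeta_fun (ns @ [n]))" using gr_zeta_fun[OF snoc.prems] by blast
  show ?case
  proof (rule ent_bootstrap[OF _ _ _ C e0_pos(1) q_ge_2])
    show "zeta_fun (ns @ [n]) = 1 * \<tau> (zeta_fun (ns @ [n])) + zeta_term n * \<tau> (zeta_fun ns)"
      using zeta_fun_snoc[OF snoc.prems] by (simp only: mult_1)
    show "ent (zeta_term n * \<tau> (zeta_fun ns))" by (intro ent_mult ent_zeta_term ent_compose snoc.IH) (use snoc.prems in auto)
  qed simp
qed simp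

section \<open>Values at t = theta\<close>

abbreviation \<phi> :: "'a fls \<Rightarrow> 'a fls" where "\<phi> \<equiv> phi e0"

lemmas phi_hom = phi_add[OF e0_pos(2)] phi_mult[OF e0_pos(2)] phi_power[OF e0_pos(2)] phi_sum[OF e0_pos(2)]
  phi_prod[OF e0_pos(2)] phi_diff[OF e0_pos(2)] phi_uminus[OF e0_pos(2)] phi_inverse[OF e0_pos(2)]
  phi_divide[OF e0_pos(2)] phi_0[OF e0_pos(2)] phi_1[OF e0_pos(2)] phi_const[OF e0_pos(2)]

lemma phi_theta_power: "\<phi> (theta ^ (q ^ i)) = - fls_shift (int (e0 * q ^ i)) 1"
proof -
  have "\<phi> (theta ^ (q ^ i)) = (- fls_shift (int e0) 1) ^ (q ^ i)" by (simp only: phi_hom phi_theta[OF e0_pos(2)])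
  also have "\<dots> = - (fls_shift (int e0) 1 ^ (q ^ i))" by (rule frob_fls(4)[OF q_card])
  also have "\<dots> = - fls_shift (int (e0 * q ^ i)) 1" by (simp only: intpow_power of_nat_mult mult.commute)
  finally show ?thesis .
qed

lemma ev_const: "ev e0 (fls_const p) = \<phi> (poly_to_Kinf p)"
proof (induction p)
  case (pCons a p)
  have "fls_const (pCons a p) = cc (fls_const a) + tt * fls_const p"
    by (rule fls_eqI) (simp add: tt_def)
  hence "ev e0 (fls_const (pCons a p)) = fls_const a + ev e0 tt * \<phi> (poly_to_Kinf p)"
    by (simp add: ev_add ev_mult ent_closed pCons.IH)
  also have "ev e0 tt = \<phi> theta" by (simp add: ev_tt phi_theta[OF e0_pos(2)])
  also have "fls_const a + \<phi> theta * \<phi> (poly_to_Kinf p) = \<phi> (fls_const a + theta * poly_to_Kinf p)"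
    by (simp only: phi_hom)
  also have "fls_const a + theta * poly_to_Kinf p = poly_to_Kinf (pCons a p)"
    by (simp add: poly_to_Kinf_conv map_poly_pCons)
  finally show ?case .
qed (simp add: phi_hom)

lemma ev_hx: "ev e0 (fls_compose_power (hx e0 G) (q ^ i)) = \<phi> (bev G (theta ^ (q ^ i)))"
proof -
  have dm: "degree (map_poly poly_to_Kinf G) = degree G" by (rule degree_map_poly) simp
  have sumc: "fls_compose_power (sum f S) r = (\<Sum>k\<in>S. fls_compose_power (f k) r)" for f :: "nat \<Rightarrow> 'a poly fls" and S r
    by (induction S rule: infinite_finite_induct) auto
  have "fls_compose_power (hx e0 G) (q ^ i)
      = (\<Sum>k\<le>degree G. fls_const (coeff G k) * (- fls_shift (int (e0 * q ^ i)) 1) ^ k)"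
    by (simp add: hx_def poly_map_fls_const sumc mult_ac)
  also have "ev e0 \<dots> = (\<Sum>k\<le>degree G. \<phi> (poly_to_Kinf (coeff G k)) * (- fls_shift (int (e0 * q ^ i)) 1) ^ k)"
  proof (subst ev_sum)
    fix k
    show "ent (fls_const (coeff G k) * (- fls_shift (int (e0 * q ^ i)) 1) ^ k)"
      by (intro ent_closed)
  next
    show "(\<Sum>k\<le>degree G. ev e0 (fls_const (coeff G k) * (- fls_shift (int (e0 * q ^ i)) 1) ^ k))
       = (\<Sum>k\<le>degree G. \<phi> (poly_to_Kinf (coeff G k)) * (- fls_shift (int (e0 * q ^ i)) 1) ^ k)"
      by (rule sum.cong[OF refl])
        (simp only: ev_mult ev_power ev_uminus ev_intpow ev_const ent_const ent_intpow ent_uminus ent_power)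
  qed
  also have "\<dots> = \<phi> (bev G (theta ^ (q ^ i)))"
    by (simp only: bev_conv poly_altdef dm coeff_map_poly poly_to_Kinf_0 phi_hom phi_theta_power[symmetric])
  finally show ?thesis .
qed

definition Om_val :: "'a fls" where "Om_val = ev e0 Om"

lemma Om_iterate: "Om = (\<Prod>j\<in>{1..i}. ap e0 (q ^ j)) * fls_compose_power Om (q ^ i)"
proof (induction i)
  case (Suc i)
  have c: "fls_compose_power Om (q ^ i) = ap e0 (q ^ Suc i) * fls_compose_power Om (q ^ Suc i)"
  proof -
    have "fls_compose_power Om (q ^ i) = fls_compose_power (ap e0 q * \<tau> Om) (q ^ i)" using Om_eq by simp
    also have "\<dots> = ap e0 (q * q ^ i) * fls_compose_power Om (q * q ^ i)"
      by (simp add: ap_compose compose_compose)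
    finally show ?thesis by simp
  qed
  show ?case by (subst Suc, subst c) (simp add: mult_ac)
qed (simp add: fls_eq_iff fls_nth_compose_power)

lemma ev_ap: "ev e0 (ap e0 (q ^ j)) = \<phi> (theta - theta ^ (q ^ j))"
  by (simp only: ap_def ev_add ent_tt ent_intpow ev_tt ev_intpow phi_hom(6) phi_theta_power phi_theta[OF e0_pos(2)])
    simp

lemma Om_val_iterate: "Om_val = \<phi> (ll q i) * ev e0 (fls_compose_power Om (q ^ i))"
proof -
  have "Om_val = ev e0 ((\<Prod>j\<in>{1..i}. ap e0 (q ^ j)) * fls_compose_power Om (q ^ i))"
    unfolding Om_val_def using Om_iterate[of i] by simp
  also have "\<dots> = (\<Prod>j\<in>{1..i}. ev e0 (ap e0 (q ^ j))) * ev e0 (fls_compose_power Om (q ^ i))"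
    by (simp add: ev_mult ev_prod ent_prod ent_compose)
  also have "(\<Prod>j\<in>{1..i}. ev e0 (ap e0 (q ^ j))) = \<phi> (ll q i)"
    by (simp only: ev_ap ll_def[OF q_card] phi_hom)
  finally show ?thesis .
qed

text \<open>The factor \<open>ll q i ^ n\<close> of the Anderson-Thakur identity combines with the
  value of the twisted \<open>Om ^ n\<close> to \<open>Om_val ^ n\<close>. This no longer depends on
  \<open>i\<close> and can be taken out of the sums.\<close>

lemma ev_zeta_term:
  assumes "n \<ge> 1"
  shows "ev e0 (fls_compose_power (zeta_term n) (q ^ i)) = \<phi> (poly_to_Kinf (\<Delta> n) * power_sum_monic i n) * Om_val ^ n"
proof -
  let ?O = "ev e0 (fls_compose_power Om (q ^ i))"
  have "ev e0 (fls_compose_power (zeta_term n) (q ^ i)) = \<phi> (bev (H n) (theta ^ (q ^ i))) * ?O ^ n"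
    by (simp add: zeta_term_def ev_mult ev_power ent_power ent_compose lpoly_ent ev_hx)
  also have "\<dots> = \<phi> (poly_to_Kinf (\<Delta> n) * power_sum_monic i n) * (\<phi> (ll q i) * ?O) ^ n"
    by (simp only: bev_H[OF assms] phi_hom power_mult_distrib ac_simps)
  finally show ?thesis by (simp only: Om_val_iterate[of i, symmetric])
qed

lemma ev_zeta_sum:
  assumes "\<forall>n\<in>set ns. n \<ge> 1"
  shows "ev e0 (zeta_sum N ns) = \<phi> (prod_list (map (\<lambda>n. poly_to_Kinf (\<Delta> n)) ns)) * Om_val ^ sum_list ns * \<phi> (mzeta_partial N ns)"
  using assms
proof (induction N ns rule: zeta_sum.induct)
  case (3 N n ns)
  have ent_zeta_sum: "ent (zeta_sum N ns)" for N ns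
    by (induction N ns rule: zeta_sum.induct) (auto intro!: ent_closed)
  have n: "n \<ge> 1" "\<forall>n\<in>set ns. n \<ge> 1" using 3 by auto
  let ?P = "\<lambda>ns. \<phi> (prod_list (map (\<lambda>n. poly_to_Kinf (\<Delta> n)) ns))"
  have "ev e0 (zeta_sum (Suc N) (n # ns)) = ev e0 (zeta_sum N (n # ns)) + ev e0 (fls_compose_power (zeta_term n) (q ^ N)) * ev e0 (zeta_sum N ns)"
    by (simp add: ev_add ev_mult ent_mult ent_compose ent_zeta_sum)
  also have "\<dots> = ?P (n # ns) * Om_val ^ sum_list (n # ns) * \<phi> (mzeta_partial N (n # ns)) +
     \<phi> (poly_to_Kinf (\<Delta> n) * power_sum_monic N n) * Om_val ^ n * (?P ns * Om_val ^ sum_list ns * \<phi> (mzeta_partial N ns))"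
    by (simp only: "3.IH"(1)[OF "3.prems"] "3.IH"(2)[OF n(2)] ev_zeta_term[OF n(1)])
  also have "\<dots> = ?P (n # ns) * Om_val ^ sum_list (n # ns) * (\<phi> (mzeta_partial N (n # ns)) + \<phi> (power_sum_monic N n) * \<phi> (mzeta_partial N ns))"
    by (simp add: phi_hom power_add algebra_simps)
  finally show ?case by (simp only: mzeta_partial_simps phi_hom)
qed (simp_all add: mzeta_partial_simps phi_hom)

lemma val_ge_all_eq:
  fixes x y :: "'a fls"
  assumes "\<And>N::nat. val_ge (int N - c) (x - y)" shows "x = y"
  using val_ge_all[of c "x - y"] assms by simp

lemma phi_val_ge': "val_ge (int N) f \<Longrightarrow> val_ge (int N) (\<phi> f)"
proof (rule val_ge_mono[OF phi_val_ge[OF e0_pos(2)]])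
  have "1 * int N \<le> int e0 * int N" using e0_pos by (intro mult_right_mono) auto
  thus "int N \<le> int e0 * int N" by simp
qed

theorem ev_zeta_fun:
  assumes "\<forall>n\<in>set ns. n \<ge> 1"
  shows "ev e0 (zeta_fun ns) = \<phi> (prod_list (map (\<lambda>n. poly_to_Kinf (\<Delta> n)) ns)) * Om_val ^ sum_list ns * \<phi> (mzeta ns)"
    (is "_ = ?K * _")
proof -
  obtain C where C: "\<And>N. gr e0 (C - int N) (zeta_fun ns - zeta_sum N ns)" using zeta_fun_limit[OF assms] by auto
  obtain c where c: "val_ge c ?K" using val_ge_exists by blast
  have ent_zeta_sum: "ent (zeta_sum N ns)" for N ns
    by (induction N ns rule: zeta_sum.induct) (auto intro!: ent_closed)
  show ?thesis
  proof (rule val_ge_all_eq)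
    fix N
    have 1: "val_ge (- (C - int N)) (ev e0 (zeta_fun ns) - ?K * \<phi> (mzeta_partial N ns))"
      using ev_gr[OF ent_diff[OF ent_zeta_fun[OF assms] ent_zeta_sum] C order_refl, of N] ev_zeta_sum[OF assms, of N]
      by (simp add: ev_diff ent_zeta_fun[OF assms] ent_zeta_sum)
    have 2: "val_ge (c + int N) (?K * \<phi> (mzeta ns - mzeta_partial N ns))"
      by (intro val_ge_mult c phi_val_ge' mzeta_limit assms)
    have "ev e0 (zeta_fun ns) - ?K * \<phi> (mzeta ns)
       = (ev e0 (zeta_fun ns) - ?K * \<phi> (mzeta_partial N ns)) - ?K * \<phi> (mzeta ns - mzeta_partial N ns)"
      by (simp only: phi_hom) (simp add: algebra_simps)
    moreover have "val_ge (int N - (\<bar>C\<bar> + \<bar>c\<bar>)) (ev e0 (zeta_fun ns) - ?K * \<phi> (mzeta_partial N ns))"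
      by (rule val_ge_mono[OF 1]) linarith
    moreover have "val_ge (int N - (\<bar>C\<bar> + \<bar>c\<bar>)) (?K * \<phi> (mzeta ns - mzeta_partial N ns))"
      by (rule val_ge_mono[OF 2]) linarith
    ultimately show "val_ge (int N - (\<bar>C\<bar> + \<bar>c\<bar>)) (ev e0 (zeta_fun ns) - ?K * \<phi> (mzeta ns))"
      by (simp only: val_ge_diff)
  qed
qed

text \<open>With \<open>w\<close> as the chosen root the period is
  \<open>w ^ q * carlitz_prod\<close>, so \<open>Om_val\<close> is its reciprocal.\<close>

theorem Om_val_carlitz: "Om_val * \<phi> carlitz_prod = fls_X_intpow (int q)"
proof -
  define P where "P N = (\<Prod>i\<in>{1..N}. inverse (1 - inverse (theta ^ (CARD('a) ^ i - 1) :: 'a fls)))" for N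
  have P: "val_ge (int N) (carlitz_prod - P N)" "val_ge 0 (P N)" for N
    using carlitz_prod_limit[where 'a = 'a] by (auto simp: P_def)
  have ent_OmN: "ent (OmN N)" for N unfolding OmN_def by (intro ent_closed)
  have lam_phi: "ev e0 (lam (e0 * q ^ i)) = \<phi> (1 - inverse (theta ^ (q ^ i - 1)))" if "i \<ge> 1" for i
  proof -
    let ?m = "q ^ i"
    have m: "?m \<ge> 1" by (simp add: Suc_le_eq)
    have "ev e0 (lam (e0 * ?m)) = 1 - fls_shift (int e0) 1 * fls_X_intpow (int (e0 * ?m))"
      by (simp only: lam_def ev_add ev_mult ent_closed ev_1 ev_tt ev_intpow) simp
    moreover have "\<phi> (inverse (theta ^ (?m - 1))) = fls_shift (int e0) 1 * fls_X_intpow (int (e0 * ?m))"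
    proof -
      have "\<phi> (theta ^ (?m - 1)) * (fls_shift (int e0) 1 * fls_X_intpow (int (e0 * ?m)))
         = - (\<phi> (theta ^ (?m - 1)) * \<phi> theta) * fls_X_intpow (int (e0 * ?m))"
        by (simp add: phi_theta[OF e0_pos(2)])
      also have "\<phi> (theta ^ (?m - 1)) * \<phi> theta = \<phi> (theta ^ ?m)"
        using m by (simp only: phi_hom(2)[symmetric] power_Suc2[symmetric]) simp
      also have "- \<phi> (theta ^ ?m) * fls_X_intpow (int (e0 * ?m)) = 1"
        by (simp only: phi_theta_power minus_minus intpow_mult) simp
      finally have "inverse (\<phi> (theta ^ (?m - 1))) = fls_shift (int e0) 1 * fls_X_intpow (int (e0 * ?m))"
        by (rule inverse_unique)
      thus ?thesis by (simp only: phi_hom)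
    qed
    ultimately show ?thesis by (simp only: phi_hom)
  qed
  have PY: "ev e0 (OmN N) * \<phi> (P N) = fls_X_intpow (int q)" for N
  proof -
    have u: "\<phi> (1 - inverse (theta ^ (q ^ i - 1))) \<noteq> 0" if "i \<in> {1..N}" for i
    proof -
      have "(ev e0 (lam (e0 * q ^ i)) :: 'a fls) $$ 0 \<noteq> 0"
      proof -
        have "q ^ i > 1" using that q_ge_2 by (intro one_less_power) auto
        hence "e0 * 1 < e0 * q ^ i" using e0_pos by (intro mult_strict_left_mono) auto
        hence ne: "int e0 + - int (e0 * q ^ i) \<noteq> 0" by linarith
        define c where "c = int e0 + - int (e0 * q ^ i)"
        have "ev e0 (lam (e0 * q ^ i)) = 1 - (fls_shift c 1 :: 'a fls)"
          unfolding c_def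
          by (simp only: lam_def ev_add ev_mult ent_closed ev_1 ev_tt ev_intpow intpow_mult[symmetric]) simp
        thus ?thesis using ne[folded c_def] by simp
      qed
      thus ?thesis using lam_phi[of i] that by (metis atLeastAtMost_iff fls_zero_nth)
    qed
    have "ev e0 (OmN N) = fls_X_intpow (int q) * (\<Prod>i\<in>{1..N}. ev e0 (lam (e0 * q ^ i)))"
      by (simp only: OmN_def ev_mult ev_prod ent_closed ev_intpow)
    also have "(\<Prod>i\<in>{1..N}. ev e0 (lam (e0 * q ^ i))) = (\<Prod>i\<in>{1..N}. \<phi> (1 - inverse (theta ^ (q ^ i - 1))))"
      by (rule prod.cong) (simp_all add: lam_phi)
    also have "fls_X_intpow (int q) * \<dots> * \<phi> (P N) = fls_X_intpow (int q) *
        (\<Prod>i\<in>{1..N}. \<phi> (1 - inverse (theta ^ (q ^ i - 1))) * inverse (\<phi> (1 - inverse (theta ^ (q ^ i - 1)))))"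
      by (simp only: P_def phi_hom prod.distrib q_card mult.assoc)
    also have "(\<Prod>i\<in>{1..N}. \<phi> (1 - inverse (theta ^ (q ^ i - 1))) * inverse (\<phi> (1 - inverse (theta ^ (q ^ i - 1))))) = 1"
      by (rule prod.neutral) (use u in auto)
    finally show ?thesis by simp
  qed
  have Y: "val_ge (int N) (Om_val - ev e0 (OmN N))" for N
  proof -
    have "val_ge (- (- int N)) (ev e0 (Om - OmN N))"
      by (rule ev_gr[OF ent_diff Om_limit]) (simp_all add: ent_OmN)
    thus ?thesis by (simp add: ev_diff ent_OmN Om_val_def)
  qed
  have Y0: "val_ge 0 (ev e0 (OmN N))" for N
    using ev_gr[OF ent_OmN gr_OmN order_refl] by simp
  have c0: "val_ge 0 (carlitz_prod :: 'a fls)" using val_ge_add[OF P(1)[of 0, simplified] P(2)[of 0]] by simp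
  show ?thesis
  proof (rule val_ge_all_eq[of 0])
    fix N
    have "Om_val * \<phi> carlitz_prod - fls_X_intpow (int q)
       = (Om_val - ev e0 (OmN N)) * \<phi> carlitz_prod + ev e0 (OmN N) * \<phi> (carlitz_prod - P N)"
      unfolding PY[of N, symmetric] by (simp only: phi_hom) (simp add: algebra_simps)
    moreover have "val_ge (int N + int 0) ((Om_val - ev e0 (OmN N)) * \<phi> carlitz_prod)"
      by (intro val_ge_mult Y phi_val_ge') (use c0 in simp)
    moreover have "val_ge (0 + int N) (ev e0 (OmN N) * \<phi> (carlitz_prod - P N))"
      by (intro val_ge_mult Y0 phi_val_ge' P)
    ultimately show "val_ge (int N - 0) (Om_val * \<phi> carlitz_prod - fls_X_intpow (int q))"
      by (simp add: val_ge_add)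
  qed
qed

end

lemma compose_eq_0_iff:
  assumes "r > 0" shows "fls_compose_power E r = 0 \<longleftrightarrow> E = 0"
proof
  assume *: "fls_compose_power E r = 0"
  show "E = 0"
  proof (rule fls_zero_eqI)
    fix n
    have "fls_compose_power E r $$ (int r * n) = 0" using * by simp
    thus "E $$ n = 0" using assms by (simp add: fls_nth_compose_power)
  qed
qed simp

section \<open>Degrees in t\<close>

definition tdeg :: "'a::field poly fls \<Rightarrow> nat \<Rightarrow> bool" where
  "tdeg E D \<longleftrightarrow> (\<forall>j. degree (E $$ j) \<le> D) \<and> (\<exists>j. bc E j D \<noteq> 0)"

lemma tdeg_unique: "tdeg E D \<Longrightarrow> tdeg E D' \<Longrightarrow> D = D'"
  unfolding tdeg_def by (meson antisym le_degree order_trans)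

lemma tdeg_exists:
  assumes "lpoly E" "E \<noteq> 0" shows "\<exists>D. tdeg E D"
proof -
  obtain D0 B where "blp D0 B E" using assms(1) by (auto simp: lpoly_def)
  hence b: "bc E j k \<noteq> 0 \<Longrightarrow> k \<le> D0" for j k by (auto simp: blp_def)
  let ?P = "\<lambda>k. \<exists>j. bc E j k \<noteq> 0"
  have ex: "\<exists>k. ?P k" using assms(2) bc_eqI[of E 0] by auto
  have bd: "\<forall>k. ?P k \<longrightarrow> k \<le> D0" using b by blast
  have "?P (Greatest ?P)" by (rule GreatestI_ex_nat[OF ex, of D0]) (use bd in blast)
  moreover have "degree (E $$ j) \<le> Greatest ?P" for j
  proof (rule degree_le, intro allI impI, rule ccontr)
    fix k assume "Greatest ?P < k" "bc E j k \<noteq> 0"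
    moreover have "k \<le> Greatest ?P" by (rule Greatest_le_nat[of ?P _ D0]) (use \<open>bc E j k \<noteq> 0\<close> bd in blast)+
    ultimately show False by simp
  qed
  ultimately show ?thesis unfolding tdeg_def by blast
qed

lemma coeff_mult_top:
  fixes f g :: "'a::field poly"
  assumes "degree f \<le> D" "degree g \<le> D'"
  shows "coeff (f * g) (D + D') = coeff f D * coeff g D'"
proof -
  have "coeff (f * g) (D + D') = (\<Sum>i\<le>D + D'. coeff f i * coeff g (D + D' - i))" by (rule coeff_mult)
  also have "\<dots> = (\<Sum>i\<in>{D}. coeff f i * coeff g (D + D' - i))"
  proof (rule sum.mono_neutral_right)
    show "\<forall>i\<in>{..D + D'} - {D}. coeff f i * coeff g (D + D' - i) = 0"
    proof
      fix i assume i: "i \<in> {..D + D'} - {D}"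
      show "coeff f i * coeff g (D + D' - i) = 0"
      proof (cases "i > D")
        case True
        thus ?thesis using assms by (simp add: coeff_eq_0)
      next
        case False
        hence "D + D' - i > D'" using i by auto
        thus ?thesis using assms by (simp add: coeff_eq_0)
      qed
    qed
  qed auto
  finally show ?thesis by simp
qed

text \<open>The coefficients of the top powers of \<open>t\<close> form nonzero Laurent series in
  \<open>v\<close> over a field, and the product of these two series gives the top coefficients of
  \<open>E * F\<close>.\<close>

lemma tdeg_mult:
  assumes E: "tdeg E D" and F: "tdeg F D'"
  shows "tdeg (E * F) (D + D')"
proof -
  define lE where "lE = map_fls (\<lambda>p. coeff p D) E"
  define lF where "lF = map_fls (\<lambda>p. coeff p D') F"
  have n: "lE $$ j = bc E j D" "lF $$ j = bc F j D'" for j by (simp_all add: lE_def lF_def map_fls_nth)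
  have dE: "degree (E $$ j) \<le> D" and dF: "degree (F $$ j) \<le> D'" for j using E F by (auto simp: tdeg_def)
  have top: "bc (E * F) j (D + D') = (lE * lF) $$ j" for j
  proof -
    let ?I = "{fls_subdegree E..j - fls_subdegree F}"
    have "bc (E * F) j (D + D') = (\<Sum>i\<in>?I. coeff (E $$ i * F $$ (j - i)) (D + D'))"
      by (simp add: fls_times_nth(2) coeff_sum)
    also have "\<dots> = (\<Sum>i\<in>?I. lE $$ i * lF $$ (j - i))"
      by (rule sum.cong) (auto simp: coeff_mult_top dE dF n)
    also have "\<dots> = (lE * lF) $$ j"
    proof (rule fls_times_nth_supp[symmetric])
      fix i assume "lE $$ i \<noteq> 0" "lF $$ (j - i) \<noteq> 0"
      hence "E $$ i \<noteq> 0" "F $$ (j - i) \<noteq> 0" by (auto simp: n)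
      thus "i \<in> ?I" using fls_subdegree_leI[of E i] fls_subdegree_leI[of F "j - i"] by auto
    qed simp
    finally show ?thesis .
  qed
  have "lE \<noteq> 0" "lF \<noteq> 0" using E F n by (auto simp: tdeg_def)
  hence "lE * lF \<noteq> 0" by simp
  then obtain j where "(lE * lF) $$ j \<noteq> 0" by (meson fls_zero_eqI)
  hence "\<exists>j. bc (E * F) j (D + D') \<noteq> 0" using top by auto
  moreover have "degree ((E * F) $$ j) \<le> D + D'" for j
    unfolding fls_times_nth(2)
    by (rule degree_sum_le) (auto intro: order_trans[OF degree_mult_le] add_mono dE dF)
  ultimately show ?thesis by (simp add: tdeg_def)
qed

lemma tdeg_power: "tdeg E D \<Longrightarrow> tdeg (E ^ n) (n * D)"
proof (induction n)
  case 0
  show ?case by (auto simp: tdeg_def intro: exI[of _ 0])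
next
  case (Suc n)
  thus ?case using tdeg_mult[of E D "E ^ n" "n * D"] by simp
qed

lemma tdeg_compose:
  assumes "r > 0" "tdeg E D" shows "tdeg (fls_compose_power E r) D"
proof -
  obtain j where "bc E j D \<noteq> 0" using assms(2) by (auto simp: tdeg_def)
  hence "bc (fls_compose_power E r) (int r * j) D \<noteq> 0" using assms(1) by (simp add: fls_nth_compose_power)
  moreover have "degree (fls_compose_power E r $$ j) \<le> D" for j
    using assms by (auto simp: tdeg_def fls_nth_compose_power)
  ultimately show ?thesis unfolding tdeg_def by blast
qed

lemma tdeg_ap: "tdeg (ap e m) 1"
proof -
  have "degree (ap e m $$ j :: 'a poly) \<le> 1" for j
    unfolding ap_def tt_def fls_plus_nth by (rule degree_add_le) auto
  thus ?thesis unfolding tdeg_def by (auto simp: ap_def tt_def intro!: exI[of _ 0])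
qed

section \<open>Embedding into Laurent series over the field of fractions\<close>

text \<open>\<open>F_q[t]\<close> is replaced by its fraction field so that the series form a field,
  as the difference algebra requires; in it, \<open>kw\<close> below is
  \<open>F_q(t, w)\<close>.\<close>

definition fr :: "'a::field poly fls \<Rightarrow> 'a poly fract fls" where "fr = map_fls to_fract"

lemma fr_nth [simp]: "fr E $$ j = to_fract (E $$ j)" by (simp add: fr_def map_fls_nth)
lemma fr_add: "fr (E + F) = fr E + fr F" by (rule fls_eqI) simp
lemma fr_diff: "fr (E - F) = fr E - fr F" by (rule fls_eqI) simp
lemma fr_uminus: "fr (- E) = - fr E" by (rule fls_eqI) simp
lemma fr_mult: "fr (E * F) = fr E * fr F"
  unfolding fr_def by (rule map_fls_mult) simp_all
lemma fr_0 [simp]: "fr 0 = 0" by (rule fls_eqI) simp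
lemma fr_1 [simp]: "fr 1 = 1" by (rule fls_eqI) simp
lemma fr_power: "fr (E ^ n) = fr E ^ n" by (induction n) (simp_all add: fr_mult)
lemma fr_sum: "fr (sum f S) = (\<Sum>i\<in>S. fr (f i))"
  by (induction S rule: infinite_finite_induct) (simp_all add: fr_add)
lemma fr_prod: "fr (prod f S) = (\<Prod>i\<in>S. fr (f i))"
  by (induction S rule: infinite_finite_induct) (simp_all add: fr_mult)
lemma fr_eq_iff [simp]: "fr E = fr F \<longleftrightarrow> E = F"
  by (auto simp: fls_eq_iff)
lemma fr_eq_0_iff [simp]: "fr E = 0 \<longleftrightarrow> E = 0" using fr_eq_iff[of E 0] by simp
lemma fr_compose: "r > 0 \<Longrightarrow> fls_compose_power (fr E) r = fr (fls_compose_power E r)"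
  by (rule fls_eqI) (simp add: fls_nth_compose_power)
lemma fr_const: "fr (fls_const p) = fls_const (to_fract p)" by (rule fls_eqI) simp

lemmas fr_hom = fr_add fr_diff fr_uminus fr_mult fr_power fr_sum fr_prod

lemma CHAR_fract [simp]: "CHAR('b::idom fract) = CHAR('b)"
proof (rule CHAR_eqI)
  have of_nat: "of_nat n = to_fract (of_nat n :: 'b)" for n by (induction n) simp_all
  show "of_nat CHAR('b) = (0 :: 'b fract)" by (simp add: of_nat)
  fix x assume "of_nat x = (0 :: 'b fract)"
  thus "CHAR('b) dvd x" by (simp add: of_nat of_nat_eq_0_iff_char_dvd)
qed

lemma fract_cases_to_fract: obtains a b where "b \<noteq> 0" "x = to_fract a / to_fract (b :: 'b::idom)"
  by (cases x) (auto simp: Fract_conv_to_fract)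

definition kw :: "'a::field poly fract fls set" where "kw = fracs (fr ` {E. lpoly E})"

lemma subrng_lpoly: "subrng (fr ` {E :: 'a::field poly fls. lpoly E})"
  unfolding subrng_def
proof (intro conjI ballI)
  show "1 \<in> fr ` {E :: 'a poly fls. lpoly E}" by (rule image_eqI[of _ _ 1]) auto
  fix x :: "'a poly fract fls" assume "x \<in> fr ` {E. lpoly E}"
  then obtain E where E: "x = fr E" "lpoly E" by auto
  show "- x \<in> fr ` {E. lpoly E}" by (rule image_eqI[of _ _ "- E"]) (use E lpoly_uminus in \<open>auto simp: fr_hom\<close>)
  fix y :: "'a poly fract fls" assume "y \<in> fr ` {E. lpoly E}"
  then obtain F where F: "y = fr F" "lpoly F" by auto
  show "x + y \<in> fr ` {E. lpoly E}" by (rule image_eqI[of _ _ "E + F"]) (use E F lpoly_add in \<open>auto simp: fr_hom\<close>)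
  show "x * y \<in> fr ` {E. lpoly E}" by (rule image_eqI[of _ _ "E * F"]) (use E F lpoly_mult in \<open>auto simp: fr_hom\<close>)
qed

lemma kwI: "lpoly A \<Longrightarrow> lpoly B \<Longrightarrow> B \<noteq> 0 \<Longrightarrow> x = fr A / fr B \<Longrightarrow> x \<in> kw"
  unfolding kw_def by (rule fracsI) auto

lemma kwE: assumes "x \<in> kw" obtains A B where "lpoly A" "lpoly B" "B \<noteq> 0" "x = fr A / fr B"
  using assms by (auto simp: kw_def fracs_def)

lemma kw_fr: "lpoly A \<Longrightarrow> fr A \<in> kw" by (rule kwI[of A 1]) auto

lemma subfld_kw: "subfld (kw :: 'a::field poly fract fls set)"
  unfolding kw_def by (rule subfld_fracs[OF subrng_lpoly])

lemma kw_const: "fls_const c \<in> kw"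
proof -
  obtain a b where ab: "b \<noteq> 0" "c = to_fract a / to_fract b" by (rule fract_cases_to_fract)
  show ?thesis
  proof (rule kwI[of "fls_const a" "fls_const b"])
    have "fls_const c * fls_const (to_fract b) = fls_const (to_fract a)" using ab by simp
    thus "fls_const c = fr (fls_const a) / fr (fls_const b)" using ab
      by (simp add: fr_const nonzero_eq_divide_eq)
  qed (use ab in auto)
qed

text \<open>A fixed series has equal coefficients at \<open>n\<close> and \<open>n / q\<close>, and
  none at exponents not divisible by \<open>q\<close>; descent leaves only the exponent
  \<open>0\<close>. The constants of the difference field are thus \<open>F_q(t)\<close>.\<close>

lemma compose_fixed_const:
  fixes x :: "'b::field fls"
  assumes q: "q \<ge> 2" and x: "fls_compose_power x q = x"
  shows "x = fls_const (x $$ 0)"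
proof (rule fls_eqI)
  have "n \<noteq> 0 \<Longrightarrow> x $$ n = 0" for n
  proof (induction "nat \<bar>n\<bar>" arbitrary: n rule: less_induct)
    case (less n)
    have eq: "x $$ n = (if int q dvd n then x $$ (n div int q) else 0)"
      using arg_cong[OF x, of "\<lambda>f. f $$ n"] q by (simp add: fls_nth_compose_power)
    show ?case
    proof (cases "int q dvd n")
      case True
      then obtain m where m: "n = int q * m" by auto
      have "m \<noteq> 0" using less.prems m by auto
      hence "1 * \<bar>m\<bar> < int q * \<bar>m\<bar>" using q by (intro mult_strict_right_mono) auto
      hence "nat \<bar>m\<bar> < nat \<bar>n\<bar>" using m by (simp add: abs_mult)
      from less.hyps[OF this \<open>m \<noteq> 0\<close>] eq show ?thesis using m q by simp
    qed (use eq in simp)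
  qed
  thus "x $$ n = fls_const (x $$ 0) $$ n" for n by simp
qed

section \<open>Exponents modulo q - 1\<close>

definition exps_mod :: "nat \<Rightarrow> int \<Rightarrow> 'r::zero fls \<Rightarrow> bool" where
  "exps_mod e c f \<longleftrightarrow> (\<forall>l. f $$ l \<noteq> 0 \<longrightarrow> int e dvd (l - c))"

lemma exps_mod_mult: "exps_mod e c f \<Longrightarrow> exps_mod e c' g \<Longrightarrow> exps_mod e (c + c') (f * (g :: 'r::comm_ring_1 fls))"
  unfolding exps_mod_def
proof (intro allI impI)
  fix l assume *: "\<forall>l. f $$ l \<noteq> 0 \<longrightarrow> int e dvd (l - c)" "\<forall>l. g $$ l \<noteq> 0 \<longrightarrow> int e dvd (l - c')" "(f * g) $$ l \<noteq> 0"
  from *(3) obtain i where "f $$ i \<noteq> 0" "g $$ (l - i) \<noteq> 0" by (rule fls_times_nonzero_nth)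
  hence "int e dvd (i - c)" "int e dvd (l - i - c')" using * by auto
  hence "int e dvd (i - c) + (l - i - c')" by (rule dvd_add)
  thus "int e dvd l - (c + c')" by (simp add: algebra_simps)
qed

lemma exps_mod_power: "exps_mod e c f \<Longrightarrow> exps_mod e (int n * c) ((f :: 'r::comm_ring_1 fls) ^ n)"
proof (induction n)
  case (Suc n)
  from exps_mod_mult[OF Suc.prems Suc.IH[OF Suc.prems]] show ?case by (simp add: algebra_simps)
qed (auto simp: exps_mod_def)

lemma exps_mod_cong: "exps_mod e c f \<Longrightarrow> int e dvd (c - c') \<Longrightarrow> exps_mod e c' f"
  unfolding exps_mod_def
proof (intro allI impI)
  fix l assume "\<forall>l. f $$ l \<noteq> 0 \<longrightarrow> int e dvd (l - c)" "int e dvd (c - c')" "f $$ l \<noteq> 0"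
  hence "int e dvd (l - c) + (c - c')" by (intro dvd_add) auto
  thus "int e dvd l - c'" by simp
qed

lemma exps_mod_unique: "exps_mod e c f \<Longrightarrow> exps_mod e c' f \<Longrightarrow> f \<noteq> 0 \<Longrightarrow> int e dvd (c - c')"
proof -
  assume *: "exps_mod e c f" "exps_mod e c' f" "f \<noteq> 0"
  from *(3) obtain l where "f $$ l \<noteq> 0" by (meson fls_zero_eqI)
  hence "int e dvd (l - c')" "int e dvd (l - c)" using * by (auto simp: exps_mod_def)
  from dvd_diff[OF this] show ?thesis by simp
qed

lemma exps_mod_compose:
  assumes "r > 0" "exps_mod e c f" shows "exps_mod e (int r * c) (fls_compose_power f r)"
  unfolding exps_mod_def
proof (intro allI impI)
  fix l assume "fls_compose_power f r $$ l \<noteq> 0"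
  then obtain m where m: "l = int r * m" "f $$ m \<noteq> 0"
    using assms(1) by (auto simp: fls_nth_compose_power split: if_splits elim!: dvdE)
  hence "int e dvd int r * (m - c)" using assms(2) by (auto simp: exps_mod_def)
  thus "int e dvd l - int r * c" by (simp add: m algebra_simps)
qed

lemma exps_mod_ev_const:
  assumes "e dvd e'" shows "exps_mod e 0 (ev e' (fls_const c))"
  unfolding exps_mod_def
proof (intro allI impI)
  fix l assume "ev e' (fls_const c) $$ l \<noteq> 0"
  then obtain i where "bc (fls_const c) (l + int (e' * i)) i \<noteq> 0" using ev_nth_nonzero[OF ent_const] by blast
  hence "l + int (e' * i) = 0" by (auto split: if_splits)
  hence "l = - int (e' * i)" by linarith
  thus "int e dvd l - 0" using assms by simp
qed

context carlitz
begin

lemma phi_exps_mod: "exps_mod e0 0 (\<phi> f)"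
  using phi_nth_nonzero[OF e0_pos(2)] by (auto simp: exps_mod_def)

lemma Om_val_nonzero: "Om_val \<noteq> 0"
proof
  assume "Om_val = 0"
  hence "fls_X_intpow (int q) = (0 :: 'a fls)" using Om_val_carlitz by simp
  thus False by simp
qed

lemma carlitz_prod_nonzero: "carlitz_prod \<noteq> (0 :: 'a fls)"
proof
  assume "carlitz_prod = (0 :: 'a fls)"
  hence "fls_X_intpow (int q) = (0 :: 'a fls)" using Om_val_carlitz by (simp add: phi_hom)
  thus False by simp
qed

lemma exps_mod_Om_val: "exps_mod e0 1 Om_val"
proof -
  have "\<phi> carlitz_prod \<noteq> 0" using carlitz_prod_nonzero by (simp add: phi_eq_0_iff[OF e0_pos(2)])
  hence "Om_val = fls_X_intpow (int q) * \<phi> (inverse carlitz_prod)"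
    using Om_val_carlitz by (simp add: phi_hom field_simps)
  moreover have "exps_mod e0 1 (fls_X_intpow (int q) :: 'a fls)"
    unfolding exps_mod_def
  proof (intro allI impI)
    fix l assume "(fls_X_intpow (int q) :: 'a fls) $$ l \<noteq> 0"
    hence "l - 1 = int e0" by (simp add: q_Suc split: if_splits)
    thus "int e0 dvd l - 1" by simp
  qed
  ultimately show ?thesis using exps_mod_mult[of e0 1 "fls_X_intpow (int q)" 0 "\<phi> (inverse carlitz_prod)"] phi_exps_mod by simp
qed

text \<open>p divides \<open>q = e0 + 1\<close> and is therefore prime to \<open>e0\<close>.\<close>

lemma not_dvd_p_power: assumes "\<not> e0 dvd m" shows "\<not> int e0 dvd int (m * CHAR('a) ^ j)"
proof -
  have "CHAR('a) dvd Suc e0" using CHAR_dvd_q[OF q_card] by (simp add: q_Suc)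
  have "coprime e0 CHAR('a)"
  proof (rule coprimeI)
    fix c assume "c dvd e0" "c dvd CHAR('a)"
    hence "c dvd Suc e0" using \<open>CHAR('a) dvd Suc e0\<close> dvd_trans by blast
    thus "is_unit c" using \<open>c dvd e0\<close> by (metis Suc_eq_plus1 dvd_add_right_iff)
  qed
  hence "coprime e0 (CHAR('a) ^ j)" by simp
  hence "\<not> e0 dvd m * CHAR('a) ^ j" using assms by (metis coprime_dvd_mult_left_iff)
  thus ?thesis by (simp only: int_dvd_int_iff not_False_eq_True)
qed

sublocale df: difference_field "\<lambda>E :: 'a poly fract fls. fls_compose_power E q"
proof
  show "prime CHAR('a poly fract fls)" using char_prime[OF q_card] by simp
qed simp_all

lemma Fix_const: "x \<in> df.Fix \<Longrightarrow> \<exists>c. x = fls_const c"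
  unfolding df.Fix_def using compose_fixed_const[OF q_ge_2] by blast

lemma good_kw: "df.good kw"
  unfolding df.good_def
proof (intro conjI subfld_kw)
  show "(\<lambda>E :: 'a poly fract fls. \<tau> E) ` kw \<subseteq> kw"
  proof (rule image_subsetI)
    fix x assume "x \<in> (kw :: 'a poly fract fls set)"
    then obtain A B where *: "lpoly A" "lpoly B" "B \<noteq> 0" "x = fr A / fr B" by (rule kwE)
    show "\<tau> x \<in> kw"
    proof (rule kwI)
      show "lpoly (\<tau> A)" "lpoly (\<tau> B)" using * by (auto intro: lpoly_compose)
      show "\<tau> B \<noteq> 0" using * by (simp add: compose_eq_0_iff)
      show "\<tau> x = fr (\<tau> A) / fr (\<tau> B)" unfolding *(4) by (simp add: df.tau_divide fr_compose)
    qed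
  qed
  show "df.Fix \<subseteq> kw" using Fix_const kw_const by blast
qed

abbreviation OmF :: "'a poly fract fls" where "OmF \<equiv> fr Om"
definition E0 :: "'a poly fract fls set" where "E0 = adj kw OmF"

lemma Om_nonzero: "Om \<noteq> 0"
proof
  assume "Om = 0"
  hence "Om_val = 0" by (simp add: Om_val_def)
  thus False using Om_val_nonzero by simp
qed

lemma tau_OmF: "\<tau> OmF = OmF / fr (ap e0 q)"
proof -
  have "\<tau> OmF * fr (ap e0 q) = fr (ap e0 q * \<tau> Om)"
    by (simp only: fr_mult fr_compose[OF q_pos(1)] mult.commute)
  also have "\<dots> = OmF" by (simp only: Om_eq[symmetric])
  finally have 1: "\<tau> OmF * fr (ap e0 q) = OmF" .
  have 2: "fr (ap e0 q :: 'a poly fls) \<noteq> 0" using ap_nonzero[of e0 q] by simp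
  show ?thesis by (rule nonzero_eq_divide_eq[OF 2, THEN iffD2, OF 1])
qed

text \<open>Comparison of degrees in \<open>t\<close>: \<open>\<tau>\<close> preserves them, while
  the factor \<open>ap e0 q ^ e\<close> raises them by \<open>e\<close>.\<close>

lemma no_twisted_solution:
  fixes c :: "'a poly fract fls"
  assumes "e > 0" "c \<in> kw" "c = fr (ap e0 q) ^ e * \<tau> c" shows "c = 0"
proof (rule ccontr)
  assume "c \<noteq> 0"
  obtain A B where *: "lpoly A" "lpoly B" "B \<noteq> 0" "c = fr A / fr B" using assms(2) by (rule kwE)
  have A: "A \<noteq> 0" using * \<open>c \<noteq> 0\<close> by auto
  have tB: "fr (\<tau> B) \<noteq> 0" using * by (simp add: compose_eq_0_iff)
  have tq: "\<tau> (fr A / fr B) = fr (\<tau> A) / fr (\<tau> B)" by (simp add: df.tau_divide fr_compose)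
  have "fr A / fr B = (fr (ap e0 q) ^ e * fr (\<tau> A)) / fr (\<tau> B)"
    using assms(3) unfolding *(4) tq times_divide_eq_right .
  hence "fr A * fr (\<tau> B) = (fr (ap e0 q) ^ e * fr (\<tau> A)) * fr B"
    using frac_eq_eq[of "fr B" "fr (\<tau> B)"] tB *(3) by (metis fr_eq_0_iff)
  hence "fr (A * \<tau> B) = fr (ap e0 q ^ e * \<tau> A * B)" by (simp only: fr_hom)
  hence eq: "A * \<tau> B = ap e0 q ^ e * \<tau> A * B" by (simp only: fr_eq_iff)
  obtain a b where ab: "tdeg A a" "tdeg B b" using tdeg_exists * A by blast
  have "tdeg (A * \<tau> B) (a + b)" by (intro tdeg_mult tdeg_compose ab) simp
  moreover have "tdeg (ap e0 q ^ e * \<tau> A * B) (e * 1 + a + b)"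
    by (intro tdeg_mult tdeg_power tdeg_ap tdeg_compose ab) simp
  ultimately show False using tdeg_unique eq assms(1) by fastforce
qed

lemma ap_facts: "fr (ap e0 q :: 'a poly fls) \<in> kw" "fr (ap e0 q :: 'a poly fls) \<noteq> 0" "OmF \<noteq> 0"
  using ap_nonzero Om_nonzero by (auto intro: kw_fr)

lemma OmF_transcendental: "OmF \<notin> clo kw"
  by (rule df.torus_transcendental[OF good_kw ap_facts(1,2,3) tau_OmF no_twisted_solution])

lemma good_E0: "df.good E0"
  unfolding E0_def
proof (rule df.good_adj[OF good_kw])
  show "\<tau> OmF \<in> adj kw OmF" unfolding tau_OmF
    by (rule subfld_divide[OF subfld_adj[OF subfld_kw]]) (use adj_incl[OF subfld_kw] adj_self[OF subfld_kw] ap_facts in auto)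
qed

lemma zeta_term_E0: "fr (zeta_term n) \<in> E0"
  unfolding E0_def zeta_term_def fr_hom
  by (intro subfld_mult[OF subfld_adj[OF subfld_kw]] subfld_power[OF subfld_adj[OF subfld_kw]] adj_self[OF subfld_kw]
    adj_incl[OF subfld_kw] kw_fr lpoly_hx)

lemma ev_Om_vanishes: "ev (e0 * q ^ Suc r) Om = 0"
proof -
  have "Om = (\<Prod>j\<in>{1..Suc r}. ap e0 (q ^ j)) * fls_compose_power Om (q ^ Suc r)" by (rule Om_iterate)
  also have "(\<Prod>j\<in>{1..Suc r}. ap e0 (q ^ j)) = (\<Prod>j\<in>{1..r}. ap e0 (q ^ j)) * ap e0 (q ^ Suc r)" by simp
  finally have "ev (e0 * q ^ Suc r) Om = ev (e0 * q ^ Suc r) (\<Prod>j\<in>{1..r}. ap e0 (q ^ j)) * ev (e0 * q ^ Suc r) (ap e0 (q ^ Suc r))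
     * ev (e0 * q ^ Suc r) (fls_compose_power Om (q ^ Suc r))"
    by (metis ent_Om ent_ap ent_compose ent_mult ent_prod ev_mult q_pos(1) zero_less_power)
  also have "ev (e0 * q ^ Suc r) (ap e0 (q ^ Suc r)) = (0 :: 'a fls)"
    unfolding ap_lam by (simp only: ev_mult ent_closed ev_lam) simp
  finally show ?thesis by simp
qed

lemma zeta_fun_single: assumes "n \<ge> 1" shows "zeta_fun [n] = \<tau> (zeta_fun [n]) + zeta_term n"
  using zeta_fun_snoc[of "[]" n] assms by simp

text \<open>At \<open>t = theta ^ (q ^ Suc r)\<close> the series \<open>Om\<close> vanishes, hence
  so does \<open>zeta_term n\<close>, and the functional equation reduces to invariance under
  \<open>\<tau>\<close>, which connects neighbouring points.\<close>

lemma ev_zeta_fun_single: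
  assumes "n \<ge> 1" shows "ev (e0 * q ^ r) (zeta_fun [n]) = fls_compose_power (ev e0 (zeta_fun [n])) (q ^ r)"
proof (induction r)
  case 0
  show ?case by (simp add: fls_eq_iff fls_nth_compose_power)
next
  case (Suc r)
  have e: "ent (zeta_fun [n])" using ent_zeta_fun[of "[n]"] assms by simp
  have "ev (e0 * q ^ Suc r) (zeta_fun [n]) = ev (e0 * q ^ Suc r) (\<tau> (zeta_fun [n])) + ev (e0 * q ^ Suc r) (zeta_term n)"
    using zeta_fun_single[OF assms] e by (metis ent_compose ent_zeta_term ev_add q_pos(1))
  also have "ev (e0 * q ^ Suc r) (zeta_term n) = 0"
    unfolding zeta_term_def using assms
    by (simp only: ev_mult ev_power lpoly_ent lpoly_hx ent_power ent_Om ev_Om_vanishes) simp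
  also have "ev (e0 * q ^ Suc r) (\<tau> (zeta_fun [n])) = ev ((e0 * q ^ r) * q) (\<tau> (zeta_fun [n]))" by (simp add: mult_ac)
  also have "\<dots> = \<tau> (ev (e0 * q ^ r) (zeta_fun [n]))" by (rule ev_compose) (use e in auto)
  also have "\<dots> = fls_compose_power (ev e0 (zeta_fun [n])) (q ^ Suc r)"
    by (simp add: Suc compose_compose mult_ac)
  finally show ?case by simp
qed

lemma ev_zeta_fun_single_exps_mod:
  assumes "n \<ge> 1" shows "exps_mod e0 (int n) (ev e0 (zeta_fun [n]))" "ev e0 (zeta_fun [n]) \<noteq> 0"
proof -
  have v: "ev e0 (zeta_fun [n]) = Om_val ^ n * \<phi> (poly_to_Kinf (\<Delta> n) * mzeta [n])"
    using ev_zeta_fun[of "[n]"] assms by (simp add: phi_hom mult_ac)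
  have "exps_mod e0 (int n * 1 + 0) (ev e0 (zeta_fun [n]))" unfolding v by (intro exps_mod_mult exps_mod_power exps_mod_Om_val phi_exps_mod)
  thus "exps_mod e0 (int n) (ev e0 (zeta_fun [n]))" by simp
  show "ev e0 (zeta_fun [n]) \<noteq> 0" unfolding v using Om_val_nonzero mzeta_single_nonzero[OF assms] \<Delta>_nz[OF assms]
    by (simp add: phi_eq_0_iff[OF e0_pos(2)])
qed

text \<open>At \<open>t = theta ^ (q ^ r)\<close> the left-hand side vanishes, and the exponents of the two remaining values are
  \<open>n * p ^ j\<close> and \<open>0\<close> modulo \<open>q - 1\<close>.\<close>

lemma no_relation:
  assumes n: "n \<ge> 1" "\<not> e0 dvd n" and m: "m \<ge> 1" and A: "lpoly A" "lpoly B" "B \<noteq> 0"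
    and rel: "A * Om ^ m = B * (fls_const c * zeta_fun [n] ^ (CHAR('a) ^ j) + fls_const c')"
  shows "c = 0"
proof (rule ccontr)
  assume c: "c \<noteq> 0"
  obtain D N where DN: "blp D N B" using A(2) by (auto simp: lpoly_def)
  have "lpoly (fls_const c)" by simp
  then obtain D' N' where DN': "blp D' N' (fls_const c)" by (auto simp: lpoly_def)
  \<comment> \<open>Far enough out that neither \<open>B\<close> nor \<open>c\<close> vanishes at
    the point, by \<open>ev_nonzero_large\<close>.\<close>
  define r where "r = 2 * N + 2 * N'"
  let ?e = "e0 * q ^ Suc r"
  have "Suc r < q ^ Suc r" using q_ge_2 by (intro power_gt_expt) auto
  also have "1 * q ^ Suc r \<le> ?e" using e0_pos by (intro mult_le_mono1) auto
  finally have e: "?e > 2 * N" "?e > 2 * N'" by (simp_all add: r_def)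
  have zeta_fun: "ent (zeta_fun [n])" using ent_zeta_fun[of "[n]"] n by simp
  let ?L = "fls_compose_power (ev e0 (zeta_fun [n])) (q ^ Suc r)"
  have "ev ?e (A * Om ^ m) = 0"
    using m by (simp only: ev_mult ev_power lpoly_ent A ent_power ent_Om ev_Om_vanishes) simp
  moreover have "ev ?e (B * (fls_const c * zeta_fun [n] ^ (CHAR('a) ^ j) + fls_const c'))
     = ev ?e B * (ev ?e (fls_const c) * ?L ^ (CHAR('a) ^ j) + ev ?e (fls_const c'))"
    by (simp only: ev_mult ev_add ev_power lpoly_ent A ent_closed zeta_fun ev_zeta_fun_single[OF n(1)])
  ultimately have "ev ?e B * (ev ?e (fls_const c) * ?L ^ (CHAR('a) ^ j) + ev ?e (fls_const c')) = 0"
    unfolding rel by simp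
  moreover have "ev ?e B \<noteq> 0" by (rule ev_nonzero_large[OF DN A(3) e(1)])
  ultimately have eq: "ev ?e (fls_const c) * ?L ^ (CHAR('a) ^ j) = - ev ?e (fls_const c')"
    by (simp add: eq_neg_iff_add_eq_0)
  have L: "?L \<noteq> 0" using ev_zeta_fun_single_exps_mod(2)[OF n(1)] by (simp add: compose_eq_0_iff)
  have nz: "ev ?e (fls_const c) * ?L ^ (CHAR('a) ^ j) \<noteq> 0"
    using ev_nonzero_large[OF DN' _ e(2)] c L by simp
  have s0: "exps_mod e0 0 (ev ?e (fls_const x))" for x :: "'a poly" by (rule exps_mod_ev_const) simp
  have "exps_mod e0 (int (q ^ Suc r) * int n) ?L"
    by (rule exps_mod_compose[OF _ ev_zeta_fun_single_exps_mod(1)[OF n(1)]]) simp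
  \<comment> \<open>\<open>q\<close> is congruent to \<open>1\<close> modulo \<open>e0\<close>, so
    the Frobenius twist does not change the residue of the exponents.\<close>
  moreover have "int e0 dvd int (q ^ Suc r) * int n - int n"
  proof -
    have "int e0 dvd int q ^ k - 1" for k
    proof (induction k)
      case (Suc k)
      have "int q ^ Suc k - 1 = int q * (int q ^ k - 1) + int e0" by (simp add: q_Suc algebra_simps)
      thus ?case using dvd_add[OF dvd_mult[OF Suc, of "int q"] dvd_refl] by simp
    qed simp
    hence "int e0 dvd (int q ^ Suc r - 1) * int n" by (rule dvd_mult2)
    thus ?thesis by (simp add: left_diff_distrib)
  qed
  ultimately have "exps_mod e0 (int n) ?L" by (rule exps_mod_cong)
  hence "exps_mod e0 (0 + int (CHAR('a) ^ j) * int n) (ev ?e (fls_const c) * ?L ^ (CHAR('a) ^ j))" by (intro exps_mod_mult s0 exps_mod_power)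
  moreover have "exps_mod e0 0 (ev ?e (fls_const c) * ?L ^ (CHAR('a) ^ j))" using s0[of c'] unfolding eq by (simp add: exps_mod_def)
  ultimately have "int e0 dvd (0 + int (CHAR('a) ^ j) * int n) - 0" using nz by (rule exps_mod_unique)
  thus False using not_dvd_p_power[OF n(2), of j] by (simp add: mult.commute)
qed

text \<open>Both \<open>x * Om ^ (n * p ^ j)\<close> and
  \<open>\<kappa> * zeta_fun [n] ^ (p ^ j)\<close> solve
  \<open>u - \<tau> u = \<kappa> * zeta_term n ^ (p ^ j)\<close>. They differ by a constant, and
  after clearing denominators this is a relation as in \<open>no_relation\<close>.\<close>

lemma no_torus_solution:
  assumes n: "n \<ge> 1" "\<not> e0 dvd n" and x: "x \<in> kw" and \<kappa>: "\<kappa> \<in> df.Fix"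
    and eq: "x - \<tau> x / fr (ap e0 q) ^ (n * CHAR('a) ^ j) = \<kappa> * fr (hx e0 (H n)) ^ (CHAR('a) ^ j)"
  shows "\<kappa> = 0"
proof -
  let ?m = "n * CHAR('a) ^ j"
  let ?F = "fr (zeta_fun [n])"
  have ppos: "CHAR('a) > 0" using char_prime[OF q_card] prime_gt_0_nat by blast
  have "(x * OmF ^ ?m) - \<tau> (x * OmF ^ ?m) = (x - \<tau> x / fr (ap e0 q) ^ ?m) * OmF ^ ?m"
    by (simp add: df.tau_mult df.tau_power tau_OmF power_divide field_simps)
  also have "\<dots> = \<kappa> * fr (zeta_term n) ^ (CHAR('a) ^ j)"
    unfolding eq by (simp add: zeta_term_def fr_hom power_mult_distrib power_mult)
  finally have 1: "(x * OmF ^ ?m) - \<tau> (x * OmF ^ ?m) = \<kappa> * fr (zeta_term n) ^ (CHAR('a) ^ j)" .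
  have "zeta_term n = zeta_fun [n] - \<tau> (zeta_fun [n])" using zeta_fun_single[OF n(1)] by (simp only: eq_diff_eq add.commute)
  hence F: "?F - \<tau> ?F = fr (zeta_term n)" by (simp only: fr_diff fr_compose[OF q_pos(1)])
  have pd: "(y - z) ^ (CHAR('a) ^ j) = y ^ (CHAR('a) ^ j) - z ^ (CHAR('a) ^ j)" for y z :: "'a poly fract fls"
  proof (induction j)
    case (Suc j)
    have "(y - z) ^ (CHAR('a) ^ Suc j) = ((y - z) ^ (CHAR('a) ^ j)) ^ CHAR('a)" by (simp only: power_Suc2 power_mult)
    also have "\<dots> = (y ^ (CHAR('a) ^ j)) ^ CHAR('a) - (z ^ (CHAR('a) ^ j)) ^ CHAR('a)" using df.power_p_diff by (simp add: Suc)
    finally show ?case by (simp only: power_Suc2 power_mult)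
  qed simp
  have "\<kappa> * ?F ^ (CHAR('a) ^ j) - \<tau> (\<kappa> * ?F ^ (CHAR('a) ^ j)) = \<kappa> * (?F - \<tau> ?F) ^ (CHAR('a) ^ j)"
    using \<kappa> by (simp add: df.Fix_def df.tau_mult df.tau_power pd right_diff_distrib)
  hence 2: "\<kappa> * ?F ^ (CHAR('a) ^ j) - \<tau> (\<kappa> * ?F ^ (CHAR('a) ^ j)) = \<kappa> * fr (zeta_term n) ^ (CHAR('a) ^ j)"
    unfolding F .
  have "\<tau> (u - v) = u - v" if "u - \<tau> u = w" "v - \<tau> v = w" for u v w :: "'a poly fract fls"
  proof -
    have "u = w + \<tau> u" "v = w + \<tau> v" using that by (simp_all only: diff_eq_eq)
    hence "u - v = (w + \<tau> u) - (w + \<tau> v)" by (rule arg_cong2)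
    also have "\<dots> = \<tau> (u - v)" by (simp only: df.tau_diff add_diff_cancel_left)
    finally show ?thesis by (rule sym)
  qed
  from this[OF 1 2] have "x * OmF ^ ?m - \<kappa> * ?F ^ (CHAR('a) ^ j) \<in> df.Fix" by (simp only: df.Fix_def mem_Collect_eq)
  then obtain k' where k': "x * OmF ^ ?m - \<kappa> * ?F ^ (CHAR('a) ^ j) = fls_const k'" using Fix_const by blast
  obtain k where k: "\<kappa> = fls_const k" using Fix_const[OF \<kappa>] by blast
  obtain a b where ab: "b \<noteq> 0" "k = to_fract a / to_fract b" by (rule fract_cases_to_fract)
  obtain a' b' where ab': "b' \<noteq> 0" "k' = to_fract a' / to_fract b'" by (rule fract_cases_to_fract)
  obtain A B where AB: "lpoly A" "lpoly B" "B \<noteq> 0" "x = fr A / fr B" using x by (rule kwE)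
  have kb: "\<kappa> * fr (fls_const b) = fr (fls_const a)" unfolding k fr_const using ab by simp
  have kb': "fls_const k' * fr (fls_const b') = fr (fls_const a')" unfolding fr_const using ab' by simp
  have xB: "x * fr B = fr A" using AB by simp
  have "x * OmF ^ ?m = \<kappa> * ?F ^ (CHAR('a) ^ j) + fls_const k'" using k' by (simp add: algebra_simps)
  hence mult: "(x * u) * (v * w) * OmF ^ ?m = u * ((\<kappa> * v) * w * ?F ^ (CHAR('a) ^ j) + (fls_const k' * w) * v)" for u v w
  proof -
    assume e: "x * OmF ^ ?m = \<kappa> * ?F ^ (CHAR('a) ^ j) + fls_const k'"
    have "(x * u) * (v * w) * OmF ^ ?m = (u * v * w) * (x * OmF ^ ?m)" by (simp only: ac_simps)
    also have "\<dots> = u * ((\<kappa> * v) * w * ?F ^ (CHAR('a) ^ j) + (fls_const k' * w) * v)"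
      unfolding e by (simp only: distrib_left ac_simps)
    finally show ?thesis .
  qed
  have bb: "fls_const (b * b') = fls_const b * (fls_const b' :: 'a poly fls)" by (simp only: fls_const_mult_const)
  from mult[of "fr B" "fr (fls_const b)" "fr (fls_const b')"]
  have "(x * fr B) * fr (fls_const (b * b')) * OmF ^ ?m
      = fr B * ((\<kappa> * fr (fls_const b)) * fr (fls_const b') * ?F ^ (CHAR('a) ^ j) + (fls_const k' * fr (fls_const b')) * fr (fls_const b))"
    unfolding bb fr_mult .
  hence "fr (A * fls_const (b * b') * Om ^ ?m)
      = fr (B * (fls_const (a * b') * zeta_fun [n] ^ (CHAR('a) ^ j) + fls_const (a' * b)))"
    unfolding xB kb kb' by (simp only: fr_hom fls_const_mult_const[symmetric])
  hence rel: "(A * fls_const (b * b')) * Om ^ ?m = B * (fls_const (a * b') * zeta_fun [n] ^ (CHAR('a) ^ j) + fls_const (a' * b))"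
    by (simp only: fr_eq_iff)
  have "a * b' = 0"
  proof (rule no_relation[OF n _ _ AB(2,3) rel])
    show "?m \<ge> 1" using n ppos by (simp add: Suc_le_eq)
    show "lpoly (A * fls_const (b * b'))" by (intro lpoly_mult AB lpoly_const)
  qed
  thus ?thesis using ab' by (simp add: k ab)
qed

end

section \<open>Algebraic independence of the functions\<close>

text \<open>\<open>n_dist\<close> says that no ratio of two entries with different indices is an
  integral power of p; natural exponents on both sides replace negative ones.\<close>

locale carlitz_family = carlitz q e0 H \<Delta>
  for q e0 :: nat and H :: "nat \<Rightarrow> 'a::{finite,field} poly poly" and \<Delta> :: "nat \<Rightarrow> 'a poly" +
  fixes d :: nat and n :: "nat \<Rightarrow> nat"
  assumes n_pos: "l \<in> {1..d} \<Longrightarrow> n l \<ge> 1" and n_ndvd: "l \<in> {1..d} \<Longrightarrow> \<not> e0 dvd n l"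
    and n_dist: "l \<in> {1..d} \<Longrightarrow> l' \<in> {1..d} \<Longrightarrow> n l * CHAR('a) ^ j = n l' * CHAR('a) ^ j' \<Longrightarrow> l = l'"
begin

text \<open>\<open>zeta_term n\<close> is a monomial of degree \<open>n\<close> in \<open>Om\<close>
  over \<open>kw\<close>, so the right-hand side is a polynomial in \<open>Om\<close>. Its exponents
  \<open>n l * p ^ j\<close> are pairwise different by \<open>n_dist\<close>;
  \<open>torus_solution\<close> isolates one coefficient, and \<open>no_torus_solution\<close> shows
  that it is zero.\<close>

lemma zeta_term_free: "df.additively_free E0 (\<lambda>l. fr (zeta_term (n l))) d"
  unfolding df.additively_free_def
proof (intro allI impI ballI)
  fix K :: "nat \<Rightarrow> 'a poly fract fls poly" and l0
  assume K: "\<forall>l. K l \<in> polys_over df.Fix" and l0: "l0 \<in> {1..d}"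
    and "\<exists>c\<in>E0. c - \<tau> c = (\<Sum>l = 1..d. ad (K l) (fr (zeta_term (n l))))"
  then obtain c where c: "c \<in> E0" "c - \<tau> c = (\<Sum>l = 1..d. ad (K l) (fr (zeta_term (n l))))" by blast
  let ?p = "CHAR('a)"
  define g where "g l j = coeff (K l) j * fr (hx e0 (H (n l))) ^ (?p ^ j)" for l j
  define B where "B = (\<Sum>l=1..d. \<Sum>j\<le>degree (K l). monom (g l j) (n l * ?p ^ j))"
  have cK: "coeff (K l) j \<in> df.Fix" for l j using K by (simp add: polys_over_def)
  have gkw: "g l j \<in> kw" for l j
    unfolding g_def using cK df.goodD(3)[OF good_kw] 
    by (intro subfld_mult[OF subfld_kw] subfld_power[OF subfld_kw] kw_fr lpoly_hx) auto
  have B: "B \<in> polys_over kw"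
    unfolding B_def by (intro polys_over_sum[OF subfld_kw] polys_over_monom[OF subfld_kw] gkw)
  have "poly B OmF = (\<Sum>l = 1..d. ad (K l) (fr (zeta_term (n l))))"
    by (simp add: B_def poly_sum poly_monom ad_def g_def zeta_term_def fr_hom power_mult_distrib power_mult mult.assoc)
  hence "c - \<tau> c = poly B OmF" using c(2) by simp
  have sol: "\<exists>x\<in>kw. x - \<tau> x / fr (ap e0 q) ^ m = coeff B m" for m
    by (rule df.torus_solution[OF good_kw ap_facts(1,2,3) tau_OmF _ c(1)[unfolded E0_def] \<open>c - \<tau> c = poly B OmF\<close> B])
      (rule no_twisted_solution)
  have inj: "n l * ?p ^ j = n l' * ?p ^ j' \<longleftrightarrow> l = l' \<and> j = j'" if "l \<in> {1..d}" "l' \<in> {1..d}" for l l' j j'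
  proof
    assume e: "n l * ?p ^ j = n l' * ?p ^ j'"
    hence "l = l'" by (rule n_dist[OF that])
    hence "?p ^ j = ?p ^ j'" using e n_pos[OF that(1)] by simp
    moreover have "?p > 1" by (rule prime_gt_1_nat[OF char_prime[OF q_card]])
    ultimately show "l = l' \<and> j = j'" using \<open>l = l'\<close> by simp
  qed simp
  have cB: "coeff B (n l0 * ?p ^ j0) = g l0 j0" for j0
  proof -
    have "coeff B (n l0 * ?p ^ j0) = (\<Sum>l=1..d. \<Sum>j\<le>degree (K l). if l = l0 \<and> j = j0 then g l j else 0)"
      unfolding B_def coeff_sum coeff_monom by (intro sum.cong refl) (simp only: inj[OF _ l0])
    also have "\<dots> = (\<Sum>l=1..d. if l = l0 then (\<Sum>j\<le>degree (K l0). if j = j0 then g l0 j else 0) else 0)"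
      by (intro sum.cong refl) auto
    also have "\<dots> = (\<Sum>j\<le>degree (K l0). if j = j0 then g l0 j else 0)" using l0 by simp
    also have "\<dots> = g l0 j0" by (simp add: g_def coeff_eq_0)
    finally show ?thesis .
  qed
  have "coeff (K l0) j = 0" for j
  proof -
    obtain x where x: "x \<in> kw" "x - \<tau> x / fr (ap e0 q) ^ (n l0 * ?p ^ j) = coeff B (n l0 * ?p ^ j)"
      using sol by blast
    show ?thesis
      by (rule no_torus_solution[OF n_pos[OF l0] n_ndvd[OF l0] x(1) cK]) (use x(2) in \<open>simp add: cB g_def\<close>)
  qed
  thus "K l0 = 0" by (intro poly_eqI) simp
qed

definition F :: "nat \<Rightarrow> nat \<Rightarrow> 'a poly fls" where "F l k = zeta_fun (map n [l..<Suc k])"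

lemma args_pos: "1 \<le> l \<Longrightarrow> k \<le> d \<Longrightarrow> \<forall>m\<in>set (map n [l..<Suc k]). m \<ge> 1"
  using n_pos by auto

lemma F_rec: "1 \<le> l \<Longrightarrow> l \<le> Suc k \<Longrightarrow> Suc k \<le> d \<Longrightarrow> F l (Suc k) = \<tau> (F l (Suc k)) + zeta_term (n (Suc k)) * \<tau> (F l k)"
  using zeta_fun_snoc[of "map n [l..<Suc k]" "n (Suc k)"] args_pos[of l "Suc k"] by (simp add: F_def)

lemma F_diag: "F (Suc k) k = 1" by (simp add: F_def)

lemma ent_F: "1 \<le> l \<Longrightarrow> k \<le> d \<Longrightarrow> ent (F l k)"
  unfolding F_def by (rule ent_zeta_fun[OF args_pos])

sublocale tow: difference_tower "\<lambda>E :: 'a poly fract fls. fls_compose_power E q" E0 "\<lambda>l. fr (zeta_term (n l))" "\<lambda>l k. fr (F l k)" d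
proof
  show "df.good E0" by (rule good_E0)
  show "df.additively_free E0 (\<lambda>l. fr (zeta_term (n l))) d" by (rule zeta_term_free)
  show "fr (zeta_term (n k)) \<in> E0" for k by (rule zeta_term_E0)
  show "fr (F (Suc k) k) = 1" for k by (simp add: F_diag)
  fix l k assume "1 \<le> l" "l \<le> Suc k" "Suc k \<le> d"
  from F_rec[OF this] show "fr (F l (Suc k)) = \<tau> (fr (F l (Suc k))) + fr (zeta_term (n (Suc k))) * \<tau> (fr (F l k))"
    by (metis fr_add fr_mult fr_compose q_pos(1))
qed

text \<open>\<open>None\<close> is the index of \<open>Om\<close> and later of the period,
  \<open>Some (l, k')\<close> that of the segment from \<open>l\<close> to
  \<open>k'\<close>.\<close>

definition J :: "nat \<Rightarrow> (nat \<times> nat) option set" where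
  "J k = insert None (Some ` {(l, k'). 1 \<le> l \<and> l \<le> k' \<and> k' \<le> k})"

definition fun_at :: "(nat \<times> nat) option \<Rightarrow> 'a poly fls" where
  "fun_at z = (case z of None \<Rightarrow> Om | Some (l, k) \<Rightarrow> F l k)"

text \<open>The tower adds one function at a time, each transcendental over the field built before;
  \<open>Ji i\<close> is the index set after \<open>i\<close> functions of column
  \<open>k + 1\<close>.\<close>

lemma functions_independent:
  assumes "k \<le> d"
  shows "alg_indep_over kw (J k) (\<lambda>z. fr (fun_at z)) \<and> (\<lambda>z. fr (fun_at z)) ` J k \<subseteq> tow.T k \<and> kw \<subseteq> tow.T k"
  using assms
proof (induction k)
  case 0
  have J0: "J 0 = insert None {}" by (auto simp: J_def)
  have "alg_indep_over kw (insert None {}) (\<lambda>z. fr (fun_at z))"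
    by (rule alg_indep_over_insert[OF subfld_kw order_refl _ alg_indep_over_empty])
      (use OmF_transcendental in \<open>auto simp: fun_at_def\<close>)
  moreover have "OmF \<in> E0" "kw \<subseteq> E0"
    unfolding E0_def using adj_self[OF subfld_kw] adj_incl[OF subfld_kw] by auto
  ultimately show ?case by (simp add: J0 fun_at_def)
next
  case (Suc k)
  hence k: "k < d" and IH: "alg_indep_over kw (J k) (\<lambda>z. fr (fun_at z))" "(\<lambda>z. fr (fun_at z)) ` J k \<subseteq> tow.T k" "kw \<subseteq> tow.T k"
    by auto
  let ?T = "\<lambda>i. df.tower (tow.T k) (\<lambda>l. fr (F l (Suc k))) i"
  define Ji where "Ji i = J k \<union> (\<lambda>l. Some (l, Suc k)) ` {1..i}" for i
  note tt = tow.tower_transcendental[OF k]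
  have sub: "(\<lambda>z. fr (fun_at z)) ` Ji i \<subseteq> ?T i" if i: "i \<le> Suc k" for i
  proof -
    have "(\<lambda>z. fr (fun_at z)) ` J k \<subseteq> ?T i" using IH(2) tt(2)[OF i] by blast
    moreover have "fr (fun_at (Some (l, Suc k))) \<in> ?T i" if "l \<in> {1..i}" for l
      using tt(3)[OF i that] by (simp add: fun_at_def)
    ultimately show ?thesis unfolding Ji_def by auto
  qed
  have "alg_indep_over kw (Ji i) (\<lambda>z. fr (fun_at z))" if "i \<le> Suc k" for i
    using that
  proof (induction i)
    case 0
    show ?case using IH(1) by (simp add: Ji_def)
  next
    case (Suc i)
    have i: "i \<le> Suc k" "i < Suc k" using Suc.prems by auto
    have e: "Ji (Suc i) = insert (Some (Suc i, Suc k)) (Ji i)" by (auto simp: Ji_def atLeastAtMostSuc_conv)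
    show ?case unfolding e
    proof (rule alg_indep_over_insert[of "?T i"])
      show "subfld (?T i)" by (rule df.goodD(1)[OF tt(1)[OF i(1)]])
      show "kw \<subseteq> ?T i" using IH(3) tt(2)[OF i(1)] by blast
      show "(\<lambda>z. fr (fun_at z)) ` Ji i \<subseteq> ?T i" by (rule sub[OF i(1)])
      show "alg_indep_over kw (Ji i) (\<lambda>z. fr (fun_at z))" by (rule Suc.IH[OF i(1)])
      show "fr (fun_at (Some (Suc i, Suc k))) \<notin> clo (?T i)" using tt(4)[OF i] by (simp add: fun_at_def)
    qed
  qed
  from this[OF order_refl] have 1: "alg_indep_over kw (Ji (Suc k)) (\<lambda>z. fr (fun_at z))" .
  have 2: "Ji (Suc k) = J (Suc k)"
    unfolding Ji_def J_def by (auto simp: le_Suc_eq image_iff)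
  have 3: "tow.T (Suc k) = ?T (Suc k)" by simp
  have 4: "kw \<subseteq> ?T (Suc k)" using IH(3) tt(2)[OF order_refl] by (rule subset_trans)
  show ?case unfolding 3 unfolding 2[symmetric] by (intro conjI 1 4 sub[OF order_refl])
qed

end

section \<open>Weighted spans of monomials\<close>

text \<open>Giving \<open>Om\<close> the weight \<open>1\<close> and \<open>F l k\<close> the weight \<open>n l + ... + n k\<close>, the functional equations express the
  monomials of weight at most \<open>W\<close> through the \<open>\<tau>\<close>-images of such monomials, and conversely.\<close>

definition wt :: "('i \<Rightarrow> nat) \<Rightarrow> ('i \<Rightarrow>\<^sub>0 nat) \<Rightarrow> nat" where
  "wt w m = (\<Sum>i\<in>Poly_Mapping.keys m. Poly_Mapping.lookup m i * w i)"

lemma wt_superset: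
  assumes "finite A" "Poly_Mapping.keys m \<subseteq> A"
  shows "wt w m = (\<Sum>i\<in>A. Poly_Mapping.lookup m i * w i)"
  unfolding wt_def using assms by (intro sum.mono_neutral_left) (auto simp: in_keys_iff)

lemma wt_add: "wt w (m + m') = wt w m + wt w m'"
proof -
  let ?A = "Poly_Mapping.keys m \<union> Poly_Mapping.keys m'"
  have "Poly_Mapping.keys (m + m') \<subseteq> ?A" by (rule Poly_Mapping.keys_add)
  thus ?thesis by (simp add: wt_superset[of ?A] lookup_add sum.distrib algebra_simps)
qed

lemma wt_0 [simp]: "wt w 0 = 0" by (simp add: wt_def)
lemma wt_single [simp]: "wt w (Poly_Mapping.single i e) = e * w i" by (simp add: wt_def)

definition Mon :: "'i set \<Rightarrow> ('i \<Rightarrow> nat) \<Rightarrow> nat \<Rightarrow> ('i \<Rightarrow>\<^sub>0 nat) set" where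
  "Mon J w W = {m. Poly_Mapping.keys m \<subseteq> J \<and> wt w m \<le> W}"

lemma finite_Mon:
  assumes "finite J" "\<And>i. i \<in> J \<Longrightarrow> w i \<ge> 1"
  shows "finite (Mon J w W)"
proof -
  have "finite {f :: 'a \<Rightarrow> nat. \<forall>x. (x \<in> J \<longrightarrow> f x \<in> {..W}) \<and> (x \<notin> J \<longrightarrow> f x = 0)}"
    by (rule finite_set_of_finite_funs) (use assms in auto)
  moreover have "Poly_Mapping.lookup ` Mon J w W \<subseteq> {f. \<forall>x. (x \<in> J \<longrightarrow> f x \<in> {..W}) \<and> (x \<notin> J \<longrightarrow> f x = 0)}"
  proof (intro image_subsetI CollectI allI conjI impI)
    fix m x assume m: "m \<in> Mon J w W"
    {
      assume "x \<in> J"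
      show "Poly_Mapping.lookup m x \<in> {..W}"
      proof (cases "x \<in> Poly_Mapping.keys m")
        case True
        have "Poly_Mapping.lookup m x * 1 \<le> Poly_Mapping.lookup m x * w x"
          using assms(2)[OF \<open>x \<in> J\<close>] by (intro mult_le_mono2)
        also have "\<dots> \<le> wt w m" unfolding wt_def
          by (rule member_le_sum[of x _ "\<lambda>i. Poly_Mapping.lookup m i * w i"]) (use True in auto)
        finally show ?thesis using m by (simp add: Mon_def)
      qed (simp add: in_keys_iff)
    }
    {
      assume "x \<notin> J"
      thus "Poly_Mapping.lookup m x = 0" using m by (auto simp: Mon_def in_keys_iff)
    }
  qed
  ultimately have "finite (Poly_Mapping.lookup ` Mon J w W)" by (rule finite_subset[rotated])
  thus ?thesis by (rule finite_imageD) (simp add: inj_on_def lookup_inject)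
qed

definition wspan :: "('i \<Rightarrow> 'a::field poly fls) \<Rightarrow> 'i set \<Rightarrow> ('i \<Rightarrow> nat) \<Rightarrow> nat \<Rightarrow> 'a poly fls set" where
  "wspan Y J w W = combs {E. lpoly E} (Mon J w W) Y"

lemma wspan_mono: "W \<le> W' \<Longrightarrow> wspan Y J w W \<subseteq> wspan Y J w W'"
  unfolding wspan_def combs_def Mon_def by fastforce

lemma wspan_mult:
  assumes "u \<in> wspan Y J w W" "v \<in> wspan Y J w W'" shows "u * v \<in> wspan Y J w (W + W')"
proof -
  have "m + m' \<in> Mon J w (W + W')" if "m \<in> Mon J w W" "m' \<in> Mon J w W'" for m m'
    using Poly_Mapping.keys_add[of m m'] that by (auto simp: Mon_def wt_add)
  thus ?thesis using assms unfolding wspan_def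
    by (intro combs_mult[of "{E. lpoly E}"]) (auto intro: lpoly_add lpoly_mult)
qed

lemma wspan_add: "u \<in> wspan Y J w W \<Longrightarrow> v \<in> wspan Y J w W \<Longrightarrow> u + v \<in> wspan Y J w W"
  unfolding wspan_def by (rule combs_add) (auto intro: lpoly_add lpoly_mult)

lemma wspan_lpoly: "lpoly a \<Longrightarrow> a \<in> wspan Y J w W"
  unfolding wspan_def by (rule combs_const) (auto intro: lpoly_add lpoly_mult simp: Mon_def)

lemma wspan_var: "i \<in> J \<Longrightarrow> w i \<le> W \<Longrightarrow> Y i \<in> wspan Y J w W"
  unfolding wspan_def by (rule combs_var) (auto intro: lpoly_add lpoly_mult simp: Mon_def)

lemma wspan_lmult: "lpoly a \<Longrightarrow> u \<in> wspan Y J w W \<Longrightarrow> a * u \<in> wspan Y J w W"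
  using wspan_mult[OF wspan_lpoly[of a Y J w 0], of u W] by simp

lemma wspan_diff: "u \<in> wspan Y J w W \<Longrightarrow> v \<in> wspan Y J w W \<Longrightarrow> u - v \<in> wspan Y J w W"
  using wspan_add[of u Y J w W "- v"] wspan_lmult[OF lpoly_uminus[OF lpoly_1], of v Y J w W] by simp

lemma wspan_power: "u \<in> wspan Y J w W \<Longrightarrow> u ^ k \<in> wspan Y J w (k * W)"
proof (induction k)
  case 0
  show ?case by (simp add: wspan_lpoly)
next
  case (Suc k)
  thus ?case using wspan_mult[of u Y J w W "u ^ k" "k * W"] by simp
qed

lemma wspan_prod:
  assumes "finite A" "\<And>i. i \<in> A \<Longrightarrow> u i \<in> wspan Y J w (W i)"
  shows "prod u A \<in> wspan Y J w (sum W A)"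
  using assms
proof (induction A)
  case empty
  show ?case by (simp add: wspan_lpoly)
next
  case (insert x A)
  thus ?case using wspan_mult[of "u x" Y J w "W x" "prod u A" "sum W A"] by simp
qed

lemma wspan_powprod:
  assumes "\<And>i. i \<in> J \<Longrightarrow> X' i \<in> wspan Y J w (w i)" "Poly_Mapping.keys m \<subseteq> J" "wt w m \<le> W"
  shows "powprod X' m \<in> wspan Y J w W"
proof -
  have "powprod X' m \<in> wspan Y J w (\<Sum>i\<in>Poly_Mapping.keys m. Poly_Mapping.lookup m i * w i)"
    unfolding powprod_def by (rule wspan_prod) (use assms in \<open>auto intro!: wspan_power\<close>)
  thus ?thesis using wspan_mono[OF assms(3)] by (auto simp: wt_def)
qed

lemma wspanE:
  assumes "u \<in> wspan Y J w W" "finite (Mon J w W)"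
  shows "\<exists>c. (\<forall>m. lpoly (c m)) \<and> u = (\<Sum>m\<in>Mon J w W. c m * powprod Y m)"
proof -
  obtain S c where u: "u = (\<Sum>m\<in>S. c m * powprod Y m)" "finite S" "\<forall>m\<in>S. m \<in> Mon J w W \<and> lpoly (c m)"
    using assms(1) by (auto simp: wspan_def combs_def)
  have "u = (\<Sum>m\<in>Mon J w W. (if m \<in> S then c m else 0) * powprod Y m)"
    unfolding u(1) by (rule sum.mono_neutral_cong_left) (use u assms in auto)
  moreover have "\<forall>m. lpoly (if m \<in> S then c m else 0)" using u by auto
  ultimately show ?thesis by (intro exI[of _ "\<lambda>m. if m \<in> S then c m else 0"] conjI)
qed

section \<open>Algebraic independence of the values\<close>

definition LP :: "'a::zero fls set" where "LP = {f. \<exists>B. lp B f}"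

context carlitz_family
begin

definition wt_at :: "(nat \<times> nat) option \<Rightarrow> nat" where
  "wt_at z = (case z of None \<Rightarrow> 1 | Some (l, k) \<Rightarrow> sum n {l..k})"

lemma finite_J: "finite (J k)"
proof -
  have "{(l, k'). 1 \<le> l \<and> l \<le> k' \<and> k' \<le> k} \<subseteq> {..k} \<times> {..k}" by auto
  hence "finite {(l, k'). 1 \<le> l \<and> l \<le> k' \<and> k' \<le> k}" by (rule finite_subset) simp
  thus ?thesis by (simp add: J_def)
qed

lemma wt_at_pos: "z \<in> J d \<Longrightarrow> wt_at z \<ge> 1"
proof -
  assume z: "z \<in> J d"
  show "wt_at z \<ge> 1"
  proof (cases z)
    case (Some lk)
    obtain l k where lk: "z = Some (l, k)" "1 \<le> l" "l \<le> k" "k \<le> d" using z Some by (auto simp: J_def)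
    have "n l \<le> sum n {l..k}" by (rule member_le_sum) (use lk in auto)
    moreover have "n l \<ge> 1" by (rule n_pos) (use lk in auto)
    ultimately show ?thesis by (simp add: lk wt_at_def)
  qed (simp add: wt_at_def)
qed

lemma J_SomeI: "1 \<le> l \<Longrightarrow> l \<le> k \<Longrightarrow> k \<le> d \<Longrightarrow> Some (l, k) \<in> J d" by (auto simp: J_def)
lemma J_None: "None \<in> J k" by (simp add: J_def)

lemma F_wspan:
  assumes "\<And>l k. 1 \<le> l \<Longrightarrow> l \<le> k \<Longrightarrow> k \<le> d \<Longrightarrow> Y (Some (l, k)) = G (F l k)" and "G 1 = 1"
    and "1 \<le> l" "l \<le> Suc k" "k \<le> d"
  shows "G (F l k) \<in> wspan Y (J d) wt_at (sum n {l..k})"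
proof (cases "l = Suc k")
  case True
  thus ?thesis by (simp add: F_diag assms wspan_lpoly)
next
  case False
  hence "Y (Some (l, k)) \<in> wspan Y (J d) wt_at (sum n {l..k})"
    using assms by (intro wspan_var J_SomeI) (auto simp: wt_at_def)
  thus ?thesis using assms False by simp
qed

lemma zeta_term_wspan:
  assumes Om: "Om \<in> wspan Y (J d) wt_at 1" and G: "G \<in> wspan Y (J d) wt_at (sum n {l..k})" and "l \<le> Suc k"
  shows "zeta_term (n (Suc k)) * G \<in> wspan Y (J d) wt_at (sum n {l..Suc k})"
proof -
  have "Om ^ n (Suc k) * G \<in> wspan Y (J d) wt_at (n (Suc k) * 1 + sum n {l..k})"
    by (intro wspan_mult wspan_power Om G)
  hence "hx e0 (H (n (Suc k))) * (Om ^ n (Suc k) * G) \<in> wspan Y (J d) wt_at (n (Suc k) * 1 + sum n {l..k})"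
    by (rule wspan_lmult[OF lpoly_hx])
  moreover have "n (Suc k) * 1 + sum n {l..k} = sum n {l..Suc k}" using assms(3) by simp
  ultimately show ?thesis by (simp add: zeta_term_def mult.assoc)
qed

lemma fun_at_forward: "z \<in> J d \<Longrightarrow> fun_at z \<in> wspan (\<lambda>z. \<tau> (fun_at z)) (J d) wt_at (wt_at z)"
proof -
  assume z: "z \<in> J d"
  let ?Y = "\<lambda>z. \<tau> (fun_at z)"
  have "\<tau> Om \<in> wspan ?Y (J d) wt_at 1"
    using wspan_var[of None "J d" wt_at 1 ?Y] J_None by (simp add: fun_at_def wt_at_def)
  hence Om: "Om \<in> wspan ?Y (J d) wt_at 1" by (subst Om_eq) (rule wspan_lmult[OF lpoly_ap])
  show ?thesis
  proof (cases z)
    case None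
    thus ?thesis using Om by (simp add: fun_at_def wt_at_def)
  next
    case (Some lk)
    obtain l k' where lk': "z = Some (l, k')" "1 \<le> l" "l \<le> k'" "k' \<le> d" using z Some by (auto simp: J_def)
    obtain k where lk: "k' = Suc k" using lk' by (cases k') auto
    have f: "\<tau> (F l k'') \<in> wspan ?Y (J d) wt_at (sum n {l..k''})" if "l \<le> Suc k''" "k'' \<le> d" for k''
      by (rule F_wspan[where G = \<tau>]) (use lk' that in \<open>auto simp: fun_at_def\<close>)
    have "\<tau> (F l (Suc k)) + zeta_term (n (Suc k)) * \<tau> (F l k) \<in> wspan ?Y (J d) wt_at (sum n {l..Suc k})"
      by (intro wspan_add zeta_term_wspan Om f) (use lk' lk in auto)
    thus ?thesis using F_rec[of l k] lk' lk by (simp add: fun_at_def wt_at_def)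
  qed
qed

text \<open>Only \<open>\<tau> Om = Om / ap e0 q\<close> needs a denominator; the uniform factor
  \<open>ap e0 q ^ wt_at z\<close> is chosen because it multiplies up along monomials. For the other
  functions, \<open>\<tau> (F l k)\<close> comes from solving the functional equation by induction
  on \<open>k\<close>.\<close>

lemma fun_at_backward: "z \<in> J d \<Longrightarrow> ap e0 q ^ wt_at z * \<tau> (fun_at z) \<in> wspan fun_at (J d) wt_at (wt_at z)"
proof -
  assume z: "z \<in> J d"
  have Om: "Om \<in> wspan fun_at (J d) wt_at 1"
    using wspan_var[of None "J d" wt_at 1 fun_at] J_None by (simp add: fun_at_def wt_at_def)
  show ?thesis
  proof (cases z)
    case None
    thus ?thesis using Om Om_eq by (simp add: fun_at_def wt_at_def)
  next
    case (Some lk)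
    obtain l k' where lk': "z = Some (l, k')" "1 \<le> l" "l \<le> k'" "k' \<le> d" using z Some by (auto simp: J_def)
    have f: "F l k \<in> wspan fun_at (J d) wt_at (sum n {l..k})" if "l \<le> Suc k" "k \<le> d" for k
      by (rule F_wspan[where G = "\<lambda>E. E"]) (use lk' that in \<open>auto simp: fun_at_def\<close>)
    have "\<tau> (F l k) \<in> wspan fun_at (J d) wt_at (sum n {l..k})" if "l \<le> Suc k" "k \<le> d" for k
      using that
    proof (induction k)
      case 0
      hence "l = Suc 0" using lk' by auto
      thus ?case by (simp add: F_diag wspan_lpoly)
    next
      case (Suc k)
      show ?case
      proof (cases "l = Suc (Suc k)")
        case True
        thus ?thesis by (simp add: F_diag wspan_lpoly)
      next
        case False
        hence l: "l \<le> Suc k" using Suc.prems by simp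
        have "F l (Suc k) - zeta_term (n (Suc k)) * \<tau> (F l k) \<in> wspan fun_at (J d) wt_at (sum n {l..Suc k})"
          by (intro wspan_diff zeta_term_wspan Om f Suc.IH) (use l Suc.prems in auto)
        moreover have "F l (Suc k) - zeta_term (n (Suc k)) * \<tau> (F l k) = \<tau> (F l (Suc k))"
          using F_rec[of l k] lk' l Suc.prems by (simp only: diff_eq_eq)
        ultimately show ?thesis by simp
      qed
    qed
    from this[of k'] show ?thesis using lk' by (auto simp: fun_at_def wt_at_def intro!: wspan_lmult lpoly_power)
  qed
qed

lemma tau_powprod: "\<tau> (powprod X' m) = powprod (\<lambda>z. \<tau> (X' z :: 'a poly fls)) m"
proof -
  have "\<tau> (prod g A) = (\<Prod>i\<in>A. \<tau> (g i))" for g :: "'b \<Rightarrow> 'a poly fls" and A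
    by (induction A rule: infinite_finite_induct) auto
  thus ?thesis by (simp add: powprod_def)
qed

lemma ent_fun_at: "z \<in> J d \<Longrightarrow> ent (fun_at z)"
  by (auto simp: J_def fun_at_def ent_F)

theorem values_independent: "alg_indep_over LP (J d) (\<lambda>z. ev e0 (fun_at z))"
proof (rule alg_indep_overI)
  fix S and c :: "((nat \<times> nat) option \<Rightarrow>\<^sub>0 nat) \<Rightarrow> 'a fls" and m0
  assume S: "finite S" "\<And>m. m \<in> S \<Longrightarrow> Poly_Mapping.keys m \<subseteq> J d" "\<And>m. m \<in> S \<Longrightarrow> c m \<in> LP"
    and rel: "(\<Sum>m\<in>S. c m * powprod (\<lambda>z. ev e0 (fun_at z)) m) = 0" and m0: "m0 \<in> S"
  \<comment> \<open>A common bound for the weights in the relation. The family is enlarged to all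
    monomials of weight at most \<open>W\<close>, because only this larger family is closed under
    the functional equations.\<close>
  define W where "W = (\<Sum>m\<in>S. wt wt_at m)"
  define M where "M = Mon (J d) wt_at W"
  have finM: "finite M" unfolding M_def by (rule finite_Mon[OF finite_J wt_at_pos])
  have SM: "S \<subseteq> M"
  proof
    fix m assume "m \<in> S"
    hence "wt wt_at m \<le> W" unfolding W_def by (intro member_le_sum) (use S in auto)
    thus "m \<in> M" using S(2)[OF \<open>m \<in> S\<close>] by (simp add: M_def Mon_def)
  qed
  have keysM: "Poly_Mapping.keys m \<subseteq> J d" "wt wt_at m \<le> W" if "m \<in> M" for m using that by (auto simp: M_def Mon_def)
  define \<psi> where "\<psi> m = powprod fun_at m" for m
  have ent\<psi>: "ent (\<psi> m)" if "m \<in> M" for m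
    unfolding \<psi>_def powprod_def by (intro ent_prod ent_power ent_fun_at) (use keysM[OF that] in auto)
  have ev\<psi>: "ev e0 (\<psi> m) = powprod (\<lambda>z. ev e0 (fun_at z)) m" if "m \<in> M" for m
  proof -
    have "ent (fun_at z)" if "z \<in> Poly_Mapping.keys m" for z using ent_fun_at keysM[OF \<open>m \<in> M\<close>] that by blast
    thus ?thesis unfolding \<psi>_def powprod_def by (simp add: ev_prod ev_power ent_power)
  qed
  have "\<exists>g. (\<forall>m. lpoly (g m)) \<and> \<psi> i = (\<Sum>m\<in>M. g m * \<tau> (\<psi> m))" if "i \<in> M" for i
    unfolding \<psi>_def tau_powprod M_def
    by (rule wspanE[OF wspan_powprod[OF fun_at_forward]]) (use keysM[OF that] finM in \<open>auto simp: M_def\<close>)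
  hence "\<forall>i. \<exists>g. i \<in> M \<longrightarrow> (\<forall>m. lpoly (g m)) \<and> \<psi> i = (\<Sum>m\<in>M. g m * \<tau> (\<psi> m))" by blast
  from choice[OF this] obtain \<Phi>0 where \<Phi>0: "\<And>i. i \<in> M \<Longrightarrow> (\<forall>m. lpoly (\<Phi>0 i m)) \<and> \<psi> i = (\<Sum>m\<in>M. \<Phi>0 i m * \<tau> (\<psi> m))"
    by blast
  define \<Phi> where "\<Phi> i m = (if i \<in> M then \<Phi>0 i m else 0)" for i m
  have "\<exists>g. (\<forall>m. lpoly (g m)) \<and> ap e0 q ^ W * \<tau> (\<psi> i) = (\<Sum>m\<in>M. g m * \<psi> m)" if "i \<in> M" for i
  proof -
    have "powprod (\<lambda>z. ap e0 q ^ wt_at z * \<tau> (fun_at z)) i \<in> wspan fun_at (J d) wt_at W"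
      by (rule wspan_powprod[OF fun_at_backward]) (use keysM[OF that] in auto)
    \<comment> \<open>Monomials of smaller weight are brought to the common exponent
      \<open>W\<close>.\<close>
    hence "ap e0 q ^ (W - wt wt_at i) * powprod (\<lambda>z. ap e0 q ^ wt_at z * \<tau> (fun_at z)) i \<in> wspan fun_at (J d) wt_at W"
      by (intro wspan_lmult lpoly_power lpoly_ap)
    moreover have "powprod (\<lambda>z. ap e0 q ^ wt_at z * \<tau> (fun_at z)) i = ap e0 q ^ wt wt_at i * \<tau> (\<psi> i)"
      unfolding \<psi>_def tau_powprod unfolding powprod_def wt_def
      by (simp add: power_mult_distrib prod.distrib power_sum power_mult[symmetric] mult.commute)
    moreover have "ap e0 q ^ (W - wt wt_at i) * (ap e0 q ^ wt wt_at i * \<tau> (\<psi> i)) = ap e0 q ^ W * \<tau> (\<psi> i)"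
      using keysM(2)[OF that] by (simp add: mult.assoc[symmetric] power_add[symmetric])
    ultimately have "ap e0 q ^ W * \<tau> (\<psi> i) \<in> wspan fun_at (J d) wt_at W" by simp
    from wspanE[OF this] finM show ?thesis by (simp add: M_def \<psi>_def)
  qed
  hence "\<forall>i. \<exists>g. i \<in> M \<longrightarrow> (\<forall>m. lpoly (g m)) \<and> ap e0 q ^ W * \<tau> (\<psi> i) = (\<Sum>m\<in>M. g m * \<psi> m)" by blast
  from choice[OF this] obtain \<Phi>1 where \<Phi>1: "\<And>i. i \<in> M \<Longrightarrow> (\<forall>m. lpoly (\<Phi>1 i m)) \<and> ap e0 q ^ W * \<tau> (\<psi> i) = (\<Sum>m\<in>M. \<Phi>1 i m * \<psi> m)"
    by blast
  define \<Phi>' where "\<Phi>' i m = (if i \<in> M then \<Phi>1 i m else 0)" for i m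
  have "\<forall>m\<in>S. \<exists>B. lp B (c m)" using S(3) by (auto simp: LP_def)
  from bchoice[OF this] obtain B where B: "\<And>m. m \<in> S \<Longrightarrow> lp (B m) (c m)" by blast
  define B0 where "B0 = (\<Sum>m\<in>S. B m)"
  define \<rho> where "\<rho> m = (if m \<in> S then c m else 0)" for m
  have \<rho>: "lp B0 (\<rho> m)" for m
  proof (cases "m \<in> S")
    case True
    hence "B m \<le> B0" unfolding B0_def by (intro member_le_sum) (use S in auto)
    thus ?thesis using B[OF True] True by (auto simp: \<rho>_def lp_def intro: order_trans)
  qed (simp add: \<rho>_def)
  have "\<forall>m\<in>M. \<rho> m = 0"
  proof (rule values_linearly_independent[where \<psi> = \<psi> and \<Phi> = \<Phi> and \<Phi>' = \<Phi>' and q = q and ?e0.0 = e0 and ?s0.0 = W and ?B0.0 = B0])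
    show "q \<ge> 2" "e0 \<ge> 1" using q_ge_2 e0_pos by auto
    show "\<psi> i = (\<Sum>m\<in>M. \<Phi> i m * \<tau> (\<psi> m))" if "i \<in> M" for i
      unfolding \<Phi>_def using conjunct2[OF \<Phi>0[OF that]] that by simp
    show "(tt + fls_shift (int (e0 * q)) 1) ^ W * \<tau> (\<psi> i) = (\<Sum>m\<in>M. \<Phi>' i m * \<psi> m)" if "i \<in> M" for i
      unfolding \<Phi>'_def ap_def[symmetric] using conjunct2[OF \<Phi>1[OF that]] that by simp
    show "lpoly (\<Phi> i m)" for i m unfolding \<Phi>_def using \<Phi>0 by simp
    show "lpoly (\<Phi>' i m)" for i m unfolding \<Phi>'_def using \<Phi>1 by simp
    show "(\<Sum>i\<in>M. \<rho> i * ev e0 (\<psi> i)) = 0"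
    proof -
      have "(\<Sum>i\<in>M. \<rho> i * ev e0 (\<psi> i)) = (\<Sum>m\<in>S. c m * powprod (\<lambda>z. ev e0 (fun_at z)) m)"
        by (rule sum.mono_neutral_cong_right[OF finM SM]) (use SM in \<open>auto simp: \<rho>_def ev\<psi>\<close>)
      thus ?thesis using rel by simp
    qed
    fix g assume g: "\<And>i. i \<in> M \<Longrightarrow> lpoly (g i)" and z: "(\<Sum>i\<in>M. g i * \<psi> i) = 0"
    show "\<forall>i\<in>M. g i = 0"
    proof
      fix i assume i: "i \<in> M"
      have frp: "fr (powprod fun_at m) = powprod (\<lambda>z. fr (fun_at z)) m" for m by (simp add: powprod_def fr_hom)
      have "(\<Sum>m\<in>M. fr (g m) * powprod (\<lambda>z. fr (fun_at z)) m) = fr (\<Sum>i\<in>M. g i * \<psi> i)"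
        by (simp only: fr_sum fr_mult \<psi>_def frp)
      hence "(\<Sum>m\<in>M. fr (g m) * powprod (\<lambda>z. fr (fun_at z)) m) = 0" using z by simp
      hence "fr (g i) = 0"
        using functions_independent[of d] keysM(1) kw_fr[OF g]
        by (intro alg_indep_overD[of kw "J d" "\<lambda>z. fr (fun_at z)" M "\<lambda>m. fr (g m)" i]) (use finM i in auto)
      thus "g i = 0" by simp
    qed
  qed (use finM ent\<psi> \<rho> in auto)
  thus "c m0 = 0" using m0 SM by (auto simp: \<rho>_def split: if_splits)
qed

end

section \<open>Transfer to the multizeta values\<close>

lemma alg_indep_over_fracs:
  assumes R: "subrng R" and ind: "alg_indep_over R I x" shows "alg_indep_over (fracs R) I x"
proof (rule alg_indep_overI)
  fix S c m
  assume S: "finite S" "\<And>m. m \<in> S \<Longrightarrow> Poly_Mapping.keys m \<subseteq> I" "\<And>m. m \<in> S \<Longrightarrow> c m \<in> fracs R"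
    "(\<Sum>m\<in>S. c m * powprod x m) = 0" "m \<in> S"
  obtain V where V: "V \<noteq> 0" "\<forall>m\<in>S. V * c m \<in> R" using common_denominator[OF R S(1), of c] S(3) by blast
  have "V * c m = 0"
  proof (rule alg_indep_overD[OF ind S(1,2)])
    have "(\<Sum>m\<in>S. V * c m * powprod x m) = V * (\<Sum>m\<in>S. c m * powprod x m)"
      by (simp add: sum_distrib_left mult.assoc)
    thus "(\<Sum>m\<in>S. V * c m * powprod x m) = 0" using S(4) by simp
  qed (use V S(5) in auto)
  thus "c m = 0" using V by simp
qed

lemma alg_indep_over_hom:
  fixes \<sigma> :: "'b::field \<Rightarrow> 'c::field"
  assumes hom: "\<And>x y. \<sigma> (x + y) = \<sigma> x + \<sigma> y" "\<And>x y. \<sigma> (x * y) = \<sigma> x * \<sigma> y" "\<sigma> 1 = 1"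
    and inj: "\<And>x. \<sigma> x = 0 \<longleftrightarrow> x = 0"
  shows "alg_indep_over (\<sigma> ` F) I (\<lambda>z. \<sigma> (x z)) \<longleftrightarrow> alg_indep_over F I x"
proof -
  have s: "\<sigma> (sum f A) = (\<Sum>i\<in>A. \<sigma> (f i))" for f :: "('a \<Rightarrow>\<^sub>0 nat) \<Rightarrow> 'b" and A
    by (induction A rule: infinite_finite_induct) (auto simp: hom inj)
  have pw: "\<sigma> (y ^ k) = \<sigma> y ^ k" for y k by (induction k) (auto simp: hom)
  have p: "\<sigma> (prod f A) = (\<Prod>i\<in>A. \<sigma> (f i))" for f :: "'a \<Rightarrow> 'b" and A
    by (induction A rule: infinite_finite_induct) (auto simp: hom)
  have rel: "(\<Sum>m\<in>S. \<sigma> (c m) * powprod (\<lambda>z. \<sigma> (x z)) m) = \<sigma> (\<Sum>m\<in>S. c m * powprod x m)" for S c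
    by (simp add: s hom(2) powprod_def p pw)
  show ?thesis
  proof
    assume L: "alg_indep_over (\<sigma> ` F) I (\<lambda>z. \<sigma> (x z))"
    show "alg_indep_over F I x"
    proof (rule alg_indep_overI)
      fix S c m
      assume S: "finite S" "\<And>m. m \<in> S \<Longrightarrow> Poly_Mapping.keys m \<subseteq> I" "\<And>m. m \<in> S \<Longrightarrow> c m \<in> F"
        "(\<Sum>m\<in>S. c m * powprod x m) = 0" "m \<in> S"
      have "\<sigma> (c m) = 0"
        by (rule alg_indep_overD[OF L S(1,2), of "\<lambda>m. \<sigma> (c m)"]) (use S in \<open>auto simp: rel inj\<close>)
      thus "c m = 0" by (simp add: inj)
    qed
  next
    assume R: "alg_indep_over F I x"
    show "alg_indep_over (\<sigma> ` F) I (\<lambda>z. \<sigma> (x z))"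
    proof (rule alg_indep_overI)
      fix S c m
      assume S: "finite S" "\<And>m. m \<in> S \<Longrightarrow> Poly_Mapping.keys m \<subseteq> I" "\<And>m. m \<in> S \<Longrightarrow> c m \<in> \<sigma> ` F"
        "(\<Sum>m\<in>S. c m * powprod (\<lambda>z. \<sigma> (x z)) m) = 0" "m \<in> S"
      have "\<forall>m\<in>S. \<exists>b. b \<in> F \<and> c m = \<sigma> b" using S(3) by blast
      from bchoice[OF this] obtain b where b: "\<And>m. m \<in> S \<Longrightarrow> b m \<in> F \<and> c m = \<sigma> (b m)" by blast
      have "(\<Sum>m\<in>S. c m * powprod (\<lambda>z. \<sigma> (x z)) m) = \<sigma> (\<Sum>m\<in>S. b m * powprod x m)"
        unfolding rel[symmetric] by (rule sum.cong) (use b in auto)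
      hence "(\<Sum>m\<in>S. b m * powprod x m) = 0" using S(4) by (simp add: inj)
      from alg_indep_overD[OF R S(1,2) _ this S(5)] have "b m = 0" using b by blast
      thus "c m = 0" using b[OF S(5)] by (simp add: inj)
    qed
  qed
qed

text \<open>\<open>i0\<close> is put at the head of the list: the equivalence of \<open>x z\<close>
  and \<open>x' z\<close> may then use \<open>x i0\<close>, which lies in every later field.\<close>

lemma alg_indep_over_equivalent:
  assumes F: "subfld F" and "finite I" "i0 \<in> I" and ind: "alg_indep_over F I x"
    and eq: "\<And>E z. subfld E \<Longrightarrow> clo F \<subseteq> E \<Longrightarrow> z \<in> I \<Longrightarrow> z = i0 \<or> x i0 \<in> E \<Longrightarrow> x z \<in> E \<longleftrightarrow> x' z \<in> E"
  shows "alg_indep_over (clo F) I x'"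
proof -
  obtain ys where ys: "set ys = I - {i0}" "distinct ys"
    using finite_distinct_list[of "I - {i0}"] assms(2) by auto
  define zs where "zs = i0 # ys"
  have zs: "distinct zs" "set zs = I" using ys assms(3) by (auto simp: zs_def)
  let ?E = "\<lambda>j. clo (fra F (set (take j zs)) x)"
  have sE: "subfld (?E j)" for j by (rule subfld_clo[OF subfld_fra[OF F]])
  have FE: "clo F \<subseteq> ?E j" for j
    by (rule clo_mono) (use fra_incl[OF F palg_const[OF F]] in blast)
  have xE: "x z \<in> ?E j" if "z \<in> set (take j zs)" for z j
    by (intro clo_incl[OF subfld_fra[OF F]] fra_incl[OF F] palg_var[OF F] that)
  have base: "zs ! j = i0 \<or> x i0 \<in> ?E j" for j
    by (cases j) (use xE[of i0 j] in \<open>auto simp: zs_def\<close>)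
  have key: "x (zs ! j) \<in> ?E j' \<longleftrightarrow> x' (zs ! j) \<in> ?E j'" if "j < length zs" "j' = j \<or> j' = Suc j" for j j'
  proof (rule eq[OF sE FE])
    show "zs ! j \<in> I" using that zs by auto
    show "zs ! j = i0 \<or> x i0 \<in> ?E j'"
      using that(2) base[of j] xE[of i0 "Suc j"] by (auto simp: zs_def)
  qed
  have "alg_indep_over (clo F) (set zs) x'"
  proof (rule alg_indep_over_transfer[OF F zs(1)])
    show "alg_indep_over F (set zs) x" using ind zs by simp
    fix j assume j: "j < length zs"
    have "zs ! j \<in> set (take (Suc j) zs)" using j by (auto simp: in_set_conv_nth intro!: exI[of _ j])
    thus "x' (zs ! j) \<in> ?E (Suc j)" using key[OF j, of "Suc j"] xE by auto
    show "x' (zs ! j) \<in> ?E j \<Longrightarrow> x (zs ! j) \<in> ?E j" using key[OF j, of j] by simp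
  qed
  thus ?thesis using zs by simp
qed

lemma subrng_LP: "subrng (LP :: 'a::field fls set)"
  unfolding subrng_def
proof (intro conjI ballI)
  show "1 \<in> (LP :: 'a fls set)" by (auto simp: LP_def lp_def split: if_splits)
  fix f g :: "'a fls" assume "f \<in> LP" "g \<in> LP"
  then obtain B B' where B: "lp B f" "lp B' g" by (auto simp: LP_def)
  thus "f * g \<in> LP" using lp_mult unfolding LP_def by blast
  have "lp (max B B') f" "lp (max B B') g" using B by (auto simp: lp_def intro: order_trans)
  hence "lp (max B B') (f + g)" by (rule lp_add)
  thus "f + g \<in> LP" by (auto simp: LP_def)
qed (auto simp: LP_def lp_def)

lemma LP_intpow: "fls_shift j 1 \<in> (LP :: 'a::field fls set)"
  unfolding LP_def by (rule CollectI, rule exI[of _ "nat \<bar>j\<bar>"]) (auto simp: lp_def split: if_splits)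

lemmas subfld_LP = subfld_fracs[OF subrng_LP]
lemmas LP_fracs = fracs_incl[OF subrng_LP]

lemma Kfield_fracs: "Kfield = fracs (range (poly_to_Kinf :: 'a::field poly \<Rightarrow> _))"
proof (intro equalityI subsetI)
  fix x :: "'a fls" assume "x \<in> Kfield"
  then obtain a b where "x = poly_to_Kinf a / poly_to_Kinf b" "b \<noteq> 0" by (auto simp: Kfield_def)
  thus "x \<in> fracs (range poly_to_Kinf)" by (intro fracsI[of x "poly_to_Kinf a" "poly_to_Kinf b"]) auto
next
  fix x :: "'a fls" assume "x \<in> fracs (range poly_to_Kinf)"
  then obtain a b where "x = poly_to_Kinf a / poly_to_Kinf b" "poly_to_Kinf b \<noteq> 0" by (auto simp: fracs_def)
  thus "x \<in> Kfield" unfolding Kfield_def by auto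
qed

lemma subfld_Kfield: "subfld (Kfield :: 'a::field fls set)"
  unfolding Kfield_fracs
proof (rule subfld_fracs, unfold subrng_def, intro conjI ballI)
  show "1 \<in> range (poly_to_Kinf :: 'a poly \<Rightarrow> _)" using poly_to_Kinf_1 by (metis rangeI)
  fix x y assume "x \<in> range (poly_to_Kinf :: 'a poly \<Rightarrow> _)" "y \<in> range (poly_to_Kinf :: 'a poly \<Rightarrow> _)"
  then obtain a b where ab: "x = poly_to_Kinf a" "y = poly_to_Kinf b" by auto
  show "x + y \<in> range poly_to_Kinf" unfolding ab poly_to_Kinf_add[symmetric] by (rule rangeI)
  show "x * y \<in> range poly_to_Kinf" unfolding ab poly_to_Kinf_mult[symmetric] by (rule rangeI)
next
  fix x assume "x \<in> range (poly_to_Kinf :: 'a poly \<Rightarrow> _)"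
  then obtain a where a: "x = poly_to_Kinf a" by auto
  have "- x = poly_to_Kinf (0 - a)" by (simp only: poly_to_Kinf_diff a poly_to_Kinf_0) simp
  thus "- x \<in> range poly_to_Kinf" by blast
qed

context carlitz_family
begin

definition val_at :: "(nat \<times> nat) option \<Rightarrow> 'a fls" where
  "val_at z = (case z of None \<Rightarrow> carlitz_prod | Some (l, k) \<Rightarrow> mzeta (map n [l..<Suc k]))"

lemma phi_poly_LP: "\<phi> (poly_to_Kinf a) \<in> LP"
proof -
  obtain D B where "blp D B (fls_const a)" using lpoly_const[of a] by (auto simp: lpoly_def)
  from ev_blp[OF this, of e0] show ?thesis by (auto simp: LP_def ev_const)
qed

text \<open>\<open>Om_val\<close> and the image of \<open>carlitz_prod\<close> are reciprocal up to
  the factor \<open>v ^ q\<close>. The other values are multizeta values times a nonzero factor in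
  \<open>E\<close>, a polynomial in \<open>theta\<close> times a power of
  \<open>Om_val\<close>.\<close>

lemma value_equivalent:
  assumes E: "subfld E" and FE: "fracs LP \<subseteq> E" and z: "z \<in> J d" "z = None \<or> Om_val \<in> E"
  shows "ev e0 (fun_at z) \<in> E \<longleftrightarrow> \<phi> (val_at z) \<in> E"
proof (cases z)
  case None
  have w: "fls_X_intpow (int q) \<in> E" using LP_fracs[OF LP_intpow] FE by blast
  have cp: "\<phi> carlitz_prod \<noteq> 0" using carlitz_prod_nonzero by (simp add: phi_eq_0_iff[OF e0_pos(2)])
  have "Om_val = fls_X_intpow (int q) / \<phi> carlitz_prod" "\<phi> carlitz_prod = fls_X_intpow (int q) / Om_val"
    using cp Om_val_nonzero by (simp_all add: Om_val_carlitz[symmetric])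
  hence "Om_val \<in> E \<longleftrightarrow> \<phi> carlitz_prod \<in> E" using subfld_divide[OF E w] by metis
  thus ?thesis by (simp add: None fun_at_def val_at_def Om_val_def)
next
  case (Some lk)
  obtain l k where lk: "z = Some (l, k)" "1 \<le> l" "l \<le> k" "k \<le> d" using z Some by (auto simp: J_def)
  let ?ns = "map n [l..<Suc k]"
  let ?P = "prod_list (map \<Delta> ?ns)"
  have omE: "Om_val \<in> E" using z(2) lk by simp
  have pl: "prod_list (map (\<lambda>n. poly_to_Kinf (\<Delta> n)) ms) = poly_to_Kinf (prod_list (map \<Delta> ms))" for ms
    by (induction ms) (simp_all add: poly_to_Kinf_mult)
  have "\<phi> (poly_to_Kinf ?P) \<in> E" using LP_fracs[OF phi_poly_LP] FE by blast
  hence K: "\<phi> (poly_to_Kinf ?P) * Om_val ^ sum_list ?ns \<in> E" (is "?K \<in> E")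
    by (intro subfld_mult[OF E] subfld_power[OF E] omE)
  have "?P \<noteq> 0" using args_pos[OF lk(2,4)] \<Delta>_nz by (auto simp: prod_list_zero_iff)
  hence Knz: "?K \<noteq> 0" using Om_val_nonzero by (simp add: phi_eq_0_iff[OF e0_pos(2)])
  have v: "ev e0 (F l k) = ?K * \<phi> (mzeta ?ns)"
    unfolding F_def using ev_zeta_fun[OF args_pos[OF lk(2,4)]] by (simp only: pl)
  have "?K * y \<in> E \<longleftrightarrow> y \<in> E" for y
  proof
    assume "?K * y \<in> E"
    hence "?K * y / ?K \<in> E" using K by (rule subfld_divide[OF E])
    thus "y \<in> E" using Knz by simp
  qed (rule subfld_mult[OF E K])
  thus ?thesis by (simp only: lk fun_at_def val_at_def option.case prod.case v)
qed

text \<open>Independence over the closure of the rational functions in \<open>v\<close> contains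
  that over the image of \<open>Kfield\<close>, which is pulled back along the embedding
  \<open>\<phi>\<close>.\<close>

theorem mzeta_independent: "alg_indep_over Kfield (J d) val_at"
proof -
  have "alg_indep_over (clo (fracs LP)) (J d) (\<lambda>z. \<phi> (val_at z))"
  proof (rule alg_indep_over_equivalent[OF subfld_LP finite_J J_None])
    show "alg_indep_over (fracs LP) (J d) (\<lambda>z. ev e0 (fun_at z))"
      by (rule alg_indep_over_fracs[OF subrng_LP values_independent])
    fix E z assume "subfld E" "clo (fracs LP) \<subseteq> E" "z \<in> J d" "z = None \<or> ev e0 (fun_at None) \<in> E"
    thus "ev e0 (fun_at z) \<in> E \<longleftrightarrow> \<phi> (val_at z) \<in> E"
      using clo_incl[OF subfld_LP] by (intro value_equivalent) (auto simp: fun_at_def Om_val_def)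
  qed
  moreover have "\<phi> ` Kfield \<subseteq> clo (fracs LP)"
  proof
    fix y assume "y \<in> \<phi> ` Kfield"
    then obtain a b where "b \<noteq> 0" "y = \<phi> (poly_to_Kinf a / poly_to_Kinf b)" by (auto simp: Kfield_def)
    hence ab: "b \<noteq> 0" "y = \<phi> (poly_to_Kinf a) / \<phi> (poly_to_Kinf b)" by (simp_all only: phi_hom not_False_eq_True)
    have "y \<in> fracs LP"
      by (rule fracsI[OF ab(2) phi_poly_LP phi_poly_LP]) (use ab in \<open>simp add: phi_eq_0_iff[OF e0_pos(2)]\<close>)
    thus "y \<in> clo (fracs LP)" by (rule clo_incl[OF subfld_LP])
  qed
  ultimately have "alg_indep_over (\<phi> ` Kfield) (J d) (\<lambda>z. \<phi> (val_at z))"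
    by (rule alg_indep_over_subset[OF _ order_refl])
  thus ?thesis
    using alg_indep_over_hom[of \<phi> Kfield "J d" val_at] by (simp add: phi_hom phi_eq_0_iff[OF e0_pos(2)])
qed

text \<open>\<open>\<omega>\<close> is nonzero and algebraic over \<open>F_q(theta)\<close>, so the
  period and \<open>carlitz_prod\<close> lie in the same fields over \<open>Kbar\<close>, the
  \<open>clo\<close> of the embedded \<open>Kfield\<close>. Any choice of the root therefore
  works.\<close>

lemma period_independent:
  fixes \<omega> :: "'a fls alg_closure"
  assumes \<omega>: "\<omega> ^ e0 = to_ac (- theta)"
  shows "alg_indep_over Kbar (J d) (\<lambda>z. case z of None \<Rightarrow> carlitz_period \<omega>
    | Some (l, k) \<Rightarrow> to_ac (mzeta (map n [l..<Suc k])))"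
proof -
  let ?K = "to_ac ` (Kfield :: 'a fls set)"
  let ?x' = "\<lambda>z. case z of None \<Rightarrow> carlitz_period \<omega> | Some (l, k) \<Rightarrow> to_ac (mzeta (map n [l..<Suc k]))"
  have K: "subfld ?K"
    using subfld_Kfield[where 'a = 'a] unfolding subfld_def
    by (auto simp flip: to_ac_add to_ac_mult to_ac_minus to_ac_inverse)
  have th: "- theta \<in> (Kfield :: 'a fls set)"
  proof -
    have "theta / 1 \<in> (Kfield :: 'a fls set)" unfolding Kfield_def
      by (rule CollectI, rule exI[of _ "[:0, 1:]"], rule exI[of _ 1]) (simp add: poly_to_Kinf_X)
    thus ?thesis using subfld_uminus[OF subfld_Kfield] by simp
  qed
  have \<omega>0: "\<omega> \<noteq> 0"
  proof
    assume "\<omega> = 0"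
    hence "to_ac (- theta :: 'a fls) = 0" using \<omega> e0_pos by (simp add: power_0_left)
    thus False by (simp add: theta_def)
  qed
  have "\<omega> \<in> clo ?K"
    unfolding clo_def
  proof (intro CollectI bexI[of _ "monom 1 e0 - [:to_ac (- theta):]"] conjI)
    show "monom 1 e0 - [:to_ac (- theta):] \<in> polys_over ?K"
      by (intro polys_over_closed[OF K] polys_over_monom[OF K] subfld_1[OF K])
        (use imageI[OF th, of to_ac] K in \<open>auto simp del: to_ac_minus simp: polys_over_pCons polys_over_closed\<close>)
    have "coeff (monom 1 e0 - [:to_ac (- theta):]) e0 = (1 :: 'a fls alg_closure)"
      using e0_pos by (cases e0) auto
    thus "monom 1 e0 - [:to_ac (- theta):] \<noteq> (0 :: 'a fls alg_closure poly)" by (metis coeff_0 zero_neq_one)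
    show "poly (monom 1 e0 - [:to_ac (- theta):]) \<omega> = 0" by (simp add: poly_monom \<omega>)
  qed
  have "alg_indep_over (clo ?K) (J d) ?x'"
  proof (rule alg_indep_over_equivalent[OF K finite_J J_None])
    show "alg_indep_over ?K (J d) (\<lambda>z. to_ac (val_at z))"
      using alg_indep_over_hom[of to_ac Kfield "J d" val_at] mzeta_independent by simp
    fix E z assume E: "subfld E" "clo ?K \<subseteq> E" "z \<in> J d"
    have w: "\<omega> ^ q \<in> E" using E \<open>\<omega> \<in> clo ?K\<close> by (intro subfld_power) auto
    show "to_ac (val_at z) \<in> E \<longleftrightarrow> ?x' z \<in> E"
    proof (cases z)
      case None
      have "to_ac carlitz_prod = (\<omega> ^ q * to_ac carlitz_prod) / \<omega> ^ q" using \<omega>0 by simp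
      hence "to_ac carlitz_prod \<in> E \<longleftrightarrow> \<omega> ^ q * to_ac carlitz_prod \<in> E"
        using subfld_mult[OF E(1) w] subfld_divide[OF E(1) _ w] by metis
      thus ?thesis by (simp add: None val_at_def carlitz_period_def q_card)
    qed (simp add: val_at_def split: prod.splits)
  qed
  moreover have "clo ?K = Kbar" by (auto simp: clo_def Kbar_def polys_over_def)
  ultimately show ?thesis by simp
qed

end

theorem theorem1p1:
  fixes d :: nat and n :: "nat \<Rightarrow> nat"
    and \<omega> :: "'a::{finite,field} fls alg_closure"
  assumes "d \<ge> 1"
    and "\<forall>i\<in>{1..d}. n i \<ge> 1"
    and "inj_on n {1..d}"
    and "\<forall>i\<in>{1..d}. \<not> (CARD('a) - 1) dvd n i"
    and "\<forall>i\<in>{1..d}. \<forall>j\<in>{1..d}. i \<noteq> j \<longrightarrow>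
           (\<forall>k::int. of_nat (n i) / of_nat (n j) \<noteq> (of_nat (CHAR('a)) :: rat) powi k)"
    and "\<omega> ^ (CARD('a) - 1) = to_ac (- theta)"
  shows "alg_indep_over Kbar
           (insert None (Some ` {(l, k). 1 \<le> l \<and> l \<le> k \<and> k \<le> d}))
           (\<lambda>z. case z of None \<Rightarrow> carlitz_period \<omega>
                        | Some (l, k) \<Rightarrow> to_ac (mzeta (map n [l..<Suc k]) :: 'a fls))"
proof -
  define q where "q = CARD('a)"
  have "\<forall>m. \<exists>DH :: 'a poly \<times> 'a poly poly. m \<ge> 1 \<longrightarrow> fst DH \<noteq> 0 \<and> (q - 1) * degree (snd DH) \<le> q * (m - 1) \<and>
     (\<forall>d. bev (snd DH) (theta ^ (q ^ d)) = poly_to_Kinf (fst DH) * (ll q d ^ m * power_sum_monic d m))"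
    using anderson_thakur[OF q_def] by fastforce
  from choice[OF this] obtain DH :: "nat \<Rightarrow> 'a poly \<times> 'a poly poly" where
    DH: "\<And>m. m \<ge> 1 \<Longrightarrow> fst (DH m) \<noteq> 0 \<and> (q - 1) * degree (snd (DH m)) \<le> q * (m - 1) \<and>
     (\<forall>d. bev (snd (DH m)) (theta ^ (q ^ d)) = poly_to_Kinf (fst (DH m)) * (ll q d ^ m * power_sum_monic d m))"
    by blast
  interpret carlitz_family q "q - 1" "\<lambda>m. snd (DH m)" "\<lambda>m. fst (DH m)" d n
  proof
    show "q = CARD('a)" by (rule q_def)
    show "q = Suc (q - 1)" using q_gt_1[OF q_def] by simp
    show "l \<in> {1..d} \<Longrightarrow> n l \<ge> 1" "l \<in> {1..d} \<Longrightarrow> \<not> (q - 1) dvd n l" for l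
      using assms(2,4) by (auto simp: q_def)
    fix l l' j j' assume l: "l \<in> {1..d}" "l' \<in> {1..d}" and e: "n l * CHAR('a) ^ j = n l' * CHAR('a) ^ j'"
    show "l = l'"
    proof (rule ccontr)
      assume "l \<noteq> l'"
      \<comment> \<open>The natural exponents \<open>j\<close> and \<open>j'\<close> combine to the
        integral exponent \<open>j' - j\<close>.\<close>
      hence ne: "of_nat (n l) / of_nat (n l') \<noteq> (of_nat (CHAR('a)) :: rat) powi (int j' - int j)"
        using assms(5) l by blast
      have p: "(of_nat (CHAR('a)) :: rat) \<noteq> 0" using char_prime[OF q_def] by auto
      have "n l' \<noteq> 0" using assms(2) l(2) by force
      moreover have "of_nat (n l) * of_nat CHAR('a) ^ j = (of_nat (n l') * of_nat CHAR('a) ^ j' :: rat)"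
        using e by (metis of_nat_mult of_nat_power)
      ultimately have "of_nat (n l) / of_nat (n l') = (of_nat CHAR('a) ^ j' / of_nat CHAR('a) ^ j :: rat)"
        using p by (simp add: field_simps)
      thus False using ne p by (simp add: power_int_diff)
    qed
  qed (use DH in auto)
  show ?thesis using period_independent[OF assms(6)[folded q_def]] unfolding J_def .
qed

end
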